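(* Let $\mathcal M$ be a dg-manifold, $\mathcal A\to\mathcal M$ a dg-Lie algebroid, $\mathcal E\to\mathcal M$ a dg-vector bundle, and $\nabla$ an $\mathcal A$-connection on $\mathcal E$. Let $\mathfrak a=\Gamma(S(\mathcal A[1]^\vee))$ be the associated dDG-algebra, $\mathfrak m=\mathfrak a\otimes\Gamma(\mathcal E)$ the associated DG-$\mathfrak a$-module with the connection $d_{\mathcal A,\mathcal E}$ induced by $\nabla$, and $R_{\mathfrak m}=-[Q_{\mathfrak m},d_{\mathcal A,\mathcal E}]$ its curvature. Then $R_{\mathfrak m}$ is the only DG-$\mathfrak a$-module map from $\mathfrak m$ to $\mathfrak m(1)[1]$ satisfying $$i_XR_{\mathfrak m}(e)=(-1)^{|X|}\mathrm{At}^\nabla(X,e)\qquad\text{for all }X\in\Gamma(\mathcal A),\ e\in\Gamma(\mathcal E).$$ Consequently, $\mu$ sends the Atiyah class $\alpha_{\mathcal A,\mathcal E}$ to $\alpha_{\mathfrak m}$ in cohomology.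
   Context: Graded manifolds are $\mathbb Z$-graded with sheaf of functions locally $C^\infty(U)\otimes\hat S(V^\vee)$ ($V$ a finite-dimensional graded vector space); a dg-manifold carries a homological vector field (degree 1 derivation $Q_{\mathcal M}$ of $C^\infty(\mathcal M)$ of square zero). A dg-vector bundle is a graded vector bundle $\mathcal E\to\mathcal M$ with a homological vector field $Q_{\mathcal E}$ on $\mathcal E$ preserving the space $C^\infty_{\rm lin}(\mathcal E)$ of fibrewise linear functions and projecting to $Q_{\mathcal M}$. It induces the degree 1 operator $Q_{\Gamma(\mathcal E)}$ on sections, $\langle Q_{\Gamma(\mathcal E)}\sigma,\epsilon\rangle=Q_{\mathcal M}\langle\sigma,\epsilon\rangle-(-1)^{|\sigma|}\langle\sigma,Q_{\mathcal E}\epsilon\rangle$ for $\epsilon\in C^\infty_{\rm lin}(\mathcal E)$. A graded Lie algebroid $\mathcal A\to\mathcal M$ has a degree 0 anchor and bracket with the graded Leibniz rule, and thus a Chevalley--Eilenberg homological vector field $d_{\mathcal A}$ on $\mathcal A[1]$. A dg-Lie algebroid is a dg-vector bundle and graded Lie algebroid with $[(Q_{\mathcal A})_1,d_{\mathcal A}]=0$, where $(Q_{\mathcal A})_1$ is the shift of $Q_{\mathcal A}$ to $\mathcal A[1]$. For $X\in\Gamma(\mathcal A)$, $i_X$ is the degree $|X|-1$ derivation of functions on $\mathcal A[1]$ that is zero on $C^\infty(\mathcal M)$ and given by pairing with $X$ (shifted) on linear functions; it satisfies $i_{Q_{\Gamma(\mathcal A)}X}=[(Q_{\mathcal A})_1,i_X]$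 and is extended to $\mathfrak m$ by acting on the factor $\mathfrak a$. An $\mathcal A$-connection on $\mathcal E$ is a degree-0 map with $\nabla_{fa}e=f\nabla_ae$, $\nabla_a(fe)=(-1)^{|a||f|}f\nabla_ae+\rho(a)(f)e$. Atiyah class: $\mathrm{At}^\nabla(a,e)=Q_{\Gamma(\mathcal E)}(\nabla_ae)-\nabla_{Q_{\Gamma(\mathcal A)}(a)}e-(-1)^{|a|}\nabla_aQ_{\Gamma(\mathcal E)}(e)$ is a degree 1 section of $\mathrm{Hom}(\mathcal A\otimes\mathcal E,\mathcal E)$, closed under the induced differential $Q$, and its class $\alpha_{\mathcal A,\mathcal E}\in H^1(\Gamma(\mathrm{Hom}(\mathcal A\otimes\mathcal E,\mathcal E)),Q)$ is independent of $\nabla$. A (bigraded) DG-algebra is a bigraded sheaf of algebras $\mathfrak a$ with a derivation $\bar d_{\mathfrak a}$ of bidegree $(1,0)$ and square zero. A dDG-algebra has in addition a derivation $d_{\mathfrak a}$ of bidegree $(0,1)$ anticommuting with $\bar d_{\mathfrak a}$. A DG-$\mathfrak a$-module is a bigraded sheaf of $\mathfrak a$-modules $\mathfrak m$ with an additive map $\bar d_{\mathfrak m}$ of bidegree $(1,0)$, $\bar d_{\mathfrak m}^2=0$, $\bar d_{\mathfrak m}(\alpha m)=\bar d_{\mathfrak a}(\alpha)m+(-1)^{|\alpha|}\alpha\bar d_{\mathfrak m}(m)$. A connection on it is an additive map $d_{\mathfrak m}$ of bidegree $(0,1)$ with $d_{\mathfrak m}(\alpha m)=d_{\mathfrak a}(\alpha)m+(-1)^{|\alpha|}\alpha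 d_{\mathfrak m}(m)$; its curvature is $-(d_{\mathfrak m}\bar d_{\mathfrak m}+\bar d_{\mathfrak m}d_{\mathfrak m})$. Shifts of bidegree $(1,0)$, $(0,1)$ are denoted $[1]$, $(1)$. $\mathrm{Hom}^{\bullet,\bullet}(\mathfrak m,\mathfrak m)$ is the bigraded space of $\mathfrak a$-linear graded maps. The class $\alpha_{\mathfrak m}$ of the curvature in $H^1(\mathrm{Hom}^{\bullet,1}(\mathfrak m,\mathfrak m),[\bar d_{\mathfrak m},\cdot])$ is independent of the connection. In the present case $\mathfrak a=\Gamma(S(\mathcal A[1]^\vee))\subset C^\infty(\mathcal A[1])$ (functions polynomial in the fibres), bigraded by (manifold degree of $\mathcal A$, polynomial degree), the total degree being the degree of functions on $\mathcal A[1]$, with $\bar d_{\mathfrak a}=(Q_{\mathcal A})_1$, $d_{\mathfrak a}=d_{\mathcal A}$. $\mathfrak m=\mathfrak a\otimes_{C^\infty(\mathcal M)}\Gamma(\mathcal E)$, with $\Gamma(\mathcal E)$ in bidegrees $(\bullet,0)$, has $\bar d_{\mathfrak m}=Q_{\mathfrak m}=(Q_{\mathcal A})_1\otimes1+1\otimes Q_{\Gamma(\mathcal E)}$, and $d_{\mathcal A,\mathcal E}$ is the extension of $\nabla$ to $\mathcal E$-valued $\mathcal A$-forms ($i_Xd_{\mathcal A,\mathcal E}e=\nabla_Xe$). The DG-$\mathfrak a$-module isomorphism $\mu:\mathfrak a\otimes\Gamma(\mathrm{End}(\mathcal E))\to\mathrm{Hom}^{\bullet,\bullet}(\mathfrak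 m,\mathfrak m)$ is determined by $\mu(x)|_{\Gamma(\mathcal E)}=x$. A section $T$ of $\mathrm{Hom}(\mathcal A\otimes\mathcal E,\mathcal E)$ is viewed as the element $x_T$ of $\mathfrak a\otimes\Gamma(\mathrm{End}(\mathcal E))$ of polynomial degree 1 with $i_Xx_T(e)=(-1)^{|X||T|}T(X,e)$; in particular $\mathrm{At}^\nabla$ is viewed as an element of bidegree $(1,1)$. *)

theory Defs
  imports "HOL-Analysis.Analysis" "HOL-Library.Function_Algebras"
begin

instantiation "fun" :: (type, real_vector) real_vector
begin

definition scaleR_fun :: "real \<Rightarrow> ('a \<Rightarrow> 'b) \<Rightarrow> 'a \<Rightarrow> 'b" where
  "scaleR_fun c f = (\<lambda>x. c *\<^sub>R f x)"

instance
  by standard (simp_all add: scaleR_fun_def fun_eq_iff scaleR_add_right scaleR_add_left)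

end


section \<open>Graded sheaves\<close>

text \<open>
  A graded sheaf assigns to every open set \<open>U\<close> and every degree \<open>i\<close> a real vector space
  \<open>sec S U i\<close>.  All these spaces are realised as subspaces of one ambient vector space; for a
  sheaf of algebras the product is that of an ambient (not necessarily unital) algebra.  Any
  graded sheaf can be so represented, e.g. inside the product of all its spaces of sections.
  Only homogeneous sections are ever used.  Degrees are integers, or pairs of integers for
  bigraded sheaves.  The parity of an element of bidegree \<open>(k, p)\<close> is that of \<open>k + p\<close>.
\<close>

record ('p, 'i, 'x) gsheaf =
  base :: "'p topology"
  sec :: "'p set \<Rightarrow> 'i \<Rightarrow> 'x set"
  res :: "'p set \<Rightarrow> 'p set \<Rightarrow> 'x \<Rightarrow> 'x"

record ('p, 'i, 'x) gring = "('p, 'i, 'x) gsheaf" +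
  unity :: "'p set \<Rightarrow> 'x"

record ('p, 'i, 'r, 'x) gmod = "('p, 'i, 'x) gsheaf" +
  act :: "'p set \<Rightarrow> 'r \<Rightarrow> 'x \<Rightarrow> 'x"

definition ksign :: "int \<Rightarrow> real" where
  "ksign n = (if even n then 1 else - 1)"

definition graded_sheaf :: "('p, 'i, 'x::real_vector, 'z) gsheaf_scheme \<Rightarrow> bool" where
  "graded_sheaf S \<longleftrightarrow>
    (\<forall>U. openin (base S) U \<longrightarrow> (\<forall>i. subspace (sec S U i)) \<and>
       (\<forall>J x. finite J \<and> (\<forall>i\<in>J. x i \<in> sec S U i) \<and> (\<Sum>i\<in>J. x i) = 0 \<longrightarrow> (\<forall>i\<in>J. x i = 0))) \<and>
    (\<forall>U V i. openin (base S) U \<and> openin (base S) V \<and> V \<subseteq> U \<longrightarrow>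
       (\<forall>x\<in>sec S U i. res S U V x \<in> sec S V i \<and> (\<forall>c. res S U V (c *\<^sub>R x) = c *\<^sub>R res S U V x) \<and>
          (\<forall>y\<in>sec S U i. res S U V (x + y) = res S U V x + res S U V y))) \<and>
    (\<forall>U i. openin (base S) U \<longrightarrow> (\<forall>x\<in>sec S U i. res S U U x = x)) \<and>
    (\<forall>U V W i. openin (base S) U \<and> openin (base S) V \<and> openin (base S) W \<and> W \<subseteq> V \<and> V \<subseteq> U \<longrightarrow>
       (\<forall>x\<in>sec S U i. res S V W (res S U V x) = res S U W x)) \<and>
    (\<forall>\<U> i x. (\<forall>U\<in>\<U>. openin (base S) U \<and> x U \<in> sec S U i) \<and>
       (\<forall>U\<in>\<U>. \<forall>V\<in>\<U>. res S U (U \<inter> V) (x U) = res S V (U \<inter> V) (x V)) \<longrightarrow>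
       (\<exists>!y. y \<in> sec S (\<Union>\<U>) i \<and> (\<forall>U\<in>\<U>. res S (\<Union>\<U>) U y = x U)))"

text \<open>The degree of a homogeneous section (arbitrary for the section \<open>0\<close>).\<close>

definition hdeg :: "('p, 'i, 'x, 'z) gsheaf_scheme \<Rightarrow> 'p set \<Rightarrow> 'x \<Rightarrow> 'i" where
  "hdeg S U x = (SOME i. x \<in> sec S U i)"

text \<open>Morphisms \<open>S|\<^sub>U \<rightarrow> T|\<^sub>U\<close> of sheaves of real vector spaces, of degree \<open>d\<close>.\<close>

definition sheaf_map :: "('p, 'i::plus, 'x::real_vector, 'z) gsheaf_scheme \<Rightarrow>
    ('p, 'i, 'y::real_vector, 'w) gsheaf_scheme \<Rightarrow> 'p set \<Rightarrow> 'i \<Rightarrow> ('p set \<Rightarrow> 'x \<Rightarrow> 'y) \<Rightarrow> bool" where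
  "sheaf_map S T U d F \<longleftrightarrow>
    (\<forall>V i x. openin (base S) V \<and> V \<subseteq> U \<and> x \<in> sec S V i \<longrightarrow>
       F V x \<in> sec T V (i + d) \<and>
       (\<forall>c. F V (c *\<^sub>R x) = c *\<^sub>R F V x) \<and>
       (\<forall>y\<in>sec S V i. F V (x + y) = F V x + F V y) \<and>
       (\<forall>W. openin (base S) W \<and> W \<subseteq> V \<longrightarrow> F W (res S V W x) = res T V W (F V x)))"

definition bilinear_sheaf_map :: "('p, int, 'x::real_vector, 'z) gsheaf_scheme \<Rightarrow>
    ('p, int, 'y::real_vector, 'w) gsheaf_scheme \<Rightarrow> ('p, int, 't::real_vector, 'v) gsheaf_scheme \<Rightarrow>
    int \<Rightarrow> ('p set \<Rightarrow> 'x \<Rightarrow> 'y \<Rightarrow> 't) \<Rightarrow> bool" where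
  "bilinear_sheaf_map S S' T d F \<longleftrightarrow>
    (\<forall>U i x j y. openin (base S) U \<and> x \<in> sec S U i \<and> y \<in> sec S' U j \<longrightarrow>
       F U x y \<in> sec T U (i + j + d) \<and>
       (\<forall>c. F U (c *\<^sub>R x) y = c *\<^sub>R F U x y \<and> F U x (c *\<^sub>R y) = c *\<^sub>R F U x y) \<and>
       (\<forall>x'\<in>sec S U i. F U (x + x') y = F U x y + F U x' y) \<and>
       (\<forall>y'\<in>sec S' U j. F U x (y + y') = F U x y + F U x y') \<and>
       (\<forall>V. openin (base S) V \<and> V \<subseteq> U \<longrightarrow>
          F V (res S U V x) (res S' U V y) = res T U V (F U x y)))"

definition graded_ring_sheaf :: "('p, int, 'f::real_algebra) gring \<Rightarrow> bool" where
  "graded_ring_sheaf X \<longleftrightarrow> graded_sheaf X \<and>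
    (\<forall>U. openin (base X) U \<longrightarrow> unity X U \<in> sec X U 0 \<and>
       (\<forall>V. openin (base X) V \<and> V \<subseteq> U \<longrightarrow> res X U V (unity X U) = unity X V)) \<and>
    (\<forall>U i f j g. openin (base X) U \<and> f \<in> sec X U i \<and> g \<in> sec X U j \<longrightarrow>
       f * g \<in> sec X U (i + j) \<and> g * f = ksign (i * j) *\<^sub>R (f * g) \<and>
       unity X U * f = f \<and>
       (\<forall>V. openin (base X) V \<and> V \<subseteq> U \<longrightarrow> res X U V (f * g) = res X U V f * res X U V g))"

text \<open>A derivation of degree \<open>d\<close> of the structure sheaf over the open set \<open>U\<close>.\<close>

definition derivation :: "('p, int, 'f::real_algebra) gring \<Rightarrow> 'p set \<Rightarrow> int \<Rightarrow>
    ('p set \<Rightarrow> 'f \<Rightarrow> 'f) \<Rightarrow> bool" where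
  "derivation X U d D \<longleftrightarrow> sheaf_map X X U d D \<and>
    (\<forall>V i f j g. openin (base X) V \<and> V \<subseteq> U \<and> f \<in> sec X V i \<and> g \<in> sec X V j \<longrightarrow>
       D V (f * g) = D V f * g + ksign (d * i) *\<^sub>R (f * D V g))"

definition homological :: "('p, int, 'f::real_algebra) gring \<Rightarrow> ('p set \<Rightarrow> 'f \<Rightarrow> 'f) \<Rightarrow> bool" where
  "homological X Q \<longleftrightarrow> derivation X (topspace (base X)) 1 Q \<and>
    (\<forall>U i f. openin (base X) U \<and> f \<in> sec X U i \<longrightarrow> Q U (Q U f) = 0)"


section \<open>Graded manifolds\<close>

text \<open>Smooth functions on open subsets of \<^term>\<open>Euclidean_space n\<close>, by iterated partial derivatives.\<close>

definition partial :: "nat \<Rightarrow> ((nat \<Rightarrow> real) \<Rightarrow> real) \<Rightarrow> (nat \<Rightarrow> real) \<Rightarrow> real" where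
  "partial i f x = deriv (\<lambda>t. f (x(i := t))) (x i)"

primrec cont_diff :: "nat \<Rightarrow> nat \<Rightarrow> (nat \<Rightarrow> real) set \<Rightarrow> ((nat \<Rightarrow> real) \<Rightarrow> real) \<Rightarrow> bool" where
  "cont_diff 0 n W f \<longleftrightarrow> continuous_map (subtopology (Euclidean_space n) W) euclideanreal f"
| "cont_diff (Suc k) n W f \<longleftrightarrow> continuous_map (subtopology (Euclidean_space n) W) euclideanreal f \<and>
     (\<forall>i<n. (\<forall>x\<in>W. (\<lambda>t. f (x(i := t))) differentiable at (x i)) \<and> cont_diff k n W (partial i f))"

definition smooth_function :: "nat \<Rightarrow> (nat \<Rightarrow> real) set \<Rightarrow> ((nat \<Rightarrow> real) \<Rightarrow> real) \<Rightarrow> bool" where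
  "smooth_function n W f \<longleftrightarrow> (\<forall>k. cont_diff k n W f) \<and> (\<forall>x. x \<notin> W \<longrightarrow> f x = 0)"

text \<open>
  The local model: formal power series over the smooth functions on \<open>W\<close> in graded commuting
  variables \<open>\<xi>\<^sub>0, \<xi>\<^sub>1, \<dots>\<close>, a basis of \<open>V\<^sup>\<vee>\<close>, whose degrees are listed in \<open>ds\<close>.
  A series is given by its coefficients, indexed by exponents \<open>I\<close>.  Exponents of odd variables
  are at most one, and \<open>exponent_sign\<close> is the sign in \<open>\<xi>\<^sup>I \<xi>\<^sup>J = \<plusminus> \<xi>\<^sup>I\<^sup>+\<^sup>J\<close>.
\<close>

type_synonym series = "(nat \<Rightarrow> nat) \<Rightarrow> (nat \<Rightarrow> real) \<Rightarrow> real"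

definition exponent :: "int list \<Rightarrow> (nat \<Rightarrow> nat) \<Rightarrow> bool" where
  "exponent ds I \<longleftrightarrow> (\<forall>j\<ge>length ds. I j = 0) \<and> (\<forall>j<length ds. odd (ds ! j) \<longrightarrow> I j \<le> 1)"

definition exponent_degree :: "int list \<Rightarrow> (nat \<Rightarrow> nat) \<Rightarrow> int" where
  "exponent_degree ds I = (\<Sum>j<length ds. int (I j) * ds ! j)"

definition exponent_sign :: "int list \<Rightarrow> (nat \<Rightarrow> nat) \<Rightarrow> (nat \<Rightarrow> nat) \<Rightarrow> real" where
  "exponent_sign ds I J = (\<Prod>i<length ds. \<Prod>j<i. ksign (int (I i) * ds ! i * (int (J j) * ds ! j)))"

definition series_sec :: "nat \<Rightarrow> int list \<Rightarrow> (nat \<Rightarrow> real) set \<Rightarrow> int \<Rightarrow> series set" where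
  "series_sec n ds W k =
    {c. \<forall>I. smooth_function n W (c I) \<and> (\<not> (exponent ds I \<and> exponent_degree ds I = k) \<longrightarrow> c I = 0)}"

definition series_mult :: "int list \<Rightarrow> series \<Rightarrow> series \<Rightarrow> series" where
  "series_mult ds c c' = (\<lambda>K x. if exponent ds K
     then \<Sum>I | I \<le> K. exponent_sign ds I (K - I) * c I x * c' (K - I) x else 0)"

definition series_res :: "(nat \<Rightarrow> real) set \<Rightarrow> series \<Rightarrow> series" where
  "series_res W c = (\<lambda>I x. if x \<in> W then c I x else 0)"

definition chart :: "('p, int, 'f::real_algebra) gring \<Rightarrow> nat \<Rightarrow> int list \<Rightarrow> 'p set \<Rightarrow>
    ('p \<Rightarrow> nat \<Rightarrow> real) \<Rightarrow> ('p set \<Rightarrow> 'f \<Rightarrow> series) \<Rightarrow> bool" where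
  "chart X n ds U \<phi> \<Phi> \<longleftrightarrow> openin (base X) U \<and> openin (Euclidean_space n) (\<phi> ` U) \<and>
    homeomorphic_map (subtopology (base X) U) (subtopology (Euclidean_space n) (\<phi> ` U)) \<phi> \<and>
    (\<forall>V. openin (base X) V \<and> V \<subseteq> U \<longrightarrow>
       (\<forall>k. bij_betw (\<Phi> V) (sec X V k) (series_sec n ds (\<phi> ` V) k)) \<and>
       (\<forall>i f j g. f \<in> sec X V i \<and> g \<in> sec X V j \<longrightarrow>
          \<Phi> V (f * g) = series_mult ds (\<Phi> V f) (\<Phi> V g) \<and>
          (i = j \<longrightarrow> \<Phi> V (f + g) = \<Phi> V f + \<Phi> V g) \<and>
          (\<forall>c. \<Phi> V (c *\<^sub>R f) = c *\<^sub>R \<Phi> V f) \<and>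
          (\<forall>W. openin (base X) W \<and> W \<subseteq> V \<longrightarrow> \<Phi> W (res X V W f) = series_res (\<phi> ` W) (\<Phi> V f))))"

definition graded_manifold_of :: "nat \<Rightarrow> int list \<Rightarrow> ('p, int, 'f::real_algebra) gring \<Rightarrow> bool" where
  "graded_manifold_of n ds X \<longleftrightarrow> graded_ring_sheaf X \<and>
    Hausdorff_space (base X) \<and> second_countable (base X) \<and>
    (\<forall>x\<in>topspace (base X). \<exists>U \<phi> \<Phi>. x \<in> U \<and> chart X n ds U \<phi> \<Phi>)"

definition dg_manifold :: "('p, int, 'f::real_algebra) gring \<Rightarrow> ('p set \<Rightarrow> 'f \<Rightarrow> 'f) \<Rightarrow> bool" where
  "dg_manifold M Q \<longleftrightarrow> (\<exists>n ds. graded_manifold_of n ds M) \<and> homological M Q"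


section \<open>Graded vector bundles\<close>

text \<open>
  A bundle consists of its total space, the projection on points, the pull-back of functions
  \<open>C\<^sup>\<infinity>(U) \<rightarrow> C\<^sup>\<infinity>(\<pi>\<^sup>-\<^sup>1 U)\<close> and the spaces of fibrewise linear functions
  \<open>C\<^sup>\<infinity>\<^sub>l\<^sub>i\<^sub>n \<subseteq> C\<^sup>\<infinity>(\<pi>\<^sup>-\<^sup>1 U)\<close>.
\<close>

record ('p, 'f, 'q, 'g) vbundle =
  tot :: "('q, int, 'g) gring"
  proj :: "'q \<Rightarrow> 'p"
  pull :: "'p set \<Rightarrow> 'f \<Rightarrow> 'g"
  lin :: "'p set \<Rightarrow> int \<Rightarrow> 'g set"

definition over :: "('p, 'f, 'q, 'g) vbundle \<Rightarrow> 'p set \<Rightarrow> 'q set" where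
  "over B U = {y \<in> topspace (base (tot B)). proj B y \<in> U}"

definition push_forward :: "('p, int, 'f) gring \<Rightarrow> ('p, 'f, 'q, 'g) vbundle \<Rightarrow> ('p, int, 'g) gsheaf" where
  "push_forward M B = \<lparr>base = base M, sec = (\<lambda>U. sec (tot B) (over B U)),
     res = (\<lambda>U V. res (tot B) (over B U) (over B V))\<rparr>"

definition lin_mod :: "('p, int, 'f) gring \<Rightarrow> ('p, 'f, 'q, 'g::times) vbundle \<Rightarrow> ('p, int, 'f, 'g) gmod" where
  "lin_mod M B = \<lparr>base = base M, sec = lin B, res = (\<lambda>U V. res (tot B) (over B U) (over B V)),
     act = (\<lambda>U f \<epsilon>. pull B U f * \<epsilon>)\<rparr>"

definition trunc :: "nat \<Rightarrow> (nat \<Rightarrow> real) \<Rightarrow> nat \<Rightarrow> real" where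
  "trunc n z = (\<lambda>i. if i < n then z i else 0)"

text \<open>
  The coordinate functions on a fibre are \<open>w\<close> coordinates of degree \<open>0\<close>, which are genuine
  coordinates \<open>z\<^sub>n, \<dots>, z\<^sub>n\<^sub>+\<^sub>w\<^sub>-\<^sub>1\<close> of the underlying manifold of the total space, followed by formal
  coordinates of nonzero degrees \<open>ws\<close>.
\<close>

definition fibre_degree :: "nat \<Rightarrow> int list \<Rightarrow> nat \<Rightarrow> int" where
  "fibre_degree w ws j = (if j < w then 0 else ws ! (j - w))"

definition fibre_coordinate :: "nat \<Rightarrow> nat \<Rightarrow> nat \<Rightarrow> (nat \<Rightarrow> real) set \<Rightarrow> nat \<Rightarrow> series" where
  "fibre_coordinate n m w Z j = series_res Z (\<lambda>I z.
     if j < w then (if I = 0 then z (n + j) else 0)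
     else (if I = (\<lambda>i. if i = m + (j - w) then 1 else 0) then 1 else 0))"

definition trivialisation :: "('p, int, 'f::real_algebra) gring \<Rightarrow> ('p, 'f, 'q, 'g::real_algebra) vbundle \<Rightarrow>
    nat \<Rightarrow> int list \<Rightarrow> nat \<Rightarrow> int list \<Rightarrow> 'p set \<Rightarrow> bool" where
  "trivialisation M B n ds w ws U \<longleftrightarrow> (\<exists>\<phi> \<Phi> \<psi> \<Psi> \<epsilon>.
     chart M n ds U \<phi> \<Phi> \<and> chart (tot B) (n + w) (ds @ ws) (over B U) \<psi> \<Psi> \<and>
     \<psi> ` over B U = {z \<in> topspace (Euclidean_space (n + w)). trunc n z \<in> \<phi> ` U} \<and>
     (\<forall>y\<in>over B U. trunc n (\<psi> y) = \<phi> (proj B y)) \<and>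
     (\<forall>V k f. openin (base M) V \<and> V \<subseteq> U \<and> f \<in> sec M V k \<longrightarrow>
        \<Psi> (over B V) (pull B V f) = series_res (\<psi> ` over B V) (\<lambda>I z. \<Phi> V f I (trunc n z))) \<and>
     (\<forall>j<w + length ws. \<epsilon> j \<in> sec (tot B) (over B U) (fibre_degree w ws j) \<and>
        \<Psi> (over B U) (\<epsilon> j) = fibre_coordinate n (length ds) w (\<psi> ` over B U) j) \<and>
     (\<forall>V k. openin (base M) V \<and> V \<subseteq> U \<longrightarrow>
        lin B V k = {\<Sum>j<w + length ws. pull B V (g j) * res (tot B) (over B U) (over B V) (\<epsilon> j) | g.
                       \<forall>j<w + length ws. g j \<in> sec M V (k - fibre_degree w ws j)}))"

definition graded_vector_bundle :: "('p, int, 'f::real_algebra) gring \<Rightarrow>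
    ('p, 'f, 'q, 'g::real_algebra) vbundle \<Rightarrow> bool" where
  "graded_vector_bundle M B \<longleftrightarrow>
    continuous_map (base (tot B)) (base M) (proj B) \<and>
    sheaf_map M (push_forward M B) (topspace (base M)) 0 (pull B) \<and>
    (\<forall>U. openin (base M) U \<longrightarrow> pull B U (unity M U) = unity (tot B) (over B U) \<and>
       (\<forall>i f j g. f \<in> sec M U i \<and> g \<in> sec M U j \<longrightarrow> pull B U (f * g) = pull B U f * pull B U g)) \<and>
    graded_sheaf (lin_mod M B) \<and>
    (\<forall>U k. openin (base M) U \<longrightarrow> lin B U k \<subseteq> sec (tot B) (over B U) k) \<and>
    (\<exists>n ds w ws. 0 \<notin> set ws \<and> graded_manifold_of n ds M \<and> graded_manifold_of (n + w) (ds @ ws) (tot B) \<and>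
       (\<forall>x\<in>topspace (base M). \<exists>U. x \<in> U \<and> trivialisation M B n ds w ws U))"

definition projects_to :: "('p, int, 'f::real_algebra) gring \<Rightarrow> ('p set \<Rightarrow> 'f \<Rightarrow> 'f) \<Rightarrow>
    ('p, 'f, 'q, 'g::real_algebra) vbundle \<Rightarrow> ('q set \<Rightarrow> 'g \<Rightarrow> 'g) \<Rightarrow> bool" where
  "projects_to M QM B Q \<longleftrightarrow> (\<forall>U k f. openin (base M) U \<and> f \<in> sec M U k \<longrightarrow>
     Q (over B U) (pull B U f) = pull B U (QM U f))"

definition dg_vector_bundle :: "('p, int, 'f::real_algebra) gring \<Rightarrow> ('p set \<Rightarrow> 'f \<Rightarrow> 'f) \<Rightarrow>
    ('p, 'f, 'q, 'g::real_algebra) vbundle \<Rightarrow> ('q set \<Rightarrow> 'g \<Rightarrow> 'g) \<Rightarrow> bool" where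
  "dg_vector_bundle M QM B Q \<longleftrightarrow> graded_vector_bundle M B \<and> homological (tot B) Q \<and>
    (\<forall>U k \<epsilon>. openin (base M) U \<and> \<epsilon> \<in> lin B U k \<longrightarrow> Q (over B U) \<epsilon> \<in> lin B U (k + 1)) \<and>
    projects_to M QM B Q"


section \<open>Sections\<close>

text \<open>
  The internal Hom of sheaves of graded \<open>C\<^sup>\<infinity>(M)\<close>-modules: a section over \<open>U\<close> is a graded linear
  sheaf map \<open>P|\<^sub>U \<rightarrow> P'|\<^sub>U\<close>, made a unique function by the value \<open>0\<close> off its domain.
\<close>

definition hom_ext :: "('p, int, 'x, 'z) gsheaf_scheme \<Rightarrow> 'p set \<Rightarrow> ('p set \<Rightarrow> 'x \<Rightarrow> 'y::zero) \<Rightarrow>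
    'p set \<Rightarrow> 'x \<Rightarrow> 'y" where
  "hom_ext P U F = (\<lambda>V x. if openin (base P) V \<and> V \<subseteq> U \<and> (\<exists>i. x \<in> sec P V i) then F V x else 0)"

definition hom_sec :: "('p, int, 'f) gring \<Rightarrow> ('p, int, 'f, 'x::real_vector) gmod \<Rightarrow>
    ('p, int, 'f, 'y::real_vector) gmod \<Rightarrow> 'p set \<Rightarrow> int \<Rightarrow> ('p set \<Rightarrow> 'x \<Rightarrow> 'y) set" where
  "hom_sec M P P' U k = {F. sheaf_map P P' U k F \<and> hom_ext P U F = F \<and>
     (\<forall>V i f j x. openin (base M) V \<and> V \<subseteq> U \<and> f \<in> sec M V i \<and> x \<in> sec P V j \<longrightarrow>
        F V (act P V f x) = ksign (k * i) *\<^sub>R act P' V f (F V x))}"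

definition hom_mod :: "('p, int, 'f) gring \<Rightarrow> ('p, int, 'f, 'x::real_vector) gmod \<Rightarrow>
    ('p, int, 'f, 'y::real_vector) gmod \<Rightarrow> ('p, int, 'f, 'p set \<Rightarrow> 'x \<Rightarrow> 'y) gmod" where
  "hom_mod M P P' = \<lparr>base = base M, sec = hom_sec M P P', res = (\<lambda>U V F. hom_ext P V F),
     act = (\<lambda>U f F. hom_ext P U (\<lambda>V x. act P' V (res M U V f) (F V x)))\<rparr>"

definition fun_mod :: "('p, int, 'f::times) gring \<Rightarrow> ('p, int, 'f, 'f) gmod" where
  "fun_mod M = \<lparr>base = base M, sec = sec M, res = res M, act = (\<lambda>U f g. f * g)\<rparr>"

text \<open>
  \<open>\<Gamma>(B)\<close> is the dual of \<open>C\<^sup>\<infinity>\<^sub>l\<^sub>i\<^sub>n(B)\<close>; the pairing \<open>\<langle>\<sigma>, \<epsilon>\<rangle>\<close> over \<open>V\<close> is \<open>\<sigma> V \<epsilon>\<close>.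
\<close>

abbreviation sections :: "('p, int, 'f::real_algebra) gring \<Rightarrow> ('p, 'f, 'q, 'g::real_algebra) vbundle \<Rightarrow>
    ('p, int, 'f, 'p set \<Rightarrow> 'g \<Rightarrow> 'f) gmod" where
  "sections M B \<equiv> hom_mod M (lin_mod M B) (fun_mod M)"

abbreviation endos :: "('p, int, 'f::real_algebra) gring \<Rightarrow> ('p, 'f, 'q, 'g::real_algebra) vbundle \<Rightarrow>
    ('p, int, 'f, 'p set \<Rightarrow> ('p set \<Rightarrow> 'g \<Rightarrow> 'f) \<Rightarrow> 'p set \<Rightarrow> 'g \<Rightarrow> 'f) gmod" where
  "endos M B \<equiv> hom_mod M (sections M B) (sections M B)"

definition section_field :: "('p, int, 'f::real_algebra) gring \<Rightarrow> ('p set \<Rightarrow> 'f \<Rightarrow> 'f) \<Rightarrow>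
    ('p, 'f, 'q, 'g::real_algebra) vbundle \<Rightarrow> ('q set \<Rightarrow> 'g \<Rightarrow> 'g) \<Rightarrow>
    'p set \<Rightarrow> ('p set \<Rightarrow> 'g \<Rightarrow> 'f) \<Rightarrow> 'p set \<Rightarrow> 'g \<Rightarrow> 'f" where
  "section_field M QM B Q U \<sigma> = hom_ext (lin_mod M B) U (\<lambda>V \<epsilon>.
     QM V (\<sigma> V \<epsilon>) - ksign (hdeg (sections M B) U \<sigma>) *\<^sub>R \<sigma> V (Q (over B V) \<epsilon>))"


section \<open>Differential graded Lie algebroids\<close>

definition graded_Lie_algebroid :: "('p, int, 'f::real_algebra) gring \<Rightarrow>
    ('p, 'f, 'q, 'g::real_algebra) vbundle \<Rightarrow>
    ('p set \<Rightarrow> ('p set \<Rightarrow> 'g \<Rightarrow> 'f) \<Rightarrow> 'f \<Rightarrow> 'f) \<Rightarrow>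
    ('p set \<Rightarrow> ('p set \<Rightarrow> 'g \<Rightarrow> 'f) \<Rightarrow> ('p set \<Rightarrow> 'g \<Rightarrow> 'f) \<Rightarrow> 'p set \<Rightarrow> 'g \<Rightarrow> 'f) \<Rightarrow> bool" where
  "graded_Lie_algebroid M A \<rho> br \<longleftrightarrow> graded_vector_bundle M A \<and>
    bilinear_sheaf_map (sections M A) M M 0 \<rho> \<and>
    bilinear_sheaf_map (sections M A) (sections M A) (sections M A) 0 br \<and>
    (\<forall>U i X j f k g. openin (base M) U \<and> X \<in> sec (sections M A) U i \<and> f \<in> sec M U j \<and> g \<in> sec M U k \<longrightarrow>
       \<rho> U X (f * g) = \<rho> U X f * g + ksign (i * j) *\<^sub>R (f * \<rho> U X g) \<and>
       \<rho> U (act (sections M A) U f X) g = f * \<rho> U X g) \<and>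
    (\<forall>U i X j Y k f. openin (base M) U \<and> X \<in> sec (sections M A) U i \<and> Y \<in> sec (sections M A) U j \<and>
       f \<in> sec M U k \<longrightarrow>
       br U X Y = - (ksign (i * j) *\<^sub>R br U Y X) \<and>
       br U X (act (sections M A) U f Y) =
         act (sections M A) U (\<rho> U X f) Y + ksign (i * k) *\<^sub>R act (sections M A) U f (br U X Y)) \<and>
    (\<forall>U i X j Y k Z. openin (base M) U \<and> X \<in> sec (sections M A) U i \<and> Y \<in> sec (sections M A) U j \<and>
       Z \<in> sec (sections M A) U k \<longrightarrow>
       br U X (br U Y Z) = br U (br U X Y) Z + ksign (i * j) *\<^sub>R br U Y (br U X Z))"

text \<open>
  The bundle \<open>A[1]\<close>, determined up to isomorphism by the odd isomorphism
  \<open>s : C\<^sup>\<infinity>\<^sub>l\<^sub>i\<^sub>n(A) \<rightarrow> C\<^sup>\<infinity>\<^sub>l\<^sub>i\<^sub>n(A[1])\<close> of degree 1.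
\<close>

definition shifted_bundle :: "('p, int, 'f::real_algebra) gring \<Rightarrow>
    ('p, 'f, 'q, 'g::real_algebra) vbundle \<Rightarrow> ('p, 'f, 'r, 'h::real_algebra) vbundle \<Rightarrow>
    ('p set \<Rightarrow> 'g \<Rightarrow> 'h) \<Rightarrow> bool" where
  "shifted_bundle M A A1 s \<longleftrightarrow> graded_vector_bundle M A1 \<and>
    sheaf_map (lin_mod M A) (lin_mod M A1) (topspace (base M)) 1 s \<and>
    (\<forall>U k. openin (base M) U \<longrightarrow> bij_betw (s U) (lin A U k) (lin A1 U (k + 1))) \<and>
    (\<forall>U i f k \<epsilon>. openin (base M) U \<and> f \<in> sec M U i \<and> \<epsilon> \<in> lin A U k \<longrightarrow>
       s U (pull A U f * \<epsilon>) = ksign i *\<^sub>R (pull A1 U f * s U \<epsilon>))"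

text \<open>
  The shift \<open>Q\<^sub>1\<close> of \<open>Q\<close>.  The sign is the one for which \<open>i\<^bsub>Q X\<^esub> = [Q\<^sub>1, i\<^sub>X]\<close> holds.
\<close>

definition shifted_field :: "('p, int, 'f::real_algebra) gring \<Rightarrow> ('p set \<Rightarrow> 'f \<Rightarrow> 'f) \<Rightarrow>
    ('p, 'f, 'q, 'g::real_algebra) vbundle \<Rightarrow> ('q set \<Rightarrow> 'g \<Rightarrow> 'g) \<Rightarrow>
    ('p, 'f, 'r, 'h::real_algebra) vbundle \<Rightarrow> ('p set \<Rightarrow> 'g \<Rightarrow> 'h) \<Rightarrow> ('r set \<Rightarrow> 'h \<Rightarrow> 'h) \<Rightarrow> bool" where
  "shifted_field M QM A Q A1 s Q1 \<longleftrightarrow> derivation (tot A1) (topspace (base (tot A1))) 1 Q1 \<and>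
    projects_to M QM A1 Q1 \<and>
    (\<forall>U k \<epsilon>. openin (base M) U \<and> \<epsilon> \<in> lin A U k \<longrightarrow>
       Q1 (over A1 U) (s U \<epsilon>) = - s U (Q (over A U) \<epsilon>))"

text \<open>For \<open>X\<close> a section over \<open>U\<close>, \<open>\<iota> U X\<close> is the derivation \<open>i\<^sub>X\<close> of functions on \<open>A[1]|\<^sub>U\<close>.\<close>

definition contraction :: "('p, int, 'f::real_algebra) gring \<Rightarrow>
    ('p, 'f, 'q, 'g::real_algebra) vbundle \<Rightarrow> ('p, 'f, 'r, 'h::real_algebra) vbundle \<Rightarrow>
    ('p set \<Rightarrow> 'g \<Rightarrow> 'h) \<Rightarrow> ('p set \<Rightarrow> ('p set \<Rightarrow> 'g \<Rightarrow> 'f) \<Rightarrow> 'r set \<Rightarrow> 'h \<Rightarrow> 'h) \<Rightarrow> bool" where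
  "contraction M A A1 s \<iota> \<longleftrightarrow>
    (\<forall>U k X. openin (base M) U \<and> X \<in> sec (sections M A) U k \<longrightarrow>
       derivation (tot A1) (over A1 U) (k - 1) (\<iota> U X) \<and>
       (\<forall>V. openin (base M) V \<and> V \<subseteq> U \<longrightarrow>
          (\<forall>i. \<forall>f\<in>sec M V i. \<iota> U X (over A1 V) (pull A1 V f) = 0) \<and>
          (\<forall>i. \<forall>\<epsilon>\<in>lin A V i. \<iota> U X (over A1 V) (s V \<epsilon>) = pull A1 V (X V \<epsilon>))))"

text \<open>
  The algebra \<open>\<Gamma>(S(A[1]\<^sup>\<vee>))\<close> of functions on \<open>A[1]\<close> that are polynomial in the fibres.  The elements
  of bidegree \<open>(k, p)\<close> are of degree \<open>k + p\<close> as functions on \<open>A[1]\<close>, and locally sums of products of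
  \<open>p\<close> linear functions with coefficients in \<open>C\<^sup>\<infinity>(M)\<close>.
\<close>

primrec monomials :: "('p, int, 'f) gring \<Rightarrow> ('p, 'f, 'r, 'h::times) vbundle \<Rightarrow> 'p set \<Rightarrow> nat \<Rightarrow> int \<Rightarrow> 'h set" where
  "monomials M A1 U 0 = (\<lambda>k. pull A1 U ` sec M U k)"
| "monomials M A1 U (Suc p) = (\<lambda>k. {\<alpha> * \<epsilon> | \<alpha> \<epsilon> i. \<alpha> \<in> monomials M A1 U p i \<and> \<epsilon> \<in> lin A1 U (k - i)})"

definition polynomials :: "('p, int, 'f) gring \<Rightarrow> ('p, 'f, 'r, 'h::real_algebra) vbundle \<Rightarrow>
    ('p, int \<times> int, 'h) gring" where
  "polynomials M A1 = \<lparr>base = base M,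
     sec = (\<lambda>U (k, p). if p < 0 then {0} else
       {\<alpha> \<in> sec (tot A1) (over A1 U) (k + p). \<forall>x\<in>U. \<exists>V. openin (base M) V \<and> x \<in> V \<and> V \<subseteq> U \<and>
          res (tot A1) (over A1 U) (over A1 V) \<alpha> \<in> span (monomials M A1 V (nat p) (k + p))}),
     res = (\<lambda>U V. res (tot A1) (over A1 U) (over A1 V)),
     unity = (\<lambda>U. unity (tot A1) (over A1 U))\<rparr>"

definition graded_commutator :: "int \<Rightarrow> ('q set \<Rightarrow> 'x \<Rightarrow> 'x::real_vector) \<Rightarrow> int \<Rightarrow>
    ('q set \<Rightarrow> 'x \<Rightarrow> 'x) \<Rightarrow> 'q set \<Rightarrow> 'x \<Rightarrow> 'x" where
  "graded_commutator d F e G U x = F U (G U x) - ksign (d * e) *\<^sub>R G U (F U x)"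

text \<open>
  The Chevalley--Eilenberg vector field, characterised by the Cartan formulas.  The requirement
  that it raises the polynomial degree by one is needed for uniqueness: the Cartan formulas alone
  do not distinguish \<open>d\<close> from \<open>d + Q\<^sub>1\<close>.
\<close>

definition Chevalley_Eilenberg :: "('p, int, 'f::real_algebra) gring \<Rightarrow>
    ('p, 'f, 'q, 'g::real_algebra) vbundle \<Rightarrow>
    ('p set \<Rightarrow> ('p set \<Rightarrow> 'g \<Rightarrow> 'f) \<Rightarrow> 'f \<Rightarrow> 'f) \<Rightarrow>
    ('p set \<Rightarrow> ('p set \<Rightarrow> 'g \<Rightarrow> 'f) \<Rightarrow> ('p set \<Rightarrow> 'g \<Rightarrow> 'f) \<Rightarrow> 'p set \<Rightarrow> 'g \<Rightarrow> 'f) \<Rightarrow>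
    ('p, 'f, 'r, 'h::real_algebra) vbundle \<Rightarrow>
    ('p set \<Rightarrow> ('p set \<Rightarrow> 'g \<Rightarrow> 'f) \<Rightarrow> 'r set \<Rightarrow> 'h \<Rightarrow> 'h) \<Rightarrow> ('r set \<Rightarrow> 'h \<Rightarrow> 'h) \<Rightarrow> bool" where
  "Chevalley_Eilenberg M A \<rho> br A1 \<iota> d \<longleftrightarrow> homological (tot A1) d \<and>
    sheaf_map (polynomials M A1) (polynomials M A1) (topspace (base M)) (0, 1) (\<lambda>U. d (over A1 U)) \<and>
    (\<forall>U k X i f. openin (base M) U \<and> X \<in> sec (sections M A) U k \<and> f \<in> sec M U i \<longrightarrow>
       \<iota> U X (over A1 U) (d (over A1 U) (pull A1 U f)) = pull A1 U (\<rho> U X f)) \<and>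
    (\<forall>U k X l Y V i h. openin (base M) U \<and> X \<in> sec (sections M A) U k \<and> Y \<in> sec (sections M A) U l \<and>
       openin (base (tot A1)) V \<and> V \<subseteq> over A1 U \<and> h \<in> sec (tot A1) V i \<longrightarrow>
       graded_commutator k (graded_commutator (k - 1) (\<iota> U X) 1 d) (l - 1) (\<iota> U Y) V h =
       \<iota> U (br U X Y) V h)"

definition dg_Lie_algebroid :: "('p, int, 'f::real_algebra) gring \<Rightarrow> ('p set \<Rightarrow> 'f \<Rightarrow> 'f) \<Rightarrow>
    ('p, 'f, 'q, 'g::real_algebra) vbundle \<Rightarrow> ('q set \<Rightarrow> 'g \<Rightarrow> 'g) \<Rightarrow>
    ('p set \<Rightarrow> ('p set \<Rightarrow> 'g \<Rightarrow> 'f) \<Rightarrow> 'f \<Rightarrow> 'f) \<Rightarrow>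
    ('p set \<Rightarrow> ('p set \<Rightarrow> 'g \<Rightarrow> 'f) \<Rightarrow> ('p set \<Rightarrow> 'g \<Rightarrow> 'f) \<Rightarrow> 'p set \<Rightarrow> 'g \<Rightarrow> 'f) \<Rightarrow>
    ('p, 'f, 'r, 'h::real_algebra) vbundle \<Rightarrow> ('p set \<Rightarrow> 'g \<Rightarrow> 'h) \<Rightarrow>
    ('p set \<Rightarrow> ('p set \<Rightarrow> 'g \<Rightarrow> 'f) \<Rightarrow> 'r set \<Rightarrow> 'h \<Rightarrow> 'h) \<Rightarrow>
    ('r set \<Rightarrow> 'h \<Rightarrow> 'h) \<Rightarrow> ('r set \<Rightarrow> 'h \<Rightarrow> 'h) \<Rightarrow> bool" where
  "dg_Lie_algebroid M QM A Q \<rho> br A1 s \<iota> Q1 d \<longleftrightarrow>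
    dg_vector_bundle M QM A Q \<and> graded_Lie_algebroid M A \<rho> br \<and>
    shifted_bundle M A A1 s \<and> contraction M A A1 s \<iota> \<and>
    shifted_field M QM A Q A1 s Q1 \<and> Chevalley_Eilenberg M A \<rho> br A1 \<iota> d \<and>
    (\<forall>U i h. openin (base (tot A1)) U \<and> h \<in> sec (tot A1) U i \<longrightarrow> graded_commutator 1 Q1 1 d U h = 0)"


section \<open>Connections and the Atiyah class of a bundle\<close>

definition A_connection :: "('p, int, 'f::real_algebra) gring \<Rightarrow>
    ('p, 'f, 'q, 'g::real_algebra) vbundle \<Rightarrow>
    ('p set \<Rightarrow> ('p set \<Rightarrow> 'g \<Rightarrow> 'f) \<Rightarrow> 'f \<Rightarrow> 'f) \<Rightarrow> ('p, 'f, 'r, 'h::real_algebra) vbundle \<Rightarrow>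
    ('p set \<Rightarrow> ('p set \<Rightarrow> 'g \<Rightarrow> 'f) \<Rightarrow> ('p set \<Rightarrow> 'h \<Rightarrow> 'f) \<Rightarrow> 'p set \<Rightarrow> 'h \<Rightarrow> 'f) \<Rightarrow> bool" where
  "A_connection M A \<rho> E nabla \<longleftrightarrow>
    bilinear_sheaf_map (sections M A) (sections M E) (sections M E) 0 nabla \<and>
    (\<forall>U i f k a l e. openin (base M) U \<and> f \<in> sec M U i \<and> a \<in> sec (sections M A) U k \<and>
       e \<in> sec (sections M E) U l \<longrightarrow>
       nabla U (act (sections M A) U f a) e = act (sections M E) U f (nabla U a e) \<and>
       nabla U a (act (sections M E) U f e) =
         ksign (k * i) *\<^sub>R act (sections M E) U f (nabla U a e) + act (sections M E) U (\<rho> U a f) e)"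

text \<open>The sections of degree \<open>d\<close> of \<open>Hom(A \<otimes> E, E)\<close>, and the induced differential.\<close>

definition bundle_homs :: "('p, int, 'f::real_algebra) gring \<Rightarrow>
    ('p, 'f, 'q, 'g::real_algebra) vbundle \<Rightarrow> ('p, 'f, 'r, 'h::real_algebra) vbundle \<Rightarrow> int \<Rightarrow>
    ('p set \<Rightarrow> ('p set \<Rightarrow> 'g \<Rightarrow> 'f) \<Rightarrow> ('p set \<Rightarrow> 'h \<Rightarrow> 'f) \<Rightarrow> 'p set \<Rightarrow> 'h \<Rightarrow> 'f) set" where
  "bundle_homs M A E d = {T. bilinear_sheaf_map (sections M A) (sections M E) (sections M E) d T \<and>
    (\<forall>U i f k a l e. openin (base M) U \<and> f \<in> sec M U i \<and> a \<in> sec (sections M A) U k \<and>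
       e \<in> sec (sections M E) U l \<longrightarrow>
       T U (act (sections M A) U f a) e = ksign (d * i) *\<^sub>R act (sections M E) U f (T U a e) \<and>
       T U a (act (sections M E) U f e) = ksign ((d + k) * i) *\<^sub>R act (sections M E) U f (T U a e))}"

definition bundle_hom_diff :: "('p, int, 'f::real_algebra) gring \<Rightarrow> ('p set \<Rightarrow> 'f \<Rightarrow> 'f) \<Rightarrow>
    ('p, 'f, 'q, 'g::real_algebra) vbundle \<Rightarrow> ('q set \<Rightarrow> 'g \<Rightarrow> 'g) \<Rightarrow>
    ('p, 'f, 'r, 'h::real_algebra) vbundle \<Rightarrow> ('r set \<Rightarrow> 'h \<Rightarrow> 'h) \<Rightarrow> int \<Rightarrow>
    ('p set \<Rightarrow> ('p set \<Rightarrow> 'g \<Rightarrow> 'f) \<Rightarrow> ('p set \<Rightarrow> 'h \<Rightarrow> 'f) \<Rightarrow> 'p set \<Rightarrow> 'h \<Rightarrow> 'f) \<Rightarrow>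
    'p set \<Rightarrow> ('p set \<Rightarrow> 'g \<Rightarrow> 'f) \<Rightarrow> ('p set \<Rightarrow> 'h \<Rightarrow> 'f) \<Rightarrow> 'p set \<Rightarrow> 'h \<Rightarrow> 'f" where
  "bundle_hom_diff M QM A QA E QE d T U a e =
     section_field M QM E QE U (T U a e) - ksign d *\<^sub>R T U (section_field M QM A QA U a) e
     - ksign (d + hdeg (sections M A) U a) *\<^sub>R T U a (section_field M QM E QE U e)"

text \<open>The class in \<open>H\<^sup>1\<close>, as the set of all cocycles cohomologous to \<open>T\<close>.\<close>

definition bundle_hom_class :: "('p, int, 'f::real_algebra) gring \<Rightarrow> ('p set \<Rightarrow> 'f \<Rightarrow> 'f) \<Rightarrow>
    ('p, 'f, 'q, 'g::real_algebra) vbundle \<Rightarrow> ('q set \<Rightarrow> 'g \<Rightarrow> 'g) \<Rightarrow>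
    ('p, 'f, 'r, 'h::real_algebra) vbundle \<Rightarrow> ('r set \<Rightarrow> 'h \<Rightarrow> 'h) \<Rightarrow>
    ('p set \<Rightarrow> ('p set \<Rightarrow> 'g \<Rightarrow> 'f) \<Rightarrow> ('p set \<Rightarrow> 'h \<Rightarrow> 'f) \<Rightarrow> 'p set \<Rightarrow> 'h \<Rightarrow> 'f) \<Rightarrow>
    ('p set \<Rightarrow> ('p set \<Rightarrow> 'g \<Rightarrow> 'f) \<Rightarrow> ('p set \<Rightarrow> 'h \<Rightarrow> 'f) \<Rightarrow> 'p set \<Rightarrow> 'h \<Rightarrow> 'f) set" where
  "bundle_hom_class M QM A QA E QE T = {T' \<in> bundle_homs M A E 1. \<exists>S\<in>bundle_homs M A E 0.
     \<forall>U k a l e. openin (base M) U \<and> a \<in> sec (sections M A) U k \<and> e \<in> sec (sections M E) U l \<longrightarrow>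
       bundle_hom_diff M QM A QA E QE 1 T' U a e = 0 \<and>
       T' U a e - T U a e = bundle_hom_diff M QM A QA E QE 0 S U a e}"

definition atiyah :: "('p, int, 'f::real_algebra) gring \<Rightarrow> ('p set \<Rightarrow> 'f \<Rightarrow> 'f) \<Rightarrow>
    ('p, 'f, 'q, 'g::real_algebra) vbundle \<Rightarrow> ('q set \<Rightarrow> 'g \<Rightarrow> 'g) \<Rightarrow>
    ('p, 'f, 'r, 'h::real_algebra) vbundle \<Rightarrow> ('r set \<Rightarrow> 'h \<Rightarrow> 'h) \<Rightarrow>
    ('p set \<Rightarrow> ('p set \<Rightarrow> 'g \<Rightarrow> 'f) \<Rightarrow> ('p set \<Rightarrow> 'h \<Rightarrow> 'f) \<Rightarrow> 'p set \<Rightarrow> 'h \<Rightarrow> 'f) \<Rightarrow>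
    'p set \<Rightarrow> ('p set \<Rightarrow> 'g \<Rightarrow> 'f) \<Rightarrow> ('p set \<Rightarrow> 'h \<Rightarrow> 'f) \<Rightarrow> 'p set \<Rightarrow> 'h \<Rightarrow> 'f" where
  "atiyah M QM A QA E QE nabla U a e =
     section_field M QM E QE U (nabla U a e) - nabla U (section_field M QM A QA U a) e
     - ksign (hdeg (sections M A) U a) *\<^sub>R nabla U a (section_field M QM E QE U e)"

text \<open>The common value of the classes of \<open>At\<^bsup>\<nabla>\<^esup>\<close> for all connections \<open>\<nabla>\<close>.\<close>

definition atiyah_class :: "('p, int, 'f::real_algebra) gring \<Rightarrow> ('p set \<Rightarrow> 'f \<Rightarrow> 'f) \<Rightarrow>
    ('p, 'f, 'q, 'g::real_algebra) vbundle \<Rightarrow> ('q set \<Rightarrow> 'g \<Rightarrow> 'g) \<Rightarrow>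
    ('p set \<Rightarrow> ('p set \<Rightarrow> 'g \<Rightarrow> 'f) \<Rightarrow> 'f \<Rightarrow> 'f) \<Rightarrow>
    ('p, 'f, 'r, 'h::real_algebra) vbundle \<Rightarrow> ('r set \<Rightarrow> 'h \<Rightarrow> 'h) \<Rightarrow>
    ('p set \<Rightarrow> ('p set \<Rightarrow> 'g \<Rightarrow> 'f) \<Rightarrow> ('p set \<Rightarrow> 'h \<Rightarrow> 'f) \<Rightarrow> 'p set \<Rightarrow> 'h \<Rightarrow> 'f) set" where
  "atiyah_class M QM A QA \<rho> E QE = the_elem
     {bundle_hom_class M QM A QA E QE (atiyah M QM A QA E QE nabla) | nabla. A_connection M A \<rho> E nabla}"


section \<open>Bigraded modules\<close>

definition total_degree :: "int \<times> int \<Rightarrow> int" where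
  "total_degree d = fst d + snd d"

definition bigraded_module :: "('p, int \<times> int, 'r::real_algebra) gring \<Rightarrow>
    ('p, int \<times> int, 'r, 'm::real_vector) gmod \<Rightarrow> bool" where
  "bigraded_module R m \<longleftrightarrow> graded_sheaf m \<and> base m = base R \<and>
    (\<forall>U i \<alpha> j x. openin (base R) U \<and> \<alpha> \<in> sec R U i \<and> x \<in> sec m U j \<longrightarrow>
       act m U \<alpha> x \<in> sec m U (i + j) \<and> act m U (unity R U) x = x \<and>
       (\<forall>c. act m U (c *\<^sub>R \<alpha>) x = c *\<^sub>R act m U \<alpha> x \<and> act m U \<alpha> (c *\<^sub>R x) = c *\<^sub>R act m U \<alpha> x) \<and>
       (\<forall>\<beta>\<in>sec R U i. act m U (\<alpha> + \<beta>) x = act m U \<alpha> x + act m U \<beta> x) \<and>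
       (\<forall>y\<in>sec m U j. act m U \<alpha> (x + y) = act m U \<alpha> x + act m U \<alpha> y) \<and>
       (\<forall>k. \<forall>\<beta>\<in>sec R U k. act m U (\<beta> * \<alpha>) x = act m U \<beta> (act m U \<alpha> x)) \<and>
       (\<forall>V. openin (base R) V \<and> V \<subseteq> U \<longrightarrow>
          act m V (res R U V \<alpha>) (res m U V x) = res m U V (act m U \<alpha> x)))"

text \<open>
  The tensor product \<open>\<aa> \<otimes> G\<close> over \<open>C\<^sup>\<infinity>(M)\<close> of \<open>\<aa> = polynomials M A1\<close> and a sheaf \<open>G\<close> of
  \<open>C\<^sup>\<infinity>(M)\<close>-modules, i.e. the sheaf associated with \<open>U \<mapsto> \<aa>(U) \<otimes> G(U)\<close>, characterised up to
  isomorphism.  An element of the tensor product of modules is zero iff it is annihilated by all real-valued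
  balanced maps, since linear functionals separate the points of a real vector space; the last
  condition of \<open>tensor_product\<close> says that relations between elementary tensors hold only
  if they hold locally in \<open>\<aa>(V) \<otimes> G(V)\<close>.
\<close>

definition balanced :: "('p, int, 'f) gring \<Rightarrow> ('p, 'f, 'r, 'h::real_algebra) vbundle \<Rightarrow>
    ('p, int, 'f, 'e::real_vector) gmod \<Rightarrow> 'p set \<Rightarrow> ('h \<Rightarrow> 'e \<Rightarrow> 't::real_vector) \<Rightarrow> bool" where
  "balanced M A1 G U b \<longleftrightarrow>
    (\<forall>i \<alpha> j e. \<alpha> \<in> sec (polynomials M A1) U i \<and> e \<in> sec G U j \<longrightarrow>
       (\<forall>\<beta>\<in>sec (polynomials M A1) U i. b (\<alpha> + \<beta>) e = b \<alpha> e + b \<beta> e) \<and>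
       (\<forall>e'\<in>sec G U j. b \<alpha> (e + e') = b \<alpha> e + b \<alpha> e') \<and>
       (\<forall>c. b (c *\<^sub>R \<alpha>) e = c *\<^sub>R b \<alpha> e \<and> b \<alpha> (c *\<^sub>R e) = c *\<^sub>R b \<alpha> e) \<and>
       (\<forall>k. \<forall>f\<in>sec M U k. b (\<alpha> * pull A1 U f) e = b \<alpha> (act G U f e)))"

definition tensor_product :: "('p, int, 'f) gring \<Rightarrow> ('p, 'f, 'r, 'h::real_algebra) vbundle \<Rightarrow>
    ('p, int, 'f, 'e::real_vector) gmod \<Rightarrow> ('p, int \<times> int, 'h, 'm::real_vector) gmod \<Rightarrow>
    ('p set \<Rightarrow> 'h \<Rightarrow> 'e \<Rightarrow> 'm) \<Rightarrow> bool" where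
  "tensor_product M A1 G m tens \<longleftrightarrow> bigraded_module (polynomials M A1) m \<and>
    (\<forall>U. openin (base M) U \<longrightarrow> balanced M A1 G U (tens U) \<and>
       (\<forall>k p \<alpha> j e. \<alpha> \<in> sec (polynomials M A1) U (k, p) \<and> e \<in> sec G U j \<longrightarrow>
          tens U \<alpha> e \<in> sec m U (k + j, p) \<and>
          (\<forall>i. \<forall>\<beta>\<in>sec (polynomials M A1) U i. act m U \<beta> (tens U \<alpha> e) = tens U (\<beta> * \<alpha>) e) \<and>
          (\<forall>V. openin (base M) V \<and> V \<subseteq> U \<longrightarrow>
             res m U V (tens U \<alpha> e) = tens V (res (polynomials M A1) U V \<alpha>) (res G U V e)))) \<and>
    (\<forall>U k p x y. openin (base M) U \<and> x \<in> sec m U (k, p) \<and> y \<in> U \<longrightarrow>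
       (\<exists>V N \<alpha> e. openin (base M) V \<and> y \<in> V \<and> V \<subseteq> U \<and>
          (\<forall>r<N. \<exists>j. \<alpha> r \<in> sec (polynomials M A1) V (k - j, p) \<and> e r \<in> sec G V j) \<and>
          res m U V x = (\<Sum>r<(N::nat). tens V (\<alpha> r) (e r)))) \<and>
    (\<forall>U N \<alpha> e y. openin (base M) U \<and> y \<in> U \<and>
       (\<forall>r<N. \<exists>i j. \<alpha> r \<in> sec (polynomials M A1) U i \<and> e r \<in> sec G U j) \<and>
       (\<Sum>r<(N::nat). tens U (\<alpha> r) (e r)) = 0 \<longrightarrow>
       (\<exists>V. openin (base M) V \<and> y \<in> V \<and> V \<subseteq> U \<and>
          (\<forall>b::'h \<Rightarrow> 'e \<Rightarrow> real. balanced M A1 G V b \<longrightarrow>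
             (\<Sum>r<N. b (res (polynomials M A1) U V (\<alpha> r)) (res G U V (e r))) = 0)))"

text \<open>The embedding \<open>e \<mapsto> 1 \<otimes> e\<close>, by which \<open>\<Gamma>(E)\<close> is regarded as a part of \<open>\<mm>\<close>.\<close>

abbreviation incl :: "('p, 'f, 'r, 'h) vbundle \<Rightarrow> ('p set \<Rightarrow> 'h \<Rightarrow> 'e \<Rightarrow> 'm) \<Rightarrow> 'p set \<Rightarrow> 'e \<Rightarrow> 'm" where
  "incl A1 tens U e \<equiv> tens U (unity (tot A1) (over A1 U)) e"

text \<open>\<open>Q\<^sub>\<mm> = Q\<^sub>1 \<otimes> 1 + 1 \<otimes> Q\<^bsub>\<Gamma>(E)\<^esub>\<close>\<close>

definition tensor_field :: "('p, int, 'f::real_algebra) gring \<Rightarrow> ('p set \<Rightarrow> 'f \<Rightarrow> 'f) \<Rightarrow>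
    ('p, 'f, 'r, 'h::real_algebra) vbundle \<Rightarrow> ('r set \<Rightarrow> 'h \<Rightarrow> 'h) \<Rightarrow>
    ('p, 'f, 'q, 'g::real_algebra) vbundle \<Rightarrow> ('q set \<Rightarrow> 'g \<Rightarrow> 'g) \<Rightarrow>
    ('p, int \<times> int, 'h, 'm::real_vector) gmod \<Rightarrow> ('p set \<Rightarrow> 'h \<Rightarrow> ('p set \<Rightarrow> 'g \<Rightarrow> 'f) \<Rightarrow> 'm) \<Rightarrow>
    ('p set \<Rightarrow> 'm \<Rightarrow> 'm) \<Rightarrow> bool" where
  "tensor_field M QM A1 Q1 E QE m tens Qm \<longleftrightarrow> sheaf_map m m (topspace (base M)) (1, 0) Qm \<and>
    (\<forall>U i \<alpha> j e. openin (base M) U \<and> \<alpha> \<in> sec (polynomials M A1) U i \<and> e \<in> sec (sections M E) U j \<longrightarrow>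
       Qm U (tens U \<alpha> e) = tens U (Q1 (over A1 U) \<alpha>) e +
         ksign (total_degree i) *\<^sub>R tens U \<alpha> (section_field M QM E QE U e))"

text \<open>The extension of \<open>i\<^sub>X\<close> to \<open>\<mm>\<close> by acting on the first factor.\<close>

definition tensor_contraction :: "('p, int, 'f::real_algebra) gring \<Rightarrow>
    ('p, 'f, 'q, 'g::real_algebra) vbundle \<Rightarrow> ('p, 'f, 'r, 'h::real_algebra) vbundle \<Rightarrow>
    ('p set \<Rightarrow> ('p set \<Rightarrow> 'g \<Rightarrow> 'f) \<Rightarrow> 'r set \<Rightarrow> 'h \<Rightarrow> 'h) \<Rightarrow>
    ('p, 'f, 's, 'l::real_algebra) vbundle \<Rightarrow>
    ('p, int \<times> int, 'h, 'm::real_vector) gmod \<Rightarrow> ('p set \<Rightarrow> 'h \<Rightarrow> ('p set \<Rightarrow> 'l \<Rightarrow> 'f) \<Rightarrow> 'm) \<Rightarrow>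
    ('p set \<Rightarrow> ('p set \<Rightarrow> 'g \<Rightarrow> 'f) \<Rightarrow> 'p set \<Rightarrow> 'm \<Rightarrow> 'm) \<Rightarrow> bool" where
  "tensor_contraction M A A1 \<iota> E m tens \<iota>m \<longleftrightarrow>
    (\<forall>U k X. openin (base M) U \<and> X \<in> sec (sections M A) U k \<longrightarrow>
       sheaf_map m m U (k, - 1) (\<iota>m U X) \<and>
       (\<forall>V i \<alpha> j e. openin (base M) V \<and> V \<subseteq> U \<and> \<alpha> \<in> sec (polynomials M A1) V i \<and>
          e \<in> sec (sections M E) V j \<longrightarrow>
          \<iota>m U X V (tens V \<alpha> e) = tens V (\<iota> U X (over A1 V) \<alpha>) e))"

definition module_connection :: "('p, int, 'f) gring \<Rightarrow>
    ('p, 'f, 'r, 'h::real_algebra) vbundle \<Rightarrow> ('r set \<Rightarrow> 'h \<Rightarrow> 'h) \<Rightarrow>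
    ('p, int \<times> int, 'h, 'm::real_vector) gmod \<Rightarrow> ('p set \<Rightarrow> 'm \<Rightarrow> 'm) \<Rightarrow> bool" where
  "module_connection M A1 d m D \<longleftrightarrow> sheaf_map m m (topspace (base M)) (0, 1) D \<and>
    (\<forall>U i \<alpha> j x. openin (base M) U \<and> \<alpha> \<in> sec (polynomials M A1) U i \<and> x \<in> sec m U j \<longrightarrow>
       D U (act m U \<alpha> x) = act m U (d (over A1 U) \<alpha>) x + ksign (total_degree i) *\<^sub>R act m U \<alpha> (D U x))"

definition induced_connection :: "('p, int, 'f::real_algebra) gring \<Rightarrow>
    ('p, 'f, 'q, 'g::real_algebra) vbundle \<Rightarrow> ('p, 'f, 'r, 'h::real_algebra) vbundle \<Rightarrow>
    ('r set \<Rightarrow> 'h \<Rightarrow> 'h) \<Rightarrow> ('p, 'f, 's, 'l::real_algebra) vbundle \<Rightarrow>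
    ('p set \<Rightarrow> ('p set \<Rightarrow> 'g \<Rightarrow> 'f) \<Rightarrow> ('p set \<Rightarrow> 'l \<Rightarrow> 'f) \<Rightarrow> 'p set \<Rightarrow> 'l \<Rightarrow> 'f) \<Rightarrow>
    ('p, int \<times> int, 'h, 'm::real_vector) gmod \<Rightarrow> ('p set \<Rightarrow> 'h \<Rightarrow> ('p set \<Rightarrow> 'l \<Rightarrow> 'f) \<Rightarrow> 'm) \<Rightarrow>
    ('p set \<Rightarrow> ('p set \<Rightarrow> 'g \<Rightarrow> 'f) \<Rightarrow> 'p set \<Rightarrow> 'm \<Rightarrow> 'm) \<Rightarrow> ('p set \<Rightarrow> 'm \<Rightarrow> 'm) \<Rightarrow> bool" where
  "induced_connection M A A1 d E nabla m tens \<iota>m D \<longleftrightarrow> module_connection M A1 d m D \<and>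
    (\<forall>U k X j e. openin (base M) U \<and> X \<in> sec (sections M A) U k \<and> e \<in> sec (sections M E) U j \<longrightarrow>
       \<iota>m U X U (D U (incl A1 tens U e)) = incl A1 tens U (nabla U X e))"

definition curvature :: "('p set \<Rightarrow> 'm \<Rightarrow> 'm) \<Rightarrow> ('p set \<Rightarrow> 'm \<Rightarrow> 'm) \<Rightarrow> 'p set \<Rightarrow> 'm \<Rightarrow> 'm::real_vector" where
  "curvature Qm D U x = - graded_commutator 1 Qm 1 D U x"

text \<open>
  \<open>m(1)[1]\<close>.  The signs of the two shifts, on the action of odd elements and on the differential,
  cancel each other, so that action and differential are those of \<open>m\<close>.
\<close>

definition shift11 :: "('p, int \<times> int, 'r, 'm) gmod \<Rightarrow> ('p, int \<times> int, 'r, 'm) gmod" where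
  "shift11 m = m\<lparr>sec := (\<lambda>U i. sec m U (i + (1, 1)))\<rparr>"

definition dg_module_map :: "('p, int \<times> int, 'r::real_algebra) gring \<Rightarrow>
    ('p, int \<times> int, 'r, 'm::real_vector) gmod \<Rightarrow> ('p set \<Rightarrow> 'm \<Rightarrow> 'm) \<Rightarrow>
    ('p, int \<times> int, 'r, 'n::real_vector) gmod \<Rightarrow> ('p set \<Rightarrow> 'n \<Rightarrow> 'n) \<Rightarrow>
    ('p set \<Rightarrow> 'm \<Rightarrow> 'n) \<Rightarrow> bool" where
  "dg_module_map R m Qm n Qn F \<longleftrightarrow> sheaf_map m n (topspace (base R)) (0, 0) F \<and>
    (\<forall>U i \<alpha> j x. openin (base R) U \<and> \<alpha> \<in> sec R U i \<and> x \<in> sec m U j \<longrightarrow>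
       F U (act m U \<alpha> x) = act n U \<alpha> (F U x) \<and> F U (Qm U x) = Qn U (F U x))"

text \<open>\<open>Hom\<^sup>d(m|\<^sub>U, m|\<^sub>U)\<close>, its differential, and the class in \<open>H\<^sup>1(Hom\<^sup>\<bullet>\<^sup>,\<^sup>1(m, m))\<close> of \<open>F\<close>.\<close>

definition module_homs :: "('p, int \<times> int, 'r::real_algebra) gring \<Rightarrow>
    ('p, int \<times> int, 'r, 'm::real_vector) gmod \<Rightarrow> 'p set \<Rightarrow> int \<times> int \<Rightarrow> ('p set \<Rightarrow> 'm \<Rightarrow> 'm) set" where
  "module_homs R m U d = {F. sheaf_map m m U d F \<and>
    (\<forall>V i \<alpha> j x. openin (base R) V \<and> V \<subseteq> U \<and> \<alpha> \<in> sec R V i \<and> x \<in> sec m V j \<longrightarrow>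
       F V (act m V \<alpha> x) = ksign (total_degree d * total_degree i) *\<^sub>R act m V \<alpha> (F V x))}"

definition module_hom_diff :: "('p set \<Rightarrow> 'm \<Rightarrow> 'm) \<Rightarrow> int \<times> int \<Rightarrow> ('p set \<Rightarrow> 'm \<Rightarrow> 'm) \<Rightarrow>
    'p set \<Rightarrow> 'm \<Rightarrow> 'm::real_vector" where
  "module_hom_diff Qm d F = graded_commutator 1 Qm (total_degree d) F"

definition module_hom_class :: "('p, int \<times> int, 'r::real_algebra) gring \<Rightarrow>
    ('p, int \<times> int, 'r, 'm::real_vector) gmod \<Rightarrow> ('p set \<Rightarrow> 'm \<Rightarrow> 'm) \<Rightarrow>
    ('p set \<Rightarrow> 'm \<Rightarrow> 'm) \<Rightarrow> ('p set \<Rightarrow> 'm \<Rightarrow> 'm) set" where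
  "module_hom_class R m Qm F = {F' \<in> module_homs R m (topspace (base R)) (1, 1).
     \<exists>G\<in>module_homs R m (topspace (base R)) (0, 1). \<forall>U i x. openin (base R) U \<and> x \<in> sec m U i \<longrightarrow>
       module_hom_diff Qm (1, 1) F' U x = 0 \<and>
       F' U x - F U x = module_hom_diff Qm (0, 1) G U x}"

definition module_class :: "('p, int, 'f) gring \<Rightarrow> ('p, 'f, 'r, 'h::real_algebra) vbundle \<Rightarrow>
    ('r set \<Rightarrow> 'h \<Rightarrow> 'h) \<Rightarrow> ('p, int \<times> int, 'h, 'm::real_vector) gmod \<Rightarrow> ('p set \<Rightarrow> 'm \<Rightarrow> 'm) \<Rightarrow>
    ('p set \<Rightarrow> 'm \<Rightarrow> 'm) set" where
  "module_class M A1 d m Qm = the_elem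
     {module_hom_class (polynomials M A1) m Qm (curvature Qm D) | D. module_connection M A1 d m D}"

text \<open>
  The isomorphism \<open>\<mu> : \<nn> = \<aa> \<otimes> \<Gamma>(End E) \<rightarrow> Hom(\<mm>, \<mm>)\<close>.  It is determined by
  \<open>\<mu>(\<alpha> \<otimes> \<Phi>)(1 \<otimes> e) = \<alpha> \<otimes> \<Phi>(e)\<close>.  Sections \<open>x\<close> of \<open>\<nn>\<close> over \<open>U\<close> are mapped to
  \<open>\<mu> U x \<in> Hom(\<mm>|\<^sub>U, \<mm>|\<^sub>U)\<close>.
\<close>

definition hom_iso :: "('p, int, 'f::real_algebra) gring \<Rightarrow> ('p, 'f, 'r, 'h::real_algebra) vbundle \<Rightarrow>
    ('p, 'f, 's, 'l::real_algebra) vbundle \<Rightarrow>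
    ('p, int \<times> int, 'h, 'm::real_vector) gmod \<Rightarrow> ('p set \<Rightarrow> 'h \<Rightarrow> ('p set \<Rightarrow> 'l \<Rightarrow> 'f) \<Rightarrow> 'm) \<Rightarrow>
    ('p, int \<times> int, 'h, 'n::real_vector) gmod \<Rightarrow>
    ('p set \<Rightarrow> 'h \<Rightarrow> ('p set \<Rightarrow> ('p set \<Rightarrow> 'l \<Rightarrow> 'f) \<Rightarrow> 'p set \<Rightarrow> 'l \<Rightarrow> 'f) \<Rightarrow> 'n) \<Rightarrow>
    ('p set \<Rightarrow> 'n \<Rightarrow> 'p set \<Rightarrow> 'm \<Rightarrow> 'm) \<Rightarrow> bool" where
  "hom_iso M A1 E m tens n tensn \<mu> \<longleftrightarrow>
    (\<forall>U d x. openin (base M) U \<and> x \<in> sec n U d \<longrightarrow>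
       \<mu> U x \<in> module_homs (polynomials M A1) m U d \<and>
       (\<forall>V j \<xi>. openin (base M) V \<and> V \<subseteq> U \<and> \<xi> \<in> sec m V j \<longrightarrow>
          (\<forall>c. \<mu> U (c *\<^sub>R x) V \<xi> = c *\<^sub>R \<mu> U x V \<xi>) \<and>
          (\<forall>y\<in>sec n U d. \<mu> U (x + y) V \<xi> = \<mu> U x V \<xi> + \<mu> U y V \<xi>) \<and>
          \<mu> V (res n U V x) V \<xi> = \<mu> U x V \<xi>)) \<and>
    (\<forall>U i \<alpha> d \<Phi> j e. openin (base M) U \<and> \<alpha> \<in> sec (polynomials M A1) U i \<and> \<Phi> \<in> sec (endos M E) U d \<and>
       e \<in> sec (sections M E) U j \<longrightarrow>
       \<mu> U (tensn U \<alpha> \<Phi>) U (incl A1 tens U e) = tens U \<alpha> (\<Phi> U e))"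

text \<open>
  The element \<open>x\<^sub>T\<close> of \<open>\<nn>\<close> corresponding to a section \<open>T\<close> of degree \<open>d\<close> of \<open>Hom(A \<otimes> E, E)\<close>;
  \<open>x\<^sub>T(e)\<close> is \<open>\<mu>(x\<^sub>T)(e)\<close>.
\<close>

definition form_of :: "('p, int, 'f::real_algebra) gring \<Rightarrow>
    ('p, 'f, 'q, 'g::real_algebra) vbundle \<Rightarrow> ('p, 'f, 'r, 'h::real_algebra) vbundle \<Rightarrow>
    ('p, 'f, 's, 'l::real_algebra) vbundle \<Rightarrow> ('p set \<Rightarrow> 'h \<Rightarrow> ('p set \<Rightarrow> 'l \<Rightarrow> 'f) \<Rightarrow> 'm::real_vector) \<Rightarrow>
    ('p set \<Rightarrow> ('p set \<Rightarrow> 'g \<Rightarrow> 'f) \<Rightarrow> 'p set \<Rightarrow> 'm \<Rightarrow> 'm) \<Rightarrow>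
    ('p, int \<times> int, 'h, 'n::real_vector) gmod \<Rightarrow> ('p set \<Rightarrow> 'n \<Rightarrow> 'p set \<Rightarrow> 'm \<Rightarrow> 'm) \<Rightarrow> int \<Rightarrow>
    ('p set \<Rightarrow> ('p set \<Rightarrow> 'g \<Rightarrow> 'f) \<Rightarrow> ('p set \<Rightarrow> 'l \<Rightarrow> 'f) \<Rightarrow> 'p set \<Rightarrow> 'l \<Rightarrow> 'f) \<Rightarrow> 'n" where
  "form_of M A A1 E tens \<iota>m n \<mu> d T = (THE x. x \<in> sec n (topspace (base M)) (d, 1) \<and>
     (\<forall>U k X j e. openin (base M) U \<and> X \<in> sec (sections M A) U k \<and> e \<in> sec (sections M E) U j \<longrightarrow>
        \<iota>m U X U (\<mu> (topspace (base M)) x U (incl A1 tens U e)) =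
        ksign (k * d) *\<^sub>R incl A1 tens U (T U X e)))"

text \<open>\<open>i\<^sub>X R(e) = (-1)\<^bsup>|X|\<^esup> At(X, e)\<close> for all sections \<open>X\<close> of \<open>A\<close> and \<open>e\<close> of \<open>E\<close> over \<open>U\<close>.\<close>

definition contracts_to_atiyah :: "('p, int, 'f::real_algebra) gring \<Rightarrow> ('p set \<Rightarrow> 'f \<Rightarrow> 'f) \<Rightarrow>
    ('p, 'f, 'q, 'g::real_algebra) vbundle \<Rightarrow> ('q set \<Rightarrow> 'g \<Rightarrow> 'g) \<Rightarrow>
    ('p, 'f, 'r, 'h::real_algebra) vbundle \<Rightarrow>
    ('p, 'f, 's, 'l::real_algebra) vbundle \<Rightarrow> ('s set \<Rightarrow> 'l \<Rightarrow> 'l) \<Rightarrow>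
    ('p set \<Rightarrow> ('p set \<Rightarrow> 'g \<Rightarrow> 'f) \<Rightarrow> ('p set \<Rightarrow> 'l \<Rightarrow> 'f) \<Rightarrow> 'p set \<Rightarrow> 'l \<Rightarrow> 'f) \<Rightarrow>
    ('p set \<Rightarrow> 'h \<Rightarrow> ('p set \<Rightarrow> 'l \<Rightarrow> 'f) \<Rightarrow> 'm::real_vector) \<Rightarrow>
    ('p set \<Rightarrow> ('p set \<Rightarrow> 'g \<Rightarrow> 'f) \<Rightarrow> 'p set \<Rightarrow> 'm \<Rightarrow> 'm) \<Rightarrow> 'p set \<Rightarrow> ('p set \<Rightarrow> 'm \<Rightarrow> 'm) \<Rightarrow> bool" where
  "contracts_to_atiyah M QM A QA A1 E QE nabla tens \<iota>m U R \<longleftrightarrow>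
    (\<forall>k X j e. X \<in> sec (sections M A) U k \<and> e \<in> sec (sections M E) U j \<longrightarrow>
       \<iota>m U X U (R U (incl A1 tens U e)) =
       ksign k *\<^sub>R incl A1 tens U (atiyah M QM A QA E QE nabla U X e))"

end

(*
  The contraction identity is Cartan calculus on m: the operator i_X (anti)commutes with Q_m up to
  i_{QX}, and i_X d e = nabla_X e, so contracting R = -[Q_m, d] applied to 1 (x) e gives
  (-1)^|X| At(X, e).  Linearity of R over a follows because Q_1 and d_A anticommute.

  Uniqueness: linearity over a reduces to the values on sections e of E, which lie in a^1 (x) E.  In a
  local frame such an element is determined by its contractions with the dual frame of A.  Only global
  X and e are available in the hypothesis; local ones become global after multiplication with a
  bump function, and bump functions are not zero divisors where they do not vanish.

  By the same principle mu(x_At) = R, and in polynomial degree one mu intertwines the two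
  differentials up to sign, so mu carries the cohomology class of At onto that of R.
*)
theory Submission
  imports Defs
begin

section \<open>Graded sheaves and modules\<close>

text \<open>The structures are characterised rather than constructed, and this shapes the proof. No
  axiom says directly that the contractions with X and with a restriction of X agree, that
  \<open>Q1\<close> squares to zero, that \<open>Qm\<close> satisfies a Leibniz rule or that
  \<open>\<mu>\<close> is injective; each has to be recovered. On polynomial functions this works
  because a derivation is determined by pull-backs and linear functions, on m because m is locally
  generated by elementary tensors. General functions on A[1] may be formal power series, so the
  recovered identities are proved for polynomial ones only. The tensor product is seen only through
  real-valued balanced maps. A frame of G makes it usable: coordinates followed by a linear
  functional are such maps, so tensors with frame elements are independent. A recurring nuisance is
  0, which has every degree, so that \<open>hdeg\<close> says nothing about it. Tensoriality and
  closedness of At are not computed from the connection: they are read off from linearity of R and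
  from [Q_m, R] = 0, because e |-> 1 (x) e is injective.\<close>

lemma ksign_0 [simp]: "ksign 0 = 1"
  by (simp add: ksign_def)

lemma ksign_add: "ksign (a + b) = ksign a * ksign b"
  by (auto simp: ksign_def)

lemma ksign_diff: "ksign (a - b) = ksign a * ksign b"
  by (auto simp: ksign_def)

lemma ksign_square [simp]: "ksign a * ksign a = 1" "ksign a * (ksign a * x) = x"
  by (auto simp: ksign_def)

lemma ksign_nonzero [simp]: "ksign a \<noteq> 0"
  by (simp add: ksign_def)

lemma ksign_1 [simp]: "ksign 1 = -1"
  by (simp add: ksign_def)

lemma scaleR_fun_apply [simp]: "(c *\<^sub>R f) x = c *\<^sub>R f x"
  by (simp add: scaleR_fun_def)

lemma sum_fun_apply: "(\<Sum>i\<in>I. f i) x = (\<Sum>i\<in>I. f i x)"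
  by (induction I rule: infinite_finite_induct) auto

text \<open>Gluing is left out because it is never established for the Hom modules, which therefore
  enter only at this level. Of the directness of the sum over degrees the pairwise form
  \<open>degree\<close> is kept; it makes the degree of a nonzero section unique.\<close>

locale presheaf_on =
  fixes T :: "'p topology" and S :: "('p, 'i, 'x::real_vector, 'z) gsheaf_scheme"
  assumes base: "base S = T"
    and subspace: "openin T U \<Longrightarrow> subspace (sec S U i)"
    and degree: "openin T U \<Longrightarrow> x \<in> sec S U i \<Longrightarrow> x \<in> sec S U j \<Longrightarrow> i \<noteq> j \<Longrightarrow> x = 0"
    and res_in: "openin T U \<Longrightarrow> openin T V \<Longrightarrow> V \<subseteq> U \<Longrightarrow> x \<in> sec S U i \<Longrightarrow> res S U V x \<in> sec S V i"
    and res_scale: "openin T U \<Longrightarrow> openin T V \<Longrightarrow> V \<subseteq> U \<Longrightarrow> x \<in> sec S U i \<Longrightarrow>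
      res S U V (c *\<^sub>R x) = c *\<^sub>R res S U V x"
    and res_add: "openin T U \<Longrightarrow> openin T V \<Longrightarrow> V \<subseteq> U \<Longrightarrow> x \<in> sec S U i \<Longrightarrow> y \<in> sec S U i \<Longrightarrow>
      res S U V (x + y) = res S U V x + res S U V y"
    and res_id: "openin T U \<Longrightarrow> x \<in> sec S U i \<Longrightarrow> res S U U x = x"
    and res_res: "openin T U \<Longrightarrow> openin T V \<Longrightarrow> openin T W \<Longrightarrow> W \<subseteq> V \<Longrightarrow> V \<subseteq> U \<Longrightarrow> x \<in> sec S U i \<Longrightarrow>
      res S V W (res S U V x) = res S U W x"

lemmas presheaf_base = presheaf_on.base
  and presheaf_subspace = presheaf_on.subspace
  and presheaf_degree = presheaf_on.degree
  and presheaf_res_in = presheaf_on.res_in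
  and presheaf_res_scale = presheaf_on.res_scale
  and presheaf_res_add = presheaf_on.res_add
  and presheaf_res_id = presheaf_on.res_id
  and presheaf_res_res = presheaf_on.res_res

context
  fixes T :: "'p topology" and S :: "('p, 'i, 'x::real_vector, 'z) gsheaf_scheme"
  assumes S: "presheaf_on T S"
begin

lemma presheaf_0: "openin T U \<Longrightarrow> 0 \<in> sec S U i"
  using presheaf_subspace[OF S] subspace_0 by blast

lemma presheaf_add: "openin T U \<Longrightarrow> x \<in> sec S U i \<Longrightarrow> y \<in> sec S U i \<Longrightarrow> x + y \<in> sec S U i"
  using presheaf_subspace[OF S] subspace_add by blast

lemma presheaf_diff: "openin T U \<Longrightarrow> x \<in> sec S U i \<Longrightarrow> y \<in> sec S U i \<Longrightarrow> x - y \<in> sec S U i"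
  using presheaf_subspace[OF S] subspace_diff by blast

lemma presheaf_scale: "openin T U \<Longrightarrow> x \<in> sec S U i \<Longrightarrow> c *\<^sub>R x \<in> sec S U i"
  using presheaf_subspace[OF S] subspace_scale by blast

lemma presheaf_uminus: "openin T U \<Longrightarrow> x \<in> sec S U i \<Longrightarrow> - x \<in> sec S U i"
  using presheaf_subspace[OF S] subspace_neg by blast

lemma presheaf_sum: "openin T U \<Longrightarrow> (\<And>r. r \<in> J \<Longrightarrow> x r \<in> sec S U i) \<Longrightarrow> (\<Sum>r\<in>J. x r) \<in> sec S U i"
  using presheaf_subspace[OF S] subspace_sum by blast

lemma presheaf_res_0: "openin T U \<Longrightarrow> openin T V \<Longrightarrow> V \<subseteq> U \<Longrightarrow> res S U V 0 = 0"
  using presheaf_res_scale[OF S, of U V 0 _ 0] presheaf_0 by simp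

lemma presheaf_res_uminus: "openin T U \<Longrightarrow> openin T V \<Longrightarrow> V \<subseteq> U \<Longrightarrow> x \<in> sec S U i \<Longrightarrow> res S U V (- x) = - res S U V x"
  using presheaf_res_scale[OF S, of U V x i "-1"] by simp

lemma presheaf_res_diff:
  "openin T U \<Longrightarrow> openin T V \<Longrightarrow> V \<subseteq> U \<Longrightarrow> x \<in> sec S U i \<Longrightarrow> y \<in> sec S U i \<Longrightarrow>
   res S U V (x - y) = res S U V x - res S U V y"
  using presheaf_res_add[OF S, of U V x i "- y"] presheaf_res_uminus presheaf_uminus by simp

lemma presheaf_res_sum:
  "openin T U \<Longrightarrow> openin T V \<Longrightarrow> V \<subseteq> U \<Longrightarrow> (\<And>r. r \<in> J \<Longrightarrow> x r \<in> sec S U i) \<Longrightarrow>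
   res S U V (\<Sum>r\<in>J. x r) = (\<Sum>r\<in>J. res S U V (x r))"
proof (induction J rule: infinite_finite_induct)
  case (insert r J)
  then show ?case
    by (subst sum.insert; (simp add: presheaf_res_add[OF S, of U V _ i] presheaf_sum)?)
qed (auto simp: presheaf_res_0)

text \<open>For nonzero x only one degree is possible, so \<open>hdeg\<close> finds it; for x = 0
  the chosen degree is arbitrary but both sides vanish. Signs that involve \<open>hdeg\<close> are
  turned in this way into signs in a known degree.\<close>

lemma ksign_hdeg: "openin T U \<Longrightarrow> x \<in> sec S U i \<Longrightarrow> c (hdeg S U x) *\<^sub>R x = c i *\<^sub>R x"
  by (cases "x = 0") (simp, metis hdeg_def presheaf_degree[OF S] someI_ex)

lemma hdeg_eq: "openin T U \<Longrightarrow> x \<in> sec S U i \<Longrightarrow> x \<noteq> 0 \<Longrightarrow> hdeg S U x = i"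
  by (metis hdeg_def presheaf_degree[OF S] someI_ex)

end

definition sheaf_on :: "'p topology \<Rightarrow> ('p, 'i, 'x::real_vector, 'z) gsheaf_scheme \<Rightarrow> bool" where
  "sheaf_on T S \<longleftrightarrow> base S = T \<and> graded_sheaf S"

text \<open>The family with x in degree i and -x in degree j sums to zero, so directness forces both
  to vanish.\<close>

lemma graded_sheaf_degree:
  assumes "graded_sheaf S" "openin (base S) U" "x \<in> sec S U i" "x \<in> sec S U j" "i \<noteq> j"
  shows "x = 0"
proof -
  define y where "y = (\<lambda>k. if k = i then x else - x)"
  have "subspace (sec S U j)"
    using assms(1)[unfolded graded_sheaf_def, THEN conjunct1] assms(2) by blast
  then have "- x \<in> sec S U j"
    using assms(4) subspace_neg by blast
  then have "\<forall>k\<in>{i,j}. y k \<in> sec S U k" "(\<Sum>k\<in>{i,j}. y k) = 0"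
    using assms(3,5) by (auto simp: y_def)
  then have "\<forall>k\<in>{i,j}. y k = 0"
    using assms(1)[unfolded graded_sheaf_def, THEN conjunct1] assms(2) by (meson finite.emptyI finite_insert)
  then show ?thesis by (simp add: y_def)
qed

lemma sheaf_on_presheaf:
  assumes "sheaf_on T S"
  shows "presheaf_on T S"
proof -
  have T: "base S = T" and S: "graded_sheaf S" using assms by (auto simp: sheaf_on_def)
  note D = S[unfolded graded_sheaf_def T]
  show ?thesis
  proof (unfold_locales, goal_cases)
    case (2 U i)
    then show ?case using D[THEN conjunct1] by blast
  next
    case (3 U x i j)
    then show ?case using graded_sheaf_degree[OF S] T by metis
  next
    case (4 U V x i)
    then show ?case using D[THEN conjunct2, THEN conjunct1] by blast
  next
    case (5 U V x i c)
    then show ?case using D[THEN conjunct2, THEN conjunct1] by blast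
  next
    case (6 U V x i y)
    then show ?case using D[THEN conjunct2, THEN conjunct1] by blast
  next
    case (7 U x i)
    then show ?case using D[THEN conjunct2, THEN conjunct2, THEN conjunct1] by blast
  next
    case (8 U V W x i)
    then show ?case using D[THEN conjunct2, THEN conjunct2, THEN conjunct2, THEN conjunct1] by blast
  qed (rule T)
qed

text \<open>The sheaf axiom indexes the local sections by the open sets themselves, whereas the
  covers below come with an index set in which open sets may repeat. Compatibility of two indices
  with the same open set makes their sections equal, so any choice \<open>h\<close> of an index for
  each set will do.\<close>

lemma sheaf_glue:
  assumes S: "sheaf_on T S" and op: "\<And>j. j \<in> J \<Longrightarrow> openin T (V j)"
    and x: "\<And>j. j \<in> J \<Longrightarrow> x j \<in> sec S (V j) i"
    and compat: "\<And>j k. j \<in> J \<Longrightarrow> k \<in> J \<Longrightarrow> res S (V j) (V j \<inter> V k) (x j) = res S (V k) (V j \<inter> V k) (x k)"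
  shows "\<exists>!a. a \<in> sec S (\<Union>(V ` J)) i \<and> (\<forall>j\<in>J. res S (\<Union>(V ` J)) (V j) a = x j)"
proof -
  define h where "h = (\<lambda>W. SOME j. j \<in> J \<and> V j = W)"
  have h: "h W \<in> J \<and> V (h W) = W" if "W \<in> V ` J" for W
    unfolding h_def using that by (rule_tac someI_ex) auto
  have id: "res S (V j) (V j) (x j) = x j" if "j \<in> J" for j
    using that S op x presheaf_res_id sheaf_on_presheaf by metis
  have hx: "x (h (V j)) = x j" if "j \<in> J" for j
    using compat[of j "h (V j)"] h[of "V j"] id that by (metis Int_absorb imageI)
  have "\<exists>!a. a \<in> sec S (\<Union>(V ` J)) i \<and> (\<forall>W\<in>V ` J. res S (\<Union>(V ` J)) W a = x (h W))"
  proof -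
    have "(\<forall>W\<in>V ` J. openin (base S) W \<and> x (h W) \<in> sec S W i) \<and>
       (\<forall>U\<in>V ` J. \<forall>W\<in>V ` J. res S U (U \<inter> W) (x (h U)) = res S W (U \<inter> W) (x (h W)))"
    proof (intro conjI ballI)
      fix U W assume "U \<in> V ` J" "W \<in> V ` J"
      then show "res S U (U \<inter> W) (x (h U)) = res S W (U \<inter> W) (x (h W))"
        using compat[of "h U" "h W"] h by simp
    qed (use S op x hx in \<open>auto simp: sheaf_on_def\<close>)
    then show ?thesis
      using S unfolding sheaf_on_def graded_sheaf_def
      by (elim conjE) (drule spec[of _ "V ` J"], drule spec[of _ i], drule spec[of _ "\<lambda>W. x (h W)"], blast)
  qed
  then show ?thesis using hx by simp
qed

text \<open>Both sections glue the restrictions of a to a cover indexed by the points of U, and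
  gluing is unique.\<close>

lemma sheaf_eqI:
  assumes S: "sheaf_on T S" and U: "openin T U" and a: "a \<in> sec S U i" "b \<in> sec S U i"
    and loc: "\<And>y. y \<in> U \<Longrightarrow> \<exists>V. openin T V \<and> y \<in> V \<and> V \<subseteq> U \<and> res S U V a = res S U V b"
  shows "a = b"
proof -
  note P = sheaf_on_presheaf[OF S]
  obtain V where V: "\<And>y. y \<in> U \<Longrightarrow> openin T (V y) \<and> y \<in> V y \<and> V y \<subseteq> U \<and> res S U (V y) a = res S U (V y) b"
    using loc by metis
  have un: "\<Union>(V ` U) = U" using V by blast
  have "\<exists>!c. c \<in> sec S (\<Union>(V ` U)) i \<and> (\<forall>j\<in>U. res S (\<Union>(V ` U)) (V j) c = res S U (V j) a)"
  proof (rule sheaf_glue[OF S])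
    fix j k assume "j \<in> U" "k \<in> U"
    then show "res S (V j) (V j \<inter> V k) (res S U (V j) a) = res S (V k) (V j \<inter> V k) (res S U (V k) a)"
      using V presheaf_res_res[OF P U] a(1) by (metis inf_le1 inf_le2 openin_Int)
  qed (use V U a presheaf_res_in[OF P] in auto)
  then show ?thesis unfolding un using a V by metis
qed

section \<open>Morphisms of graded sheaves\<close>

context
  fixes T :: "'p topology" and S :: "('p, 'i::plus, 'x::real_vector, 'z) gsheaf_scheme"
    and S' :: "('p, 'i, 'y::real_vector, 'w) gsheaf_scheme" and U d F
  assumes S: "presheaf_on T S" and F: "sheaf_map S S' U d F"
begin

lemma sheaf_map_in: "openin T V \<Longrightarrow> V \<subseteq> U \<Longrightarrow> x \<in> sec S V i \<Longrightarrow> F V x \<in> sec S' V (i + d)"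
  using F presheaf_base[OF S] unfolding sheaf_map_def by blast

lemma sheaf_map_scale: "openin T V \<Longrightarrow> V \<subseteq> U \<Longrightarrow> x \<in> sec S V i \<Longrightarrow> F V (c *\<^sub>R x) = c *\<^sub>R F V x"
  using F presheaf_base[OF S] unfolding sheaf_map_def by blast

lemma sheaf_map_add:
  "openin T V \<Longrightarrow> V \<subseteq> U \<Longrightarrow> x \<in> sec S V i \<Longrightarrow> y \<in> sec S V i \<Longrightarrow> F V (x + y) = F V x + F V y"
  using F presheaf_base[OF S] unfolding sheaf_map_def by blast

lemma sheaf_map_res:
  "openin T V \<Longrightarrow> V \<subseteq> U \<Longrightarrow> openin T W \<Longrightarrow> W \<subseteq> V \<Longrightarrow> x \<in> sec S V i \<Longrightarrow>
   F W (res S V W x) = res S' V W (F V x)"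
  using F presheaf_base[OF S] unfolding sheaf_map_def by blast

lemma sheaf_map_0: "openin T V \<Longrightarrow> V \<subseteq> U \<Longrightarrow> F V 0 = 0"
  using sheaf_map_scale[of V 0 undefined 0] presheaf_0[OF S] by simp

lemma sheaf_map_uminus: "openin T V \<Longrightarrow> V \<subseteq> U \<Longrightarrow> x \<in> sec S V i \<Longrightarrow> F V (- x) = - F V x"
  using sheaf_map_scale[of V x i "-1"] by simp

lemma sheaf_map_minus:
  "openin T V \<Longrightarrow> V \<subseteq> U \<Longrightarrow> x \<in> sec S V i \<Longrightarrow> y \<in> sec S V i \<Longrightarrow> F V (x - y) = F V x - F V y"
  using sheaf_map_add[of V x i "- y"] sheaf_map_uminus presheaf_uminus[OF S] by simp

lemma sheaf_map_sum:
  "openin T V \<Longrightarrow> V \<subseteq> U \<Longrightarrow> (\<And>r. r \<in> J \<Longrightarrow> x r \<in> sec S V i) \<Longrightarrow> F V (\<Sum>r\<in>J. x r) = (\<Sum>r\<in>J. F V (x r))"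
proof (induction J rule: infinite_finite_induct)
  case (insert r J)
  then show ?case
    by (subst sum.insert; (simp add: sheaf_map_add[of V _ i] presheaf_sum[OF S])?)
qed (auto simp: sheaf_map_0)

end

lemma sheaf_mapI:
  assumes "base S = T"
    and "\<And>V i x. openin T V \<Longrightarrow> V \<subseteq> U \<Longrightarrow> x \<in> sec S V i \<Longrightarrow> F V x \<in> sec S' V (i + d)"
    and "\<And>V i x c. openin T V \<Longrightarrow> V \<subseteq> U \<Longrightarrow> x \<in> sec S V i \<Longrightarrow> F V (c *\<^sub>R x) = c *\<^sub>R F V x"
    and "\<And>V i x y. openin T V \<Longrightarrow> V \<subseteq> U \<Longrightarrow> x \<in> sec S V i \<Longrightarrow> y \<in> sec S V i \<Longrightarrow> F V (x + y) = F V x + F V y"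
    and "\<And>V W i x. openin T V \<Longrightarrow> V \<subseteq> U \<Longrightarrow> openin T W \<Longrightarrow> W \<subseteq> V \<Longrightarrow> x \<in> sec S V i \<Longrightarrow>
          F W (res S V W x) = res S' V W (F V x)"
  shows "sheaf_map S S' U d F"
  unfolding sheaf_map_def by (intro allI impI conjI ballI; elim conjE) (simp_all add: assms)

lemma sheaf_map_mono: "sheaf_map S S' U d F \<Longrightarrow> V \<subseteq> U \<Longrightarrow> sheaf_map S S' V d F"
  unfolding sheaf_map_def by blast

lemma sheaf_map_comp:
  fixes S :: "('p, 'i::semigroup_add, 'x::real_vector, 'z) gsheaf_scheme"
  assumes S: "presheaf_on T S" and S': "presheaf_on T S'"
    and F: "sheaf_map S S' U d F" and G: "sheaf_map S' S'' U e G"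
  shows "sheaf_map S S'' U (d + e) (\<lambda>V x. G V (F V x))"
proof (rule sheaf_mapI[OF presheaf_base[OF S]])
  fix V i x assume *: "openin T V" "V \<subseteq> U" "x \<in> sec S V i"
  show "G V (F V x) \<in> sec S'' V (i + (d + e))"
    using sheaf_map_in[OF S' G *(1,2) sheaf_map_in[OF S F *]] by (simp add: add.assoc)
next
  fix V i x c assume *: "openin T V" "V \<subseteq> U" "x \<in> sec S V i"
  show "G V (F V (c *\<^sub>R x)) = c *\<^sub>R G V (F V x)"
    using sheaf_map_scale[OF S' G *(1,2) sheaf_map_in[OF S F *]] sheaf_map_scale[OF S F *] by simp
next
  fix V i x y assume *: "openin T V" "V \<subseteq> U" "x \<in> sec S V i" "y \<in> sec S V i"
  show "G V (F V (x + y)) = G V (F V x) + G V (F V y)"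
    using sheaf_map_add[OF S' G *(1,2) sheaf_map_in[OF S F *(1-3)] sheaf_map_in[OF S F *(1,2,4)]]
      sheaf_map_add[OF S F *] by simp
next
  fix V W i x assume *: "openin T V" "V \<subseteq> U" "openin T W" "W \<subseteq> V" "x \<in> sec S V i"
  show "G W (F W (res S V W x)) = res S'' V W (G V (F V x))"
    using sheaf_map_res[OF S' G *(1-4) sheaf_map_in[OF S F *(1,2,5)]] sheaf_map_res[OF S F *] by simp
qed

text \<open>Two coefficients cover sums, differences and multiples at once. Later terms such as
  \<open>1 *\<^sub>R F + (-1) *\<^sub>R G\<close>, or with a second coefficient 0, are written in
  this shape in order to match it.\<close>

lemma sheaf_map_lincomb:
  assumes S: "presheaf_on T S" and S': "presheaf_on T S'"
    and F: "sheaf_map S S' U d F" and G: "sheaf_map S S' U d G" and UT: "openin T U"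
  shows "sheaf_map S S' U d (\<lambda>V x. a *\<^sub>R F V x + b *\<^sub>R G V x)"
  by (rule sheaf_mapI[OF presheaf_base[OF S]])
    (auto simp: presheaf_add[OF S'] presheaf_scale[OF S'] sheaf_map_in[OF S F] sheaf_map_in[OF S G]
      sheaf_map_scale[OF S F] sheaf_map_scale[OF S G] sheaf_map_add[OF S F] sheaf_map_add[OF S G]
      sheaf_map_res[OF S F] sheaf_map_res[OF S G]
      presheaf_res_add[OF S' _ _ _ presheaf_scale[OF S' _ sheaf_map_in[OF S F]] presheaf_scale[OF S' _ sheaf_map_in[OF S G]]]
      presheaf_res_scale[OF S' _ _ _ sheaf_map_in[OF S F]] presheaf_res_scale[OF S' _ _ _ sheaf_map_in[OF S G]]
      algebra_simps)

text \<open>Maps commute with restriction, so agreement on small restrictions of x gives local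
  agreement of the images; the sheaf property of the target does the rest.\<close>

lemma graded_sheaf_map_eqI:
  fixes S :: "('p, 'i::plus, 'x::real_vector, 'z) gsheaf_scheme"
  assumes S: "presheaf_on T S" and S': "sheaf_on T S'"
    and F: "sheaf_map S S' U d F" and G: "sheaf_map S S' U d G"
    and U: "openin T U" and V: "openin T V" "V \<subseteq> U" "x \<in> sec S V i"
    and loc: "\<And>y. y \<in> V \<Longrightarrow> \<exists>W. openin T W \<and> y \<in> W \<and> W \<subseteq> V \<and> F W (res S V W x) = G W (res S V W x)"
  shows "F V x = G V x"
proof (rule sheaf_eqI[OF S' V(1) sheaf_map_in[OF S F V] sheaf_map_in[OF S G V]])
  fix y assume "y \<in> V"
  then show "\<exists>W. openin T W \<and> y \<in> W \<and> W \<subseteq> V \<and> res S' V W (F V x) = res S' V W (G V x)"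
    using loc[of y] sheaf_map_res[OF S F V(1,2) _ _ V(3)] sheaf_map_res[OF S G V(1,2) _ _ V(3)] by metis
qed

section \<open>Graded commutative rings and modules over them\<close>

lemma ring_sheaf: "graded_ring_sheaf X \<Longrightarrow> sheaf_on (base X) X"
  by (simp add: graded_ring_sheaf_def sheaf_on_def)

context
  fixes X :: "('p, int, 'f::real_algebra) gring"
  assumes X: "graded_ring_sheaf X"
begin

lemma ring_presheaf: "presheaf_on (base X) X"
  using ring_sheaf[OF X] sheaf_on_presheaf by blast

lemma ring_unity_in: "openin (base X) U \<Longrightarrow> unity X U \<in> sec X U 0"
  using X[unfolded graded_ring_sheaf_def, THEN conjunct2, THEN conjunct1] by blast

lemma ring_unity_res: "openin (base X) U \<Longrightarrow> openin (base X) V \<Longrightarrow> V \<subseteq> U \<Longrightarrow> res X U V (unity X U) = unity X V"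
  using X[unfolded graded_ring_sheaf_def, THEN conjunct2, THEN conjunct1] by blast

lemma ring_mult_in: "openin (base X) U \<Longrightarrow> f \<in> sec X U i \<Longrightarrow> g \<in> sec X U j \<Longrightarrow> f * g \<in> sec X U (i + j)"
  using X[unfolded graded_ring_sheaf_def, THEN conjunct2, THEN conjunct2] by blast

lemma ring_commute: "openin (base X) U \<Longrightarrow> f \<in> sec X U i \<Longrightarrow> g \<in> sec X U j \<Longrightarrow> g * f = ksign (i * j) *\<^sub>R (f * g)"
  using X[unfolded graded_ring_sheaf_def, THEN conjunct2, THEN conjunct2] by blast

lemma ring_unity_left: "openin (base X) U \<Longrightarrow> f \<in> sec X U i \<Longrightarrow> unity X U * f = f"
  using X[unfolded graded_ring_sheaf_def, THEN conjunct2, THEN conjunct2] by blast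

lemma ring_unity_right: "openin (base X) U \<Longrightarrow> f \<in> sec X U i \<Longrightarrow> f * unity X U = f"
  using ring_commute[of U "unity X U" 0 f i] ring_unity_in ring_unity_left by simp

lemma ring_res_mult:
  "openin (base X) U \<Longrightarrow> openin (base X) V \<Longrightarrow> V \<subseteq> U \<Longrightarrow> f \<in> sec X U i \<Longrightarrow> g \<in> sec X U j \<Longrightarrow>
   res X U V (f * g) = res X U V f * res X U V g"
  using X[unfolded graded_ring_sheaf_def, THEN conjunct2, THEN conjunct2] by blast

end

locale module_on =
  fixes M :: "('p, int, 'f::real_algebra) gring" and P :: "('p, int, 'f, 'x::real_vector) gmod"
  assumes presheaf: "presheaf_on (base M) P"
    and act_in: "openin (base M) U \<Longrightarrow> f \<in> sec M U i \<Longrightarrow> x \<in> sec P U j \<Longrightarrow> act P U f x \<in> sec P U (i + j)"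
    and unity: "openin (base M) U \<Longrightarrow> x \<in> sec P U j \<Longrightarrow> act P U (unity M U) x = x"
    and scale_left: "openin (base M) U \<Longrightarrow> f \<in> sec M U i \<Longrightarrow> x \<in> sec P U j \<Longrightarrow>
      act P U (c *\<^sub>R f) x = c *\<^sub>R act P U f x"
    and scale_right: "openin (base M) U \<Longrightarrow> f \<in> sec M U i \<Longrightarrow> x \<in> sec P U j \<Longrightarrow>
      act P U f (c *\<^sub>R x) = c *\<^sub>R act P U f x"
    and add_left: "openin (base M) U \<Longrightarrow> f \<in> sec M U i \<Longrightarrow> g \<in> sec M U i \<Longrightarrow> x \<in> sec P U j \<Longrightarrow>
      act P U (f + g) x = act P U f x + act P U g x"
    and add_right: "openin (base M) U \<Longrightarrow> f \<in> sec M U i \<Longrightarrow> x \<in> sec P U j \<Longrightarrow> y \<in> sec P U j \<Longrightarrow>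
      act P U f (x + y) = act P U f x + act P U f y"
    and assoc: "openin (base M) U \<Longrightarrow> f \<in> sec M U i \<Longrightarrow> g \<in> sec M U k \<Longrightarrow> x \<in> sec P U j \<Longrightarrow>
      act P U (g * f) x = act P U g (act P U f x)"
    and res: "openin (base M) U \<Longrightarrow> f \<in> sec M U i \<Longrightarrow> x \<in> sec P U j \<Longrightarrow> openin (base M) V \<Longrightarrow> V \<subseteq> U \<Longrightarrow>
      res P U V (act P U f x) = act P V (res M U V f) (res P U V x)"

lemmas module_presheaf = module_on.presheaf
  and module_act_in = module_on.act_in
  and module_unity = module_on.unity
  and module_scale_left = module_on.scale_left
  and module_scale_right = module_on.scale_right
  and module_add_left = module_on.add_left
  and module_add_right = module_on.add_right
  and module_assoc = module_on.assoc
  and module_res = module_on.res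

context
  fixes M :: "('p, int, 'f::real_algebra) gring" and P :: "('p, int, 'f, 'x::real_vector) gmod"
  assumes P: "module_on M P"
begin

lemma module_zero_left: "openin (base M) U \<Longrightarrow> presheaf_on (base M) M \<Longrightarrow> x \<in> sec P U j \<Longrightarrow> act P U 0 x = 0"
  using module_scale_left[OF P, of U 0 0 x j 0] presheaf_0[of "base M" M] by simp

lemma module_zero_right: "openin (base M) U \<Longrightarrow> f \<in> sec M U i \<Longrightarrow> act P U f 0 = 0"
  using module_scale_right[OF P, of U f i 0 0 0] presheaf_0[OF module_presheaf[OF P]] by simp

lemma module_sum_right:
  assumes "openin (base M) U" "f \<in> sec M U i" "\<And>r. r \<in> J \<Longrightarrow> x r \<in> sec P U j"
  shows "act P U f (\<Sum>r\<in>J. x r) = (\<Sum>r\<in>J. act P U f (x r))"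
  using assms(3)
proof (induction J rule: infinite_finite_induct)
  case (insert r J)
  then show ?case
    using assms(1,2) by (simp add: module_add_right[OF P, of U f i _ j] presheaf_sum[OF module_presheaf[OF P]])
qed (auto simp: module_zero_right[OF assms(1,2)])

end

lemma fun_mod_simps [simp]:
  "base (fun_mod M) = base M" "sec (fun_mod M) = sec M" "res (fun_mod M) = res M" "act (fun_mod M) U f g = f * g"
  by (simp_all add: fun_mod_def)

lemma module_fun_mod: 
  assumes M: "graded_ring_sheaf M" 
  shows "module_on M (fun_mod M)"
proof (rule module_on.intro)
  show "presheaf_on (base M) (fun_mod M)"
    using ring_presheaf[OF M] by (simp add: presheaf_on_def)
qed (auto simp: ring_mult_in[OF M] ring_unity_left[OF M] ring_res_mult[OF M] algebra_simps)

section \<open>Modules of homomorphisms\<close>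

lemma hom_mod_simps [simp]:
  "base (hom_mod M P P') = base M" "sec (hom_mod M P P') = hom_sec M P P'"
  "res (hom_mod M P P') = (\<lambda>U V F. hom_ext P V F)"
  "act (hom_mod M P P') = (\<lambda>U f F. hom_ext P U (\<lambda>V x. act P' V (res M U V f) (F V x)))"
  by (simp_all add: hom_mod_def)

lemma hom_ext_apply: "openin (base P) V \<Longrightarrow> V \<subseteq> U \<Longrightarrow> x \<in> sec P V i \<Longrightarrow> hom_ext P U F V x = F V x"
  by (auto simp: hom_ext_def)

lemma hom_ext_hom_ext: "V \<subseteq> U \<Longrightarrow> hom_ext P V (hom_ext P U F) = hom_ext P V F"
  by (auto simp: hom_ext_def fun_eq_iff)

lemma hom_ext_eqI:
  assumes "\<And>V i x. openin (base P) V \<Longrightarrow> V \<subseteq> U \<Longrightarrow> x \<in> sec P V i \<Longrightarrow> F V x = G V x"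
  shows "hom_ext P U F = hom_ext P U G"
  using assms by (auto simp: hom_ext_def fun_eq_iff)

lemma hom_sec_map: "F \<in> hom_sec M P P' U k \<Longrightarrow> sheaf_map P P' U k F"
  by (simp add: hom_sec_def)

lemma hom_sec_ext: "F \<in> hom_sec M P P' U k \<Longrightarrow> hom_ext P U F = F"
  by (simp add: hom_sec_def)

lemma hom_sec_act: "F \<in> hom_sec M P P' U k \<Longrightarrow> openin (base M) V \<Longrightarrow> V \<subseteq> U \<Longrightarrow> f \<in> sec M V i \<Longrightarrow>
    x \<in> sec P V j \<Longrightarrow> F V (act P V f x) = ksign (k * i) *\<^sub>R act P' V f (F V x)"
  unfolding hom_sec_def by blast

text \<open>A section of the Hom sheaf is 0 off its domain by \<open>hom_ext\<close>, so equality on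
  homogeneous arguments is equality of functions.\<close>

lemma hom_sec_eqI:
  assumes "F \<in> hom_sec M P P' U k" "G \<in> hom_sec M P P' U k'"
    and "\<And>V i x. openin (base P) V \<Longrightarrow> V \<subseteq> U \<Longrightarrow> x \<in> sec P V i \<Longrightarrow> F V x = G V x"
  shows "F = G"
  using hom_ext_eqI[of P U F G] hom_sec_ext[OF assms(1)] hom_sec_ext[OF assms(2)] assms(3) by simp

text \<open>Separates two concerns: linearity is checked for an unnormalised F, and the normal form
  with value 0 off the domain is imposed afterwards. The Hom sections constructed later are built
  this way.\<close>

lemma hom_ext_in_hom_sec:
  assumes P: "module_on M P"
    and F: "sheaf_map P P' U k F"
    and lin: "\<And>V i f j x. openin (base M) V \<Longrightarrow> V \<subseteq> U \<Longrightarrow> f \<in> sec M V i \<Longrightarrow> x \<in> sec P V j \<Longrightarrow>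
        F V (act P V f x) = ksign (k * i) *\<^sub>R act P' V f (F V x)"
  shows "hom_ext P U F \<in> hom_sec M P P' U k"
proof -
  note p = module_presheaf[OF P] note [simp] = presheaf_base[OF p]
  have "sheaf_map P P' U k (hom_ext P U F)"
  proof (rule sheaf_mapI[OF presheaf_base[OF p]], goal_cases)
    case (4 V W i x)
    then have "W \<subseteq> U" by blast
    with 4 show ?case 
      by (simp add: hom_ext_apply[of P V U x i] hom_ext_apply[of P W U "res P V W x" i] 
         presheaf_res_in[OF p] sheaf_map_res[OF p F])
  next
    case (3 V i x y)
    then show ?case by (simp add: hom_ext_apply[of P V U _ i] presheaf_add[OF p] sheaf_map_add[OF p F])
  next
    case (2 V i x c)
    then show ?case by (simp add: hom_ext_apply[of P V U _ i] presheaf_scale[OF p] sheaf_map_scale[OF p F])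
  qed (simp add: hom_ext_apply sheaf_map_in[OF p F])
  moreover have "hom_ext P U F V (act P V f x) = ksign (k * i) *\<^sub>R act P' V f (hom_ext P U F V x)"
    if "openin (base M) V" "V \<subseteq> U" "f \<in> sec M V i" "x \<in> sec P V j" for V i f j x
    using that by (simp add: hom_ext_apply[of P V U "act P V f x" "i + j"] hom_ext_apply[of P V U x j] 
        module_act_in[OF P] lin)
  ultimately show ?thesis unfolding hom_sec_def by (auto simp: hom_ext_hom_ext)
qed

lemma hom_sec_zeroI:
  assumes "F \<in> hom_sec M P P' U k"
    and "\<And>V i x. openin (base P) V \<Longrightarrow> V \<subseteq> U \<Longrightarrow> x \<in> sec P V i \<Longrightarrow> F V x = 0"
  shows "F = 0"
proof -
  have "hom_ext P U F = 0"
    using hom_ext_eqI[of P U F 0] assms(2) by (simp add: hom_ext_def fun_eq_iff)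
  then show ?thesis using hom_sec_ext[OF assms(1)] by simp
qed

text \<open>Serves twice in a row: sections of a bundle are Hom(linear functions, functions), and
  endomorphisms are Hom(sections, sections).\<close>

lemma module_hom_mod:
  assumes M: "graded_ring_sheaf M" and P: "module_on M P" and P': "module_on M P'"
  shows "module_on M (hom_mod M P P')"
proof -
  note p = module_presheaf[OF P] note p' = module_presheaf[OF P'] note m = ring_presheaf[OF M]
  note [simp] = presheaf_base[OF p] presheaf_base[OF p']
  have ext0: "hom_ext P U 0 = 0" for U by (simp add: hom_ext_def fun_eq_iff)
  have ext_add: "hom_ext P U (F + G) = hom_ext P U F + hom_ext P U G" for U and F G :: "'a set \<Rightarrow> 'c \<Rightarrow> 'd"
    by (auto simp: hom_ext_def fun_eq_iff)
  have ext_scale: "hom_ext P U (c *\<^sub>R F) = c *\<^sub>R hom_ext P U F" for U c and F :: "'a set \<Rightarrow> 'c \<Rightarrow> 'd"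
    by (auto simp: hom_ext_def fun_eq_iff)
  have comb: "a *\<^sub>R F + b *\<^sub>R G \<in> hom_sec M P P' U k" if U: "openin (base M) U" 
    and F: "F \<in> hom_sec M P P' U k" and G: "G \<in> hom_sec M P P' U k" for U k F G a b
  proof -
    note f = hom_sec_map[OF F] note g = hom_sec_map[OF G]
    have "sheaf_map P P' U k (\<lambda>V x. a *\<^sub>R F V x + b *\<^sub>R G V x)"
      by (rule sheaf_map_lincomb[OF p p' f g U])
    then have 1: "sheaf_map P P' U k (a *\<^sub>R F + b *\<^sub>R G)"
      by (simp add: plus_fun_def scaleR_fun_def)
    show ?thesis
    \<comment> \<open>Rewrites the combination as the normal form of itself, to which the membership
      rule for \<open>hom_ext\<close> applies.\<close>
    proof (subst hom_sec_ext[OF F, symmetric], subst hom_sec_ext[OF G, symmetric], 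
        subst ext_scale[symmetric], subst ext_scale[symmetric], subst ext_add[symmetric], 
        rule hom_ext_in_hom_sec[OF P 1])
      fix V i h j x assume *: "openin (base M) V" "V \<subseteq> U" "h \<in> sec M V i" "x \<in> sec P V j"
      show "(a *\<^sub>R F + b *\<^sub>R G) V (act P V h x) = ksign (k * i) *\<^sub>R act P' V h ((a *\<^sub>R F + b *\<^sub>R G) V x)"
        using * by (simp add: hom_sec_act[OF F] hom_sec_act[OF G] scaleR_add_right mult.commute
            module_add_right[OF P' *(1,3) presheaf_scale[OF p' *(1) sheaf_map_in[OF p f *(1,2,4)]] 
              presheaf_scale[OF p' *(1) sheaf_map_in[OF p g *(1,2,4)]]]
            module_scale_right[OF P' *(1,3) sheaf_map_in[OF p f *(1,2,4)]]
            module_scale_right[OF P' *(1,3) sheaf_map_in[OF p g *(1,2,4)]])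
    qed
  qed
  have act_in: "hom_ext P U (\<lambda>V x. act P' V (res M U V f) (F V x)) \<in> hom_sec M P P' U (i + j)"
    if U: "openin (base M) U" and f: "f \<in> sec M U i" and F: "F \<in> hom_sec M P P' U j" for U i f j F
  proof (rule hom_ext_in_hom_sec[OF P])
    note s = hom_sec_map[OF F]
    have rf: "res M U V f \<in> sec M V i" if "openin (base M) V" "V \<subseteq> U" for V
      using presheaf_res_in[OF m U that f] .
    show "sheaf_map P P' U (i + j) (\<lambda>V x. act P' V (res M U V f) (F V x))"
    proof (rule sheaf_mapI[OF presheaf_base[OF p]], goal_cases)
      case (1 V k x)
      then show ?case using module_act_in[OF P' _ rf sheaf_map_in[OF p s]] by (fastforce simp: add_ac)
    next
      case (2 V k x c)
      then show ?case using module_scale_right[OF P' _ rf sheaf_map_in[OF p s]] 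
        by (simp add: sheaf_map_scale[OF p s])
    next
      case (3 V k x y)
      then show ?case using module_add_right[OF P' _ rf sheaf_map_in[OF p s] sheaf_map_in[OF p s]] 
        by (simp add: sheaf_map_add[OF p s])
    next
      case (4 V W k x)
      then show ?case using module_res[OF P' _ rf sheaf_map_in[OF p s]] 
        by (simp add: sheaf_map_res[OF p s] presheaf_res_res[OF m U _ _ _ _ f])
    qed
    fix V k g l x assume *: "openin (base M) V" "V \<subseteq> U" "g \<in> sec M V k" "x \<in> sec P V l"
    note Fx = sheaf_map_in[OF p s *(1,2,4)]
    have "act P' V (res M U V f) (F V (act P V g x)) = ksign (j * k) *\<^sub>R act P' V (res M U V f * g) (F V x)"
      using hom_sec_act[OF F *] module_scale_right[OF P' *(1) rf[OF *(1,2)] module_act_in[OF P' *(1,3) Fx]]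
        module_assoc[OF P' *(1) *(3) rf[OF *(1,2)] Fx] by simp
    also have "\<dots> = ksign (j * k) *\<^sub>R ksign (k * i) *\<^sub>R act P' V g (act P' V (res M U V f) (F V x))"
      using ring_commute[OF M *(1) *(3) rf[OF *(1,2)]] 
        module_scale_left[OF P' *(1) ring_mult_in[OF M *(1) *(3) rf[OF *(1,2)]] Fx]
        module_assoc[OF P' *(1) rf[OF *(1,2)] *(3)  Fx] by simp
    \<comment> \<open>Passing g through F gives the exponent jk, commuting it with f gives ki;
      together (i + j)k.\<close>
    finally show "act P' V (res M U V f) (F V (act P V g x)) = ksign ((i + j) * k) *\<^sub>R act P' V g (act P' V (res M U V f) (F V x))"
      by (simp add: ring_distribs ksign_add mult.commute)
  qed
  have zero: "0 \<in> hom_sec M P P' U k" if "openin (base M) U" for U k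
  proof -
    have "sheaf_map P P' U k 0"
      by (rule sheaf_mapI[OF presheaf_base[OF p]]) (use openin_subset in \<open>auto simp: presheaf_0[OF p'] presheaf_res_0[OF p']\<close>)
    from hom_ext_in_hom_sec[OF P this] show ?thesis
      by (simp add: ext0 module_zero_right[OF P'])
  qed
  have res_in: "hom_ext P V F \<in> hom_sec M P P' V k" if "openin (base M) V" "V \<subseteq> U" "F \<in> hom_sec M P P' U k" for U V F k
    by (rule hom_ext_in_hom_sec[OF P sheaf_map_mono[OF hom_sec_map[OF that(3)] that(2)]])
      (use that(2) in \<open>auto intro!: hom_sec_act[OF that(3)]\<close>)
  have subsp: "subspace (hom_sec M P P' U k)" if "openin (base M) U" for U k
    using comb[OF that, of _ k _ 1 1] zero[OF that] comb[OF that, of _ k _ _ 0]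
    unfolding subspace_def by (metis add.right_neutral scaleR_one scaleR_zero_left)
  have deg: "F = 0" if "openin (base M) U" "F \<in> hom_sec M P P' U i" "F \<in> hom_sec M P P' U j" "i \<noteq> j" for U F i j
  proof (rule hom_sec_zeroI[OF that(2)])
    fix V k x assume *: "openin (base P) V" "V \<subseteq> U" "x \<in> sec P V k"
    have "F V x \<in> sec P' V (k + i)" "F V x \<in> sec P' V (k + j)"
      using * sheaf_map_in[OF p hom_sec_map[OF that(2)]] sheaf_map_in[OF p hom_sec_map[OF that(3)]] by auto
    then show "F V x = 0" using presheaf_degree[OF p'] * that(4) by (metis add_left_cancel presheaf_base[OF p])
  qed
  show ?thesis
  proof (rule module_on.intro, goal_cases)
    case 1
    show ?case 
      by unfold_locales (auto simp: subsp ext_add ext_scale hom_ext_hom_ext res_in deg hom_sec_ext)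
  next
    case (2 U f i x j)
    then show ?case using act_in by simp
  next
    case (3 U F j)
    then have F: "F \<in> hom_sec M P P' U j" by simp
    have "hom_ext P U (\<lambda>V x. act P' V (res M U V (unity M U)) (F V x)) = hom_ext P U F"
    proof (rule hom_ext_eqI)
      fix V i x assume "openin (base P) V" and *: "V \<subseteq> U" "x \<in> sec P V i"
      then have V: "openin (base M) V" by simp
      show "act P' V (res M U V (unity M U)) (F V x) = F V x"
        using module_unity[OF P' V sheaf_map_in[OF p hom_sec_map[OF F] V *]] ring_unity_res[OF M 3(1) V *(1)] by simp
    qed
    then show ?case using hom_sec_ext[OF F] by simp
  next
    case (4 U f i F j c)
    then have F: "F \<in> hom_sec M P P' U j" by simp
    show ?case unfolding hom_mod_simps ext_scale[symmetric]
      by (rule hom_ext_eqI) (simp add: presheaf_res_scale[OF m 4(1) _ _ 4(2)]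
         module_scale_left[OF P' _ presheaf_res_in[OF m 4(1) _ _ 4(2)] sheaf_map_in[OF p hom_sec_map[OF F]]])
  next
    case (5 U f i F j c)
    then have F: "F \<in> hom_sec M P P' U j" by simp
    show ?case unfolding hom_mod_simps ext_scale[symmetric]
      by (rule hom_ext_eqI) (simp add: 
         module_scale_right[OF P' _ presheaf_res_in[OF m 5(1) _ _ 5(2)] sheaf_map_in[OF p hom_sec_map[OF F]]])
  next
    case (6 U f i g F j)
    then have F: "F \<in> hom_sec M P P' U j" by simp
    show ?case unfolding hom_mod_simps ext_add[symmetric]
      by (rule hom_ext_eqI) (simp add: presheaf_res_add[OF m 6(1) _ _ 6(2,3)]
         module_add_left[OF P' _ presheaf_res_in[OF m 6(1) _ _ 6(2)] presheaf_res_in[OF m 6(1) _ _ 6(3)] 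
           sheaf_map_in[OF p hom_sec_map[OF F]]])
  next
    case (7 U f i F j G)
    then have F: "F \<in> hom_sec M P P' U j" "G \<in> hom_sec M P P' U j" by simp_all
    show ?case unfolding hom_mod_simps ext_add[symmetric]
      by (rule hom_ext_eqI) (simp add: module_add_right[OF P' _ presheaf_res_in[OF m 7(1) _ _ 7(2)] 
           sheaf_map_in[OF p hom_sec_map[OF F(1)]] sheaf_map_in[OF p hom_sec_map[OF F(2)]]])
  next
    case (8 U f i g k F j)
    then have F: "F \<in> hom_sec M P P' U j" by simp
    show ?case unfolding hom_mod_simps
      by (rule hom_ext_eqI) (simp add: hom_ext_apply ring_res_mult[OF M 8(1) _ _ 8(3,2)]
          module_assoc[OF P' _ presheaf_res_in[OF m 8(1) _ _ 8(2)] presheaf_res_in[OF m 8(1) _ _ 8(3)] 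
           sheaf_map_in[OF p hom_sec_map[OF F]]])
  next
    case (9 U f i F j V)
    then show ?case unfolding hom_mod_simps hom_ext_hom_ext[OF 9(5)]
      by (intro hom_ext_eqI) (simp add: hom_ext_apply presheaf_res_res[OF m 9(1) 9(4) _ _ 9(5) 9(2)])
  qed
qed

section \<open>Local frames\<close>

lemma sum_delta_eq: "finite I \<Longrightarrow> j \<in> I \<Longrightarrow> (\<And>i. i \<in> I \<Longrightarrow> i \<noteq> j \<Longrightarrow> f i = 0) \<Longrightarrow> (\<Sum>i\<in>I. f i) = f j"
  by (simp add: sum.remove)

text \<open>Spanning and independence are demanded over every smaller open set and in every degree.
  Hence frames restrict at once, and coefficients never have to be glued.\<close>

locale frame_on =
  fixes M :: "('p, int, 'f::real_algebra) gring" and P :: "('p, int, 'f, 'x::real_vector) gmod"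
    and U :: "'p set" and I :: "'i set" and d :: "'i \<Rightarrow> int" and p :: "'i \<Rightarrow> 'x"
  assumes ring: "graded_ring_sheaf M" and module: "module_on M P"
    and open_base: "openin (base M) U" and finite_index: "finite I"
    and frame_in: "i \<in> I \<Longrightarrow> p i \<in> sec P U (d i)"
    and spanning: "openin (base M) V \<Longrightarrow> V \<subseteq> U \<Longrightarrow> x \<in> sec P V k \<Longrightarrow>
      \<exists>c. (\<forall>i\<in>I. c i \<in> sec M V (k - d i)) \<and> x = (\<Sum>i\<in>I. act P V (c i) (res P U V (p i)))"
    and independent: "openin (base M) V \<Longrightarrow> V \<subseteq> U \<Longrightarrow> (\<And>i. i \<in> I \<Longrightarrow> c i \<in> sec M V (k - d i)) \<Longrightarrow>
      (\<Sum>i\<in>I. act P V (c i) (res P U V (p i))) = 0 \<Longrightarrow> i \<in> I \<Longrightarrow> c i = 0"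
begin

abbreviation basis :: "'p set \<Rightarrow> 'i \<Rightarrow> 'x" where
  "basis V i \<equiv> res P U V (p i)"

text \<open>The degree k is chosen along with the coefficients, so that the coordinates depend on
  the section alone. Only x = 0 admits several degrees, and its coordinates are 0 by
  independence.\<close>

definition coord :: "'p set \<Rightarrow> 'x \<Rightarrow> 'i \<Rightarrow> 'f" where
  "coord V x = (SOME c. \<exists>k. x \<in> sec P V k \<and> (\<forall>i\<in>I. c i \<in> sec M V (k - d i)) \<and>
     x = (\<Sum>i\<in>I. act P V (c i) (basis V i)))"

lemmas pre = module_presheaf[OF module] and pre_ring = ring_presheaf[OF ring]

lemma basis_in: "openin (base M) V \<Longrightarrow> V \<subseteq> U \<Longrightarrow> i \<in> I \<Longrightarrow> basis V i \<in> sec P V (d i)"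
  using presheaf_res_in[OF pre open_base _ _ frame_in] .

lemma term_in: "openin (base M) V \<Longrightarrow> V \<subseteq> U \<Longrightarrow> i \<in> I \<Longrightarrow> c \<in> sec M V (k - d i) \<Longrightarrow> act P V c (basis V i) \<in> sec P V k"
  using module_act_in[OF module _ _ basis_in, of V c "k - d i" i] by simp

lemma coord_props:
  assumes "openin (base M) V" "V \<subseteq> U" "x \<in> sec P V k"
  shows "(\<forall>i\<in>I. coord V x i \<in> sec M V (k - d i)) \<and> x = (\<Sum>i\<in>I. act P V (coord V x i) (basis V i))"
proof -
  obtain c where "(\<forall>i\<in>I. c i \<in> sec M V (k - d i)) \<and> x = (\<Sum>i\<in>I. act P V (c i) (basis V i))"
    using spanning[OF assms] ..
  with assms(3) have "\<exists>c k. x \<in> sec P V k \<and> (\<forall>i\<in>I. c i \<in> sec M V (k - d i)) \<and>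
      x = (\<Sum>i\<in>I. act P V (c i) (basis V i))" by (intro exI conjI) auto
  from someI_ex[OF this, folded coord_def]
  obtain k' where k': "x \<in> sec P V k'" "\<forall>i\<in>I. coord V x i \<in> sec M V (k' - d i)"
    "x = (\<Sum>i\<in>I. act P V (coord V x i) (basis V i))" by (elim exE conjE) (rule that)
  show ?thesis
  proof (cases "k = k'")
    case False
    then have "x = 0" using presheaf_degree[OF pre assms(1)] assms(3) k'(1) by blast
    moreover have "coord V x i = 0" if "i \<in> I" for i
      using independent[OF assms(1,2) k'(2)[rule_format] _ that] k'(3) \<open>x = 0\<close> by metis
    ultimately show ?thesis using k'(3) presheaf_0[OF pre_ring assms(1)] by metis
  next
    case True
    with k' show ?thesis by blast
  qed
qed

lemma coord_in: "openin (base M) V \<Longrightarrow> V \<subseteq> U \<Longrightarrow> x \<in> sec P V k \<Longrightarrow> i \<in> I \<Longrightarrow> coord V x i \<in> sec M V (k - d i)"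
  by (rule coord_props[THEN conjunct1, rule_format])

lemma coord_sum: "openin (base M) V \<Longrightarrow> V \<subseteq> U \<Longrightarrow> x \<in> sec P V k \<Longrightarrow> (\<Sum>i\<in>I. act P V (coord V x i) (basis V i)) = x"
  by (rule coord_props[THEN conjunct2, symmetric])

text \<open>The difference of two coefficient families is a relation among the basis. The rules for
  coordinates below all follow by exhibiting coefficients.\<close>

lemma coord_unique:
  assumes V: "openin (base M) V" "V \<subseteq> U" and c: "\<And>i. i \<in> I \<Longrightarrow> c i \<in> sec M V (k - d i)"
    and x: "x = (\<Sum>i\<in>I. act P V (c i) (basis V i))" and i: "i \<in> I"
  shows "coord V x i = c i"
proof -
  have xk: "x \<in> sec P V k"
    unfolding x by (rule presheaf_sum[OF pre V(1)]) (rule term_in[OF V _ c])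
  note co = coord_in[OF V xk]
  have "(\<Sum>i\<in>I. act P V (coord V x i - c i) (basis V i)) =
      (\<Sum>i\<in>I. act P V (coord V x i) (basis V i) - act P V (c i) (basis V i))"
  proof (rule sum.cong[OF refl])
    fix j assume j: "j \<in> I"
    have "act P V (coord V x j + (-1) *\<^sub>R c j) (basis V j) =
        act P V (coord V x j) (basis V j) + (-1) *\<^sub>R act P V (c j) (basis V j)"
      using module_add_left[OF module V(1) co[OF j] presheaf_scale[OF pre_ring V(1) c[OF j], of "-1"] basis_in[OF V j]]
        module_scale_left[OF module V(1) c[OF j] basis_in[OF V j], of "-1"] by simp
    then show "act P V (coord V x j - c j) (basis V j) = act P V (coord V x j) (basis V j) - act P V (c j) (basis V j)"
      by simp
  qed
  also have "\<dots> = 0"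
    using coord_sum[OF V xk] x by (simp add: sum_subtractf)
  finally have "coord V x i - c i = 0"
    using independent[OF V, of "\<lambda>i. coord V x i - c i" k] presheaf_diff[OF pre_ring V(1) co c] i by blast
  then show ?thesis by simp
qed

lemma coord_add:
  assumes V: "openin (base M) V" "V \<subseteq> U" and x: "x \<in> sec P V k" "y \<in> sec P V k" and i: "i \<in> I"
  shows "coord V (x + y) i = coord V x i + coord V y i"
proof (rule coord_unique[OF V _ _ i, where k = k])
  show "x + y = (\<Sum>i\<in>I. act P V (coord V x i + coord V y i) (basis V i))"
    using coord_sum[OF V x(1)] coord_sum[OF V x(2)]
    by (simp add: module_add_left[OF module V(1) coord_in[OF V x(1)] coord_in[OF V x(2)] basis_in[OF V]] sum.distrib)
qed (simp add: presheaf_add[OF pre_ring V(1)] coord_in[OF V x(1)] coord_in[OF V x(2)])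

lemma coord_scale:
  assumes V: "openin (base M) V" "V \<subseteq> U" and x: "x \<in> sec P V k" and i: "i \<in> I"
  shows "coord V (a *\<^sub>R x) i = a *\<^sub>R coord V x i"
proof (rule coord_unique[OF V _ _ i, where k = k])
  show "a *\<^sub>R x = (\<Sum>i\<in>I. act P V (a *\<^sub>R coord V x i) (basis V i))"
    using coord_sum[OF V x]
    by (simp add: module_scale_left[OF module V(1) coord_in[OF V x] basis_in[OF V]] flip: scaleR_sum_right)
qed (simp add: presheaf_scale[OF pre_ring V(1)] coord_in[OF V x])

lemma coord_act:
  assumes V: "openin (base M) V" "V \<subseteq> U" and x: "x \<in> sec P V k" and f: "f \<in> sec M V l" and i: "i \<in> I"
  shows "coord V (act P V f x) i = f * coord V x i"
proof (rule coord_unique[OF V _ _ i, where k = "l + k"])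
  show "f * coord V x i \<in> sec M V (l + k - d i)" if "i \<in> I" for i
    using ring_mult_in[OF ring V(1) f coord_in[OF V x that]] by (simp add: add_diff_eq)
  have "act P V f x = act P V f (\<Sum>i\<in>I. act P V (coord V x i) (basis V i))"
    by (simp add: coord_sum[OF V x])
  also have "\<dots> = (\<Sum>i\<in>I. act P V f (act P V (coord V x i) (basis V i)))"
    by (rule module_sum_right[OF module V(1) f term_in[OF V _ coord_in[OF V x]]])
  finally show "act P V f x = (\<Sum>i\<in>I. act P V (f * coord V x i) (basis V i))"
    by (simp add: module_assoc[OF module V(1) coord_in[OF V x] f basis_in[OF V]])
qed

lemma coord_res:
  assumes V: "openin (base M) V" "V \<subseteq> U" and W: "openin (base M) W" "W \<subseteq> V" and x: "x \<in> sec P V k" and i: "i \<in> I"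
  shows "coord W (res P V W x) i = res M V W (coord V x i)"
proof -
  have WU: "W \<subseteq> U" using V W by blast
  show ?thesis
  proof (rule coord_unique[OF W(1) WU _ _ i, where k = k])
    show "res M V W (coord V x i) \<in> sec M W (k - d i)" if "i \<in> I" for i
      using presheaf_res_in[OF pre_ring V(1) W coord_in[OF V x that]] .
    have "res P V W x = res P V W (\<Sum>i\<in>I. act P V (coord V x i) (basis V i))"
      by (simp add: coord_sum[OF V x])
    also have "\<dots> = (\<Sum>i\<in>I. res P V W (act P V (coord V x i) (basis V i)))"
      by (rule presheaf_res_sum[OF pre V(1) W term_in[OF V _ coord_in[OF V x]]])
    finally show "res P V W x = (\<Sum>i\<in>I. act P W (res M V W (coord V x i)) (basis W i))"
      by (simp add: module_res[OF module V(1) coord_in[OF V x] basis_in[OF V] W]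
          presheaf_res_res[OF pre open_base V(1) W(1,2) V(2) frame_in])
  qed
qed

lemma coord_basis:
  assumes V: "openin (base M) V" "V \<subseteq> U" and i: "i \<in> I" "j \<in> I"
  shows "coord V (basis V j) i = (if i = j then unity M V else 0)"
proof (rule coord_unique[OF V _ _ i(1), where k = "d j"])
  show "basis V j = (\<Sum>i\<in>I. act P V (if i = j then unity M V else 0) (basis V i))"
    by (subst sum_delta_eq[OF finite_index i(2)])
      (auto simp: module_unity[OF module V(1) basis_in[OF V]] i module_zero_left[OF module V(1) pre_ring basis_in[OF V]])
qed (auto simp: ring_unity_in[OF ring V(1)] presheaf_0[OF pre_ring V(1)])

lemma frame_restrict:
  assumes V: "openin (base M) V" "V \<subseteq> U"
  shows "frame_on M P V I d (basis V)"
proof (rule frame_on.intro, goal_cases)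
  case (6 W x k)
  then show ?case
    using spanning[of W x k] V by (simp add: presheaf_res_res[OF pre open_base V(1) _ _ V(2) frame_in])
next
  case (7 W c k i)
  then show ?case
    using independent[of W c k i] V by (simp add: presheaf_res_res[OF pre open_base V(1) _ _ V(2) frame_in])
qed (use ring module V finite_index basis_in in auto)

end

text \<open>The functions form a free module of rank one on the unit. With this module as target,
  frames of Hom modules become dual frames.\<close>

lemma frame_fun_mod:
  assumes M: "graded_ring_sheaf M" and U: "openin (base M) U"
  shows "frame_on M (fun_mod M) U {()} (\<lambda>_. 0) (\<lambda>_. unity M U)"
proof (rule frame_on.intro, goal_cases)
  case (6 V x k)
  then show ?case
    by (intro exI[of _ "\<lambda>_. x"]) (simp add: ring_unity_res[OF M U] ring_unity_right[OF M])
next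
  case (7 V c k i)
  then show ?case by (simp add: ring_unity_res[OF M U] ring_unity_right[OF M])
qed (use M U module_fun_mod in \<open>auto simp: ring_unity_in[OF M U]\<close>)

locale two_frames = A: frame_on M P U I d p + B: frame_on M P' U I' d' p'
  for M :: "('p, int, 'f::real_algebra) gring" and P :: "('p, int, 'f, 'x::real_vector) gmod"
    and P' :: "('p, int, 'f, 'y::real_vector) gmod" and U :: "'p set"
    and I :: "'i set" and d p and I' :: "'j set" and d' p'
begin

text \<open>The matrix unit sending \<open>p i\<close> to \<open>p' j\<close> and the other basis
  elements to 0. It has degree \<open>d' j - d i\<close>, and the sign arises when it passes the
  coordinate of x, whose degree is that of x minus \<open>d i\<close>.\<close>

definition elementary :: "'i \<times> 'j \<Rightarrow> 'p set \<Rightarrow> 'x \<Rightarrow> 'y" where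
  "elementary = (\<lambda>(i, j). hom_ext P U (\<lambda>V x. ksign ((d' j - d i) * (hdeg P V x - d i)) *\<^sub>R
     act P' V (A.coord V x i) (B.basis V j)))"

text \<open>Any degree k of x may stand for \<open>hdeg\<close>: if x = 0, its coordinate vanishes
  and the sign is immaterial.\<close>

lemma elementary_apply:
  assumes V: "openin (base M) V" "V \<subseteq> U" and x: "x \<in> sec P V k" and i: "i \<in> I" "j \<in> I'"
  shows "elementary (i, j) V x = ksign ((d' j - d i) * (k - d i)) *\<^sub>R act P' V (A.coord V x i) (B.basis V j)"
proof (cases "x = 0")
  case True
  have "A.coord V 0 i = 0" using A.coord_scale[OF V x i(1), of 0] by simp
  then show ?thesis
    using True x V i unfolding elementary_def prod.case
    by (subst hom_ext_apply[of P V U x k]) (simp_all add: presheaf_base[OF A.pre] module_zero_left[OF B.module V(1) A.pre_ring B.basis_in[OF V]])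
next
  case False
  then show ?thesis
    using x V hdeg_eq[OF A.pre V(1) x] unfolding elementary_def prod.case
    by (subst hom_ext_apply[of P V U x k]) (simp_all add: presheaf_base[OF A.pre])
qed

lemma elementary_in:
  assumes i: "i \<in> I" "j \<in> I'"
  shows "elementary (i, j) \<in> hom_sec M P P' U (d' j - d i)"
proof -
  define E where "E = (\<lambda>V x. ksign ((d' j - d i) * (hdeg P V x - d i)) *\<^sub>R act P' V (A.coord V x i) (B.basis V j))"
  have E: "E V x = ksign ((d' j - d i) * (k - d i)) *\<^sub>R act P' V (A.coord V x i) (B.basis V j)"
    if "openin (base M) V" "V \<subseteq> U" "x \<in> sec P V k" for V x k
    using elementary_apply[OF that i] hom_ext_apply[of P V U x k E] that presheaf_base[OF A.pre]
    unfolding elementary_def E_def[symmetric] prod.case by simp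
  have "hom_ext P U E \<in> hom_sec M P P' U (d' j - d i)"
  proof (rule hom_ext_in_hom_sec[OF A.module])
    show "sheaf_map P P' U (d' j - d i) E"
    proof (rule sheaf_mapI[OF presheaf_base[OF A.pre]], goal_cases)
      case (1 V k x)
      then show ?case
        using module_act_in[OF B.module 1(1) A.coord_in[OF 1 i(1)] B.basis_in[OF 1(1,2) i(2)]]
        by (simp add: E[OF 1] algebra_simps presheaf_scale[OF B.pre])
    next
      case (2 V k x c)
      then show ?case
        by (simp add: E[of V _ k] presheaf_scale[OF A.pre] A.coord_scale[OF 2 i(1)]
           module_scale_left[OF B.module _ A.coord_in[OF 2 i(1)] B.basis_in[OF _ _ i(2)]])
    next
      case (3 V k x y)
      then show ?case
        by (simp add: E[of V _ k] presheaf_add[OF A.pre] A.coord_add[OF 3 i(1)] scaleR_add_right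
           module_add_left[OF B.module _ A.coord_in[OF 3(1-3) i(1)] A.coord_in[OF 3(1,2,4) i(1)] B.basis_in[OF _ _ i(2)]])
    next
      case (4 V W k x)
      have W: "W \<subseteq> U" using 4 by blast
      note e = module_act_in[OF B.module 4(1) A.coord_in[OF 4(1,2,5) i(1)] B.basis_in[OF 4(1,2) i(2)]]
      show ?case
        using E[OF 4(3) W presheaf_res_in[OF A.pre 4(1,3,4,5)]] E[OF 4(1,2,5)] 
        by (simp add: A.coord_res[OF 4 i(1)] presheaf_res_scale[OF B.pre 4(1,3,4) e]
            module_res[OF B.module 4(1) A.coord_in[OF 4(1,2,5) i(1)] B.basis_in[OF 4(1,2) i(2)] 4(3,4)]
            presheaf_res_res[OF B.pre A.open_base 4(1,3,4,2) B.frame_in[OF i(2)]])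
    qed
    fix V l f k x assume *: "openin (base M) V" "V \<subseteq> U" "f \<in> sec M V l" "x \<in> sec P V k"
    note e = module_act_in[OF B.module *(1) A.coord_in[OF *(1,2,4) i(1)] B.basis_in[OF *(1,2) i(2)]]
    show "E V (act P V f x) = ksign ((d' j - d i) * l) *\<^sub>R act P' V f (E V x)"
      by (simp add: E[OF *(1,2,4)] E[OF *(1,2) module_act_in[OF A.module *(1,3,4)]] A.coord_act[OF *(1,2,4,3) i(1)]
          module_assoc[OF B.module *(1) A.coord_in[OF *(1,2,4) i(1)] *(3) B.basis_in[OF *(1,2) i(2)]]
          module_scale_right[OF B.module *(1,3) e] add_diff_eq[symmetric] ring_distribs(1) ksign_add)
  qed
  then show ?thesis by (simp add: elementary_def E_def)
qed

text \<open>A linear map is determined by its values on the basis; the coefficients are its matrix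
  entries, placed to the left of the matrix units.\<close>

lemma hom_expand:
  assumes V: "openin (base M) V" "V \<subseteq> U" and F: "F \<in> hom_sec M P P' V k"
  shows "F = (\<Sum>ij\<in>I \<times> I'. act (hom_mod M P P') V (B.coord V (F V (A.basis V (fst ij))) (snd ij))
           (res (hom_mod M P P') U V (elementary ij)))" (is "F = ?S")
    and "i \<in> I \<Longrightarrow> j \<in> I' \<Longrightarrow> B.coord V (F V (A.basis V i)) j \<in> sec M V (k - (d' j - d i))"
proof -
  define c where "c = (\<lambda>i j. B.coord V (F V (A.basis V i)) j)"
  have Fb: "F V (A.basis V i) \<in> sec P' V (d i + k)" if "i \<in> I" for i
    using sheaf_map_in[OF A.pre hom_sec_map[OF F] V(1) _ A.basis_in[OF V that]] by simp
  have c: "c i j \<in> sec M V (k - (d' j - d i))" if "i \<in> I" "j \<in> I'" for i j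
    using B.coord_in[OF V Fb that(2)] that(1) by (simp add: c_def algebra_simps)
  then show "i \<in> I \<Longrightarrow> j \<in> I' \<Longrightarrow> B.coord V (F V (A.basis V i)) j \<in> sec M V (k - (d' j - d i))"
    by (simp add: c_def)
  let ?H = "hom_mod M P P'"
  note H = module_hom_mod[OF A.ring A.module B.module]
  note h = module_presheaf[OF H]
  have E: "res ?H U V (elementary (i, j)) \<in> sec ?H V (d' j - d i)" if "i \<in> I" "j \<in> I'" for i j
    using presheaf_res_in[OF h A.open_base V, of "elementary (i, j)"] elementary_in[OF that] by simp
  have S: "?S \<in> sec ?H V k"
  proof (rule presheaf_sum[OF h V(1)])
    fix ij assume "ij \<in> I \<times> I'"
    then obtain i j where ij: "ij = (i, j)" "i \<in> I" "j \<in> I'" by blast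
    show "act ?H V (B.coord V (F V (A.basis V (fst ij))) (snd ij)) (res ?H U V (elementary ij)) \<in> sec ?H V k"
      using module_act_in[OF H V(1) c[OF ij(2,3)] E[OF ij(2,3)]] by (simp add: ij c_def)
  qed
  have S': "?S \<in> hom_sec M P P' V k" using S by (simp only: hom_mod_simps(2))
  show "F = ?S"
  proof (rule hom_sec_eqI[OF F S'])
    fix W l x assume "openin (base P) W" and WV: "W \<subseteq> V" and x: "x \<in> sec P W l"
    then have W: "openin (base M) W" "W \<subseteq> U" using V presheaf_base[OF A.pre] by auto
    note co = A.coord_in[OF W x] 
    have rc: "res M V W (c i j) \<in> sec M W (k - (d' j - d i))" if "i \<in> I" "j \<in> I'" for i j
      using presheaf_res_in[OF A.pre_ring V(1) W(1) WV c[OF that]] .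
    have Fb': "F W (A.basis W i) = (\<Sum>j\<in>I'. act P' W (res M V W (c i j)) (B.basis W j))" if i: "i \<in> I" for i
    proof -
      have "F W (A.basis W i) = F W (res P V W (A.basis V i))"
        using presheaf_res_res[OF A.pre A.open_base V(1) W(1) WV V(2) A.frame_in[OF i]] by simp
      also have "\<dots> = res P' V W (F V (A.basis V i))"
        using sheaf_map_res[OF A.pre hom_sec_map[OF F] V(1) _ W(1) WV A.basis_in[OF V i]] by simp
      finally have *: "F W (A.basis W i) = res P' V W (F V (A.basis V i))" .
      show ?thesis
        using B.coord_sum[OF W, of "F W (A.basis W i)" "d i + k"] B.coord_res[OF V W(1) WV Fb[OF i]]
          presheaf_res_in[OF B.pre V(1) W(1) WV Fb[OF i]]
        unfolding * c_def by simp
    qed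
    have "F W x = F W (\<Sum>i\<in>I. act P W (A.coord W x i) (A.basis W i))"
      by (simp add: A.coord_sum[OF W x])
    also have "\<dots> = (\<Sum>i\<in>I. F W (act P W (A.coord W x i) (A.basis W i)))"
      by (rule sheaf_map_sum[OF A.pre hom_sec_map[OF F] W(1) WV A.term_in[OF W _ co]])
    also have "\<dots> = (\<Sum>i\<in>I. ksign (k * (l - d i)) *\<^sub>R act P' W (A.coord W x i) (F W (A.basis W i)))"
      by (simp add: hom_sec_act[OF F W(1) WV co A.basis_in[OF W]])
    also have "\<dots> = (\<Sum>i\<in>I. \<Sum>j\<in>I'. (act ?H V (c i j) (res ?H U V (elementary (i, j)))) W x)"
    proof (rule sum.cong[OF refl])
      fix i assume i: "i \<in> I"
      have e1: "act P' W (res M V W (c i j)) (B.basis W j) \<in> sec P' W (d i + k)" if "j \<in> I'" for j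
        using B.term_in[OF W that, of _ "d i + k"] rc[OF i that] by (simp add: algebra_simps)
      have "ksign (k * (l - d i)) *\<^sub>R act P' W (A.coord W x i) (F W (A.basis W i)) = 
         (\<Sum>j\<in>I'. ksign (k * (l - d i)) *\<^sub>R act P' W (A.coord W x i) (act P' W (res M V W (c i j)) (B.basis W j)))"
        unfolding Fb'[OF i] scaleR_sum_right[symmetric]
        by (subst module_sum_right[OF B.module W(1) co[OF i] e1]) simp_all
      also have "\<dots> = (\<Sum>j\<in>I'. (act ?H V (c i j) (res ?H U V (elementary (i, j)))) W x)"
      proof (rule sum.cong[OF refl])
        fix j assume j: "j \<in> I'"
        let ?a = "A.coord W x i" and ?c = "res M V W (c i j)"
        note b = B.basis_in[OF W j]
        have "(act ?H V (c i j) (res ?H U V (elementary (i, j)))) W x = act P' W ?c (elementary (i, j) W x)"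
          using W(1) WV x presheaf_base[OF A.pre] by (simp add: hom_ext_apply[of P W V x l])
        also have "\<dots> = ksign ((d' j - d i) * (l - d i)) *\<^sub>R act P' W (?c * ?a) (B.basis W j)"
          by (simp add: elementary_apply[OF W x i j] module_assoc[OF B.module W(1) co[OF i] rc[OF i j] b]
              module_scale_right[OF B.module W(1) rc[OF i j] module_act_in[OF B.module W(1) co[OF i] b]])
        also have "?c * ?a = ksign ((l - d i) * (k - (d' j - d i))) *\<^sub>R (?a * ?c)"
          by (rule ring_commute[OF A.ring W(1) co[OF i] rc[OF i j]])
        also have "act P' W \<dots> (B.basis W j) = ksign ((l - d i) * (k - (d' j - d i))) *\<^sub>R act P' W ?a (act P' W ?c (B.basis W j))"
          by (simp add: module_scale_left[OF B.module W(1) ring_mult_in[OF A.ring W(1) co[OF i] rc[OF i j]] b]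
             module_assoc[OF B.module W(1) rc[OF i j] co[OF i] b])
        finally show "ksign (k * (l - d i)) *\<^sub>R act P' W ?a (act P' W ?c (B.basis W j)) = 
           (act ?H V (c i j) (res ?H U V (elementary (i, j)))) W x"
          \<comment> \<open>The exponents \<open>(d' j - d i) * (l - d i)\<close>, from the matrix
            unit, and \<open>(l - d i) * (k - (d' j - d i))\<close>, from commuting entry and
            coordinate, add up to \<open>k * (l - d i)\<close>.\<close>
          by (simp add: right_diff_distrib[of "l - d i" k "d' j - d i"] ksign_diff mult.commute[of _ "l - d i"])
      qed
      finally show "ksign (k * (l - d i)) *\<^sub>R act P' W (A.coord W x i) (F W (A.basis W i)) = \<dots>" .
    qed
    also have "\<dots> = ?S W x"
      by (simp add: sum_fun_apply c_def sum.cartesian_product case_prod_beta del: hom_mod_simps)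
    finally show "F W x = ?S W x" .
  qed
qed

text \<open>No sign survives: for i = l its exponent contains the factor \<open>d l - d i\<close>,
  which is 0.\<close>

lemma elementary_basis:
  assumes V: "openin (base M) V" "V \<subseteq> U" and i: "i \<in> I" "j \<in> I'" "l \<in> I"
  shows "elementary (i, j) V (A.basis V l) = (if i = l then B.basis V j else 0)"
  using module_unity[OF B.module V(1) B.basis_in[OF V i(2)]] 
  by (simp add: elementary_apply[OF V A.basis_in[OF V i(3)] i(1,2)] A.coord_basis[OF V i(1,3)]
    module_zero_left[OF B.module V(1) A.pre_ring B.basis_in[OF V i(2)]])

text \<open>Spanning is \<open>hom_expand\<close>. For independence a relation is evaluated at the
  l-th basis element, which leaves the l-th row of coefficients as a relation among the basis of
  P'.\<close>

lemma frame_hom: "frame_on M (hom_mod M P P') U (I \<times> I') (\<lambda>(i, j). d' j - d i) elementary"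
proof (rule frame_on.intro, goal_cases)
  case (6 V F k)
  then have F: "F \<in> hom_sec M P P' V k" by simp
  show ?case
    by (rule exI[of _ "\<lambda>(i,j). B.coord V (F V (A.basis V i)) j"])
     (use hom_expand[OF 6(1,2) F] in \<open>auto simp: case_prod_beta simp del: hom_mod_simps\<close>)
next
  case (7 V c k ij)
  obtain l j where lj: "ij = (l, j)" "l \<in> I" "j \<in> I'" using 7 by blast
  let ?H = "hom_mod M P P'"
  note V = 7(1,2)
  have b: "A.basis V l \<in> sec P V (d l)" using A.basis_in[OF V lj(2)] .
  have c: "c (i, j) \<in> sec M V (k - (d' j - d i))" if "i \<in> I" "j \<in> I'" for i j
    using 7(3)[of "(i, j)"] that by simp
  have val: "act ?H V (c (i, j)) (res ?H U V (elementary (i, j))) V (A.basis V l) =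
     (if i = l then act P' V (c (i, j)) (B.basis V j) else 0)" if "i \<in> I" "j \<in> I'" for i j
    using V(1) b presheaf_base[OF A.pre] that elementary_basis[OF V that lj(2)]
    by (simp add: hom_ext_apply[of P V V "A.basis V l" "d l"] presheaf_res_id[OF A.pre_ring V(1) c[OF that]] module_zero_right[OF B.module V(1) c[OF that]])
  have "0 = (\<Sum>ij\<in>I \<times> I'. act ?H V (c ij) (res ?H U V (elementary ij))) V (A.basis V l)"
    using 7(4) by simp
  also have "\<dots> = (\<Sum>i\<in>I. \<Sum>j\<in>I'. act ?H V (c (i, j)) (res ?H U V (elementary (i, j))) V (A.basis V l))"
    by (simp add: sum_fun_apply sum.cartesian_product case_prod_beta del: hom_mod_simps)
  also have "\<dots> = (\<Sum>i\<in>I. \<Sum>j\<in>I'. if i = l then act P' V (c (i, j)) (B.basis V j) else 0)"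
    by (intro sum.cong refl) (rule val)
  also have "\<dots> = (\<Sum>j\<in>I'. act P' V (c (l, j)) (B.basis V j))"
    by (subst sum_delta_eq[OF A.finite_index lj(2)]) auto
  finally have "(\<Sum>j\<in>I'. act P' V (c (l, j)) (B.basis V j)) = 0" by simp
  then show ?case
    using B.independent[OF V, of "\<lambda>j. c (l, j)" "k + d l"] c[OF lj(2)] lj by (simp add: algebra_simps)
qed (use A.ring A.open_base A.finite_index B.finite_index elementary_in module_hom_mod[OF A.ring A.module B.module] in auto)

end

section \<open>Charts and trivialisations\<close>

lemma topspace_Euclidean_space': "topspace (Euclidean_space n) = {x. \<forall>i\<ge>n. x i = 0}"
  by (simp add: topspace_Euclidean_space)

text \<open>Makes the sums in \<open>series_mult\<close> genuine: over an infinite set they would be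
  0 by convention. An exponent below K vanishes beyond the listed variables and is bounded on
  them.\<close>

lemma finite_below_exponent:
  assumes "exponent ds K"
  shows "finite {I. I \<le> K}"
proof (rule finite_subset)
  show "{I. I \<le> K} \<subseteq> (\<lambda>f j. if j < length ds then f j else 0) ` (Pi\<^sub>E {..<length ds} (\<lambda>j. {..K j}))"
  proof
    fix I assume "I \<in> {I. I \<le> K}"
    then have le: "I j \<le> K j" for j by (simp add: le_fun_def)
    then have "I j = 0" if "j \<ge> length ds" for j
      using assms that by (metis exponent_def le_zero_eq)
    then have "I = (\<lambda>j. if j < length ds then restrict I {..<length ds} j else 0)"
      by (auto simp: fun_eq_iff)
    moreover have "restrict I {..<length ds} \<in> Pi\<^sub>E {..<length ds} (\<lambda>j. {..K j})"
      using le by auto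
    ultimately show "I \<in> (\<lambda>f j. if j < length ds then f j else 0) ` (Pi\<^sub>E {..<length ds} (\<lambda>j. {..K j}))"
      by (rule image_eqI)
  qed
  show "finite ((\<lambda>f j. if j < length ds then f j else 0) ` (Pi\<^sub>E {..<length ds} (\<lambda>j. {..K j})))"
    by (intro finite_imageI finite_PiE) auto
qed

lemma unit_exponent_le: "(\<lambda>l. if l = a then 1 else 0) \<le> K \<longleftrightarrow> K a \<noteq> (0::nat)"
  by (auto simp: le_fun_def)

lemma exponent_sign_0 [simp]: "exponent_sign ds 0 K = 1" "exponent_sign ds K 0 = 1"
  by (simp_all add: exponent_sign_def)

lemma exponent_sign_nonzero: "exponent_sign ds I J \<noteq> 0"
  by (simp add: exponent_sign_def)

text \<open>The case of a fibre coordinate of degree 0: at z it is a series with constant term only,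
  and multiplication acts on each coefficient.\<close>

lemma series_mult_constant:
  assumes K: "exponent ds K" and H: "\<And>I. H I z = (if I = 0 then a else 0)"
  shows "series_mult ds G H K z = G K z * a"
proof -
  have "(\<Sum>I | I \<le> K. exponent_sign ds I (K - I) * G I z * H (K - I) z) =
      exponent_sign ds K (K - K) * G K z * H (K - K) z"
  proof (rule sum_delta_eq)
    fix I assume I: "I \<in> {I. I \<le> K}" "I \<noteq> K"
    then have "K - I \<noteq> 0" by (auto simp: le_fun_def fun_eq_iff) (metis le_antisym)
    then show "exponent_sign ds I (K - I) * G I z * H (K - I) z = 0" by (simp add: H)
  qed (use finite_below_exponent[OF K] in auto)
  then show ?thesis using K by (simp add: series_mult_def H)
qed

text \<open>The case of a formal fibre coordinate with exponent e: multiplication shifts exponents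
  by e, up to sign.\<close>

lemma series_mult_variable:
  assumes K: "exponent ds K" and H: "\<And>I. H I z = (if I = e then 1 else 0)"
  shows "series_mult ds G H K z = (if e \<le> K then exponent_sign ds (K - e) e * G (K - e) z else 0)"
proof (cases "e \<le> K")
  case True
  then have Ke: "K - (K - e) = e" by (auto simp: le_fun_def fun_eq_iff)
  have "(\<Sum>I | I \<le> K. exponent_sign ds I (K - I) * G I z * H (K - I) z) =
      exponent_sign ds (K - e) (K - (K - e)) * G (K - e) z * H (K - (K - e)) z"
  proof (rule sum_delta_eq)
    fix I assume I: "I \<in> {I. I \<le> K}" "I \<noteq> K - e"
    then have "K - I \<noteq> e" by (auto simp: le_fun_def fun_eq_iff) (metis diff_diff_cancel)
    then show "exponent_sign ds I (K - I) * G I z * H (K - I) z = 0" by (simp add: H)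
  qed (use finite_below_exponent[OF K] in \<open>auto simp: le_fun_def\<close>)
  then show ?thesis using K True by (simp add: series_mult_def H Ke)
next
  case False
  have "K - I \<noteq> e" for I using False by (auto simp: le_fun_def fun_eq_iff) (metis diff_le_self)
  then show ?thesis using False by (simp add: series_mult_def H)
qed

text \<open>A series with constant term only as left factor; this is how a bump function acts on
  power series.\<close>

lemma series_mult_one:
  assumes "\<And>I. c I x = (if I = 0 then a else 0)" "exponent ds K"
  shows "series_mult ds c c' K x = a * c' K x"
proof -
  have "(\<Sum>I | I \<le> K. exponent_sign ds I (K - I) * c I x * c' (K - I) x) =
      exponent_sign ds 0 (K - 0) * c 0 x * c' (K - 0) x"
    using finite_below_exponent[OF assms(2)] by (intro sum_delta_eq) (auto simp: assms(1) le_fun_def)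
  then show ?thesis using assms by (simp add: series_mult_def)
qed

section \<open>Functions in a chart\<close>

locale chart_on =
  fixes X :: "('p, int, 'f::real_algebra) gring" and n ds U \<phi> \<Phi>
  assumes chart: "chart X n ds U \<phi> \<Phi>" and ring: "graded_ring_sheaf X"
begin

lemma open_U: "openin (base X) U" and open_image: "openin (Euclidean_space n) (\<phi> ` U)"
  and homeo: "homeomorphic_map (subtopology (base X) U) (subtopology (Euclidean_space n) (\<phi> ` U)) \<phi>"
  using chart unfolding chart_def by blast+

lemma image_subset: "\<phi> ` U \<subseteq> topspace (Euclidean_space n)"
  using open_image openin_subset by blast

lemma inj: "inj_on \<phi> U"
  using homeo open_U openin_subset by (fastforce simp: homeomorphic_map_def topspace_subtopology Int_absorb1)

lemmas chart_sections = chart[unfolded chart_def, THEN conjunct2, THEN conjunct2, THEN conjunct2, THEN spec, THEN mp, OF conjI]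
lemmas chart_pair = chart_sections[THEN conjunct2, THEN spec, THEN spec, THEN spec, THEN spec, THEN mp, OF _ _ conjI]

lemma bij: "openin (base X) V \<Longrightarrow> V \<subseteq> U \<Longrightarrow> bij_betw (\<Phi> V) (sec X V k) (series_sec n ds (\<phi> ` V) k)"
  by (rule chart_sections[THEN conjunct1, THEN spec])

lemma mult: "openin (base X) V \<Longrightarrow> V \<subseteq> U \<Longrightarrow> f \<in> sec X V i \<Longrightarrow> g \<in> sec X V j \<Longrightarrow>
    \<Phi> V (f * g) = series_mult ds (\<Phi> V f) (\<Phi> V g)"
  by (rule chart_pair[THEN conjunct1])

lemma add: "openin (base X) V \<Longrightarrow> V \<subseteq> U \<Longrightarrow> f \<in> sec X V i \<Longrightarrow> g \<in> sec X V i \<Longrightarrow> \<Phi> V (f + g) = \<Phi> V f + \<Phi> V g"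
  by (rule chart_pair[THEN conjunct2, THEN conjunct1, rule_format]) simp_all

lemma scale: "openin (base X) V \<Longrightarrow> V \<subseteq> U \<Longrightarrow> f \<in> sec X V i \<Longrightarrow> \<Phi> V (c *\<^sub>R f) = c *\<^sub>R \<Phi> V f"
  by (rule chart_pair[THEN conjunct2, THEN conjunct2, THEN conjunct1, rule_format, of V f i f i c])

lemma restrict: "openin (base X) V \<Longrightarrow> V \<subseteq> U \<Longrightarrow> f \<in> sec X V i \<Longrightarrow> openin (base X) W \<Longrightarrow> W \<subseteq> V \<Longrightarrow>
    \<Phi> W (res X V W f) = series_res (\<phi> ` W) (\<Phi> V f)"
  by (rule chart_pair[THEN conjunct2, THEN conjunct2, THEN conjunct2, THEN spec, THEN mp, OF _ _ _ _ conjI, of V f i f i])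

lemma series_in: "openin (base X) V \<Longrightarrow> V \<subseteq> U \<Longrightarrow> f \<in> sec X V k \<Longrightarrow> \<Phi> V f \<in> series_sec n ds (\<phi> ` V) k"
  using bij bij_betwE by blast

lemma zero: "openin (base X) V \<Longrightarrow> V \<subseteq> U \<Longrightarrow> \<Phi> V 0 = 0"
  using scale[of V 0 0 0] presheaf_0[OF ring_presheaf[OF ring]] by simp

lemma sum: "openin (base X) V \<Longrightarrow> V \<subseteq> U \<Longrightarrow> (\<And>r. r \<in> J \<Longrightarrow> f r \<in> sec X V i) \<Longrightarrow>
    \<Phi> V (\<Sum>r\<in>J. f r) = (\<Sum>r\<in>J. \<Phi> V (f r))"
proof (induction J rule: infinite_finite_induct)
  case (insert r J)
  then show ?case
    by (subst sum.insert; (simp add: add[of V _ i] presheaf_sum[OF ring_presheaf[OF ring]])?)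
qed (auto simp: zero)

text \<open>Coefficients at other exponents or points are 0 in any element of
  \<open>series_sec\<close>, and the chart is injective on sections.\<close>

lemma eq_0I:
  assumes V: "openin (base X) V" "V \<subseteq> U" and f: "f \<in> sec X V k"
    and 0: "\<And>I x. exponent ds I \<Longrightarrow> x \<in> \<phi> ` V \<Longrightarrow> \<Phi> V f I x = 0"
  shows "f = 0"
proof -
  have "\<Phi> V f I x = 0" for I x
    using series_in[OF V f] 0[of I x] unfolding series_sec_def smooth_function_def by (auto simp: fun_eq_iff)
  then have "\<Phi> V f = \<Phi> V 0" by (simp add: zero[OF V] fun_eq_iff)
  then show ?thesis
    using bij[OF V, of k] f presheaf_0[OF ring_presheaf[OF ring] V(1)] unfolding bij_betw_def inj_on_def by blast
qed

end

section \<open>Functions, linear functions and pull-backs of a graded vector bundle\<close>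

locale vector_bundle =
  fixes M :: "('p, int, 'f::real_algebra) gring" and B :: "('p, 'f, 'q, 'g::real_algebra) vbundle"
  assumes graded_vector_bundle: "graded_vector_bundle M B"
begin

lemma
  shows ring: "graded_ring_sheaf M" and ring_tot: "graded_ring_sheaf (tot B)"
    and sheaf_lin: "sheaf_on (base M) (lin_mod M B)"
    and pull_map: "sheaf_map M (push_forward M B) (topspace (base M)) 0 (pull B)"
    and continuous_proj: "continuous_map (base (tot B)) (base M) (proj B)"
    and lin_tot: "openin (base M) U \<Longrightarrow> \<epsilon> \<in> lin B U k \<Longrightarrow> \<epsilon> \<in> sec (tot B) (over B U) k"
    and pull_unity: "openin (base M) U \<Longrightarrow> pull B U (unity M U) = unity (tot B) (over B U)"
    and pull_mult: "openin (base M) U \<Longrightarrow> f \<in> sec M U i \<Longrightarrow> g \<in> sec M U j \<Longrightarrow>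
      pull B U (f * g) = pull B U f * pull B U g"
  using graded_vector_bundle unfolding graded_vector_bundle_def graded_manifold_of_def sheaf_on_def 
  by (auto simp: lin_mod_def subset_iff)

lemma trivialisations:
  obtains n ds w ws where "\<And>x. x \<in> topspace (base M) \<Longrightarrow> \<exists>U. x \<in> U \<and> trivialisation M B n ds w ws U"
  using graded_vector_bundle unfolding graded_vector_bundle_def by (elim conjE exE) (rule that, erule bspec)

lemma over_open: "openin (base M) U \<Longrightarrow> openin (base (tot B)) (over B U)"
  using continuous_proj by (simp add: over_def continuous_map_def)

lemma over_mono: "V \<subseteq> U \<Longrightarrow> over B V \<subseteq> over B U"
  by (auto simp: over_def)

lemma over_topspace: "over B (topspace (base M)) = topspace (base (tot B))"
  using continuous_proj by (auto simp: over_def continuous_map_def)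

lemma presheaf_tot: "presheaf_on (base (tot B)) (tot B)"
  using ring_presheaf[OF ring_tot] .

lemmas pre_ring = ring_presheaf[OF ring]

lemma push_forward_simps [simp]:
  "base (push_forward M B) = base M" "sec (push_forward M B) U = sec (tot B) (over B U)"
  "res (push_forward M B) U V = res (tot B) (over B U) (over B V)"
  by (simp_all add: push_forward_def)

lemma lin_mod_simps [simp]:
  "base (lin_mod M B) = base M" "sec (lin_mod M B) = lin B"
  "res (lin_mod M B) U V = res (tot B) (over B U) (over B V)" "act (lin_mod M B) U f \<epsilon> = pull B U f * \<epsilon>"
  by (simp_all add: lin_mod_def)

lemmas pull_map_rules = sheaf_map_in[OF pre_ring pull_map, OF _ openin_subset]
  sheaf_map_add[OF pre_ring pull_map, OF _ openin_subset] 
  sheaf_map_scale[OF pre_ring pull_map, OF _ openin_subset] 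
  sheaf_map_res[OF pre_ring pull_map, OF _ openin_subset] 

lemma pull_in: "openin (base M) U \<Longrightarrow> f \<in> sec M U k \<Longrightarrow> pull B U f \<in> sec (tot B) (over B U) k"
  using pull_map_rules(1)[of U f k] by simp

lemma pull_add: "openin (base M) U \<Longrightarrow> f \<in> sec M U k \<Longrightarrow> g \<in> sec M U k \<Longrightarrow> pull B U (f + g) = pull B U f + pull B U g"
  using pull_map_rules(2)[of U f k g] by simp

lemma pull_scale: "openin (base M) U \<Longrightarrow> f \<in> sec M U k \<Longrightarrow> pull B U (c *\<^sub>R f) = c *\<^sub>R pull B U f"
  using pull_map_rules(3)[of U f k c] by simp

lemma pull_res: "openin (base M) U \<Longrightarrow> openin (base M) V \<Longrightarrow> V \<subseteq> U \<Longrightarrow> f \<in> sec M U k \<Longrightarrow>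
    res (tot B) (over B U) (over B V) (pull B U f) = pull B V (res M U V f)"
  using pull_map_rules(4)[of U V f k] by simp

lemma pull_0: "openin (base M) U \<Longrightarrow> pull B U 0 = 0"
  using pull_scale[of U 0 0 0] presheaf_0[OF pre_ring] by simp

text \<open>Preimages of open sets of the base cover the preimage of U, so locality can be tested
  downstairs.\<close>

lemma tot_eqI:
  assumes U: "openin (base M) U" and a: "a \<in> sec (tot B) (over B U) k" "b \<in> sec (tot B) (over B U) k"
    and loc: "\<And>y. y \<in> U \<Longrightarrow> \<exists>V. openin (base M) V \<and> y \<in> V \<and> V \<subseteq> U \<and>
      res (tot B) (over B U) (over B V) a = res (tot B) (over B U) (over B V) b"
  shows "a = b"
proof (rule sheaf_eqI[OF ring_sheaf[OF ring_tot] over_open[OF U] a])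
  fix z assume "z \<in> over B U"
  then have "proj B z \<in> U" "z \<in> topspace (base (tot B))" by (auto simp: over_def)
  then obtain V where "openin (base M) V" "proj B z \<in> V" "V \<subseteq> U"
    "res (tot B) (over B U) (over B V) a = res (tot B) (over B U) (over B V) b" using loc by blast
  then show "\<exists>W. openin (base (tot B)) W \<and> z \<in> W \<and> W \<subseteq> over B U \<and>
      res (tot B) (over B U) W a = res (tot B) (over B U) W b"
    using \<open>z \<in> over B U\<close> over_open over_mono by (intro exI[of _ "over B V"]) (auto simp: over_def)
qed

text \<open>That linear functions are closed under multiplication by functions of the base is
  visible only in trivialisations. The local products are glued in the sheaf of linear functions,
  and the result is identified with the product in the sheaf of all functions.\<close>

lemma lin_pull:
  assumes U: "openin (base M) U" and f: "f \<in> sec M U i" and \<epsilon>: "\<epsilon> \<in> lin B U k"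
  shows "pull B U f * \<epsilon> \<in> lin B U (i + k)"
proof -
  obtain n ds w ws where triv: "\<And>x. x \<in> topspace (base M) \<Longrightarrow> \<exists>U. x \<in> U \<and> trivialisation M B n ds w ws U"
    using trivialisations by blast
  let ?r = "\<lambda>V. res (tot B) (over B U) (over B V)"
  note pl = sheaf_on_presheaf[OF sheaf_lin]
  have tot: "pull B U f * \<epsilon> \<in> sec (tot B) (over B U) (i + k)"
    by (rule ring_mult_in[OF ring_tot over_open[OF U] pull_in[OF U f] lin_tot[OF U \<epsilon>]])
  have loc: "\<exists>V. openin (base M) V \<and> y \<in> V \<and> V \<subseteq> U \<and> ?r V (pull B U f * \<epsilon>) \<in> lin B V (i + k)" if y: "y \<in> U" for y
  proof -
    obtain W where W: "y \<in> W" "trivialisation M B n ds w ws W"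
      using triv[OF subsetD[OF openin_subset[OF U] y]] by auto
    obtain \<phi> \<Phi> e where "chart M n ds W \<phi> \<Phi>" and e: "\<forall>V k. openin (base M) V \<and> V \<subseteq> W \<longrightarrow>
        lin B V k = {\<Sum>j<w + length ws. pull B V (g j) * res (tot B) (over B W) (over B V) (e j) | g.
                       \<forall>j<w + length ws. g j \<in> sec M V (k - fibre_degree w ws j)}"
      using W(2)[unfolded trivialisation_def] by (elim exE conjE) (rule that)
    then have "openin (base M) W" unfolding chart_def by blast
    define V where "V = U \<inter> W"
    have V: "openin (base M) V" "y \<in> V" "V \<subseteq> U" "V \<subseteq> W" 
      using U \<open>openin (base M) W\<close> y W(1) by (auto simp: V_def)
    have "?r V \<epsilon> \<in> lin B V k" using presheaf_res_in[OF pl U V(1,3), of \<epsilon> k] \<epsilon> by simp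
    then obtain g where g: "\<forall>j<w + length ws. g j \<in> sec M V (k - fibre_degree w ws j)"
      "?r V \<epsilon> = (\<Sum>j<w + length ws. pull B V (g j) * res (tot B) (over B W) (over B V) (e j))"
      using e V by auto
    have rf: "res M U V f \<in> sec M V i" using presheaf_res_in[OF pre_ring U V(1,3) f] .
    have "?r V (pull B U f * \<epsilon>) = pull B V (res M U V f) * ?r V \<epsilon>"
      using ring_res_mult[OF ring_tot over_open[OF U] over_open[OF V(1)] over_mono[OF V(3)] pull_in[OF U f] lin_tot[OF U \<epsilon>]]
        pull_res[OF U V(1,3) f] by simp
    also have "\<dots> = (\<Sum>j<w + length ws. pull B V (res M U V f * g j) * res (tot B) (over B W) (over B V) (e j))"
      unfolding g(2) sum_distrib_left
    proof (rule sum.cong[OF refl])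
      fix j assume "j \<in> {..<w + length ws}"
      then have "g j \<in> sec M V (k - fibre_degree w ws j)" using g(1) by simp
      then show "pull B V (res M U V f) * (pull B V (g j) * res (tot B) (over B W) (over B V) (e j)) =
          pull B V (res M U V f * g j) * res (tot B) (over B W) (over B V) (e j)"
        using pull_mult[OF V(1) rf] by (simp add: mult.assoc)
    qed
    finally have eq: "?r V (pull B U f * \<epsilon>) = \<dots>" .
    have "\<forall>j<w + length ws. res M U V f * g j \<in> sec M V (i + k - fibre_degree w ws j)"
      using ring_mult_in[OF ring V(1) rf] g(1) by (metis add_diff_eq)
    then have "?r V (pull B U f * \<epsilon>) \<in> lin B V (i + k)"
      unfolding e[rule_format, OF conjI, OF V(1) V(4)] eq by (intro CollectI exI[of _ "\<lambda>j. res M U V f * g j"]) simp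
    then show ?thesis using V by blast
  qed
  then obtain V where V: "\<And>y. y \<in> U \<Longrightarrow> openin (base M) (V y) \<and> y \<in> V y \<and> V y \<subseteq> U \<and> ?r (V y) (pull B U f * \<epsilon>) \<in> lin B (V y) (i + k)"
    by metis
  have un: "\<Union>(V ` U) = U" using V by blast
  have "\<exists>!a. a \<in> sec (lin_mod M B) (\<Union>(V ` U)) (i + k) \<and>
      (\<forall>y\<in>U. res (lin_mod M B) (\<Union>(V ` U)) (V y) a = ?r (V y) (pull B U f * \<epsilon>))"
  proof (rule sheaf_glue[OF sheaf_lin])
    fix y z assume y: "y \<in> U" and z: "z \<in> U"
    have 1: "openin (base M) (V y \<inter> V z)" using V y z by blast
    have "res (tot B) (over B (V y)) (over B (V y \<inter> V z)) (?r (V y) (pull B U f * \<epsilon>)) = ?r (V y \<inter> V z) (pull B U f * \<epsilon>)"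
      using presheaf_res_res[OF presheaf_tot over_open[OF U] over_open over_open over_mono over_mono tot] V[OF y] 1 by simp
    moreover have "res (tot B) (over B (V z)) (over B (V y \<inter> V z)) (?r (V z) (pull B U f * \<epsilon>)) = ?r (V y \<inter> V z) (pull B U f * \<epsilon>)"
      using presheaf_res_res[OF presheaf_tot over_open[OF U] over_open over_open over_mono over_mono tot] V[OF z] 1 by simp
    ultimately show "res (lin_mod M B) (V y) (V y \<inter> V z) (?r (V y) (pull B U f * \<epsilon>)) =
       res (lin_mod M B) (V z) (V y \<inter> V z) (?r (V z) (pull B U f * \<epsilon>))" by simp
  qed (use V in auto)
  then obtain a where a: "a \<in> lin B U (i + k)" "\<And>y. y \<in> U \<Longrightarrow> ?r (V y) a = ?r (V y) (pull B U f * \<epsilon>)"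
    unfolding un by auto
  have "a = pull B U f * \<epsilon>"
    by (rule tot_eqI[OF U lin_tot[OF U a(1)] tot]) (use a(2) V in blast)
  then show ?thesis using a(1) by simp
qed

lemma module_lin: "module_on M (lin_mod M B)"
proof (rule module_on.intro, goal_cases)
  case 1
  then show ?case using sheaf_on_presheaf[OF sheaf_lin] by simp
next
  case (3 U x j)
  then show ?case using ring_unity_left[OF ring_tot over_open lin_tot] by (simp add: pull_unity)
next
  case (9 U f i x j V)
  then show ?case
    using ring_res_mult[OF ring_tot over_open[OF 9(1)] over_open[OF 9(4)] over_mono[OF 9(5)] pull_in[OF 9(1,2)] lin_tot[OF 9(1)]]
    by (simp add: pull_res)
qed (simp_all add: lin_pull pull_scale pull_add ring_distribs pull_mult mult.assoc)

end

lemma exponent_append: "exponent ds I \<Longrightarrow> exponent (ds @ ws) I"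
  by (auto simp: exponent_def nth_append)

text \<open>Independence and injectivity are read off from coefficients in the chart of the total
  space. A function of the base is recovered from its pull-back along the zero section. In a
  relation among the fibre coordinates, each coefficient is isolated by a suitable choice of point
  and exponent.\<close>

lemma (in vector_bundle) trivialisation_frame:
  assumes triv: "trivialisation M B n ds w ws U"
  obtains e where "frame_on M (lin_mod M B) U {..<w + length ws} (fibre_degree w ws) e"
    and "\<And>V f k. openin (base M) V \<Longrightarrow> V \<subseteq> U \<Longrightarrow> f \<in> sec M V k \<Longrightarrow> pull B V f = 0 \<Longrightarrow> f = 0"
proof -
  let ?N = "w + length ws" and ?fd = "fibre_degree w ws" and ?m = "length ds"
  obtain \<phi> \<Phi> \<psi> \<Psi> e where ch: "chart M n ds U \<phi> \<Phi>" and ch': "chart (tot B) (n + w) (ds @ ws) (over B U) \<psi> \<Psi>"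
    and im: "\<psi> ` over B U = {z \<in> topspace (Euclidean_space (n + w)). trunc n z \<in> \<phi> ` U}"
    and pr: "\<forall>y\<in>over B U. trunc n (\<psi> y) = \<phi> (proj B y)"
    and pu: "\<forall>V k f. openin (base M) V \<and> V \<subseteq> U \<and> f \<in> sec M V k \<longrightarrow>
        \<Psi> (over B V) (pull B V f) = series_res (\<psi> ` over B V) (\<lambda>I z. \<Phi> V f I (trunc n z))"
    and e: "\<forall>j<?N. e j \<in> sec (tot B) (over B U) (?fd j) \<and> \<Psi> (over B U) (e j) = fibre_coordinate n ?m w (\<psi> ` over B U) j"
    and li: "\<forall>V k. openin (base M) V \<and> V \<subseteq> U \<longrightarrow>
        lin B V k = {\<Sum>j<?N. pull B V (g j) * res (tot B) (over B U) (over B V) (e j) | g.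
                       \<forall>j<?N. g j \<in> sec M V (k - ?fd j)}"
    using triv[unfolded trivialisation_def] by (elim exE conjE) (rule that)
  interpret c: chart_on M n ds U \<phi> \<Phi> using ch ring by unfold_locales
  interpret c': chart_on "tot B" "n + w" "ds @ ws" "over B U" \<psi> \<Psi> using ch' ring_tot by unfold_locales
  have Zin: "z \<in> \<psi> ` over B V" if "V \<subseteq> U" "z \<in> topspace (Euclidean_space (n + w))" "trunc n z \<in> \<phi> ` V" for V z
  proof -
    have "trunc n z \<in> \<phi> ` U" using that(1,3) by (rule_tac subsetD[OF image_mono])
    then have "z \<in> \<psi> ` over B U" unfolding im using that(2) by simp
    then obtain y where y: "y \<in> over B U" "z = \<psi> y" by (rule imageE)
    then have "\<phi> (proj B y) \<in> \<phi> ` V" using pr that by auto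
    then have "proj B y \<in> V" using c.inj that(1) y(1) by (auto simp: inj_on_def over_def)
    then show ?thesis using y by (auto simp: over_def)
  qed
  have im0: "x \<in> topspace (Euclidean_space n)" if "x \<in> \<phi> ` V" "V \<subseteq> U" for x V
    using subsetD[OF c.image_subset subsetD[OF image_mono[OF that(2)] that(1)]] .
  have x0: "trunc n x = x" "x (n + j) = 0" and xE: "x \<in> topspace (Euclidean_space (n + w))" 
    if "x \<in> \<phi> ` V" "V \<subseteq> U" for x V j
    using im0[OF that] by (auto simp: trunc_def fun_eq_iff topspace_Euclidean_space')
  have ctr: "\<Psi> (over B V) (pull B V f) I z = \<Phi> V f I x"
    if "openin (base M) V" "V \<subseteq> U" "f \<in> sec M V k" "x \<in> \<phi> ` V" "z \<in> topspace (Euclidean_space (n + w))" "trunc n z = x" 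
    for V f k I x z
    using pu that Zin[of V z] by (simp add: series_res_def)
  have inj: "f = 0" if V: "openin (base M) V" "V \<subseteq> U" and f: "f \<in> sec M V k" and 0: "pull B V f = 0" for V f k
  proof (rule c.eq_0I[OF V f])
    fix I x assume x: "x \<in> \<phi> ` V"
    \<comment> \<open>The point x, with fibre coordinates 0, is also a point of the total space,
      namely on the zero section.\<close>
    show "\<Phi> V f I x = 0"
      using ctr[OF V f x xE[OF x V(2)] x0(1)[OF x V(2)], of I] 0 c'.zero[OF over_open[OF V(1)] over_mono[OF V(2)]] by simp
  qed
  have ind: "c j = 0" if V: "openin (base M) V" "V \<subseteq> U" and c: "\<And>i. i < ?N \<Longrightarrow> c i \<in> sec M V (k - ?fd i)"
    and s: "(\<Sum>i<?N. pull B V (c i) * res (tot B) (over B U) (over B V) (e i)) = 0" and j: "j < ?N" for V c k j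
  proof (rule c.eq_0I[OF V c[OF j]])
    fix I x assume I: "exponent ds I" and x: "x \<in> \<phi> ` V"
    let ?G = "\<lambda>i. \<Psi> (over B V) (pull B V (c i))"
    let ?F = "\<lambda>i. \<Psi> (over B V) (res (tot B) (over B U) (over B V) (e i))"
    note oV = over_open[OF V(1)] over_mono[OF V(2)]
    have re: "res (tot B) (over B U) (over B V) (e i) \<in> sec (tot B) (over B V) (?fd i)" if "i < ?N" for i
      using presheaf_res_in[OF presheaf_tot over_open[OF c.open_U] oV] e that by blast
    have summand: "pull B V (c i) * res (tot B) (over B U) (over B V) (e i) \<in> sec (tot B) (over B V) k" if "i < ?N" for i
      using ring_mult_in[OF ring_tot oV(1) pull_in[OF V(1) c[OF that]] re[OF that]] by simp
    have 0: "(\<Sum>i<?N. series_mult (ds @ ws) (?G i) (?F i) K z) = 0" for K z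
    proof -
      have "(\<Sum>i<?N. series_mult (ds @ ws) (?G i) (?F i)) = (\<Sum>i<?N. \<Psi> (over B V) (pull B V (c i) * res (tot B) (over B U) (over B V) (e i)))"
        by (rule sum.cong[OF refl]) (use c'.mult[OF oV pull_in[OF V(1) c] re] in auto)
      also have "\<dots> = \<Psi> (over B V) (\<Sum>i<?N. pull B V (c i) * res (tot B) (over B U) (over B V) (e i))"
        by (rule c'.sum[OF oV, symmetric]) (use summand in auto)
      also have "\<dots> = 0" using s c'.zero[OF oV] by simp
      finally have "(\<Sum>i<?N. series_mult (ds @ ws) (?G i) (?F i)) K z = 0" by simp
      then show ?thesis by (simp add: sum_fun_apply)
    qed
    have F: "?F i K z = fibre_coordinate n ?m w (\<psi> ` over B U) i K z" if "i < ?N" "z \<in> \<psi> ` over B V" for i K z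
      using c'.restrict[OF over_open[OF c.open_U] order_refl e[rule_format, OF that(1), THEN conjunct1] oV] e that by (simp add: series_res_def)
    have coo: "series_mult (ds @ ws) (?G i) (?F i) K z = 
        (if i < w then ?G i K z * z (n + i)
         else if (\<lambda>l. if l = ?m + (i - w) then 1 else 0) \<le> K then exponent_sign (ds @ ws) (K - (\<lambda>l. if l = ?m + (i - w) then 1 else 0)) (\<lambda>l. if l = ?m + (i - w) then 1 else 0) 
            * ?G i (K - (\<lambda>l. if l = ?m + (i - w) then 1 else 0)) z
         else 0)" if "i < ?N" "z \<in> \<psi> ` over B V" "exponent (ds @ ws) K" for i K z
    proof -
      have z: "z \<in> \<psi> ` over B U" using that(2) oV(2) by blast
      show ?thesis
      proof (cases "i < w")
        case True
        show ?thesis unfolding if_P[OF True]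
          by (rule series_mult_constant[OF that(3)]) (use True z F[OF that(1,2)] in \<open>simp add: fibre_coordinate_def series_res_def\<close>)
      next
        case False
        show ?thesis unfolding if_not_P[OF False]
          by (rule series_mult_variable[OF that(3)]) (use False z F[OF that(1,2)] in \<open>simp add: fibre_coordinate_def series_res_def\<close>)
      qed
    qed
    have Gout: "?G i K z = 0" if "i < ?N" "\<not> exponent ds K" "z \<in> topspace (Euclidean_space (n + w))" "trunc n z = x" for i K z
      using ctr[OF V c[OF that(1)] x that(3,4), of K] c.series_in[OF V c[OF that(1)]] that(2)
      by (simp add: series_sec_def)
    have GI: "?G j I z = \<Phi> V (c j) I x" if "z \<in> topspace (Euclidean_space (n + w))" "trunc n z = x" for z
      using ctr[OF V c[OF j] x that] by simp
    show "\<Phi> V (c j) I x = 0"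
    proof (cases "j < w")
      case True
      \<comment> \<open>The point over x whose fibre coordinate j is 1 and whose other fibre
        coordinates of degree 0 are 0. The formal fibre coordinates do not contribute to the
        exponent I, which involves only variables of the base.\<close>
      define z where "z = x(n + j := 1)"
      have z: "z \<in> topspace (Euclidean_space (n + w))" "trunc n z = x"
        using im0[OF x V(2)] True by (auto simp: z_def trunc_def topspace_Euclidean_space' fun_eq_iff)
      then have zZ: "z \<in> \<psi> ` over B V" using Zin V(2) x by simp
      have "(\<Sum>i<?N. series_mult (ds @ ws) (?G i) (?F i) I z) = series_mult (ds @ ws) (?G j) (?F j) I z"
      proof (rule sum_delta_eq)
        fix i assume i: "i \<in> {..<?N}" "i \<noteq> j"
        have "I (?m + (i - w)) = 0" using I by (simp add: exponent_def)
        then have nle: "\<not> (\<lambda>l. if l = ?m + (i - w) then 1 else 0) \<le> I"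
          by (simp add: unit_exponent_le)
        have iN: "i < ?N" using i by simp
        show "series_mult (ds @ ws) (?G i) (?F i) I z = 0"
        proof (cases "i < w")
          case True
          then show ?thesis
            unfolding coo[OF iN zZ exponent_append[OF I]] using i x0(2)[OF x V(2), of i] by (simp add: z_def)
        next
          case False
          then show ?thesis
            unfolding coo[OF iN zZ exponent_append[OF I]] if_not_P[OF False] if_not_P[OF nle] by simp
        qed
      qed (use j in auto)
      then have "?G j I z * z (n + j) = 0"
        using 0[of I z] coo[OF j zZ exponent_append[OF I]] True by simp
      then show ?thesis using GI[OF z] by (simp add: z_def)
    next
      case False
      let ?l = "?m + (j - w)"
      define u where "u = (\<lambda>l. if l = ?l then 1 else 0 :: nat)"
      \<comment> \<open>At x on the zero section the coefficient of exponent \<open>I + u\<close>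
        comes from the j-th formal coordinate alone: a coordinate of degree 0 would need a
        coefficient of exponent K in a pull-back, which is 0 by \<open>Gout\<close>, and K is 0 at
        the variables of the other formal coordinates.\<close>
      define K where "K = I + u"
      note z = xE[OF x V(2)] x0(1)[OF x V(2)]
      then have zZ: "x \<in> \<psi> ` over B V" using Zin V(2) x by simp
      have Kl: "K ?l \<noteq> 0" by (simp add: K_def u_def)
      have K0: "K l = 0" if "l \<ge> ?m" "l \<noteq> ?l" for l
        using that I by (simp add: K_def u_def exponent_def)
      have K1: "K l = I l" if "l < ?m" for l using that by (simp add: K_def u_def)
      have K: "exponent (ds @ ws) K"
        unfolding exponent_def
      proof (intro conjI allI impI)
        fix l assume "l < length (ds @ ws)" "odd ((ds @ ws) ! l)"
        then show "K l \<le> 1"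
          using I K0[of l] K1[of l] by (cases "l < ?m"; cases "l = ?l") (auto simp: exponent_def nth_append K_def u_def)
      qed (use K0 j False in auto)
      have nK: "\<not> exponent ds K" using Kl by (auto simp: exponent_def)
      have "(\<Sum>i<?N. series_mult (ds @ ws) (?G i) (?F i) K x) = series_mult (ds @ ws) (?G j) (?F j) K x"
      proof (rule sum_delta_eq)
        fix i assume i: "i \<in> {..<?N}" "i \<noteq> j"
        show "series_mult (ds @ ws) (?G i) (?F i) K x = 0"
        proof (cases "i < w")
          case True
          then show ?thesis using coo[OF _ zZ K, of i] i Gout[OF _ nK z, of i] by simp
        next
          case nw: False
          then have "K (?m + (i - w)) = 0" using i False by (intro K0) auto
          then have nle: "\<not> (\<lambda>l. if l = ?m + (i - w) then 1 else 0) \<le> K"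
            by (simp add: unit_exponent_le)
          have iN: "i < ?N" using i by simp
          show ?thesis unfolding coo[OF iN zZ K] if_not_P[OF nw] if_not_P[OF nle] by simp
        qed
      qed (use j in auto)
      moreover have "u \<le> K" "K - u = I" by (auto simp: K_def le_fun_def fun_eq_iff)
      ultimately have "exponent_sign (ds @ ws) I u * ?G j I x = 0"
        using 0[of K x] coo[OF j zZ K, unfolded if_not_P[OF False] u_def[symmetric]] by simp
      then show ?thesis using GI[OF z] exponent_sign_nonzero by simp
    qed
  qed
  have ein: "e j \<in> lin B U (?fd j)" if j: "j < ?N" for j
  proof -
    \<comment> \<open>The coordinate j is the combination with Kronecker coefficients, hence linear
      by the local description of \<open>lin\<close>.\<close>
    define g where "g = (\<lambda>i. if i = j then unity M U else 0)"
    have "(\<Sum>i<?N. pull B U (g i) * res (tot B) (over B U) (over B U) (e i)) = e j"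
      using ring_unity_left[OF ring_tot over_open[OF c.open_U]] e j presheaf_res_id[OF presheaf_tot over_open[OF c.open_U]]
      by (subst sum_delta_eq[of _ j]) (auto simp: g_def pull_0[OF c.open_U] pull_unity[OF c.open_U])
    moreover have "\<forall>i<?N. g i \<in> sec M U (?fd j - ?fd i)"
      by (auto simp: g_def ring_unity_in[OF ring c.open_U] presheaf_0[OF pre_ring c.open_U])
    ultimately show ?thesis
      unfolding li[rule_format, OF conjI, OF c.open_U order_refl] by (intro CollectI exI[of _ g]) simp
  qed
  have "frame_on M (lin_mod M B) U {..<?N} ?fd e"
  proof (rule frame_on.intro, goal_cases)
    case (6 V x k)
    then have "x \<in> lin B V k" by simp
    then obtain g where "x = (\<Sum>j<?N. pull B V (g j) * res (tot B) (over B U) (over B V) (e j))"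
      "\<forall>j<?N. g j \<in> sec M V (k - ?fd j)"
      unfolding li[rule_format, OF conjI, OF 6(1,2)] by blast
    then show ?case by (intro exI[of _ g]) simp
  next
    case (7 V c k i)
    then show ?case using ind[of V c k i] by simp
  qed (use ring module_lin c.open_U ein in auto)
  then show ?thesis using inj that by blast
qed

lemma (in vector_bundle) frame_at:
  assumes "x \<in> topspace (base M)"
  obtains U N d e where "x \<in> U" "frame_on M (lin_mod M B) U {..<N::nat} d e"
  using assms trivialisations trivialisation_frame that by metis

text \<open>Injectivity of the pull-back is a local matter, and each trivialisation supplies
  it.\<close>

lemma (in vector_bundle) pull_eq_0:
  assumes U: "openin (base M) U" and f: "f \<in> sec M U k" and 0: "pull B U f = 0"
  shows "f = 0"
proof (rule sheaf_eqI[OF ring_sheaf[OF ring] U f presheaf_0[OF pre_ring U]])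
  fix y assume y: "y \<in> U"
  then have "y \<in> topspace (base M)" using U openin_subset by blast
  then obtain n ds w ws W where W: "y \<in> W" "trivialisation M B n ds w ws W"
    using trivialisations by metis
  then have "openin (base M) W" unfolding trivialisation_def chart_def by blast
  then have V: "openin (base M) (U \<inter> W)" "U \<inter> W \<subseteq> U" "U \<inter> W \<subseteq> W" using U by auto
  have "pull B (U \<inter> W) (res M U (U \<inter> W) f) = 0"
    using pull_res[OF U V(1,2) f] presheaf_res_0[OF presheaf_tot over_open[OF U] over_open[OF V(1)] over_mono[OF V(2)]] 0 by simp
  then have "res M U (U \<inter> W) f = 0"
    using trivialisation_frame[OF W(2)] V(1,3) presheaf_res_in[OF pre_ring U V(1,2) f] by metis
  then show "\<exists>V. openin (base M) V \<and> y \<in> V \<and> V \<subseteq> U \<and> res M U V f = res M U V 0"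
    using V W(1) y presheaf_res_0[OF pre_ring U] by auto
qed

section \<open>Derivations of polynomial functions\<close>

lemma derivation_map: "derivation X U d D \<Longrightarrow> sheaf_map X X U d D"
  by (simp add: derivation_def)

lemma derivation_mult:
  assumes "derivation X U d D" and "openin (base X) V" "V \<subseteq> U" "f \<in> sec X V i" "g \<in> sec X V j"
  shows "D V (f * g) = D V f * g + ksign (d * i) *\<^sub>R (f * D V g)"
  using assms(1)[unfolded derivation_def, THEN conjunct2, THEN spec[of _ V], THEN spec[of _ i], THEN spec[of _ f],
      THEN spec[of _ j], THEN spec[of _ g]] assms(2-) by simp

lemma derivation_mono:
  assumes D: "derivation X U d D" and V: "V \<subseteq> U"
  shows "derivation X V d D"
  unfolding derivation_def
  using sheaf_map_mono[OF derivation_map[OF D] V] derivation_mult[OF D _ subset_trans[OF _ V]] by auto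

text \<open>Lets commutation relations be tested on generators, since the bracket of two derivations
  is itself one.\<close>

lemma derivation_commutator:
  assumes X: "graded_ring_sheaf X" and U: "openin (base X) U"
    and D: "derivation X U d D" and E: "derivation X U e E"
  shows "derivation X U (d + e) (graded_commutator d D e E)"
  unfolding derivation_def
proof (intro conjI allI impI)
  note p = ring_presheaf[OF X] and d = derivation_map[OF D] and e' = derivation_map[OF E]
  have "sheaf_map X X U (d + e) (\<lambda>V x. 1 *\<^sub>R D V (E V x) + (- ksign (d * e)) *\<^sub>R E V (D V x))"
    using sheaf_map_comp[OF p p e' d] sheaf_map_comp[OF p p d e']
    by (intro sheaf_map_lincomb[OF p p _ _ U]) (simp_all add: add.commute)
  then show "sheaf_map X X U (d + e) (graded_commutator d D e E)"
    by (simp add: graded_commutator_def[abs_def])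
  fix V i f j g assume "openin (base X) V \<and> V \<subseteq> U \<and> f \<in> sec X V i \<and> g \<in> sec X V j"
  then have V: "openin (base X) V" "V \<subseteq> U" and f: "f \<in> sec X V i" and g: "g \<in> sec X V j" by auto
  note Df = sheaf_map_in[OF p d V f] and Dg = sheaf_map_in[OF p d V g]
    and Ef = sheaf_map_in[OF p e' V f] and Eg = sheaf_map_in[OF p e' V g]
  have s: "D V (x + c *\<^sub>R y) = D V x + c *\<^sub>R D V y" "E V (x + c *\<^sub>R y) = E V x + c *\<^sub>R E V y"
    if "x \<in> sec X V k" "y \<in> sec X V k" for x y c k
    using that sheaf_map_add[OF p d V that(1) presheaf_scale[OF p V(1) that(2), of c]] sheaf_map_scale[OF p d V that(2)]
      sheaf_map_add[OF p e' V that(1) presheaf_scale[OF p V(1) that(2), of c]] sheaf_map_scale[OF p e' V that(2)] by auto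
  have 1: "D V (E V (f * g)) = D V (E V f * g) + ksign (e * i) *\<^sub>R D V (f * E V g)"
    using derivation_mult[OF E V f g] s(1)[of "E V f * g" "i + j + e" "f * E V g"] 
      ring_mult_in[OF X V(1) Ef g] ring_mult_in[OF X V(1) f Eg] by (simp add: algebra_simps)
  have 2: "E V (D V (f * g)) = E V (D V f * g) + ksign (d * i) *\<^sub>R E V (f * D V g)"
    using derivation_mult[OF D V f g] s(2)[of "D V f * g" "i + j + d" "f * D V g"] 
      ring_mult_in[OF X V(1) Df g] ring_mult_in[OF X V(1) f Dg] by (simp add: algebra_simps)
  have sgn: "ksign (d * (i + e)) = ksign (d * i) * ksign (d * e)" "ksign (e * (i + d)) = ksign (e * i) * ksign (d * e)"
    "ksign ((d + e) * i) = ksign (d * i) * ksign (e * i)"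
    by (simp_all add: ring_distribs ksign_add mult.commute)
  show "graded_commutator d D e E V (f * g) =
      graded_commutator d D e E V f * g + ksign ((d + e) * i) *\<^sub>R (f * graded_commutator d D e E V g)"
    unfolding graded_commutator_def 1 2 derivation_mult[OF D V Ef g] derivation_mult[OF D V f Eg]
      derivation_mult[OF E V Df g] derivation_mult[OF E V f Dg] sgn
    by (simp add: algebra_simps)
qed

lemma span_mult:
  fixes x y :: "'a::real_algebra"
  assumes "x \<in> span A" "y \<in> span B" and AB: "\<And>a b. a \<in> A \<Longrightarrow> b \<in> B \<Longrightarrow> a * b \<in> span C"
  shows "x * y \<in> span C"
proof -
  have "a * y \<in> span C" if a: "a \<in> A" for a
    using assms(2) by (induction rule: span_induct_alt) (auto simp: ring_distribs span_zero intro!: span_add span_scale AB[OF a])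
  with assms(1) show ?thesis
    by (induction rule: span_induct_alt) (auto simp: ring_distribs span_zero intro!: span_add span_scale)
qed

lemma poly_simps [simp]:
  "base (polynomials M B) = base M" "res (polynomials M B) U V = res (tot B) (over B U) (over B V)"
  "unity (polynomials M B) U = unity (tot B) (over B U)"
  by (simp_all add: polynomials_def)

section \<open>Functions polynomial in the fibres\<close>

context vector_bundle
begin

abbreviation "polys \<equiv> sec (polynomials M B)"
abbreviation "tres U V \<equiv> res (tot B) (over B U) (over B V)"
abbreviation "tsec U \<equiv> sec (tot B) (over B U)"

lemma poly_iff: "\<alpha> \<in> polys U (k, p) \<longleftrightarrow> (if p < 0 then \<alpha> = 0 else \<alpha> \<in> tsec U (k + p) \<and>
    (\<forall>x\<in>U. \<exists>V. openin (base M) V \<and> x \<in> V \<and> V \<subseteq> U \<and> tres U V \<alpha> \<in> span (monomials M B V (nat p) (k + p))))"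
  by (auto simp: polynomials_def)

lemma tot_0: "openin (base M) U \<Longrightarrow> 0 \<in> tsec U k"
  using presheaf_0[OF presheaf_tot over_open] .

lemma tot_mult: "openin (base M) U \<Longrightarrow> a \<in> tsec U i \<Longrightarrow> b \<in> tsec U j \<Longrightarrow> a * b \<in> tsec U (i + j)"
  using ring_mult_in[OF ring_tot over_open] .

lemma tot_res_mult: "openin (base M) U \<Longrightarrow> openin (base M) V \<Longrightarrow> V \<subseteq> U \<Longrightarrow> a \<in> tsec U i \<Longrightarrow> b \<in> tsec U j \<Longrightarrow>
    tres U V (a * b) = tres U V a * tres U V b"
  using ring_res_mult[OF ring_tot over_open over_open over_mono] .

lemma tot_res_in: "openin (base M) U \<Longrightarrow> openin (base M) V \<Longrightarrow> V \<subseteq> U \<Longrightarrow> a \<in> tsec U i \<Longrightarrow> tres U V a \<in> tsec V i"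
  using presheaf_res_in[OF presheaf_tot over_open over_open over_mono] .

lemma tot_res_res: "openin (base M) U \<Longrightarrow> openin (base M) V \<Longrightarrow> openin (base M) W \<Longrightarrow> W \<subseteq> V \<Longrightarrow> V \<subseteq> U \<Longrightarrow> a \<in> tsec U i \<Longrightarrow>
    tres V W (tres U V a) = tres U W a"
  using presheaf_res_res[OF presheaf_tot over_open over_open over_open over_mono over_mono] .

lemma tot_res_0: "openin (base M) U \<Longrightarrow> openin (base M) V \<Longrightarrow> V \<subseteq> U \<Longrightarrow> tres U V 0 = 0"
  using presheaf_res_0[OF presheaf_tot over_open over_open over_mono] .

lemma poly_tot:
  assumes "openin (base M) U" "\<alpha> \<in> polys U (k, p)"
  shows "\<alpha> \<in> tsec U (k + p)"
  using assms tot_0 by (cases "p < 0") (auto simp: poly_iff)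

lemma monomials_tot: "openin (base M) U \<Longrightarrow> monomials M B U p k \<subseteq> tsec U k"
proof (induction p arbitrary: k)
  case 0
  then show ?case using pull_in by auto
next
  case (Suc p)
  show ?case
  proof
    fix a assume "a \<in> monomials M B U (Suc p) k"
    then obtain \<alpha> \<epsilon> i where "a = \<alpha> * \<epsilon>" "\<alpha> \<in> monomials M B U p i" "\<epsilon> \<in> lin B U (k - i)" by auto
    then show "a \<in> tsec U k"
      using tot_mult[OF Suc(2), of \<alpha> i \<epsilon> "k - i"] lin_tot[OF Suc(2)] Suc.IH[OF Suc(2)] by auto
  qed
qed

lemma span_monomials_res:
  assumes U: "openin (base M) U" and V: "openin (base M) V" "V \<subseteq> U" and a: "a \<in> span (monomials M B U p k)"
  shows "tres U V a \<in> span (monomials M B V p k)"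
proof -
  have mon: "tres U V a \<in> monomials M B V p k" if "a \<in> monomials M B U p k" for a k
    using that
  proof (induction p arbitrary: a k)
    case 0
    then show ?case using pull_res[OF U V] presheaf_res_in[OF pre_ring U V] by auto
  next
    case (Suc p)
    then obtain \<alpha> \<epsilon> i where a: "a = \<alpha> * \<epsilon>" "\<alpha> \<in> monomials M B U p i" "\<epsilon> \<in> lin B U (k - i)" by auto
    have "\<alpha> \<in> tsec U i" using a(2) monomials_tot[OF U] by blast
    then have "tres U V a = tres U V \<alpha> * tres U V \<epsilon>" 
      using a(1) tot_res_mult[OF U V _ lin_tot[OF U a(3)]] by simp
    moreover have "tres U V \<epsilon> \<in> lin B V (k - i)"
      using presheaf_res_in[OF sheaf_on_presheaf[OF sheaf_lin] U V] a(3) by simp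
    ultimately show ?case using Suc.IH[OF a(2)] by auto
  qed
  \<comment> \<open>Membership in \<open>tsec\<close> is carried through the induction because
    restriction is additive only on sections.\<close>
  have "tres U V a \<in> span (monomials M B V p k) \<and> a \<in> tsec U k"
    using a
  proof (induction rule: span_induct_alt)
    case base
    then show ?case using tot_0[OF U] tot_res_0[OF U V] by (simp add: span_zero)
  next
    case (step c x y)
    then have x: "x \<in> tsec U k" using monomials_tot[OF U] by blast
    note P = presheaf_tot note o = over_open[OF U] over_open[OF V(1)] over_mono[OF V(2)]
    show ?case
      using presheaf_res_add[OF P o presheaf_scale[OF P o(1) x]] presheaf_res_scale[OF P o x] step mon[OF step(1)]
       presheaf_add[OF P o(1) presheaf_scale[OF P o(1) x]] span_base[OF mon[OF step(1)]]
      by (auto intro!: span_add span_scale)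
  qed
  then show ?thesis by blast
qed

lemma poly_0: "openin (base M) U \<Longrightarrow> 0 \<in> polys U (k, p)"
  by (auto simp: poly_iff tot_0 tot_res_0 intro!: exI[of _ U] span_zero)

lemma poly_res_in:
  assumes U: "openin (base M) U" and V: "openin (base M) V" "V \<subseteq> U" and \<alpha>: "\<alpha> \<in> polys U (k, p)"
  shows "tres U V \<alpha> \<in> polys V (k, p)"
proof (cases "p < 0")
  case True
  then show ?thesis using \<alpha> tot_res_0[OF U V] by (simp add: poly_iff)
next
  case False
  have "\<exists>W. openin (base M) W \<and> x \<in> W \<and> W \<subseteq> V \<and> tres V W (tres U V \<alpha>) \<in> span (monomials M B W (nat p) (k + p))"
    if x: "x \<in> V" for x
  proof -
    obtain W where W: "openin (base M) W" "x \<in> W" "W \<subseteq> U" "tres U W \<alpha> \<in> span (monomials M B W (nat p) (k + p))"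
      using \<alpha> subsetD[OF V(2) x] False unfolding poly_iff by auto
    have o: "openin (base M) (W \<inter> V)" "W \<inter> V \<subseteq> W" "W \<inter> V \<subseteq> V" using W V by auto
    have "tres V (W \<inter> V) (tres U V \<alpha>) = tres W (W \<inter> V) (tres U W \<alpha>)"
      using tot_res_res[OF U V(1) o(1,3) V(2) poly_tot[OF U \<alpha>]] tot_res_res[OF U W(1) o(1,2) W(3) poly_tot[OF U \<alpha>]] by simp
    then show ?thesis using span_monomials_res[OF W(1) o(1,2) W(4)] o W(2) x by auto
  qed
  then show ?thesis using False tot_res_in[OF U V] \<alpha> by (simp add: poly_iff)
qed

lemma poly_local:
  assumes U: "openin (base M) U" and \<alpha>: "\<alpha> \<in> polys U (k, int q)" and x: "x \<in> U"
  obtains V where "openin (base M) V" "x \<in> V" "V \<subseteq> U" "tres U V \<alpha> \<in> span (monomials M B V q (k + int q))"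
  using \<alpha> x by (auto simp: poly_iff)

lemma poly_localI:
  assumes U: "openin (base M) U" and \<alpha>: "\<alpha> \<in> tsec U (k + int q)"
    and loc: "\<And>x. x \<in> U \<Longrightarrow> \<exists>V. openin (base M) V \<and> x \<in> V \<and> V \<subseteq> U \<and> tres U V \<alpha> \<in> span (monomials M B V q (k + int q))"
  shows "\<alpha> \<in> polys U (k, int q)"
  using assms by (simp add: poly_iff)

lemma poly_subspace:
  assumes U: "openin (base M) U"
  shows "subspace (polys U (k, p))"
proof (cases "p < 0")
  case True
  then have "polys U (k, p) = {0}" by (auto simp: poly_iff)
  then show ?thesis by simp
next
  case False
  then obtain q where p: "p = int q" by (metis nonneg_int_cases not_less)
  show ?thesis
    unfolding subspace_def p
  proof (intro conjI ballI allI)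
    show "0 \<in> polys U (k, int q)" using poly_0[OF U] .
    note P = presheaf_tot
    fix a assume a: "a \<in> polys U (k, int q)"
    note at = poly_tot[OF U a]
    {
      fix b assume b: "b \<in> polys U (k, int q)"
      note bt = poly_tot[OF U b]
      show "a + b \<in> polys U (k, int q)"
      proof (rule poly_localI[OF U presheaf_add[OF P over_open[OF U] at bt]])
        fix x assume x: "x \<in> U"
        obtain V where V: "openin (base M) V" "x \<in> V" "V \<subseteq> U" "tres U V a \<in> span (monomials M B V q (k + int q))"
          using poly_local[OF U a x] .
        obtain W where W: "openin (base M) W" "x \<in> W" "W \<subseteq> V" "tres V W (tres U V b) \<in> span (monomials M B W q (k + int q))"
          using poly_local[OF V(1) poly_res_in[OF U V(1,3) b] V(2)] .
        have "W \<subseteq> U" using W V by blast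
        moreover have "tres U W (a + b) = tres V W (tres U V a) + tres V W (tres U V b)"
          using presheaf_res_add[OF P over_open[OF U] over_open[OF W(1)] over_mono[OF \<open>W \<subseteq> U\<close>] at bt]
            tot_res_res[OF U V(1) W(1,3) V(3) at] tot_res_res[OF U V(1) W(1,3) V(3) bt] by simp
        ultimately show "\<exists>V. openin (base M) V \<and> x \<in> V \<and> V \<subseteq> U \<and> tres U V (a + b) \<in> span (monomials M B V q (k + int q))"
          using W span_monomials_res[OF V(1) W(1,3) V(4)] span_add by metis
      qed
    }
    fix c :: real
    show "c *\<^sub>R a \<in> polys U (k, int q)"
    proof (rule poly_localI[OF U presheaf_scale[OF P over_open[OF U] at]])
      fix x assume x: "x \<in> U"
      obtain V where V: "openin (base M) V" "x \<in> V" "V \<subseteq> U" "tres U V a \<in> span (monomials M B V q (k + int q))"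
        using poly_local[OF U a x] .
      then show "\<exists>V. openin (base M) V \<and> x \<in> V \<and> V \<subseteq> U \<and> tres U V (c *\<^sub>R a) \<in> span (monomials M B V q (k + int q))"
        using presheaf_res_scale[OF P over_open[OF U] over_open[OF V(1)] over_mono[OF V(3)] at] span_scale by metis
    qed
  qed
qed

lemma pull_poly:
  assumes U: "openin (base M) U" and f: "f \<in> sec M U k"
  shows "pull B U f \<in> polys U (k, 0)"
  using U f pull_in[OF U f] pull_res[OF U U order_refl f] presheaf_res_id[OF pre_ring U f]
  by (auto simp: poly_iff intro!: exI[of _ U] span_base)

lemma unity_poly: "openin (base M) U \<Longrightarrow> unity (tot B) (over B U) \<in> polys U (0, 0)"
  using pull_poly[of U "unity M U" 0] ring_unity_in[OF ring] pull_unity by simp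

text \<open>The total degree k is manifold degree plus polynomial degree, which leaves k - 1 for the
  former.\<close>

lemma lin_poly:
  assumes U: "openin (base M) U" and e: "\<epsilon> \<in> lin B U k"
  shows "\<epsilon> \<in> polys U (k - 1, 1)"
proof -
  have "\<epsilon> = pull B U (unity M U) * \<epsilon>"
    using ring_unity_left[OF ring_tot over_open[OF U] lin_tot[OF U e]] pull_unity[OF U] by simp
  then have "\<epsilon> \<in> monomials M B U (Suc 0) k"
    unfolding monomials.simps
    by (intro CollectI exI[of _ "pull B U (unity M U)"] exI[of _ \<epsilon>] exI[of _ 0]) 
      (use e ring_unity_in[OF ring U] in auto)
  then show ?thesis using U lin_tot[OF U e] presheaf_res_id[OF presheaf_tot over_open[OF U] lin_tot[OF U e]]
    by (auto simp: poly_iff intro!: exI[of _ U] span_base simp del: monomials.simps)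
qed

lemma lin_subspace: "openin (base M) U \<Longrightarrow> subspace (lin B U k)"
  using presheaf_subspace[OF sheaf_on_presheaf[OF sheaf_lin]] by simp

text \<open>A monomial with one linear factor is linear by \<open>lin_pull\<close>, and linear
  functions form a subspace. Elements of polynomial degree 1 thereby become linear functions,
  locally.\<close>

lemma span_monomials_1: "openin (base M) U \<Longrightarrow> a \<in> span (monomials M B U (Suc 0) k) \<Longrightarrow> a \<in> lin B U k"
proof -
  assume U: "openin (base M) U" and a: "a \<in> span (monomials M B U (Suc 0) k)"
  have "monomials M B U (Suc 0) k \<subseteq> lin B U k"
  proof
    fix x assume "x \<in> monomials M B U (Suc 0) k"
    then obtain f \<epsilon> i where "x = pull B U f * \<epsilon>" "f \<in> sec M U i" "\<epsilon> \<in> lin B U (k - i)" by auto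
    then show "x \<in> lin B U k" using lin_pull[OF U, of f i \<epsilon> "k - i"] by simp
  qed
  then show "a \<in> lin B U k" using span_minimal[OF _ lin_subspace[OF U]] a by blast
qed

lemma pull_monomial:
  assumes U: "openin (base M) U" and f: "f \<in> sec M U i" and a: "a \<in> monomials M B U p k"
  shows "pull B U f * a \<in> monomials M B U p (i + k)"
  using a
proof (induction p arbitrary: a k)
  case 0
  then obtain g where g: "g \<in> sec M U k" "a = pull B U g" by auto
  then have "pull B U f * a = pull B U (f * g)" using pull_mult[OF U f] by simp
  then show ?case using ring_mult_in[OF ring U f g(1)] by simp
next
  case (Suc p)
  then obtain \<alpha> \<epsilon> j where a: "a = \<alpha> * \<epsilon>" "\<alpha> \<in> monomials M B U p j" "\<epsilon> \<in> lin B U (k - j)" by auto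
  have "pull B U f * a = (pull B U f * \<alpha>) * \<epsilon>" using a by (simp add: mult.assoc)
  moreover have "\<epsilon> \<in> lin B U (i + k - (i + j))" using a(3) by simp
  ultimately show ?case using Suc.IH[OF a(2)] unfolding monomials.simps by blast
qed

lemma span_mult_lin:
  assumes a: "a \<in> span (monomials M B U p i)" and e: "\<epsilon> \<in> lin B U j"
  shows "a * \<epsilon> \<in> span (monomials M B U (Suc p) (i + j))"
  using span_mult[OF a span_base[of \<epsilon> "{\<epsilon>}"], of "monomials M B U (Suc p) (i + j)"] e
  by (force intro: span_base)

text \<open>The pull-back stands on the right and is first commuted to the left, at the cost of a
  sign that the span absorbs.\<close>

lemma span_mult_pull:
  assumes U: "openin (base M) U" and a: "a \<in> span (monomials M B U p i)" and f: "f \<in> sec M U j"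
  shows "a * pull B U f \<in> span (monomials M B U p (i + j))"
proof (rule span_mult[OF a span_base[of "pull B U f" "{pull B U f}"]])
  fix a b assume a: "a \<in> monomials M B U p i" and b: "b \<in> {pull B U f}"
  have "a * pull B U f = ksign (j * i) *\<^sub>R (pull B U f * a)"
    using ring_commute[OF ring_tot over_open[OF U] pull_in[OF U f]] monomials_tot[OF U] a by blast
  then show "a * b \<in> span (monomials M B U p (i + j))"
    using b span_scale[OF span_base[OF pull_monomial[OF U f a]], of "ksign (j * i)"] by (simp add: add.commute)
qed auto

lemma span_monomials_mult:
  assumes U: "openin (base M) U" and a: "a \<in> span (monomials M B U p i)" and b: "b \<in> span (monomials M B U q j)"
  shows "a * b \<in> span (monomials M B U (p + q) (i + j))"
proof (rule span_mult[OF a b])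
  fix x y assume x: "x \<in> monomials M B U p i" and y: "y \<in> monomials M B U q j"
  from y show "x * y \<in> span (monomials M B U (p + q) (i + j))"
  proof (induction q arbitrary: y j)
    case 0
    then show ?case using span_mult_pull[OF U span_base[OF x]] by auto
  next
    case (Suc q)
    then obtain \<beta> \<epsilon> l where y: "y = \<beta> * \<epsilon>" "\<beta> \<in> monomials M B U q l" "\<epsilon> \<in> lin B U (j - l)" by auto
    show ?case
      using span_mult_lin[OF Suc.IH[OF y(2)] y(3)] y(1) by (simp add: mult.assoc add.assoc del: monomials.simps)
  qed
qed

text \<open>Each factor becomes a sum of monomials only locally, so the neighbourhood is shrunk once
  for each of them.\<close>

lemma poly_mult:
  assumes U: "openin (base M) U" and \<alpha>: "\<alpha> \<in> polys U (k, p)" and \<beta>: "\<beta> \<in> polys U (l, q)"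
  shows "\<alpha> * \<beta> \<in> polys U (k + l, p + q)"
proof (cases "p < 0 \<or> q < 0")
  case True
  then have "\<alpha> * \<beta> = 0" using \<alpha> \<beta> by (auto simp: poly_iff)
  then show ?thesis using poly_0[OF U] by simp
next
  case False
  then obtain p' q' where p: "p = int p'" and q: "q = int q'" by (metis nonneg_int_cases not_less)
  note t = poly_tot[OF U \<alpha>] poly_tot[OF U \<beta>]
  have "\<alpha> * \<beta> \<in> polys U (k + l, int (p' + q'))"
  proof (rule poly_localI[OF U])
    show "\<alpha> * \<beta> \<in> tsec U (k + l + int (p' + q'))"
      using tot_mult[OF U t] by (simp add: p q algebra_simps)
    fix x assume x: "x \<in> U"
    obtain V where V: "openin (base M) V" "x \<in> V" "V \<subseteq> U" "tres U V \<alpha> \<in> span (monomials M B V p' (k + int p'))"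
      using poly_local[OF U \<alpha>[unfolded p] x] .
    obtain W where W: "openin (base M) W" "x \<in> W" "W \<subseteq> V" "tres V W (tres U V \<beta>) \<in> span (monomials M B W q' (l + int q'))"
      using poly_local[OF V(1) poly_res_in[OF U V(1,3) \<beta>[unfolded q]] V(2)] .
    have WU: "W \<subseteq> U" using W V by blast
    have "tres U W (\<alpha> * \<beta>) = tres V W (tres U V \<alpha>) * tres V W (tres U V \<beta>)"
      using tot_res_mult[OF U W(1) WU t] tot_res_res[OF U V(1) W(1,3) V(3) t(1)] tot_res_res[OF U V(1) W(1,3) V(3) t(2)] by simp
    then have "tres U W (\<alpha> * \<beta>) \<in> span (monomials M B W (p' + q') (k + int p' + (l + int q')))"
      using span_monomials_mult[OF W(1) span_monomials_res[OF V(1) W(1,3) V(4)] W(4)] by simp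
    then show "\<exists>V. openin (base M) V \<and> x \<in> V \<and> V \<subseteq> U \<and> tres U V (\<alpha> * \<beta>) \<in> span (monomials M B V (p' + q') (k + l + int (p' + q')))"
      using W WU by (intro exI[of _ W]) (simp add: algebra_simps)
  qed
  then show ?thesis by (simp add: p q)
qed

section \<open>Derivations tested on pull-backs and linear functions\<close>

context
  fixes U D d
  assumes U: "openin (base M) U" and D: "derivation (tot B) (over B U) d D"
begin

lemma derivation_tot_in: "openin (base M) V \<Longrightarrow> V \<subseteq> U \<Longrightarrow> a \<in> tsec V i \<Longrightarrow> D (over B V) a \<in> tsec V (i + d)"
  using sheaf_map_in[OF presheaf_tot derivation_map[OF D] over_open over_mono] .

lemma derivation_tot_res: "openin (base M) V \<Longrightarrow> V \<subseteq> U \<Longrightarrow> openin (base M) W \<Longrightarrow> W \<subseteq> V \<Longrightarrow> a \<in> tsec V i \<Longrightarrow>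
    tres V W (D (over B V) a) = D (over B W) (tres V W a)"
  using sheaf_map_res[OF presheaf_tot derivation_map[OF D] over_open over_mono over_open over_mono] by simp

lemma derivation_span:
  assumes V: "openin (base M) V" "V \<subseteq> U" and a: "a \<in> span (monomials M B V p k)"
    and S: "subspace S" and mon: "\<And>a. a \<in> monomials M B V p k \<Longrightarrow> D (over B V) a \<in> S"
  shows "D (over B V) a \<in> S"
proof -
  note P = presheaf_tot and m = derivation_map[OF D] and o = over_open[OF V(1)] over_mono[OF V(2)]
  have "D (over B V) a \<in> S \<and> a \<in> tsec V k"
    using a
  proof (induction rule: span_induct_alt)
    case base
    then show ?case using tot_0[OF V(1)] sheaf_map_0[OF P m o] subspace_0[OF S] by simp
  next
    case (step c x y)
    then have x: "x \<in> tsec V k" using monomials_tot[OF V(1)] by blast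
    show ?case
      using sheaf_map_add[OF P m o presheaf_scale[OF P o(1) x]] sheaf_map_scale[OF P m o x] step mon[OF step(1)]
        presheaf_add[OF P o(1) presheaf_scale[OF P o(1) x]] subspace_add[OF S subspace_scale[OF S]] by auto
  qed
  then show ?thesis by blast
qed

lemma derivation_product:
  assumes V: "openin (base M) V" "V \<subseteq> U" and a: "a \<in> monomials M B V p i" and e: "\<epsilon> \<in> lin B V j"
  shows "D (over B V) (a * \<epsilon>) = D (over B V) a * \<epsilon> + ksign (d * i) *\<^sub>R (a * D (over B V) \<epsilon>)"
  using derivation_mult[OF D over_open[OF V(1)] over_mono[OF V(2)] _ lin_tot[OF V(1) e]] monomials_tot[OF V(1)] a by blast

text \<open>Locally a polynomial function is a sum of products of pull-backs and linear functions,
  to which the product rule reduces everything. The rules relating \<open>Q1\<close> and the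
  contractions are proved by applying this to a bracket or a difference of derivations.\<close>

lemma derivation_poly_eq_0:
  assumes pull: "\<And>V f k. openin (base M) V \<Longrightarrow> V \<subseteq> U \<Longrightarrow> f \<in> sec M V k \<Longrightarrow> D (over B V) (pull B V f) = 0"
    and lin: "\<And>V \<epsilon> k. openin (base M) V \<Longrightarrow> V \<subseteq> U \<Longrightarrow> \<epsilon> \<in> lin B V k \<Longrightarrow> D (over B V) \<epsilon> = 0"
    and V: "openin (base M) V" "V \<subseteq> U" and \<alpha>: "\<alpha> \<in> polys V (k, p)"
  shows "D (over B V) \<alpha> = 0"
proof (cases "p < 0")
  case True
  then show ?thesis using \<alpha> sheaf_map_0[OF presheaf_tot derivation_map[OF D] over_open[OF V(1)] over_mono[OF V(2)]] by (simp add: poly_iff)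
next
  case False
  then obtain q where p: "p = int q" by (metis nonneg_int_cases not_less)
  note t = poly_tot[OF V(1) \<alpha>]
  have mon: "D (over B W) a = 0" if W: "openin (base M) W" "W \<subseteq> U" and a: "a \<in> monomials M B W q l" for W q a l
    using a
  proof (induction q arbitrary: a l)
    case 0
    then show ?case using pull[OF W] by auto
  next
    case (Suc q)
    then obtain \<alpha> \<epsilon> j where a: "a = \<alpha> * \<epsilon>" "\<alpha> \<in> monomials M B W q j" "\<epsilon> \<in> lin B W (l - j)" by auto
    then show ?case using derivation_product[OF W a(2,3)] Suc.IH[OF a(2)] lin[OF W a(3)] by simp
  qed
  show ?thesis
  proof (rule tot_eqI[OF V(1) derivation_tot_in[OF V t] tot_0[OF V(1)]])
    fix y assume y: "y \<in> V"
    obtain W where W: "openin (base M) W" "y \<in> W" "W \<subseteq> V" "tres V W \<alpha> \<in> span (monomials M B W q (k + int q))"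
      using poly_local[OF V(1) \<alpha>[unfolded p] y] .
    have WU: "W \<subseteq> U" using W V by blast
    have "D (over B W) (tres V W \<alpha>) \<in> {0}"
      by (rule derivation_span[OF W(1) WU W(4)]) (use mon[OF W(1) WU] in auto)
    then show "\<exists>W. openin (base M) W \<and> y \<in> W \<and> W \<subseteq> V \<and> tres V W (D (over B V) \<alpha>) = tres V W 0"
      using W derivation_tot_res[OF V W(1,3) t] tot_res_0[OF V(1) W(1,3)] by auto
  qed
qed

text \<open>The case of \<open>Q1\<close>: the product rule keeps the number of linear
  factors.\<close>

lemma derivation_poly_0:
  assumes pull: "\<And>V f k. openin (base M) V \<Longrightarrow> V \<subseteq> U \<Longrightarrow> f \<in> sec M V k \<Longrightarrow> D (over B V) (pull B V f) \<in> pull B V ` sec M V (k + d)"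
    and lin: "\<And>V \<epsilon> k. openin (base M) V \<Longrightarrow> V \<subseteq> U \<Longrightarrow> \<epsilon> \<in> lin B V k \<Longrightarrow> D (over B V) \<epsilon> \<in> lin B V (k + d)"
    and V: "openin (base M) V" "V \<subseteq> U" and \<alpha>: "\<alpha> \<in> polys V (k, p)"
  shows "D (over B V) \<alpha> \<in> polys V (k + d, p)"
proof (cases "p < 0")
  case True
  then show ?thesis using \<alpha> sheaf_map_0[OF presheaf_tot derivation_map[OF D] over_open[OF V(1)] over_mono[OF V(2)]] by (simp add: poly_iff)
next
  case False
  then obtain q where p: "p = int q" by (metis nonneg_int_cases not_less)
  note t = poly_tot[OF V(1) \<alpha>]
  have mon: "D (over B W) a \<in> span (monomials M B W q (l + d))" if W: "openin (base M) W" "W \<subseteq> U" and a: "a \<in> monomials M B W q l" for W q a l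
    using a
  proof (induction q arbitrary: a l)
    case 0
    then show ?case using pull[OF W] by (auto intro: span_base)
  next
    case (Suc q)
    then obtain \<alpha> \<epsilon> j where a: "a = \<alpha> * \<epsilon>" "\<alpha> \<in> monomials M B W q j" "\<epsilon> \<in> lin B W (l - j)" by auto
    show ?case
      unfolding a(1) derivation_product[OF W a(2,3)]
      using span_mult_lin[OF Suc.IH[OF a(2)] a(3)] span_mult_lin[OF span_base[OF a(2)] lin[OF W a(3)]]
      by (intro span_add span_scale) (simp_all add: algebra_simps del: monomials.simps)
  qed
  show ?thesis unfolding p
  proof (rule poly_localI[OF V(1)])
    show "D (over B V) \<alpha> \<in> tsec V (k + d + int q)" using derivation_tot_in[OF V t] by (simp add: p algebra_simps)
    fix y assume y: "y \<in> V"
    obtain W where W: "openin (base M) W" "y \<in> W" "W \<subseteq> V" "tres V W \<alpha> \<in> span (monomials M B W q (k + int q))"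
      using poly_local[OF V(1) \<alpha>[unfolded p] y] .
    have WU: "W \<subseteq> U" using W V by blast
    have "D (over B W) (tres V W \<alpha>) \<in> span (monomials M B W q (k + int q + d))"
      by (rule derivation_span[OF W(1) WU W(4) subspace_span mon[OF W(1) WU]])
    then show "\<exists>W. openin (base M) W \<and> y \<in> W \<and> W \<subseteq> V \<and> tres V W (D (over B V) \<alpha>) \<in> span (monomials M B W q (k + d + int q))"
      using W derivation_tot_res[OF V W(1,3) t] by (intro exI[of _ W]) (simp add: algebra_simps)
  qed
qed

text \<open>The case of the contractions: one linear factor is replaced by a function. The total
  degree changes by d while the polynomial degree drops by 1, so the manifold degree changes by d +
  1.\<close>

lemma derivation_poly_minus_1:
  assumes pull: "\<And>V f k. openin (base M) V \<Longrightarrow> V \<subseteq> U \<Longrightarrow> f \<in> sec M V k \<Longrightarrow> D (over B V) (pull B V f) = 0"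
    and lin: "\<And>V \<epsilon> k. openin (base M) V \<Longrightarrow> V \<subseteq> U \<Longrightarrow> \<epsilon> \<in> lin B V k \<Longrightarrow> D (over B V) \<epsilon> \<in> pull B V ` sec M V (k + d)"
    and V: "openin (base M) V" "V \<subseteq> U" and \<alpha>: "\<alpha> \<in> polys V (k, p)"
  shows "D (over B V) \<alpha> \<in> polys V (k + d + 1, p - 1)"
proof (cases "p < 0")
  case True
  then show ?thesis using \<alpha> sheaf_map_0[OF presheaf_tot derivation_map[OF D] over_open[OF V(1)] over_mono[OF V(2)]] by (simp add: poly_iff)
next
  case False
  then obtain q where p: "p = int q" by (metis nonneg_int_cases not_less)
  note t = poly_tot[OF V(1) \<alpha>]
  have mon0: "D (over B W) a = 0" if W: "openin (base M) W" "W \<subseteq> U" and a: "a \<in> monomials M B W 0 l" for W a l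
    using a pull[OF W] by auto
  have mon: "D (over B W) a \<in> span (monomials M B W q (l + d))" if W: "openin (base M) W" "W \<subseteq> U" and a: "a \<in> monomials M B W (Suc q) l" for W q a l
    using a
  proof (induction q arbitrary: a l)
    case 0
    then obtain \<alpha> \<epsilon> j where a: "a = \<alpha> * \<epsilon>" "\<alpha> \<in> monomials M B W 0 j" "\<epsilon> \<in> lin B W (l - j)" by auto
    obtain f where f: "f \<in> sec M W (l - j + d)" "D (over B W) \<epsilon> = pull B W f" using lin[OF W a(3)] by blast
    show ?case
      unfolding a(1) derivation_product[OF W a(2,3)] mon0[OF W a(2)] f(2)
      using span_mult_pull[OF W(1) span_base[OF a(2)] f(1)]
      by (simp add: algebra_simps span_scale del: monomials.simps)
  next
    case (Suc q)
    then obtain \<alpha> \<epsilon> j where a: "a = \<alpha> * \<epsilon>" "\<alpha> \<in> monomials M B W (Suc q) j" "\<epsilon> \<in> lin B W (l - j)"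
      unfolding monomials.simps(2)[of M B W "Suc q"] by blast
    obtain f where f: "f \<in> sec M W (l - j + d)" "D (over B W) \<epsilon> = pull B W f" using lin[OF W a(3)] by blast
    show ?case
      unfolding a(1) derivation_product[OF W a(2,3)] f(2)
      using span_mult_pull[OF W(1) span_base[OF a(2)] f(1)] span_mult_lin[OF Suc.IH[OF a(2)] a(3)]
      by (intro span_add span_scale) (simp_all add: algebra_simps del: monomials.simps)
  qed
  have loc: "\<exists>W. openin (base M) W \<and> y \<in> W \<and> W \<subseteq> V \<and> tres V W \<alpha> \<in> span (monomials M B W q (k + int q)) \<and>
     tres V W (D (over B V) \<alpha>) = D (over B W) (tres V W \<alpha>) \<and> W \<subseteq> U" if y: "y \<in> V" for y
  proof -
    obtain W where W: "openin (base M) W" "y \<in> W" "W \<subseteq> V" "tres V W \<alpha> \<in> span (monomials M B W q (k + int q))"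
      using poly_local[OF V(1) \<alpha>[unfolded p] y] .
    then show ?thesis using derivation_tot_res[OF V W(1,3) t] V by blast
  qed
  show ?thesis
  proof (cases q)
    case 0
    \<comment> \<open>The target has polynomial degree -1, where 0 is the only element.\<close>
    have "D (over B V) \<alpha> = 0"
    proof (rule tot_eqI[OF V(1) derivation_tot_in[OF V t] tot_0[OF V(1)]])
      fix y assume y: "y \<in> V"
      obtain W where W: "openin (base M) W" "y \<in> W" "W \<subseteq> V" "tres V W \<alpha> \<in> span (monomials M B W 0 (k + int q))"
        "tres V W (D (over B V) \<alpha>) = D (over B W) (tres V W \<alpha>)" "W \<subseteq> U" using loc[OF y] unfolding 0 by blast
      have "D (over B W) (tres V W \<alpha>) \<in> {0}"
        by (rule derivation_span[OF W(1,6,4)]) (use mon0[OF W(1,6)] in auto)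
      then show "\<exists>W. openin (base M) W \<and> y \<in> W \<and> W \<subseteq> V \<and> tres V W (D (over B V) \<alpha>) = tres V W 0"
        using W tot_res_0[OF V(1) W(1,3)] by auto
    qed
    then show ?thesis using poly_0[OF V(1)] by simp
  next
    case (Suc r)
    have "D (over B V) \<alpha> \<in> polys V (k + d + 1, int r)"
    proof (rule poly_localI[OF V(1)])
      show "D (over B V) \<alpha> \<in> tsec V (k + d + 1 + int r)" using derivation_tot_in[OF V t] by (simp add: p Suc algebra_simps)
      fix y assume y: "y \<in> V"
      obtain W where W: "openin (base M) W" "y \<in> W" "W \<subseteq> V" "tres V W \<alpha> \<in> span (monomials M B W (Suc r) (k + int q))"
        "tres V W (D (over B V) \<alpha>) = D (over B W) (tres V W \<alpha>)" "W \<subseteq> U" using loc[OF y] unfolding Suc by blast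
      have "D (over B W) (tres V W \<alpha>) \<in> span (monomials M B W r (k + int q + d))"
        by (rule derivation_span[OF W(1,6,4) subspace_span mon[OF W(1,6)]])
      then show "\<exists>W. openin (base M) W \<and> y \<in> W \<and> W \<subseteq> V \<and> tres V W (D (over B V) \<alpha>) \<in> span (monomials M B W r (k + d + 1 + int r))"
        using W by (intro exI[of _ W]) (simp add: Suc algebra_simps)
    qed
    then show ?thesis by (simp add: p Suc)
  qed
qed

end

end

section \<open>Tensor products\<close>

text \<open>Bridges the gap between the real-valued balanced maps in \<open>tensor_product\<close>
  and equations between functions.\<close>

lemma linear_functional_separates:
  fixes x :: "'a::real_vector"
  assumes "\<And>f :: 'a \<Rightarrow> real. linear f \<Longrightarrow> f x = 0"
  shows "x = 0"
proof (rule ccontr)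
  assume "x \<noteq> 0"
  then have "independent {x}" by simp
  then obtain f where "linear f" "\<forall>y\<in>{x}. f y = (1::real)"
    using linear_independent_extend[of "{x}" "\<lambda>_. 1"] by blast
  then show False using assms[of f] by simp
qed

text \<open>G is kept general since it is the module of sections of E for m and that of
  endomorphisms for n.\<close>

locale tensor_module = vector_bundle M B
  for M :: "('p, int, 'f::real_algebra) gring" and B :: "('p, 'f, 'q, 'g::real_algebra) vbundle" +
  fixes G :: "('p, int, 'f, 'e::real_vector) gmod" and m :: "('p, int \<times> int, 'g, 'm::real_vector) gmod"
    and tens :: "'p set \<Rightarrow> 'g \<Rightarrow> 'e \<Rightarrow> 'm"
  assumes module_G: "module_on M G" and tensor_product: "tensor_product M B G m tens"
begin

lemma bigraded: "bigraded_module (polynomials M B) m"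
  using tensor_product[unfolded tensor_product_def, THEN conjunct1] .

lemma sheaf_m: "sheaf_on (base M) m"
  using bigraded by (simp add: bigraded_module_def sheaf_on_def)

lemmas pre_m = sheaf_on_presheaf[OF sheaf_m]
lemmas pre_G = module_presheaf[OF module_G]

lemmas act_rules = bigraded[unfolded bigraded_module_def poly_simps, THEN conjunct2, THEN conjunct2, THEN spec, THEN spec,
    THEN spec, THEN spec, THEN spec, THEN mp, OF conjI, OF _ conjI]

context
  fixes U \<alpha> i x j
  assumes U: "openin (base M) U" and \<alpha>: "\<alpha> \<in> polys U i" and x: "x \<in> sec m U j"
begin

lemma act_in: "act m U \<alpha> x \<in> sec m U (i + j)"
  using act_rules[OF U \<alpha> x] by blast

lemma act_scale_left: "act m U (c *\<^sub>R \<alpha>) x = c *\<^sub>R act m U \<alpha> x"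
  using act_rules[OF U \<alpha> x] by blast

lemma act_scale_right: "act m U \<alpha> (c *\<^sub>R x) = c *\<^sub>R act m U \<alpha> x"
  using act_rules[OF U \<alpha> x] by blast

lemma act_add_left: "\<beta> \<in> polys U i \<Longrightarrow> act m U (\<alpha> + \<beta>) x = act m U \<alpha> x + act m U \<beta> x"
  using act_rules[OF U \<alpha> x] by blast

lemma act_add_right: "y \<in> sec m U j \<Longrightarrow> act m U \<alpha> (x + y) = act m U \<alpha> x + act m U \<alpha> y"
  using act_rules[OF U \<alpha> x] by blast

lemma act_assoc: "\<beta> \<in> polys U k \<Longrightarrow> act m U (\<beta> * \<alpha>) x = act m U \<beta> (act m U \<alpha> x)"
  using act_rules[OF U \<alpha> x] by blast

lemma act_res: "openin (base M) V \<Longrightarrow> V \<subseteq> U \<Longrightarrow> act m V (tres U V \<alpha>) (res m U V x) = res m U V (act m U \<alpha> x)"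
  using act_rules[OF U \<alpha> x] by blast

end

lemmas tensor_rules = tensor_product[unfolded tensor_product_def, THEN conjunct2, THEN conjunct1, THEN spec, THEN mp]

lemma balanced_tens: "openin (base M) U \<Longrightarrow> balanced M B G U (tens U)"
  using tensor_rules by blast

lemmas tens_balanced_rules = balanced_tens[unfolded balanced_def, THEN spec, THEN spec, THEN spec, THEN spec, THEN mp, OF _ conjI]

lemmas tens_rules = tensor_rules[THEN conjunct2, THEN spec, THEN spec, THEN spec, THEN spec, THEN spec, THEN mp, OF _ conjI]

context
  fixes U
  assumes U: "openin (base M) U"
begin

lemma tens_add_left: "\<alpha> \<in> polys U i \<Longrightarrow> \<beta> \<in> polys U i \<Longrightarrow> e \<in> sec G U j \<Longrightarrow> tens U (\<alpha> + \<beta>) e = tens U \<alpha> e + tens U \<beta> e"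
  using tens_balanced_rules[OF U, of \<alpha> i e j] by blast

lemma tens_add_right: "\<alpha> \<in> polys U i \<Longrightarrow> e \<in> sec G U j \<Longrightarrow> e' \<in> sec G U j \<Longrightarrow> tens U \<alpha> (e + e') = tens U \<alpha> e + tens U \<alpha> e'"
  using tens_balanced_rules[OF U, of \<alpha> i e j] by blast

lemma tens_scale_left: "\<alpha> \<in> polys U i \<Longrightarrow> e \<in> sec G U j \<Longrightarrow> tens U (c *\<^sub>R \<alpha>) e = c *\<^sub>R tens U \<alpha> e"
  using tens_balanced_rules[OF U, of \<alpha> i e j] by blast

lemma tens_scale_right: "\<alpha> \<in> polys U i \<Longrightarrow> e \<in> sec G U j \<Longrightarrow> tens U \<alpha> (c *\<^sub>R e) = c *\<^sub>R tens U \<alpha> e"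
  using tens_balanced_rules[OF U, of \<alpha> i e j] by blast

lemma tens_pull: "\<alpha> \<in> polys U i \<Longrightarrow> e \<in> sec G U j \<Longrightarrow> f \<in> sec M U k \<Longrightarrow> tens U (\<alpha> * pull B U f) e = tens U \<alpha> (act G U f e)"
  using tens_balanced_rules[OF U, of \<alpha> i e j] by blast

lemma tens_in: "\<alpha> \<in> polys U (k, p) \<Longrightarrow> e \<in> sec G U j \<Longrightarrow> tens U \<alpha> e \<in> sec m U (k + j, p)"
  using tens_rules[OF U, of \<alpha> k p e j] by blast

lemma act_tens: "\<alpha> \<in> polys U (k, p) \<Longrightarrow> e \<in> sec G U j \<Longrightarrow> \<beta> \<in> polys U i \<Longrightarrow> act m U \<beta> (tens U \<alpha> e) = tens U (\<beta> * \<alpha>) e"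
  using tens_rules[OF U, of \<alpha> k p e j] by blast

lemma tens_res: "\<alpha> \<in> polys U (k, p) \<Longrightarrow> e \<in> sec G U j \<Longrightarrow> openin (base M) V \<Longrightarrow> V \<subseteq> U \<Longrightarrow>
    res m U V (tens U \<alpha> e) = tens V (tres U V \<alpha>) (res G U V e)"
  using tens_rules[OF U, of \<alpha> k p e j] by (simp add: poly_simps)

lemma tens_0_left: "e \<in> sec G U j \<Longrightarrow> tens U 0 e = 0"
  using tens_scale_left[of 0 "(0,0)" e j 0] poly_0[OF U] by simp

lemma tens_0_right: "\<alpha> \<in> polys U i \<Longrightarrow> tens U \<alpha> 0 = 0"
  using tens_scale_right[of \<alpha> i 0 0 0] presheaf_0[OF pre_G U] by simp

lemma tens_diff_right: "\<alpha> \<in> polys U i \<Longrightarrow> e \<in> sec G U j \<Longrightarrow> e' \<in> sec G U j \<Longrightarrow> tens U \<alpha> (e - e') = tens U \<alpha> e - tens U \<alpha> e'"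
  using tens_add_right[of \<alpha> i e j "- e'"] tens_scale_right[of \<alpha> i e' j "-1"] presheaf_uminus[OF pre_G U] by simp

lemma tens_sum_left: "(\<And>r. r \<in> J \<Longrightarrow> \<alpha> r \<in> polys U (k, p)) \<Longrightarrow> e \<in> sec G U j \<Longrightarrow> tens U (\<Sum>r\<in>J. \<alpha> r) e = (\<Sum>r\<in>J. tens U (\<alpha> r) e)"
proof (induction J rule: infinite_finite_induct)
  case (insert r J)
  then show ?case by (simp add: tens_add_left[of _ "(k, p)" _ e j] subspace_sum[OF poly_subspace[OF U]])
qed (auto simp: tens_0_left)

lemma tens_sum_right: "\<alpha> \<in> polys U i \<Longrightarrow> (\<And>r. r \<in> J \<Longrightarrow> e r \<in> sec G U j) \<Longrightarrow> tens U \<alpha> (\<Sum>r\<in>J. e r) = (\<Sum>r\<in>J. tens U \<alpha> (e r))"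
proof (induction J rule: infinite_finite_induct)
  case (insert r J)
  then show ?case by (simp add: tens_add_right[of \<alpha> i _ j] presheaf_sum[OF pre_G U])
qed (auto simp: tens_0_right)

abbreviation (input) "one \<equiv> unity (tot B) (over B U)"

lemma incl_in: "e \<in> sec G U j \<Longrightarrow> tens U one e \<in> sec m U (j, 0)"
  using tens_in[OF unity_poly[OF U]] by simp

lemma incl_act: "e \<in> sec G U j \<Longrightarrow> \<alpha> \<in> polys U (k, p) \<Longrightarrow> act m U \<alpha> (tens U one e) = tens U \<alpha> e"
  using act_tens[OF unity_poly[OF U]] ring_unity_right[OF ring_tot over_open[OF U] poly_tot[OF U]] by simp

lemma incl_pull: "e \<in> sec G U j \<Longrightarrow> f \<in> sec M U k \<Longrightarrow> tens U (pull B U f) e = tens U one (act G U f e)"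
  using tens_pull[OF unity_poly[OF U]] ring_unity_left[OF ring_tot over_open[OF U] pull_in[OF U]] by simp

end

lemma incl_res: "openin (base M) U \<Longrightarrow> openin (base M) V \<Longrightarrow> V \<subseteq> U \<Longrightarrow> e \<in> sec G U j \<Longrightarrow>
    res m U V (tens U (unity (tot B) (over B U)) e) = tens V (unity (tot B) (over B V)) (res G U V e)"
  using tens_res[OF _ unity_poly] ring_unity_res[OF ring_tot over_open over_open over_mono] by simp

lemma generated:
  assumes "openin (base M) U" "x \<in> sec m U (k, p)" "y \<in> U"
  obtains V N \<alpha> e j where "openin (base M) V" "y \<in> V" "V \<subseteq> U"
    "\<And>r. r < (N::nat) \<Longrightarrow> \<alpha> r \<in> polys V (k - j r, p)" "\<And>r. r < N \<Longrightarrow> e r \<in> sec G V (j r)"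
    "res m U V x = (\<Sum>r<N. tens V (\<alpha> r) (e r))"
proof -
  have "\<exists>V N \<alpha> e. openin (base M) V \<and> y \<in> V \<and> V \<subseteq> U \<and>
          (\<forall>r<N. \<exists>j. \<alpha> r \<in> sec (polynomials M B) V (k - j, p) \<and> e r \<in> sec G V j) \<and>
          res m U V x = (\<Sum>r<(N::nat). tens V (\<alpha> r) (e r))"
    by (rule tensor_product[unfolded tensor_product_def, THEN conjunct2, THEN conjunct2, THEN conjunct1, THEN spec, THEN spec,
        THEN spec, THEN spec, THEN spec, THEN mp]) (use assms in blast)
  then obtain V N \<alpha> e where V: "openin (base M) V" "y \<in> V" "V \<subseteq> U"
    and r: "\<forall>r<N. \<exists>j. \<alpha> r \<in> polys V (k - j, p) \<and> e r \<in> sec G V j"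
    and x: "res m U V x = (\<Sum>r<(N::nat). tens V (\<alpha> r) (e r))"
    by (elim exE conjE) (rule that)
  define j where "j = (\<lambda>r. SOME j. \<alpha> r \<in> polys V (k - j, p) \<and> e r \<in> sec G V j)"
  have "\<alpha> r \<in> polys V (k - j r, p) \<and> e r \<in> sec G V (j r)" if "r < N" for r
    unfolding j_def by (rule someI_ex[OF r[rule_format, OF that]])
  then show ?thesis using that[OF V _ _ x] by blast
qed

text \<open>Locally every element is a sum of elementary tensors, and sheaf maps are additive.
  Identities between operators on m are reduced to elementary tensors in this way.\<close>

lemma tens_ext:
  assumes S: "sheaf_on (base M) S" and F: "sheaf_map m S U d F" and F': "sheaf_map m S U d F'" and U: "openin (base M) U"
    and eq: "\<And>V \<alpha> k p e j. openin (base M) V \<Longrightarrow> V \<subseteq> U \<Longrightarrow> \<alpha> \<in> polys V (k, p) \<Longrightarrow> e \<in> sec G V j \<Longrightarrow> F V (tens V \<alpha> e) = F' V (tens V \<alpha> e)"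
    and V: "openin (base M) V" "V \<subseteq> U" and x: "x \<in> sec m V i"
  shows "F V x = F' V x"
proof (rule graded_sheaf_map_eqI[OF pre_m S F F' U V x])
  fix y assume y: "y \<in> V"
  obtain k p where i: "i = (k, p)" by (cases i)
  obtain W N \<alpha> e j where W: "openin (base M) W" "y \<in> W" "W \<subseteq> V"
    and r: "\<And>r. r < (N::nat) \<Longrightarrow> \<alpha> r \<in> polys W (k - j r, p)" "\<And>r. r < N \<Longrightarrow> e r \<in> sec G W (j r)"
    "res m V W x = (\<Sum>r<N. tens W (\<alpha> r) (e r))"
    by (rule generated[OF V(1) x[unfolded i] y]) (rule that)
  have WU: "W \<subseteq> U" using W V by blast
  have t: "tens W (\<alpha> r) (e r) \<in> sec m W (k, p)" if "r \<in> {..<N}" for r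
    using tens_in[OF W(1) r(1,2)] that by fastforce
  have "F W (\<Sum>r<N. tens W (\<alpha> r) (e r)) = (\<Sum>r<N. F W (tens W (\<alpha> r) (e r)))"
    by (rule sheaf_map_sum[OF pre_m F W(1) WU]) (rule t)
  moreover have "F' W (\<Sum>r<N. tens W (\<alpha> r) (e r)) = (\<Sum>r<N. F' W (tens W (\<alpha> r) (e r)))"
    by (rule sheaf_map_sum[OF pre_m F' W(1) WU]) (rule t)
  moreover have "F W (tens W (\<alpha> r) (e r)) = F' W (tens W (\<alpha> r) (e r))" if "r < N" for r
    using eq[OF W(1) WU r(1,2)[OF that]] .
  ultimately have "F W (res m V W x) = F' W (res m V W x)" unfolding r(3) by simp
  then show "\<exists>W. openin (base M) W \<and> y \<in> W \<and> W \<subseteq> V \<and> F W (res m V W x) = F' W (res m V W x)"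
    using W by blast
qed

lemma act_map:
  assumes U: "openin (base M) U" and \<alpha>: "\<alpha> \<in> polys U (k, p)"
  shows "sheaf_map m m U (k, p) (\<lambda>V. act m V (tres U V \<alpha>))"
proof (rule sheaf_mapI[OF presheaf_base[OF pre_m]], goal_cases)
  case (1 V i x)
  show ?case using act_in[OF 1(1) poly_res_in[OF U 1(1,2) \<alpha>] 1(3)] by (simp add: add.commute)
next
  case (2 V i x c)
  show ?case using act_scale_right[OF 2(1) poly_res_in[OF U 2(1,2) \<alpha>] 2(3)] .
next
  case (3 V i x y)
  show ?case using act_add_right[OF 3(1) poly_res_in[OF U 3(1,2) \<alpha>] 3(3,4)] .
next
  case (4 V W i x)
  show ?case using act_res[OF 4(1) poly_res_in[OF U 4(1,2) \<alpha>] 4(5,3,4)] tot_res_res[OF U 4(1,3,4,2) poly_tot[OF U \<alpha>]] by simp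
qed

end

locale framed_tensor = tensor_module M B G m tens + F: frame_on M G U I d g
  for M :: "('p, int, 'f::real_algebra) gring" and B :: "('p, 'f, 'q, 'g::real_algebra) vbundle"
    and G :: "('p, int, 'f, 'e::real_vector) gmod" and m :: "('p, int \<times> int, 'g, 'm::real_vector) gmod"
    and tens :: "'p set \<Rightarrow> 'g \<Rightarrow> 'e \<Rightarrow> 'm" and U and I :: "'i set" and d g
begin

text \<open>The coordinates of each factor in G stand to the left of the basis, so they pass to the
  polynomial factor by balancedness without a sign.\<close>

lemma tens_expand:
  assumes U': "openin (base M) U'" "U' \<subseteq> U" and x: "x \<in> sec m U' (k, p)" and y: "y \<in> U'"
  obtains V \<beta> where "openin (base M) V" "y \<in> V" "V \<subseteq> U'" "\<And>i. i \<in> I \<Longrightarrow> \<beta> i \<in> polys V (k - d i, p)"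
    "res m U' V x = (\<Sum>i\<in>I. tens V (\<beta> i) (F.basis V i))"
proof -
  obtain V N \<alpha> e j where V: "openin (base M) V" "y \<in> V" "V \<subseteq> U'"
    and r: "\<And>r. r < (N::nat) \<Longrightarrow> \<alpha> r \<in> polys V (k - j r, p)" "\<And>r. r < N \<Longrightarrow> e r \<in> sec G V (j r)"
    "res m U' V x = (\<Sum>r<N. tens V (\<alpha> r) (e r))"
    by (rule generated[OF U'(1) x y]) (rule that)
  have VU: "V \<subseteq> U" using V U' by blast
  note VV = V(1) VU
  define c where "c = (\<lambda>r. F.coord V (e r))"
  have c: "c r i \<in> sec M V (j r - d i)" if "r < N" "i \<in> I" for r i
    unfolding c_def by (rule F.coord_in[OF VV r(2)[OF that(1)] that(2)])
  have ac: "\<alpha> r * pull B V (c r i) \<in> polys V (k - d i, p)" if "r < N" "i \<in> I" for r i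
    using poly_mult[OF V(1) r(1)[OF that(1)] pull_poly[OF V(1) c[OF that]]] by simp
  define \<beta> where "\<beta> = (\<lambda>i. \<Sum>r<N. \<alpha> r * pull B V (c r i))"
  have "tens V (\<alpha> r) (e r) = (\<Sum>i\<in>I. tens V (\<alpha> r * pull B V (c r i)) (F.basis V i))" if "r < N" for r
  proof -
    have "tens V (\<alpha> r) (e r) = tens V (\<alpha> r) (\<Sum>i\<in>I. act G V (c r i) (F.basis V i))"
      unfolding c_def F.coord_sum[OF VV r(2)[OF that]] ..
    also have "\<dots> = (\<Sum>i\<in>I. tens V (\<alpha> r) (act G V (c r i) (F.basis V i)))"
      by (rule tens_sum_right[OF V(1) r(1)[OF that] F.term_in[OF VV _ c[OF that]]])
    also have "\<dots> = (\<Sum>i\<in>I. tens V (\<alpha> r * pull B V (c r i)) (F.basis V i))"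
      by (rule sum.cong[OF refl]) (simp add: tens_pull[OF V(1) r(1)[OF that] F.basis_in[OF VV] c[OF that]])
    finally show ?thesis .
  qed
  then have "res m U' V x = (\<Sum>r<N. \<Sum>i\<in>I. tens V (\<alpha> r * pull B V (c r i)) (F.basis V i))"
    unfolding r(3) by simp
  also have "\<dots> = (\<Sum>i\<in>I. \<Sum>r<N. tens V (\<alpha> r * pull B V (c r i)) (F.basis V i))"
    by (rule sum.swap)
  also have "\<dots> = (\<Sum>i\<in>I. tens V (\<beta> i) (F.basis V i))"
  proof (rule sum.cong[OF refl])
    fix i assume i: "i \<in> I"
    show "(\<Sum>r<N. tens V (\<alpha> r * pull B V (c r i)) (F.basis V i)) = tens V (\<beta> i) (F.basis V i)"
      unfolding \<beta>_def by (rule tens_sum_left[OF V(1) _ F.basis_in[OF VV i], symmetric]) (use ac[OF _ i] in auto)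
  qed
  finally have "res m U' V x = (\<Sum>i\<in>I. tens V (\<beta> i) (F.basis V i))" .
  moreover have "\<beta> i \<in> polys V (k - d i, p)" if "i \<in> I" for i
    unfolding \<beta>_def using ac that by (intro subspace_sum[OF poly_subspace[OF V(1)]]) auto
  ultimately show ?thesis using that V by blast
qed

text \<open>The map \<alpha> (x) e |-> \<alpha> e_i extracts the i-th coefficient; the arbitrary
  functional l only makes it real-valued, as \<open>tensor_product\<close> requires.\<close>

lemma balanced_coord:
  fixes l :: "'g \<Rightarrow> real"
  assumes V: "openin (base M) V" "V \<subseteq> U" and i: "i \<in> I" and l: "linear l"
  shows "balanced M B G V (\<lambda>\<alpha> e. l (\<alpha> * pull B V (F.coord V e i)))"
  unfolding balanced_def
proof (intro allI impI, elim conjE, intro conjI ballI allI)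
  fix h \<alpha> j e assume \<alpha>: "\<alpha> \<in> polys V h" and e: "e \<in> sec G V j"
  note c = F.coord_in[OF V e i]
  note lin = linear_add[OF l] linear_scale[OF l]
  show "l ((\<alpha> + \<beta>) * pull B V (F.coord V e i)) = l (\<alpha> * pull B V (F.coord V e i)) + l (\<beta> * pull B V (F.coord V e i))" for \<beta>
    by (simp add: lin ring_distribs)
  show "l (\<alpha> * pull B V (F.coord V (e + e') i)) = l (\<alpha> * pull B V (F.coord V e i)) + l (\<alpha> * pull B V (F.coord V e' i))"
    if "e' \<in> sec G V j" for e'
    using F.coord_in[OF V that i] by (simp add: F.coord_add[OF V e that i] pull_add[OF V(1) c] ring_distribs lin)
  show "l (r *\<^sub>R \<alpha> * pull B V (F.coord V e i)) = r *\<^sub>R l (\<alpha> * pull B V (F.coord V e i))" for r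
    by (simp add: lin)
  show "l (\<alpha> * pull B V (F.coord V (r *\<^sub>R e) i)) = r *\<^sub>R l (\<alpha> * pull B V (F.coord V e i))" for r
    by (simp add: lin F.coord_scale[OF V e i] pull_scale[OF V(1) c])
  show "l (\<alpha> * pull B V f * pull B V (F.coord V e i)) = l (\<alpha> * pull B V (F.coord V (act G V f e) i))"
    if "f \<in> sec M V k" for k f
    by (simp add: F.coord_act[OF V e that i] pull_mult[OF V(1) that c] mult.assoc)
qed

text \<open>The maps of \<open>balanced_coord\<close> send the relation to
  \<open>l (\<beta> i)\<close> near each point, for every functional l, and functionals
  separate.\<close>

lemma tens_independent:
  assumes V: "openin (base M) V" "V \<subseteq> U" and \<beta>: "\<And>i. i \<in> I \<Longrightarrow> \<beta> i \<in> polys V (k - d i, p)"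
    and 0: "(\<Sum>i\<in>I. tens V (\<beta> i) (F.basis V i)) = 0" and i: "i \<in> I"
  shows "\<beta> i = 0"
proof (rule tot_eqI[OF V(1) poly_tot[OF V(1) \<beta>[OF i]] tot_0[OF V(1)]])
  fix y assume y: "y \<in> V"
  \<comment> \<open>The relations in \<open>tensor_product\<close> are indexed by initial segments
    of the naturals, so I is enumerated.\<close>
  obtain h where h: "bij_betw h {..<card I} I"
    using ex_bij_betw_nat_finite[OF F.finite_index] by (metis atLeast0LessThan)
  have hI: "h r \<in> I" if "r < card I" for r using h that by (auto simp: bij_betw_def)
  have sumh: "(\<Sum>r<card I. q (h r)) = (\<Sum>i\<in>I. q i)" for q :: "'i \<Rightarrow> 'z::comm_monoid_add"
    using sum.reindex_bij_betw[OF h] .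
  have "\<exists>W. openin (base M) W \<and> y \<in> W \<and> W \<subseteq> V \<and>
          (\<forall>b::'g \<Rightarrow> 'e \<Rightarrow> real. balanced M B G W b \<longrightarrow>
             (\<Sum>r<card I. b (res (polynomials M B) V W (\<beta> (h r))) (res G V W (F.basis V (h r)))) = 0)"
  proof (rule tensor_product[unfolded tensor_product_def, THEN conjunct2, THEN conjunct2, THEN conjunct2, THEN spec, THEN spec,
        THEN spec, THEN spec, THEN spec, THEN mp], intro conjI)
    show "\<forall>r<card I. \<exists>i j. \<beta> (h r) \<in> polys V i \<and> F.basis V (h r) \<in> sec G V j"
      using \<beta>[OF hI] F.basis_in[OF V hI] by blast
    show "(\<Sum>r<card I. tens V (\<beta> (h r)) (F.basis V (h r))) = 0"
      using sumh[of "\<lambda>i. tens V (\<beta> i) (F.basis V i)"] 0 by simp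
  qed (use V y in auto)
  then obtain W where W: "openin (base M) W" "y \<in> W" "W \<subseteq> V"
    and b: "\<And>b::'g \<Rightarrow> 'e \<Rightarrow> real. balanced M B G W b \<Longrightarrow> (\<Sum>r<card I. b (tres V W (\<beta> (h r))) (res G V W (F.basis V (h r)))) = 0"
    unfolding poly_simps by blast
  have WU: "W \<subseteq> U" using W V by blast
  have bas: "res G V W (F.basis V j) = F.basis W j" if "j \<in> I" for j
    using presheaf_res_res[OF pre_G F.open_base V(1) W(1,3) V(2) F.frame_in[OF that]] .
  have rb: "tres V W (\<beta> j) \<in> tsec W (k - d j + p)" if "j \<in> I" for j
    using poly_tot[OF W(1) poly_res_in[OF V(1) W(1,3) \<beta>[OF that]]] .
  have "tres V W (\<beta> i) = 0"
  proof (rule linear_functional_separates)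
    fix l :: "'g \<Rightarrow> real" assume l: "linear l"
    have "0 = (\<Sum>r<card I. l (tres V W (\<beta> (h r)) * pull B W (F.coord W (res G V W (F.basis V (h r))) i)))"
      using b[OF balanced_coord[OF W(1) WU i l]] by simp
    also have "\<dots> = (\<Sum>j\<in>I. l (tres V W (\<beta> j) * pull B W (F.coord W (res G V W (F.basis V j)) i)))"
      using sumh[of "\<lambda>j. l (tres V W (\<beta> j) * pull B W (F.coord W (res G V W (F.basis V j)) i))"] .
    also have "\<dots> = (\<Sum>j\<in>I. l (tres V W (\<beta> j) * pull B W (if i = j then unity M W else 0)))"
      by (intro sum.cong refl) (simp add: bas F.coord_basis[OF W(1) WU i])
    also have "\<dots> = l (tres V W (\<beta> i) * pull B W (unity M W))"
      by (subst sum_delta_eq[OF F.finite_index i]) (auto simp: pull_0[OF W(1)] linear_0[OF l])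
    also have "\<dots> = l (tres V W (\<beta> i))"
      using ring_unity_right[OF ring_tot over_open[OF W(1)] rb[OF i]] by (simp add: pull_unity[OF W(1)])
    finally show "l (tres V W (\<beta> i)) = 0" by simp
  qed
  then show "\<exists>W. openin (base M) W \<and> y \<in> W \<and> W \<subseteq> V \<and> tres V W (\<beta> i) = tres V W 0"
    using W tot_res_0[OF V(1) W(1,3)] by auto
qed

end

section \<open>Sections of dg vector bundles\<close>

locale dg_bundle = vector_bundle M B
  for M :: "('p, int, 'f::real_algebra) gring" and B :: "('p, 'f, 'q, 'g::real_algebra) vbundle" +
  fixes QM :: "'p set \<Rightarrow> 'f \<Rightarrow> 'f" and Q :: "'q set \<Rightarrow> 'g \<Rightarrow> 'g"
  assumes homological_base: "homological M QM" and dg_vector_bundle: "dg_vector_bundle M QM B Q"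
begin

abbreviation "secs \<equiv> hom_sec M (lin_mod M B) (fun_mod M)"
abbreviation "QS \<equiv> section_field M QM B Q"

lemma QM_derivation: "derivation M (topspace (base M)) 1 QM"
  and QM_QM: "openin (base M) U \<Longrightarrow> f \<in> sec M U i \<Longrightarrow> QM U (QM U f) = 0"
  using homological_base unfolding homological_def by auto

lemma Q_derivation: "derivation (tot B) (topspace (base (tot B))) 1 Q"
  and Q_Q: "openin (base (tot B)) W \<Longrightarrow> f \<in> sec (tot B) W i \<Longrightarrow> Q W (Q W f) = 0"
  using dg_vector_bundle unfolding dg_vector_bundle_def homological_def by auto

lemma Q_lin: "openin (base M) U \<Longrightarrow> \<epsilon> \<in> lin B U k \<Longrightarrow> Q (over B U) \<epsilon> \<in> lin B U (k + 1)"
  using dg_vector_bundle unfolding dg_vector_bundle_def by auto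

lemma Q_pull: "openin (base M) U \<Longrightarrow> f \<in> sec M U k \<Longrightarrow> Q (over B U) (pull B U f) = pull B U (QM U f)"
  using dg_vector_bundle unfolding dg_vector_bundle_def projects_to_def by auto

lemmas QM_map = derivation_map[OF QM_derivation] and Q_map = derivation_map[OF Q_derivation]

context
  fixes U
  assumes U: "openin (base M) U"
begin

lemmas U' = openin_subset[OF U] and oU = over_open[OF U] and oU' = openin_subset[OF over_open[OF U]]

lemma QM_in: "f \<in> sec M U k \<Longrightarrow> QM U f \<in> sec M U (k + 1)"
  using sheaf_map_in[OF pre_ring QM_map U U'] .

lemma QM_add: "f \<in> sec M U k \<Longrightarrow> g \<in> sec M U k \<Longrightarrow> QM U (f + g) = QM U f + QM U g"
  using sheaf_map_add[OF pre_ring QM_map U U'] .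

lemma QM_diff: "f \<in> sec M U k \<Longrightarrow> g \<in> sec M U k \<Longrightarrow> QM U (f - g) = QM U f - QM U g"
  using sheaf_map_minus[OF pre_ring QM_map U U'] .

lemma QM_scale: "f \<in> sec M U k \<Longrightarrow> QM U (c *\<^sub>R f) = c *\<^sub>R QM U f"
  using sheaf_map_scale[OF pre_ring QM_map U U'] .

lemma QM_mult: "f \<in> sec M U k \<Longrightarrow> g \<in> sec M U l \<Longrightarrow> QM U (f * g) = QM U f * g + ksign k *\<^sub>R (f * QM U g)"
  using derivation_mult[OF QM_derivation U U'] by simp

lemma QM_res: "openin (base M) V \<Longrightarrow> V \<subseteq> U \<Longrightarrow> f \<in> sec M U k \<Longrightarrow> QM V (res M U V f) = res M U V (QM U f)"
  using sheaf_map_res[OF pre_ring QM_map U U'] .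

lemma QM_unity: "QM U (unity M U) = 0"
proof -
  have u: "unity M U \<in> sec M U 0" by (rule ring_unity_in[OF ring U])
  have "QM U (unity M U * unity M U) = QM U (unity M U) * unity M U + unity M U * QM U (unity M U)"
    using QM_mult[OF u u] by simp
  then show ?thesis
    using ring_unity_left[OF ring U u] ring_unity_left[OF ring U QM_in[OF u]] ring_unity_right[OF ring U QM_in[OF u]] by simp
qed

lemma Q_add: "a \<in> lin B U k \<Longrightarrow> b \<in> lin B U k \<Longrightarrow> Q (over B U) (a + b) = Q (over B U) a + Q (over B U) b"
  using sheaf_map_add[OF presheaf_tot Q_map oU oU' lin_tot[OF U] lin_tot[OF U]] .

lemma Q_scale: "a \<in> lin B U k \<Longrightarrow> Q (over B U) (c *\<^sub>R a) = c *\<^sub>R Q (over B U) a"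
  using sheaf_map_scale[OF presheaf_tot Q_map oU oU' lin_tot[OF U]] .

lemma Q_act: "f \<in> sec M U i \<Longrightarrow> a \<in> lin B U k \<Longrightarrow>
    Q (over B U) (pull B U f * a) = pull B U (QM U f) * a + ksign i *\<^sub>R (pull B U f * Q (over B U) a)"
  using derivation_mult[OF Q_derivation oU oU' pull_in[OF U] lin_tot[OF U]] Q_pull[OF U] by simp

lemma Q_res: "openin (base M) V \<Longrightarrow> V \<subseteq> U \<Longrightarrow> a \<in> lin B U k \<Longrightarrow> Q (over B V) (tres U V a) = tres U V (Q (over B U) a)"
  using sheaf_map_res[OF presheaf_tot Q_map oU oU' over_open over_mono lin_tot[OF U]] .

end

lemmas pre_lin = sheaf_on_presheaf[OF sheaf_lin]
lemmas module_secs = module_hom_mod[OF ring module_lin module_fun_mod[OF ring]]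

section \<open>The differential induced on sections\<close>

context
  fixes U \<sigma> k
  assumes U: "openin (base M) U" and \<sigma>: "\<sigma> \<in> secs U k"
begin

lemmas \<sigma>_map = hom_sec_map[OF \<sigma>]

lemma section_in: "openin (base M) V \<Longrightarrow> V \<subseteq> U \<Longrightarrow> \<epsilon> \<in> lin B V l \<Longrightarrow> \<sigma> V \<epsilon> \<in> sec M V (l + k)"
  using sheaf_map_in[OF pre_lin \<sigma>_map] by simp

lemma section_add: "openin (base M) V \<Longrightarrow> V \<subseteq> U \<Longrightarrow> \<epsilon> \<in> lin B V l \<Longrightarrow> \<delta> \<in> lin B V l \<Longrightarrow> \<sigma> V (\<epsilon> + \<delta>) = \<sigma> V \<epsilon> + \<sigma> V \<delta>"
  using sheaf_map_add[OF pre_lin \<sigma>_map] by simp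

lemma section_scale: "openin (base M) V \<Longrightarrow> V \<subseteq> U \<Longrightarrow> \<epsilon> \<in> lin B V l \<Longrightarrow> \<sigma> V (c *\<^sub>R \<epsilon>) = c *\<^sub>R \<sigma> V \<epsilon>"
  using sheaf_map_scale[OF pre_lin \<sigma>_map] by simp

lemma section_res: "openin (base M) V \<Longrightarrow> V \<subseteq> U \<Longrightarrow> openin (base M) W \<Longrightarrow> W \<subseteq> V \<Longrightarrow> \<epsilon> \<in> lin B V l \<Longrightarrow>
    \<sigma> W (tres V W \<epsilon>) = res M V W (\<sigma> V \<epsilon>)"
  using sheaf_map_res[OF pre_lin \<sigma>_map] by simp

lemma section_act: "openin (base M) V \<Longrightarrow> V \<subseteq> U \<Longrightarrow> f \<in> sec M V i \<Longrightarrow> \<epsilon> \<in> lin B V l \<Longrightarrow>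
    \<sigma> V (pull B V f * \<epsilon>) = ksign (k * i) *\<^sub>R (f * \<sigma> V \<epsilon>)"
  using hom_sec_act[OF \<sigma>] by simp

text \<open>The sign in \<open>section_field\<close> refers to \<open>hdeg\<close>, which may be
  replaced by the known degree k; for \<sigma> = 0 the term it multiplies vanishes.\<close>

lemma section_field_eq: "QS U \<sigma> = hom_ext (lin_mod M B) U (\<lambda>V \<epsilon>. QM V (\<sigma> V \<epsilon>) - ksign k *\<^sub>R \<sigma> V (Q (over B V) \<epsilon>))"
proof -
  have "ksign (hdeg (sections M B) U \<sigma>) *\<^sub>R \<sigma> = ksign k *\<^sub>R \<sigma>"
    using ksign_hdeg[OF module_presheaf[OF module_secs] U, of \<sigma> k ksign] \<sigma> by simp
  then have "ksign (hdeg (sections M B) U \<sigma>) *\<^sub>R \<sigma> V \<epsilon> = ksign k *\<^sub>R \<sigma> V \<epsilon>" for V \<epsilon>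
    by (metis scaleR_fun_apply)
  then show ?thesis unfolding section_field_def by (simp only:)
qed

lemma section_field_apply: "openin (base M) V \<Longrightarrow> V \<subseteq> U \<Longrightarrow> \<epsilon> \<in> lin B V l \<Longrightarrow>
    QS U \<sigma> V \<epsilon> = QM V (\<sigma> V \<epsilon>) - ksign k *\<^sub>R \<sigma> V (Q (over B V) \<epsilon>)"
  unfolding section_field_eq by (subst hom_ext_apply[where i = l]) auto

lemma section_field_in: "QS U \<sigma> \<in> secs U (k + 1)"
  unfolding section_field_eq
proof (rule hom_ext_in_hom_sec[OF module_lin])
  show "sheaf_map (lin_mod M B) (fun_mod M) U (k + 1) (\<lambda>V \<epsilon>. QM V (\<sigma> V \<epsilon>) - ksign k *\<^sub>R \<sigma> V (Q (over B V) \<epsilon>))"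
  proof (rule sheaf_mapI[OF presheaf_base[OF pre_lin]], goal_cases)
    case (1 V i \<epsilon>)
    then have e: "\<epsilon> \<in> lin B V i" by simp
    show ?case
      using presheaf_diff[OF pre_ring 1(1) QM_in[OF 1(1) section_in[OF 1(1,2) e]]
          presheaf_scale[OF pre_ring 1(1), of "\<sigma> V (Q (over B V) \<epsilon>)" "i + k + 1" "ksign k"]] section_in[OF 1(1,2) Q_lin[OF 1(1) e]]
      by (simp add: algebra_simps)
  next
    case (2 V i \<epsilon> c)
    then have e: "\<epsilon> \<in> lin B V i" by simp
    show ?case
      by (simp add: section_scale[OF 2(1,2) e] QM_scale[OF 2(1) section_in[OF 2(1,2) e]] Q_scale[OF 2(1) e]
          section_scale[OF 2(1,2) Q_lin[OF 2(1) e]] scaleR_diff_right)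
  next
    case (3 V i \<epsilon> \<delta>)
    then have e: "\<epsilon> \<in> lin B V i" "\<delta> \<in> lin B V i" by simp_all
    show ?case
      by (simp add: section_add[OF 3(1,2) e] QM_add[OF 3(1) section_in[OF 3(1,2) e(1)] section_in[OF 3(1,2) e(2)]] Q_add[OF 3(1) e]
          section_add[OF 3(1,2) Q_lin[OF 3(1) e(1)] Q_lin[OF 3(1) e(2)]] scaleR_add_right)
  next
    case (4 V W i \<epsilon>)
    then have e: "\<epsilon> \<in> lin B V i" by simp
    have a: "QM V (\<sigma> V \<epsilon>) \<in> sec M V (i + k + 1)" "\<sigma> V (Q (over B V) \<epsilon>) \<in> sec M V (i + k + 1)"
      using QM_in[OF 4(1) section_in[OF 4(1,2) e]] section_in[OF 4(1,2) Q_lin[OF 4(1) e]] by (simp_all add: algebra_simps)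
    show ?case
      using presheaf_res_diff[OF pre_ring 4(1,3,4) a(1) presheaf_scale[OF pre_ring 4(1) a(2), of "ksign k"]]
       presheaf_res_scale[OF pre_ring 4(1,3,4) a(2)]
      by (simp add: section_res[OF 4(1-4) e] QM_res[OF 4(1,3,4) section_in[OF 4(1,2) e]] Q_res[OF 4(1,3,4) e]
         section_res[OF 4(1-4) Q_lin[OF 4(1) e]])
  qed
  fix V i f j \<epsilon> assume V: "openin (base M) V" "V \<subseteq> U" and f: "f \<in> sec M V i" and "\<epsilon> \<in> sec (lin_mod M B) V j"
  then have e: "\<epsilon> \<in> lin B V j" by simp
  have Qe: "Q (over B V) \<epsilon> \<in> lin B V (j + 1)" by (rule Q_lin[OF V(1) e])
  have 1: "QM V (\<sigma> V (pull B V f * \<epsilon>)) = ksign (k * i) *\<^sub>R (QM V f * \<sigma> V \<epsilon> + ksign i *\<^sub>R (f * QM V (\<sigma> V \<epsilon>)))"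
    using QM_scale[OF V(1) ring_mult_in[OF ring V(1) f section_in[OF V e]]] QM_mult[OF V(1) f section_in[OF V e]]
    by (simp add: section_act[OF V f e])
  have l1: "pull B V (QM V f) * \<epsilon> \<in> lin B V (i + j + 1)" "pull B V f * Q (over B V) \<epsilon> \<in> lin B V (i + j + 1)"
    using lin_pull[OF V(1) QM_in[OF V(1) f] e] lin_pull[OF V(1) f Qe] by (simp_all add: algebra_simps)
  have l2: "ksign i *\<^sub>R (pull B V f * Q (over B V) \<epsilon>) \<in> lin B V (i + j + 1)"
    using presheaf_scale[OF pre_lin V(1), of _ "i + j + 1"] l1(2) by simp
  have 2: "\<sigma> V (Q (over B V) (pull B V f * \<epsilon>)) =
      ksign (k * (i + 1)) *\<^sub>R (QM V f * \<sigma> V \<epsilon>) + ksign i *\<^sub>R ksign (k * i) *\<^sub>R (f * \<sigma> V (Q (over B V) \<epsilon>))"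
    using section_add[OF V l1(1) l2] section_scale[OF V l1(2)] section_act[OF V QM_in[OF V(1) f] e] section_act[OF V f Qe]
    by (simp add: Q_act[OF V(1) f e])
  \<comment> \<open>Both parts of the differential produce
    \<open>QM V f * \<sigma> V \<epsilon>\<close> with the sign (-1)^(ki), and these terms cancel;
    the rest is linear with the sign of degree k + 1.\<close>
  show "QM V (\<sigma> V (act (lin_mod M B) V f \<epsilon>)) - ksign k *\<^sub>R \<sigma> V (Q (over B V) (act (lin_mod M B) V f \<epsilon>)) =
      ksign ((k + 1) * i) *\<^sub>R act (fun_mod M) V f (QM V (\<sigma> V \<epsilon>) - ksign k *\<^sub>R \<sigma> V (Q (over B V) \<epsilon>))"
    by (simp add: 1 2 ring_distribs ksign_add algebra_simps)
qed

lemma section_field_res: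
  assumes V: "openin (base M) V" "V \<subseteq> U"
  shows "QS V (hom_ext (lin_mod M B) V \<sigma>) = hom_ext (lin_mod M B) V (QS U \<sigma>)"
proof -
  have r: "hom_ext (lin_mod M B) V \<sigma> \<in> secs V k"
    using presheaf_res_in[OF module_presheaf[OF module_secs] U V, of \<sigma> k] \<sigma> by simp
  show ?thesis
    unfolding section_field_eq
    unfolding dg_bundle.section_field_eq[OF dg_bundle_axioms V(1) r] hom_ext_hom_ext[OF V(2)]
  proof (rule hom_ext_eqI)
    fix W i \<epsilon> assume *: "openin (base (lin_mod M B)) W" "W \<subseteq> V" "\<epsilon> \<in> sec (lin_mod M B) W i"
    then have "Q (over B W) \<epsilon> \<in> sec (lin_mod M B) W (i + 1)" using Q_lin by simp
    with * show "QM W (hom_ext (lin_mod M B) V \<sigma> W \<epsilon>) - ksign k *\<^sub>R hom_ext (lin_mod M B) V \<sigma> W (Q (over B W) \<epsilon>) =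
       QM W (\<sigma> W \<epsilon>) - ksign k *\<^sub>R \<sigma> W (Q (over B W) \<epsilon>)"
      by (subst (1 2) hom_ext_apply) auto
  qed
qed

end

lemma section_eqI:
  assumes "\<sigma> \<in> secs U k" "\<tau> \<in> secs U k'"
    and "\<And>V \<epsilon> l. openin (base M) V \<Longrightarrow> V \<subseteq> U \<Longrightarrow> \<epsilon> \<in> lin B V l \<Longrightarrow> \<sigma> V \<epsilon> = \<tau> V \<epsilon>"
  shows "\<sigma> = \<tau>"
  using assms(3) by (intro hom_sec_eqI[OF assms(1,2)]) simp

lemma section_act_apply: "openin (base M) V \<Longrightarrow> V \<subseteq> U \<Longrightarrow> \<epsilon> \<in> lin B V l \<Longrightarrow>
    act (sections M B) U f \<sigma> V \<epsilon> = res M U V f * \<sigma> V \<epsilon>"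
  by (simp add: hom_ext_apply[where i = l])

lemma section_act_in: "openin (base M) U \<Longrightarrow> f \<in> sec M U i \<Longrightarrow> \<sigma> \<in> secs U k \<Longrightarrow> act (sections M B) U f \<sigma> \<in> secs U (i + k)"
  using module_act_in[OF module_secs] by simp

lemma section_field_lincomb:
  assumes U: "openin (base M) U" and \<sigma>: "\<sigma> \<in> secs U k" "\<tau> \<in> secs U k"
  shows "QS U (a *\<^sub>R \<sigma> + b *\<^sub>R \<tau>) = a *\<^sub>R QS U \<sigma> + b *\<^sub>R QS U \<tau>"
proof -
  have s: "a *\<^sub>R \<sigma> + b *\<^sub>R \<tau> \<in> secs U k"
    using presheaf_add[OF module_presheaf[OF module_secs] U presheaf_scale[OF module_presheaf[OF module_secs] U] presheaf_scale[OF module_presheaf[OF module_secs] U]] \<sigma> by simp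
  have t: "a *\<^sub>R QS U \<sigma> + b *\<^sub>R QS U \<tau> \<in> secs U (k + 1)"
    using presheaf_add[OF module_presheaf[OF module_secs] U presheaf_scale[OF module_presheaf[OF module_secs] U] presheaf_scale[OF module_presheaf[OF module_secs] U]] 
      section_field_in[OF U \<sigma>(1)] section_field_in[OF U \<sigma>(2)] by simp
  show ?thesis
  proof (rule section_eqI[OF section_field_in[OF U s] t])
    fix V \<epsilon> l assume V: "openin (base M) V" "V \<subseteq> U" and e: "\<epsilon> \<in> lin B V l"
    note i = section_in[OF U \<sigma>(1) V e] section_in[OF U \<sigma>(2) V e]
    show "QS U (a *\<^sub>R \<sigma> + b *\<^sub>R \<tau>) V \<epsilon> = (a *\<^sub>R QS U \<sigma> + b *\<^sub>R QS U \<tau>) V \<epsilon>"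
      using QM_add[OF V(1) presheaf_scale[OF pre_ring V(1) i(1), of a] presheaf_scale[OF pre_ring V(1) i(2), of b]]
        QM_scale[OF V(1) i(1)] QM_scale[OF V(1) i(2)]
      by (simp add: section_field_apply[OF U s V e] section_field_apply[OF U \<sigma>(1) V e] section_field_apply[OF U \<sigma>(2) V e] algebra_simps)
  qed
qed

text \<open>The squares of \<open>QM\<close> and \<open>Q\<close> vanish, and the two mixed terms
  have opposite signs because the differential raises the degree by one.\<close>

lemma section_field_square:
  assumes U: "openin (base M) U" and \<sigma>: "\<sigma> \<in> secs U k"
  shows "QS U (QS U \<sigma>) = 0"
proof -
  note s = section_field_in[OF U \<sigma>]
  have "0 \<in> secs U k" using presheaf_0[OF module_presheaf[OF module_secs] U] by simp
  then show ?thesis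
  proof (rule section_eqI[OF section_field_in[OF U s]])
    fix V \<epsilon> l assume V: "openin (base M) V" "V \<subseteq> U" and e: "\<epsilon> \<in> lin B V l"
    note Qe = Q_lin[OF V(1) e]
    note i = QM_in[OF V(1) section_in[OF U \<sigma> V e]] 
    have j: "\<sigma> V (Q (over B V) \<epsilon>) \<in> sec M V (l + k + 1)" using section_in[OF U \<sigma> V Qe] by (simp add: algebra_simps)
    have z: "Q (over B V) (Q (over B V) \<epsilon>) = 0" "\<sigma> V 0 = 0"
      using Q_Q[OF over_open[OF V(1)] lin_tot[OF V(1) e]] section_scale[OF U \<sigma> V e, of 0] by auto
    show "QS U (QS U \<sigma>) V \<epsilon> = 0 V \<epsilon>"
      using QM_diff[OF V(1) i presheaf_scale[OF pre_ring V(1) j, of "ksign k"]] QM_scale[OF V(1) j]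
        QM_QM[OF V(1) section_in[OF U \<sigma> V e]]
      by (simp add: section_field_apply[OF U s V e] section_field_apply[OF U \<sigma> V e] section_field_apply[OF U \<sigma> V Qe] z ksign_add)
  qed
qed

end

section \<open>The differential and the contractions of the module of forms\<close>

text \<open>From here on restriction and action of Hom modules are used through the module rules;
  unfolding them would destroy the terms that these rules match.\<close>

declare hom_mod_simps(3,4) [simp del]

lemma (in dg_bundle) section_field_res':
  "openin (base M) U \<Longrightarrow> \<sigma> \<in> secs U k \<Longrightarrow> openin (base M) V \<Longrightarrow> V \<subseteq> U \<Longrightarrow>
   QS V (res (sections M B) U V \<sigma>) = res (sections M B) U V (QS U \<sigma>)"
  using section_field_res by (simp add: hom_mod_simps)

lemma sheaf_map_zero:
  assumes S: "presheaf_on T S" and S': "presheaf_on T S'"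
  shows "sheaf_map S S' U d (\<lambda>V x. 0)"
  by (rule sheaf_mapI[OF presheaf_base[OF S]]) (auto simp: presheaf_0[OF S'] presheaf_res_0[OF S'])

lemma derivation_diff:
  assumes X: "graded_ring_sheaf X" and U: "openin (base X) U" and D: "derivation X U d D" and E: "derivation X U d E"
  shows "derivation X U d (\<lambda>V f. D V f - E V f)"
proof -
  note p = ring_presheaf[OF X]
  have "sheaf_map X X U d (\<lambda>V f. 1 *\<^sub>R D V f + (-1) *\<^sub>R E V f)"
    by (rule sheaf_map_lincomb[OF p p derivation_map[OF D] derivation_map[OF E] U])
  then have "sheaf_map X X U d (\<lambda>V f. D V f - E V f)" by simp
  then show ?thesis
    unfolding derivation_def using derivation_mult[OF D] derivation_mult[OF E] by (auto simp: algebra_simps)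
qed

text \<open>Prepares the comparison of the contraction with fX and f times the contraction with X:
  the latter has to be recognised as a derivation.\<close>

lemma derivation_mult_left:
  assumes X: "graded_ring_sheaf X" and U: "openin (base X) U" and D: "derivation X U d D" and g: "g \<in> sec X U i"
  shows "derivation X U (i + d) (\<lambda>V f. res X U V g * D V f)"
proof -
  note p = ring_presheaf[OF X] and m = derivation_map[OF D]
  have rg: "res X U V g \<in> sec X V i" if "openin (base X) V" "V \<subseteq> U" for V
    using presheaf_res_in[OF p U that g] .
  have m1: "sheaf_map X X U (i + d) (\<lambda>V f. res X U V g * D V f)"
  proof (rule sheaf_mapI[OF refl], goal_cases)
    case (1 V j f)
    show ?case using ring_mult_in[OF X 1(1) rg[OF 1(1,2)] sheaf_map_in[OF p m 1]] by (simp add: algebra_simps)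
  next
    case (2 V j f c)
    then show ?case by (simp add: sheaf_map_scale[OF p m])
  next
    case (3 V j f f')
    then show ?case by (simp add: sheaf_map_add[OF p m 3] ring_distribs)
  next
    case (4 V W j f)
    then show ?case 
      by (simp add: sheaf_map_res[OF p m 4] ring_res_mult[OF X 4(1,3,4) rg[OF 4(1,2)] sheaf_map_in[OF p m 4(1,2,5)]]
         presheaf_res_res[OF p U 4(1,3,4,2) g])
  qed
  have m2: "res X U V g * D V (f * h) = res X U V g * D V f * h + ksign ((i + d) * j) *\<^sub>R (f * (res X U V g * D V h))"
    if V: "openin (base X) V" "V \<subseteq> U" and f: "f \<in> sec X V j" and h: "h \<in> sec X V k" for V j f k h
  proof -
    have c: "res X U V g * f = ksign (j * i) *\<^sub>R (f * res X U V g)"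
      by (rule ring_commute[OF X V(1) f rg[OF V]])
    have "res X U V g * (f * D V h) = ksign (j * i) *\<^sub>R (f * (res X U V g * D V h))"
      using arg_cong[OF c, of "\<lambda>x. x * D V h"] by (simp add: mult.assoc)
    moreover have "ksign ((i + d) * j) = ksign (d * j) * ksign (j * i)"
      by (simp add: distrib_right ksign_add mult.commute[of j])
    ultimately show ?thesis
      by (simp add: derivation_mult[OF D V f h] distrib_left mult.assoc)
  qed
  show ?thesis
    unfolding derivation_def
  proof (intro conjI allI impI, goal_cases)
    case (2 V j f k h)
    then show ?case by (elim conjE) (rule m2)
  qed (rule m1)
qed

section \<open>The operators Q_1, d_A and i_X on polynomial functions\<close>

locale dg_setting = A: dg_bundle M A QM QA + E: dg_bundle M E QM QE + P: vector_bundle M A1 +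
    X: tensor_module M A1 "sections M E" m tens
  for M :: "('p, int, 'f::real_algebra) gring" and QM :: "'p set \<Rightarrow> 'f \<Rightarrow> 'f"
    and A :: "('p, 'f, 'q, 'g::real_algebra) vbundle" and QA :: "'q set \<Rightarrow> 'g \<Rightarrow> 'g"
    and A1 :: "('p, 'f, 'r, 'h::real_algebra) vbundle"
    and E :: "('p, 'f, 's, 'l::real_algebra) vbundle" and QE :: "'s set \<Rightarrow> 'l \<Rightarrow> 'l"
    and m :: "('p, int \<times> int, 'h, 'm::real_vector) gmod" and tens +
  fixes Q1 dA :: "'r set \<Rightarrow> 'h \<Rightarrow> 'h" and Qm :: "'p set \<Rightarrow> 'm \<Rightarrow> 'm"
    and \<rho> br s \<iota> \<iota>m
  assumes algebroid: "dg_Lie_algebroid M QM A QA \<rho> br A1 s \<iota> Q1 dA"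
    and tensor_field: "tensor_field M QM A1 Q1 E QE m tens Qm"
    and tensor_contraction: "tensor_contraction M A A1 \<iota> E m tens \<iota>m"
begin

abbreviation "SA \<equiv> sections M A"
abbreviation "SE \<equiv> sections M E"
abbreviation "T \<equiv> topspace (base M)"
abbreviation "incl' U e \<equiv> tens U (unity (tot A1) (over A1 U)) e"

lemma
  shows shifted: "shifted_bundle M A A1 s" and contraction: "contraction M A A1 s \<iota>"
    and shifted_field: "shifted_field M QM A QA A1 s Q1" and CE: "Chevalley_Eilenberg M A \<rho> br A1 \<iota> dA"
    and Q1_dA: "openin (base (tot A1)) W \<Longrightarrow> h \<in> sec (tot A1) W i \<Longrightarrow> Q1 W (dA W h) + dA W (Q1 W h) = 0"
  using algebroid unfolding dg_Lie_algebroid_def graded_commutator_def by simp_all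

lemma openT: "openin (base M) T" by simp

lemma openin_sub: "openin (base M) U \<Longrightarrow> U \<subseteq> T" by (rule openin_subset)

lemma Q1_derivation: "derivation (tot A1) (over A1 T) 1 Q1"
  and Q1_pull: "openin (base M) U \<Longrightarrow> f \<in> sec M U k \<Longrightarrow> Q1 (over A1 U) (pull A1 U f) = pull A1 U (QM U f)"
  and Q1_s: "openin (base M) U \<Longrightarrow> \<delta> \<in> lin A U k \<Longrightarrow> Q1 (over A1 U) (s U \<delta>) = - s U (QA (over A U) \<delta>)"
  using shifted_field P.over_topspace unfolding shifted_field_def projects_to_def by auto

lemma s_map: "sheaf_map (lin_mod M A) (lin_mod M A1) T 1 s"
  and s_bij: "openin (base M) U \<Longrightarrow> bij_betw (s U) (lin A U k) (lin A1 U (k + 1))"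
  using shifted unfolding shifted_bundle_def by auto

lemma s_in: "openin (base M) U \<Longrightarrow> \<delta> \<in> lin A U k \<Longrightarrow> s U \<delta> \<in> lin A1 U (k + 1)"
  using s_bij[of U k] by (auto simp: bij_betw_def)

lemma s_surj:
  assumes "openin (base M) U" "\<epsilon> \<in> lin A1 U k"
  obtains \<delta> where "\<delta> \<in> lin A U (k - 1)" "\<epsilon> = s U \<delta>"
  using s_bij[OF assms(1), of "k - 1"] assms(2) by (auto simp: bij_betw_def)

lemma s_res: "openin (base M) U \<Longrightarrow> openin (base M) V \<Longrightarrow> V \<subseteq> U \<Longrightarrow> \<delta> \<in> lin A U k \<Longrightarrow> P.tres U V (s U \<delta>) = s V (A.tres U V \<delta>)"
  using sheaf_map_res[OF A.pre_lin s_map _ openin_sub, of U V \<delta> k] by simp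

lemma s_0: "openin (base M) U \<Longrightarrow> s U 0 = 0"
  using sheaf_map_0[OF A.pre_lin s_map _ openin_sub] .

lemma Q1_lin:
  assumes U: "openin (base M) U" and e: "\<epsilon> \<in> lin A1 U k"
  shows "Q1 (over A1 U) \<epsilon> \<in> lin A1 U (k + 1)"
proof -
  obtain \<delta> where d: "\<delta> \<in> lin A U (k - 1)" "\<epsilon> = s U \<delta>" using s_surj[OF U e] .
  have "s U (QA (over A U) \<delta>) \<in> lin A1 U (k + 1)" using s_in[OF U A.Q_lin[OF U d(1)]] by simp
  then show ?thesis using Q1_s[OF U d(1)] d(2) subspace_neg[OF P.lin_subspace[OF U]] by simp
qed

lemma Q1_res: "openin (base M) U \<Longrightarrow> openin (base M) V \<Longrightarrow> V \<subseteq> U \<Longrightarrow> a \<in> P.tsec U k \<Longrightarrow>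
    P.tres U V (Q1 (over A1 U) a) = Q1 (over A1 V) (P.tres U V a)"
  using P.derivation_tot_res[OF openT Q1_derivation _ openin_sub] .

lemma Q1_poly: "openin (base M) U \<Longrightarrow> \<alpha> \<in> P.polys U (k, p) \<Longrightarrow> Q1 (over A1 U) \<alpha> \<in> P.polys U (k + 1, p)"
  by (rule P.derivation_poly_0[OF openT Q1_derivation _ _ _ openin_sub])
    (auto simp: Q1_pull Q1_lin intro!: imageI A.QM_in)

lemma Q1_mult: "openin (base M) U \<Longrightarrow> a \<in> P.tsec U k \<Longrightarrow> b \<in> P.tsec U l \<Longrightarrow>
    Q1 (over A1 U) (a * b) = Q1 (over A1 U) a * b + ksign k *\<^sub>R (a * Q1 (over A1 U) b)"
  using derivation_mult[OF Q1_derivation P.over_open P.over_mono[OF openin_sub]] by simp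

text \<open>The bracket [Q_1, Q_1] = 2 Q_1^2 is a derivation, and it vanishes on generators since
  \<open>QM\<close> and \<open>QA\<close> square to zero.\<close>

lemma Q1_Q1:
  assumes U: "openin (base M) U" and \<alpha>: "\<alpha> \<in> P.polys U (k, p)"
  shows "Q1 (over A1 U) (Q1 (over A1 U) \<alpha>) = 0"
proof -
  have "derivation (tot A1) (over A1 T) (1 + 1) (graded_commutator 1 Q1 1 Q1)"
    by (rule derivation_commutator[OF P.ring_tot P.over_open[OF openT] Q1_derivation Q1_derivation])
  then have "graded_commutator 1 Q1 1 Q1 (over A1 U) \<alpha> = 0"
  proof (rule P.derivation_poly_eq_0[OF openT _ _ _ U openin_sub[OF U] \<alpha>])
    fix V f k assume "openin (base M) V" "f \<in> sec M V k"
    then show "graded_commutator 1 Q1 1 Q1 (over A1 V) (pull A1 V f) = 0"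
      using Q1_pull[of V f k] Q1_pull[OF _ A.QM_in, of V f k] by (simp add: graded_commutator_def A.QM_QM P.pull_0)
  next
    fix V \<epsilon> k assume V: "openin (base M) V" and e: "\<epsilon> \<in> lin A1 V k"
    obtain \<delta> where d: "\<delta> \<in> lin A V (k - 1)" "\<epsilon> = s V \<delta>" using s_surj[OF V e] .
    have "Q1 (over A1 V) (Q1 (over A1 V) \<epsilon>) = 0"
      using Q1_s[OF V d(1)] Q1_s[OF V A.Q_lin[OF V d(1)]] A.Q_Q[OF A.over_open[OF V] A.lin_tot[OF V d(1)]] s_0[OF V] d(2)
        sheaf_map_uminus[OF P.presheaf_tot derivation_map[OF Q1_derivation] P.over_open[OF V] P.over_mono[OF openin_sub[OF V]]
          P.lin_tot[OF V s_in[OF V A.Q_lin[OF V d(1)]]]] by simp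
    then show "graded_commutator 1 Q1 1 Q1 (over A1 V) \<epsilon> = 0" by (simp add: graded_commutator_def)
  qed
  then have "2 *\<^sub>R Q1 (over A1 U) (Q1 (over A1 U) \<alpha>) = 0" by (simp add: graded_commutator_def scaleR_2)
  then show ?thesis by simp
qed

lemma dA_poly:
  assumes U: "openin (base M) U" and \<alpha>: "\<alpha> \<in> P.polys U (k, p)"
  shows "dA (over A1 U) \<alpha> \<in> P.polys U (k, p + 1)"
proof -
  have "sheaf_map (polynomials M A1) (polynomials M A1) T (0, 1) (\<lambda>U. dA (over A1 U))"
    using CE unfolding Chevalley_Eilenberg_def by simp
  then show ?thesis
    using U openin_sub[OF U] \<alpha> unfolding sheaf_map_def by fastforce
qed

lemma contraction_rules:
  assumes "openin (base M) U" "X \<in> A.secs U k"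
  shows "derivation (tot A1) (over A1 U) (k - 1) (\<iota> U X) \<and>
       (\<forall>V. openin (base M) V \<and> V \<subseteq> U \<longrightarrow>
          (\<forall>i. \<forall>f\<in>sec M V i. \<iota> U X (over A1 V) (pull A1 V f) = 0) \<and>
          (\<forall>i. \<forall>\<epsilon>\<in>lin A V i. \<iota> U X (over A1 V) (s V \<epsilon>) = pull A1 V (X V \<epsilon>)))"
  by (rule contraction[unfolded contraction_def, THEN spec, THEN spec, THEN spec, THEN mp]) (use assms in simp)

context
  fixes U X k
  assumes U: "openin (base M) U" and X: "X \<in> A.secs U k"
begin

lemma contraction_derivation: "derivation (tot A1) (over A1 U) (k - 1) (\<iota> U X)"
  using contraction_rules[OF U X] by blast

lemma contraction_pull: "openin (base M) V \<Longrightarrow> V \<subseteq> U \<Longrightarrow> f \<in> sec M V i \<Longrightarrow> \<iota> U X (over A1 V) (pull A1 V f) = 0"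
  using contraction_rules[OF U X] by blast

lemma contraction_s: "openin (base M) V \<Longrightarrow> V \<subseteq> U \<Longrightarrow> \<delta> \<in> lin A V i \<Longrightarrow> \<iota> U X (over A1 V) (s V \<delta>) = pull A1 V (X V \<delta>)"
  using contraction_rules[OF U X] by blast

lemma contraction_poly:
  assumes V: "openin (base M) V" "V \<subseteq> U" and \<alpha>: "\<alpha> \<in> P.polys V (l, p)"
  shows "\<iota> U X (over A1 V) \<alpha> \<in> P.polys V (l + k, p - 1)"
proof -
  have "\<iota> U X (over A1 V) \<alpha> \<in> P.polys V (l + (k - 1) + 1, p - 1)"
  proof (rule P.derivation_poly_minus_1[OF U contraction_derivation contraction_pull _ V \<alpha>])
    fix V \<epsilon> l assume V: "openin (base M) V" "V \<subseteq> U" and e: "\<epsilon> \<in> lin A1 V l"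
    obtain \<delta> where d: "\<delta> \<in> lin A V (l - 1)" "\<epsilon> = s V \<delta>" using s_surj[OF V(1) e] .
    show "\<iota> U X (over A1 V) \<epsilon> \<in> pull A1 V ` sec M V (l + (k - 1))"
      using contraction_s[OF V d(1)] A.section_in[OF U X V d(1)] d(2) by (simp add: algebra_simps)
  qed
  then show ?thesis by simp
qed

text \<open>Both [Q_1, i_X] and the contraction with QX are derivations of degree k that kill
  pull-backs. On \<open>s V \<delta>\<close> they agree by the formula for the differential on
  sections and the sign in \<open>shifted_field\<close>.\<close>

lemma contraction_Q:
  assumes V: "openin (base M) V" "V \<subseteq> U" and \<alpha>: "\<alpha> \<in> P.polys V (l, p)"
  shows "Q1 (over A1 V) (\<iota> U X (over A1 V) \<alpha>) - ksign (k - 1) *\<^sub>R \<iota> U X (over A1 V) (Q1 (over A1 V) \<alpha>) =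
    \<iota> U (A.QS U X) (over A1 V) \<alpha>"
proof -
  note QX = A.section_field_in[OF U X]
  let ?C = "graded_commutator 1 Q1 (k - 1) (\<iota> U X)" and ?D = "\<iota> U (A.QS U X)"
  have "derivation (tot A1) (over A1 U) (1 + (k - 1)) ?C"
    by (rule derivation_commutator[OF P.ring_tot P.over_open[OF U] 
         derivation_mono[OF Q1_derivation P.over_mono[OF openin_sub[OF U]]] contraction_derivation])
  moreover have "derivation (tot A1) (over A1 U) (k + 1 - 1) ?D"
    using contraction_rules[OF U QX] by blast
  ultimately have "derivation (tot A1) (over A1 U) k (\<lambda>V f. ?C V f - ?D V f)"
    using derivation_diff[OF P.ring_tot P.over_open[OF U]] by simp
  then have "?C (over A1 V) \<alpha> - ?D (over A1 V) \<alpha> = 0"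
  proof (rule P.derivation_poly_eq_0[OF U _ _ _ V \<alpha>])
    fix V f i assume V: "openin (base M) V" "V \<subseteq> U" and f: "f \<in> sec M V i"
    have "\<iota> U (A.QS U X) (over A1 V) (pull A1 V f) = 0"
      using contraction_rules[OF U QX] V f by blast
    then show "?C (over A1 V) (pull A1 V f) - ?D (over A1 V) (pull A1 V f) = 0"
      using Q1_pull[OF V(1) presheaf_0[OF A.pre_ring V(1)]] A.QM_scale[OF V(1) presheaf_0[OF A.pre_ring V(1)], of 0]
      by (simp add: graded_commutator_def Q1_pull[OF V(1) f] contraction_pull[OF V A.QM_in[OF V(1) f]] contraction_pull[OF V f] P.pull_0[OF V(1)])
  next
    fix V \<epsilon> i assume V: "openin (base M) V" "V \<subseteq> U" and e: "\<epsilon> \<in> lin A1 V i"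
    obtain \<delta> where d: "\<delta> \<in> lin A V (i - 1)" "\<epsilon> = s V \<delta>" using s_surj[OF V(1) e] .
    note Qd = A.Q_lin[OF V(1) d(1)] 
    note Xd = A.section_in[OF U X V d(1)] and XQd = A.section_in[OF U X V Qd]
    have D: "?D (over A1 V) \<epsilon> = pull A1 V (A.QS U X V \<delta>)"
      using contraction_rules[OF U QX] V d by blast
    have "\<iota> U X (over A1 V) (Q1 (over A1 V) \<epsilon>) = - pull A1 V (X V (QA (over A V) \<delta>))"
      using Q1_s[OF V(1) d(1)] contraction_s[OF V Qd] d(2) 
       sheaf_map_uminus[OF P.presheaf_tot derivation_map[OF contraction_derivation] P.over_open[OF V(1)] P.over_mono[OF V(2)]
          P.lin_tot[OF V(1) s_in[OF V(1) Qd]]] by simp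
    moreover have "Q1 (over A1 V) (\<iota> U X (over A1 V) \<epsilon>) = pull A1 V (QM V (X V \<delta>))"
      using contraction_s[OF V d(1)] Q1_pull[OF V(1) Xd] d(2) by simp
    moreover have "pull A1 V (A.QS U X V \<delta>) = pull A1 V (QM V (X V \<delta>)) - ksign k *\<^sub>R pull A1 V (X V (QA (over A V) \<delta>))"
    proof -
      have x: "X V (QA (over A V) \<delta>) \<in> sec M V (i - 1 + k + 1)" using XQd by (simp add: algebra_simps)
      show ?thesis
        using P.pull_add[OF V(1) A.QM_in[OF V(1) Xd] presheaf_scale[OF A.pre_ring V(1) x, of "- ksign k"]]
          P.pull_scale[OF V(1) x, of "- ksign k"] A.section_field_apply[OF U X V d(1)] by simp
    qed
    ultimately show "?C (over A1 V) \<epsilon> - ?D (over A1 V) \<epsilon> = 0"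
      by (simp add: graded_commutator_def D ksign_diff)
  qed
  then show ?thesis by (simp add: graded_commutator_def)
qed

text \<open>\<open>contraction\<close> fixes a derivation for each open set separately. The two
  sides agree because they agree on pull-backs and linear functions.\<close>

lemma contraction_res:
  assumes V: "openin (base M) V" "V \<subseteq> U" and W: "openin (base M) W" "W \<subseteq> V" and \<alpha>: "\<alpha> \<in> P.polys W (l, p)"
  shows "\<iota> V (res SA U V X) (over A1 W) \<alpha> = \<iota> U X (over A1 W) \<alpha>"
proof -
  have rX: "res SA U V X \<in> A.secs V k"
    using presheaf_res_in[OF module_presheaf[OF A.module_secs] U V, of X k] X by simp
  let ?D = "\<iota> V (res SA U V X)"
  have "derivation (tot A1) (over A1 V) (k - 1) (\<lambda>W f. ?D W f - \<iota> U X W f)"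
    by (rule derivation_diff[OF P.ring_tot P.over_open[OF V(1)] contraction_rules[OF V(1) rX, THEN conjunct1]
          derivation_mono[OF contraction_derivation P.over_mono[OF V(2)]]])
  then have "?D (over A1 W) \<alpha> - \<iota> U X (over A1 W) \<alpha> = 0"
  proof (rule P.derivation_poly_eq_0[OF V(1) _ _ _ W \<alpha>])
    fix W f i assume W: "openin (base M) W" "W \<subseteq> V" and f: "f \<in> sec M W i"
    have "?D (over A1 W) (pull A1 W f) = 0"
      using contraction_rules[OF V(1) rX] W f by blast
    then show "?D (over A1 W) (pull A1 W f) - \<iota> U X (over A1 W) (pull A1 W f) = 0"
      using contraction_pull[OF W(1) subset_trans[OF W(2) V(2)] f] by simp
  next
    fix W \<epsilon> i assume W: "openin (base M) W" "W \<subseteq> V" and e: "\<epsilon> \<in> lin A1 W i"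
    obtain \<delta> where d: "\<delta> \<in> lin A W (i - 1)" "\<epsilon> = s W \<delta>" using s_surj[OF W(1) e] .
    have "?D (over A1 W) \<epsilon> = pull A1 W (res SA U V X W \<delta>)"
      using contraction_rules[OF V(1) rX] W d by blast
    moreover have "res SA U V X W \<delta> = X W \<delta>"
      using W d(1) by (simp add: hom_mod_simps hom_ext_apply[where i = "i - 1"])
    ultimately show "?D (over A1 W) \<epsilon> - \<iota> U X (over A1 W) \<epsilon> = 0"
      using contraction_s[OF W(1) subset_trans[OF W(2) V(2)] d(1)] d(2) by simp
  qed
  then show ?thesis by simp
qed

lemma contraction_act:
  assumes f: "f \<in> sec M U i" and V: "openin (base M) V" "V \<subseteq> U" and \<alpha>: "\<alpha> \<in> P.polys V (l, p)"
  shows "\<iota> U (act SA U f X) (over A1 V) \<alpha> = pull A1 V (res M U V f) * \<iota> U X (over A1 V) \<alpha>"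
proof -
  have fX: "act SA U f X \<in> A.secs U (i + k)" by (rule A.section_act_in[OF U f X])
  let ?D = "\<iota> U (act SA U f X)" and ?E = "\<lambda>V f'. res (tot A1) (over A1 U) V (pull A1 U f) * \<iota> U X V f'"
  have "derivation (tot A1) (over A1 U) (i + k - 1) ?D"
    using contraction_rules[OF U fX] by blast
  moreover have "derivation (tot A1) (over A1 U) (i + k - 1) ?E"
    using derivation_mult_left[OF P.ring_tot P.over_open[OF U] contraction_derivation P.pull_in[OF U f]] by (simp add: add_diff_eq)
  ultimately have "derivation (tot A1) (over A1 U) (i + k - 1) (\<lambda>W f. ?D W f - ?E W f)"
    by (rule derivation_diff[OF P.ring_tot P.over_open[OF U]])
  then have "?D (over A1 V) \<alpha> - ?E (over A1 V) \<alpha> = 0"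
  proof (rule P.derivation_poly_eq_0[OF U _ _ _ V \<alpha>])
    fix W g j assume W: "openin (base M) W" "W \<subseteq> U" and g: "g \<in> sec M W j"
    have "?D (over A1 W) (pull A1 W g) = 0"
      using contraction_rules[OF U fX] W g by blast
    then show "?D (over A1 W) (pull A1 W g) - ?E (over A1 W) (pull A1 W g) = 0"
      using contraction_pull[OF W g] by simp
  next
    fix W \<epsilon> j assume W: "openin (base M) W" "W \<subseteq> U" and e: "\<epsilon> \<in> lin A1 W j"
    obtain \<delta> where d: "\<delta> \<in> lin A W (j - 1)" "\<epsilon> = s W \<delta>" using s_surj[OF W(1) e] .
    have "?D (over A1 W) \<epsilon> = pull A1 W (act SA U f X W \<delta>)"
      using contraction_rules[OF U fX] W d by blast
    also have "\<dots> = pull A1 W (res M U W f) * pull A1 W (X W \<delta>)"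
      unfolding A.section_act_apply[OF W d(1)]
      by (rule P.pull_mult[OF W(1) presheaf_res_in[OF A.pre_ring U W f] A.section_in[OF U X W d(1)]])
    finally show "?D (over A1 W) \<epsilon> - ?E (over A1 W) \<epsilon> = 0"
      using contraction_s[OF W d(1)] d(2) P.pull_res[OF U W f] by simp
  qed
  then show ?thesis using P.pull_res[OF U V f] by simp
qed

lemma contraction_pull_mult:
  assumes V: "openin (base M) V" "V \<subseteq> U" and f: "f \<in> sec M V i" and a: "a \<in> P.tsec V j"
  shows "\<iota> U X (over A1 V) (pull A1 V f * a) = ksign ((k - 1) * i) *\<^sub>R (pull A1 V f * \<iota> U X (over A1 V) a)"
  using derivation_mult[OF contraction_derivation P.over_open[OF V(1)] P.over_mono[OF V(2)] P.pull_in[OF V(1) f] a]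
    contraction_pull[OF V f] by simp

end

section \<open>The operators Q_m and i_X on the module m\<close>

lemma Qm_map: "sheaf_map m m T (1, 0) Qm"
  using tensor_field unfolding tensor_field_def by simp

lemma Qm_tens:
  assumes "openin (base M) U" "\<alpha> \<in> P.polys U (k, p)" "e \<in> E.secs U j"
  shows "Qm U (tens U \<alpha> e) = tens U (Q1 (over A1 U) \<alpha>) e + ksign (k + p) *\<^sub>R tens U \<alpha> (E.QS U e)"
  using tensor_field[unfolded tensor_field_def, THEN conjunct2, THEN spec[of _ U], THEN spec[of _ "(k, p)"], THEN spec[of _ \<alpha>],
    THEN spec[of _ j], THEN spec[of _ e]] assms by (simp add: total_degree_def)

lemma \<iota>m_rules:
  assumes "openin (base M) U" "X \<in> A.secs U k"
  shows "sheaf_map m m U (k, - 1) (\<iota>m U X)"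
    and "openin (base M) V \<Longrightarrow> V \<subseteq> U \<Longrightarrow> \<alpha> \<in> P.polys V i \<Longrightarrow> e \<in> E.secs V j \<Longrightarrow>
       \<iota>m U X V (tens V \<alpha> e) = tens V (\<iota> U X (over A1 V) \<alpha>) e"
  using tensor_contraction[unfolded tensor_contraction_def, THEN spec[of _ U], THEN spec[of _ k], THEN spec[of _ X]] assms by (cases i; auto)+

context
  fixes U
  assumes U: "openin (base M) U"
begin

lemmas U_sub = openin_subset[OF U]

lemma Qm_in: "x \<in> sec m U (k, p) \<Longrightarrow> Qm U x \<in> sec m U (k + 1, p)"
  using sheaf_map_in[OF X.pre_m Qm_map U U_sub, of x "(k, p)"] by simp

lemma Qm_add: "x \<in> sec m U i \<Longrightarrow> y \<in> sec m U i \<Longrightarrow> Qm U (x + y) = Qm U x + Qm U y"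
  using sheaf_map_add[OF X.pre_m Qm_map U U_sub] .

lemma Qm_diff: "x \<in> sec m U i \<Longrightarrow> y \<in> sec m U i \<Longrightarrow> Qm U (x - y) = Qm U x - Qm U y"
  using sheaf_map_minus[OF X.pre_m Qm_map U U_sub] .

lemma Qm_scale: "x \<in> sec m U i \<Longrightarrow> Qm U (c *\<^sub>R x) = c *\<^sub>R Qm U x"
  using sheaf_map_scale[OF X.pre_m Qm_map U U_sub] .

lemma Qm_incl: "e \<in> E.secs U j \<Longrightarrow> Qm U (incl' U e) = incl' U (E.QS U e)"
proof -
  assume e: "e \<in> E.secs U j"
  have "Q1 (over A1 U) (unity (tot A1) (over A1 U)) = 0"
    using Q1_pull[OF U ring_unity_in[OF A.ring U]] A.QM_unity[OF U] P.pull_0[OF U] P.pull_unity[OF U] by simp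
  then show ?thesis
    using Qm_tens[OF U P.unity_poly[OF U] e] X.tens_0_left[OF U, of e j] e by simp
qed

text \<open>\<open>tensor_field\<close> prescribes \<open>Qm\<close> on elementary tensors only, so
  the Leibniz rule is verified there and extended by \<open>tens_ext\<close>.\<close>

lemma Qm_act:
  assumes \<alpha>: "\<alpha> \<in> P.polys U (k, p)" and x: "x \<in> sec m U i"
  shows "Qm U (act m U \<alpha> x) = act m U (Q1 (over A1 U) \<alpha>) x + ksign (k + p) *\<^sub>R act m U \<alpha> (Qm U x)"
proof -
  let ?a = "\<lambda>V. P.tres U V \<alpha>"
  note Qa = Q1_poly[OF U \<alpha>] and Qm' = sheaf_map_mono[OF Qm_map U_sub] and p = X.pre_m
  have 1: "sheaf_map m m U (k + 1, p) (\<lambda>V x. Qm V (act m V (?a V) x))"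
    using sheaf_map_comp[OF p p X.act_map[OF U \<alpha>] Qm'] by simp
  have 2: "sheaf_map m m U (k + 1, p) (\<lambda>V x. 1 *\<^sub>R act m V (P.tres U V (Q1 (over A1 U) \<alpha>)) x + ksign (k + p) *\<^sub>R act m V (?a V) (Qm V x))"
    using sheaf_map_comp[OF p p Qm' X.act_map[OF U \<alpha>]] X.act_map[OF U Qa]
    by (intro sheaf_map_lincomb[OF p p _ _ U]) (simp_all add: add.commute)
  have "Qm U (act m U (?a U) x) = 1 *\<^sub>R act m U (P.tres U U (Q1 (over A1 U) \<alpha>)) x + ksign (k + p) *\<^sub>R act m U (?a U) (Qm U x)"
  proof (rule X.tens_ext[OF X.sheaf_m 1 2 U _ U order_refl x])
    fix V \<beta> l q e j assume V: "openin (base M) V" "V \<subseteq> U" and b: "\<beta> \<in> P.polys V (l, q)" and "e \<in> sec SE V j"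
    then have e: "e \<in> E.secs V j" by simp
    note a = P.poly_res_in[OF U V \<alpha>] and at = P.poly_tot[OF V(1) P.poly_res_in[OF U V \<alpha>]] and bt = P.poly_tot[OF V(1) b]
    note ab = P.poly_mult[OF V(1) a b] and Qb = Q1_poly[OF V(1) b] and Qa' = Q1_poly[OF V(1) a]
    note Qe = E.section_field_in[OF V(1) e]
    have r: "P.tres U V (Q1 (over A1 U) \<alpha>) = Q1 (over A1 V) (?a V)"
      by (rule Q1_res[OF U V P.poly_tot[OF U \<alpha>]])
    have m1: "Q1 (over A1 V) (?a V) * \<beta> \<in> P.polys V (k + l + 1, p + q)" using P.poly_mult[OF V(1) Qa' b] by (simp add: algebra_simps)
    have m2: "?a V * Q1 (over A1 V) \<beta> \<in> P.polys V (k + l + 1, p + q)" using P.poly_mult[OF V(1) a Qb] by (simp add: algebra_simps)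
    have "Qm V (act m V (?a V) (tens V \<beta> e)) = tens V (Q1 (over A1 V) (?a V) * \<beta>) e + ksign (k + p) *\<^sub>R tens V (?a V * Q1 (over A1 V) \<beta>) e
        + ksign (k + l + (p + q)) *\<^sub>R tens V (?a V * \<beta>) (E.QS V e)"
      using X.act_tens[OF V(1) b _ a, of e j] Qm_tens[OF V(1) ab e] Q1_mult[OF V(1) at bt]
        X.tens_add_left[OF V(1) m1 subspace_scale[OF P.poly_subspace[OF V(1)] m2, of "ksign (k + p)"], of e j] 
        X.tens_scale_left[OF V(1) m2, of e j "ksign (k + p)"] e by simp
    moreover have "act m V (?a V) (Qm V (tens V \<beta> e)) = tens V (?a V * Q1 (over A1 V) \<beta>) e + ksign (l + q) *\<^sub>R tens V (?a V * \<beta>) (E.QS V e)"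
    proof -
      have t: "tens V (Q1 (over A1 V) \<beta>) e \<in> sec m V (l + j + 1, q)" "tens V \<beta> (E.QS V e) \<in> sec m V (l + j + 1, q)"
        using X.tens_in[OF V(1) Qb, of e j] X.tens_in[OF V(1) b, of "E.QS V e" "j + 1"] e Qe by (simp_all add: algebra_simps)
      show ?thesis
        using X.act_add_right[OF V(1) a t(1) presheaf_scale[OF p V(1) t(2), of "ksign (l + q)"]] X.act_scale_right[OF V(1) a t(2)]
         X.act_tens[OF V(1) Qb _ a, of e j] X.act_tens[OF V(1) b _ a, of "E.QS V e" "j + 1"] e Qe by (simp add: Qm_tens[OF V(1) b e])
    qed
    moreover have "act m V (Q1 (over A1 V) (?a V)) (tens V \<beta> e) = tens V (Q1 (over A1 V) (?a V) * \<beta>) e"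
      using X.act_tens[OF V(1) b _ Qa', of e j] e by simp
    ultimately show "Qm V (act m V (?a V) (tens V \<beta> e)) =
       1 *\<^sub>R act m V (P.tres U V (Q1 (over A1 U) \<alpha>)) (tens V \<beta> e) + ksign (k + p) *\<^sub>R act m V (?a V) (Qm V (tens V \<beta> e))"
      by (simp add: r scaleR_add_right ksign_add)
  qed
  then show ?thesis
    using presheaf_res_id[OF P.presheaf_tot P.over_open[OF U]] P.poly_tot[OF U \<alpha>] P.poly_tot[OF U Qa] by simp
qed

text \<open>On \<alpha> (x) e the squares vanish, and the mixed terms cancel because Q_1 raises the
  degree of \<alpha> by one.\<close>

lemma Qm_Qm:
  assumes x: "x \<in> sec m U i"
  shows "Qm U (Qm U x) = 0"
proof (rule X.tens_ext[OF X.sheaf_m sheaf_map_comp[OF X.pre_m X.pre_m Qm_map Qm_map] sheaf_map_zero[OF X.pre_m X.pre_m] openT _ U U_sub x])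
  fix V \<alpha> k p e j assume V: "openin (base M) V" and a: "\<alpha> \<in> P.polys V (k, p)" and "e \<in> sec SE V j"
  then have e: "e \<in> E.secs V j" by simp
  note Qa = Q1_poly[OF V a] and Qe = E.section_field_in[OF V e]
  have t: "tens V (Q1 (over A1 V) \<alpha>) e \<in> sec m V (k + j + 1, p)" "tens V \<alpha> (E.QS V e) \<in> sec m V (k + j + 1, p)"
    using X.tens_in[OF V Qa, of e j] X.tens_in[OF V a, of "E.QS V e" "j + 1"] e Qe by (simp_all add: algebra_simps)
  have "Qm V (Qm V (tens V \<alpha> e)) = Qm V (tens V (Q1 (over A1 V) \<alpha>) e) + ksign (k + p) *\<^sub>R Qm V (tens V \<alpha> (E.QS V e))"
    using sheaf_map_add[OF X.pre_m Qm_map V openin_sub[OF V] t(1) presheaf_scale[OF X.pre_m V t(2), of "ksign (k + p)"]]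
      sheaf_map_scale[OF X.pre_m Qm_map V openin_sub[OF V] t(2)]
    by (simp add: Qm_tens[OF V a e])
  also have "\<dots> = 0"
    using Q1_Q1[OF V a] E.section_field_square[OF V e] X.tens_0_left[OF V, of e j] X.tens_0_right[OF V a] e
    by (simp add: Qm_tens[OF V Qa e] Qm_tens[OF V a Qe] ksign_add)
  finally show "Qm V (Qm V (tens V \<alpha> e)) = 0" .
qed

end

context
  fixes U X k
  assumes U: "openin (base M) U" and X: "X \<in> A.secs U k"
begin

lemmas \<iota>m_map = \<iota>m_rules(1)[OF U X] and \<iota>m_tens = \<iota>m_rules(2)[OF U X]

text \<open>The relation [Q_m, i_X] = i_(QX), solved for i_X Q_m. The summand 1 (x) Q of Q_m drops
  out of the bracket: i_X changes the degree of the polynomial factor by k - 1, which accounts for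
  exactly the sign in the bracket.\<close>

lemma \<iota>m_Qm:
  assumes V: "openin (base M) V" "V \<subseteq> U" and x: "x \<in> sec m V i"
  shows "\<iota>m U X V (Qm V x) = ksign (k - 1) *\<^sub>R (Qm V (\<iota>m U X V x) - \<iota>m U (A.QS U X) V x)"
proof -
  note p = X.pre_m and Qm' = sheaf_map_mono[OF Qm_map openin_sub[OF U]] and QX = A.section_field_in[OF U X]
  have 1: "sheaf_map m m U (k + 1, - 1) (\<lambda>V x. \<iota>m U X V (Qm V x))"
    using sheaf_map_comp[OF p p Qm' \<iota>m_map] by (simp add: add.commute)
  have 2: "sheaf_map m m U (k + 1, - 1) (\<lambda>V x. ksign (k - 1) *\<^sub>R Qm V (\<iota>m U X V x) + (- ksign (k - 1)) *\<^sub>R \<iota>m U (A.QS U X) V x)"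
    using sheaf_map_comp[OF p p \<iota>m_map Qm'] \<iota>m_rules(1)[OF U QX]
    by (intro sheaf_map_lincomb[OF p p _ _ U]) simp_all
  have "\<iota>m U X V (Qm V x) = ksign (k - 1) *\<^sub>R Qm V (\<iota>m U X V x) + (- ksign (k - 1)) *\<^sub>R \<iota>m U (A.QS U X) V x"
  proof (rule X.tens_ext[OF X.sheaf_m 1 2 U _ V x])
    fix V \<beta> l q e j assume V: "openin (base M) V" "V \<subseteq> U" and b: "\<beta> \<in> P.polys V (l, q)" and "e \<in> sec SE V j"
    then have e: "e \<in> E.secs V j" by simp
    note Qb = Q1_poly[OF V(1) b] and ib = contraction_poly[OF U X V b] and Qe = E.section_field_in[OF V(1) e]
    note iQb = contraction_poly[OF U X V Qb] and Qib = Q1_poly[OF V(1) ib]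
    have t: "tens V (Q1 (over A1 V) \<beta>) e \<in> sec m V (l + j + 1, q)" "tens V \<beta> (E.QS V e) \<in> sec m V (l + j + 1, q)"
      using X.tens_in[OF V(1) Qb, of e j] X.tens_in[OF V(1) b, of "E.QS V e" "j + 1"] e Qe by (simp_all add: algebra_simps)
    have "\<iota>m U X V (Qm V (tens V \<beta> e)) = tens V (\<iota> U X (over A1 V) (Q1 (over A1 V) \<beta>)) e + ksign (l + q) *\<^sub>R tens V (\<iota> U X (over A1 V) \<beta>) (E.QS V e)"
      using sheaf_map_add[OF p \<iota>m_map V t(1) presheaf_scale[OF p V(1) t(2), of "ksign (l + q)"]] sheaf_map_scale[OF p \<iota>m_map V t(2)]
      by (simp add: Qm_tens[OF V(1) b e] \<iota>m_tens[OF V Qb e] \<iota>m_tens[OF V b Qe])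
    moreover have "Qm V (\<iota>m U X V (tens V \<beta> e)) = tens V (Q1 (over A1 V) (\<iota> U X (over A1 V) \<beta>)) e 
        + ksign (l + k + (q - 1)) *\<^sub>R tens V (\<iota> U X (over A1 V) \<beta>) (E.QS V e)"
      by (simp add: \<iota>m_tens[OF V b e] Qm_tens[OF V(1) ib e])
    moreover have "\<iota>m U (A.QS U X) V (tens V \<beta> e) = 
       tens V (Q1 (over A1 V) (\<iota> U X (over A1 V) \<beta>)) e - ksign (k - 1) *\<^sub>R tens V (\<iota> U X (over A1 V) (Q1 (over A1 V) \<beta>)) e"
    proof -
      have iQb': "\<iota> U X (over A1 V) (Q1 (over A1 V) \<beta>) \<in> P.polys V (l + k + 1, q - 1)" using iQb by (simp add: algebra_simps)
      show ?thesis
        using X.tens_add_left[OF V(1) Qib subspace_scale[OF P.poly_subspace[OF V(1)] iQb', of "- ksign (k - 1)"], of e j] 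
          X.tens_scale_left[OF V(1) iQb', of e j "- ksign (k - 1)"] e contraction_Q[OF U X V b]
        by (simp add: \<iota>m_rules(2)[OF U QX V b e])
    qed
    ultimately show "\<iota>m U X V (Qm V (tens V \<beta> e)) = 
        ksign (k - 1) *\<^sub>R Qm V (\<iota>m U X V (tens V \<beta> e)) + (- ksign (k - 1)) *\<^sub>R \<iota>m U (A.QS U X) V (tens V \<beta> e)"
      by (simp add: scaleR_add_right scaleR_diff_right ksign_add ksign_diff)
  qed
  then show ?thesis by (simp add: scaleR_diff_right)
qed

lemma \<iota>m_res:
  assumes V: "openin (base M) V" "V \<subseteq> U" and W: "openin (base M) W" "W \<subseteq> V" and x: "x \<in> sec m W i"
  shows "\<iota>m V (res SA U V X) W x = \<iota>m U X W x"
proof -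
  have rX: "res SA U V X \<in> A.secs V k"
    using presheaf_res_in[OF module_presheaf[OF A.module_secs] U V, of X k] X by simp
  show ?thesis
  proof (rule X.tens_ext[OF X.sheaf_m \<iota>m_rules(1)[OF V(1) rX] sheaf_map_mono[OF \<iota>m_map V(2)] V(1) _ W x])
    fix W \<beta> l q e j assume W: "openin (base M) W" "W \<subseteq> V" and b: "\<beta> \<in> P.polys W (l, q)" and "e \<in> sec SE W j"
    then have e: "e \<in> E.secs W j" by simp
    show "\<iota>m V (res SA U V X) W (tens W \<beta> e) = \<iota>m U X W (tens W \<beta> e)"
      by (simp add: \<iota>m_rules(2)[OF V(1) rX W b e] \<iota>m_tens[OF W(1) subset_trans[OF W(2) V(2)] b e] contraction_res[OF U X V W b])
  qed
qed

text \<open>The rule for a function in the vector; \<open>\<iota>m_pull\<close> is the one for a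
  function in the form. Both serve to read off the tensoriality of At and to extract bump
  functions.\<close>

lemma \<iota>m_act:
  assumes f: "f \<in> sec M U i" and V: "openin (base M) V" "V \<subseteq> U" and x: "x \<in> sec m V h"
  shows "\<iota>m U (act SA U f X) V x = act m V (pull A1 V (res M U V f)) (\<iota>m U X V x)"
proof -
  note p = X.pre_m
  have fX: "act SA U f X \<in> A.secs U (i + k)" by (rule A.section_act_in[OF U f X])
  have 1: "sheaf_map m m U (i + k, - 1) (\<lambda>V x. act m V (P.tres U V (pull A1 U f)) (\<iota>m U X V x))"
    using sheaf_map_comp[OF p p \<iota>m_map X.act_map[OF U P.pull_poly[OF U f]]] by (simp add: add.commute)
  have "\<iota>m U (act SA U f X) V x = act m V (P.tres U V (pull A1 U f)) (\<iota>m U X V x)"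
  proof (rule X.tens_ext[OF X.sheaf_m \<iota>m_rules(1)[OF U fX] 1 U _ V x])
    fix V \<beta> l q e j assume V: "openin (base M) V" "V \<subseteq> U" and b: "\<beta> \<in> P.polys V (l, q)" and "e \<in> sec SE V j"
    then have e: "e \<in> E.secs V j" by simp
    show "\<iota>m U (act SA U f X) V (tens V \<beta> e) = act m V (P.tres U V (pull A1 U f)) (\<iota>m U X V (tens V \<beta> e))"
      using X.act_tens[OF V(1) contraction_poly[OF U X V b] _ P.pull_poly[OF V(1) presheaf_res_in[OF A.pre_ring U V f]], of e j] e
      by (simp add: \<iota>m_rules(2)[OF U fX V b e] \<iota>m_tens[OF V b e] contraction_act[OF U X f V b] P.pull_res[OF U V f])
  qed
  then show ?thesis by (simp add: P.pull_res[OF U V f])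
qed

lemma \<iota>m_pull:
  assumes V: "openin (base M) V" "V \<subseteq> U" and f: "f \<in> sec M V i" and x: "x \<in> sec m V h"
  shows "\<iota>m U X V (act m V (pull A1 V f) x) = ksign ((k - 1) * i) *\<^sub>R act m V (pull A1 V f) (\<iota>m U X V x)"
proof -
  note p = X.pre_m and \<iota>m' = sheaf_map_mono[OF \<iota>m_map V(2)] and pf = P.pull_poly[OF V(1) f]
  have 1: "sheaf_map m m V (k + i, - 1) (\<lambda>W x. \<iota>m U X W (act m W (P.tres V W (pull A1 V f)) x))"
    using sheaf_map_comp[OF p p X.act_map[OF V(1) pf] \<iota>m'] by (simp add: add.commute)
  have 2: "sheaf_map m m V (k + i, - 1) (\<lambda>W x. ksign ((k - 1) * i) *\<^sub>R act m W (P.tres V W (pull A1 V f)) (\<iota>m U X W x) + 0 *\<^sub>R act m W (P.tres V W (pull A1 V f)) (\<iota>m U X W x))"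
    using sheaf_map_comp[OF p p \<iota>m' X.act_map[OF V(1) pf]]
    by (intro sheaf_map_lincomb[OF p p _ _ V(1)]) simp_all
  have "\<iota>m U X V (act m V (P.tres V V (pull A1 V f)) x) = ksign ((k - 1) * i) *\<^sub>R act m V (P.tres V V (pull A1 V f)) (\<iota>m U X V x) + 0 *\<^sub>R act m V (P.tres V V (pull A1 V f)) (\<iota>m U X V x)"
  proof (rule X.tens_ext[OF X.sheaf_m 1 2 V(1) _ V(1) order_refl x])
    fix W \<beta> l q e j assume W: "openin (base M) W" "W \<subseteq> V" and b: "\<beta> \<in> P.polys W (l, q)" and eS: "e \<in> sec SE W j"
    then have e: "e \<in> E.secs W j" by simp
    have WU: "W \<subseteq> U" using W V by blast
    note rf = presheaf_res_in[OF A.pre_ring V(1) W f] and ib = contraction_poly[OF U X W(1) WU b]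
    note fb = P.poly_mult[OF W(1) P.pull_poly[OF W(1) rf] b] and fib = P.poly_mult[OF W(1) P.pull_poly[OF W(1) rf] ib]
    show "\<iota>m U X W (act m W (P.tres V W (pull A1 V f)) (tens W \<beta> e)) =
       ksign ((k - 1) * i) *\<^sub>R act m W (P.tres V W (pull A1 V f)) (\<iota>m U X W (tens W \<beta> e)) + 0 *\<^sub>R act m W (P.tres V W (pull A1 V f)) (\<iota>m U X W (tens W \<beta> e))"
      by (simp add: P.pull_res[OF V(1) W f] X.act_tens[OF W(1) b eS P.pull_poly[OF W(1) rf]] \<iota>m_tens[OF W(1) WU fb e]
         contraction_pull_mult[OF U X W(1) WU rf P.poly_tot[OF W(1) b]] \<iota>m_tens[OF W(1) WU b e]
         X.act_tens[OF W(1) ib eS P.pull_poly[OF W(1) rf]] X.tens_scale_left[OF W(1) fib eS])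
  qed
  then show ?thesis
    using presheaf_res_id[OF P.presheaf_tot P.over_open[OF V(1)] P.pull_in[OF V(1) f]] by simp
qed

end

end

section \<open>Curvature and Atiyah cocycle\<close>

text \<open>Instead of the pairings X_i(e_j), the two consequences in use are recorded: the X_i
  together detect a vanishing linear function, and a section Z has the coefficients Z(e_i).\<close>

definition (in vector_bundle) dual_frame where
  "dual_frame V N d e X \<longleftrightarrow>
    (\<forall>i<N. e i \<in> lin B V (d i) \<and> X i \<in> hom_sec M (lin_mod M B) (fun_mod M) V (- d i)) \<and>
    (\<forall>W \<delta> l. openin (base M) W \<and> W \<subseteq> V \<and> \<delta> \<in> lin B W l \<and> (\<forall>i<N. X i W \<delta> = 0) \<longrightarrow> \<delta> = 0) \<and>
    (\<forall>W Z k. openin (base M) W \<and> W \<subseteq> V \<and> Z \<in> hom_sec M (lin_mod M B) (fun_mod M) W k \<longrightarrow>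
       Z = (\<Sum>i<(N::nat). act (sections M B) W (Z W (tres V W (e i))) (res (sections M B) V W (X i))))"

text \<open>Sections are Hom(linear functions, functions), so the matrix units into the rank one
  module of functions form the dual frame.\<close>

lemma (in vector_bundle) dual_frame_at:
  assumes U: "openin (base M) U" and x: "x \<in> U"
  obtains V N d e X where "openin (base M) V" "x \<in> V" "V \<subseteq> U" "dual_frame V N d e X"
proof -
  obtain U' N d e' where U': "x \<in> U'" "frame_on M (lin_mod M B) U' {..<N::nat} d e'"
    using frame_at[of x] openin_subset[OF U] x by blast
  interpret F': frame_on M "lin_mod M B" U' "{..<N}" d e' by (rule U'(2))
  define V where "V = U \<inter> U'"
  have V: "openin (base M) V" "x \<in> V" "V \<subseteq> U" "V \<subseteq> U'"
    using U x U'(1) F'.open_base by (auto simp: V_def)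
  define e where "e = F'.basis V"
  interpret F: frame_on M "lin_mod M B" V "{..<N}" d e
    unfolding e_def by (rule F'.frame_restrict[OF V(1,4)])
  interpret G: frame_on M "fun_mod M" V "{()}" "\<lambda>_. 0" "\<lambda>_. unity M V"
    by (rule frame_fun_mod[OF ring V(1)])
  interpret FG: two_frames M "lin_mod M B" "fun_mod M" V "{..<N}" d e "{()}" "\<lambda>_. 0" "\<lambda>_. unity M V"
    by unfold_locales
  define X where "X = (\<lambda>i. FG.elementary (i, ()))"
  have Gc: "G.coord W f () = f" if W: "openin (base M) W" "W \<subseteq> V" and f: "f \<in> sec M W k" for W f k
    by (rule G.coord_unique[where k = k]) (use that ring_unity_res[OF ring V(1) W] ring_unity_right[OF ring W(1) f] in auto)
  have "dual_frame V N d e X"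
    unfolding dual_frame_def
  proof (intro conjI allI impI; (elim conjE)?)
    fix i assume i: "i < N"
    show "e i \<in> lin B V (d i)" using F.frame_in[of i] i by simp
    show "X i \<in> hom_sec M (lin_mod M B) (fun_mod M) V (- d i)"
      using FG.elementary_in[of i "()"] i by (simp add: X_def)
  next
    fix W \<delta> l assume W: "openin (base M) W" "W \<subseteq> V" and \<delta>: "\<delta> \<in> lin B W l" and 0: "\<forall>i<N. X i W \<delta> = 0"
    have \<delta>': "\<delta> \<in> sec (lin_mod M B) W l" using \<delta> by simp
    have "F.coord W \<delta> i = 0" if "i \<in> {..<N}" for i
      using FG.elementary_apply[OF W \<delta>' that, of "()"] 0 that 
       ring_unity_res[OF ring V(1) W] ring_unity_right[OF ring W(1) F.coord_in[OF W \<delta>' that]] by (simp add: X_def)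
    then show "\<delta> = 0" using F.coord_sum[OF W \<delta>'] by (simp add: pull_0[OF W(1)])
  next
    fix W Z k assume W: "openin (base M) W" "W \<subseteq> V" and Z: "Z \<in> hom_sec M (lin_mod M B) (fun_mod M) W k"
    let ?S = "sections M B"
    have "Z = (\<Sum>ij\<in>{..<N} \<times> {()}. act ?S W (G.coord W (Z W (F.basis W (fst ij))) (snd ij)) (res ?S V W (FG.elementary ij)))"
      by (rule FG.hom_expand(1)[OF W Z])
    also have "\<dots> = (\<Sum>i<N. act ?S W (G.coord W (Z W (F.basis W i)) ()) (res ?S V W (X i)))"
      by (rule sum.reindex_bij_witness[of _ "\<lambda>i. (i, ())" fst]) (auto simp: X_def)
    also have "\<dots> = (\<Sum>i<N. act ?S W (Z W (tres V W (e i))) (res ?S V W (X i)))"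
    proof (rule sum.cong[OF refl])
      fix i assume i: "i \<in> {..<N}"
      have "Z W (F.basis W i) \<in> sec M W (d i + k)"
        using sheaf_map_in[OF sheaf_on_presheaf[OF sheaf_lin] hom_sec_map[OF Z] W(1) order_refl F.basis_in[OF W i]] by simp
      then show "act ?S W (G.coord W (Z W (F.basis W i)) ()) (res ?S V W (X i)) = act ?S W (Z W (tres V W (e i))) (res ?S V W (X i))"
        using Gc[OF W] by simp
    qed
    finally show "Z = (\<Sum>i<N. act ?S W (Z W (tres V W (e i))) (res ?S V W (X i)))" .
  qed
  then show ?thesis using that[OF V(1-3)] by blast
qed

text \<open>The index type is the one that \<open>frame_hom\<close> produces when the target has the
  one-element frame.\<close>

lemma (in vector_bundle) section_frame_at:
  assumes U: "openin (base M) U" and x: "x \<in> U"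
  obtains V d g and I :: "(nat \<times> unit) set" where "openin (base M) V" "x \<in> V" "V \<subseteq> U" "frame_on M (sections M B) V I d g"
proof -
  obtain U' N d e' where U': "x \<in> U'" "frame_on M (lin_mod M B) U' {..<N::nat} d e'"
    using frame_at[of x] openin_subset[OF U] x by blast
  interpret F': frame_on M "lin_mod M B" U' "{..<N}" d e' by (rule U'(2))
  define V where "V = U \<inter> U'"
  have V: "openin (base M) V" "x \<in> V" "V \<subseteq> U" "V \<subseteq> U'"
    using U x U'(1) F'.open_base by (auto simp: V_def)
  show ?thesis
    by (rule that[OF V(1-3) two_frames.frame_hom[OF two_frames.intro[OF F'.frame_restrict[OF V(1,4)] frame_fun_mod[OF ring V(1)]]]])
qed

text \<open>Polynomial degree 1 means linear only locally; finitely many elements need a common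
  neighbourhood, found by shrinking once for each element.\<close>

lemma (in vector_bundle) poly_1_lin:
  assumes U: "openin (base M) U" and I: "finite I" and \<beta>: "\<And>i. i \<in> I \<Longrightarrow> \<beta> i \<in> polys U (k i, 1)" and x: "x \<in> U"
  shows "\<exists>V. openin (base M) V \<and> x \<in> V \<and> V \<subseteq> U \<and> (\<forall>i\<in>I. tres U V (\<beta> i) \<in> lin B V (k i + 1))"
  using I \<beta>
proof (induction I rule: finite_induct)
  case empty
  then show ?case using U x by blast
next
  case (insert i I)
  then obtain V where V: "openin (base M) V" "x \<in> V" "V \<subseteq> U" "\<forall>i\<in>I. tres U V (\<beta> i) \<in> lin B V (k i + 1)" by auto
  have bi: "\<beta> i \<in> polys U (k i, int 1)" using insert by simp
  obtain W where W: "openin (base M) W" "x \<in> W" "W \<subseteq> V" "tres V W (tres U V (\<beta> i)) \<in> span (monomials M B W 1 (k i + int 1))"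
    by (rule poly_local[OF V(1) poly_res_in[OF U V(1,3) bi] V(2)])
  have "tres U W (\<beta> i) \<in> lin B W (k i + 1)"
    using span_monomials_1[OF W(1)] W(4) tot_res_res[OF U V(1) W(1,3) V(3) poly_tot[OF U bi]] by simp
  moreover have "tres U W (\<beta> j) \<in> lin B W (k j + 1)" if "j \<in> I" for j
  proof -
    have "\<beta> j \<in> polys U (k j, 1)" using insert that by simp
    then have "tres U W (\<beta> j) = tres V W (tres U V (\<beta> j))"
      using tot_res_res[OF U V(1) W(1,3) V(3) poly_tot[OF U]] by simp
    then show ?thesis
      using presheaf_res_in[OF sheaf_on_presheaf[OF sheaf_lin] V(1) W(1,3), of "tres U V (\<beta> j)" "k j + 1"] V(4) that by simp
  qed
  ultimately show ?case using W V by blast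
qed

context dg_setting
begin

text \<open>In a local frame the coefficients of 1 (x) e are the pulled back coordinates of e; they
  are unique, and pull-back is injective. Equations proved in m can thus be transferred back to
  sections of E.\<close>

lemma incl_eq_0:
  assumes U: "openin (base M) U" and e: "e \<in> E.secs U j" and 0: "incl' U e = 0"
  shows "e = 0"
proof -
  have z: "0 \<in> E.secs U j" using presheaf_0[OF X.pre_G U] by simp
  show ?thesis
  proof (rule E.section_eqI[OF e z])
    fix V \<epsilon> l assume V: "openin (base M) V" "V \<subseteq> U" and \<epsilon>: "\<epsilon> \<in> lin E V l"
    have "e V \<epsilon> = 0"
    proof (rule sheaf_eqI[OF ring_sheaf[OF A.ring] V(1) E.section_in[OF U e V \<epsilon>] presheaf_0[OF A.pre_ring V(1)]])
      fix y assume y: "y \<in> V"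
      obtain W d' g and I :: "(nat \<times> unit) set" where W: "openin (base M) W" "y \<in> W" "W \<subseteq> V"
        and fr: "frame_on M SE W I d' g"
        by (rule E.section_frame_at[OF V(1) y])
      interpret Fr: framed_tensor M A1 SE m tens W I d' g
        using fr X.tensor_module_axioms by (intro framed_tensor.intro)
      have WU: "W \<subseteq> U" using W V by blast
      have re: "res SE U W e \<in> sec SE W j" using presheaf_res_in[OF X.pre_G U W(1) WU, of e j] e by simp
      note c = Fr.F.coord_in[OF W(1) order_refl re]
      have "0 = incl' W (res SE U W e)"
        using X.incl_res[OF U W(1) WU, of e j] e 0 presheaf_res_0[OF X.pre_m U W(1) WU] by simp
      also have "\<dots> = incl' W (\<Sum>i\<in>I. act SE W (Fr.F.coord W (res SE U W e) i) (Fr.F.basis W i))"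
        by (simp add: Fr.F.coord_sum[OF W(1) order_refl re])
      also have "\<dots> = (\<Sum>i\<in>I. incl' W (act SE W (Fr.F.coord W (res SE U W e) i) (Fr.F.basis W i)))"
        by (rule X.tens_sum_right[OF W(1) P.unity_poly[OF W(1)] Fr.F.term_in[OF W(1) order_refl _ c]])
      also have "\<dots> = (\<Sum>i\<in>I. tens W (pull A1 W (Fr.F.coord W (res SE U W e) i)) (Fr.F.basis W i))"
        by (rule sum.cong[OF refl]) (simp add: X.incl_pull[OF W(1) Fr.F.basis_in[OF W(1) order_refl] c])
      finally have "pull A1 W (Fr.F.coord W (res SE U W e) i) = 0" if "i \<in> I" for i
        using Fr.tens_independent[OF W(1) order_refl P.pull_poly[OF W(1) c]] that by simp
      then have "Fr.F.coord W (res SE U W e) i = 0" if "i \<in> I" for i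
        using P.pull_eq_0[OF W(1) c] that by blast
      then have "res SE U W e = 0"
        using Fr.F.coord_sum[OF W(1) order_refl re] by (simp add: module_zero_left[OF X.module_G W(1) A.pre_ring Fr.F.basis_in[OF W(1) order_refl]])
      moreover have \<epsilon>': "E.tres V W \<epsilon> \<in> lin E W l"
        using presheaf_res_in[OF E.pre_lin V(1) W(1,3), of \<epsilon> l] \<epsilon> by simp
      moreover have "res SE U W e W (E.tres V W \<epsilon>) = e W (E.tres V W \<epsilon>)"
        using W(1) \<epsilon>' by (simp add: hom_mod_simps hom_ext_apply[where i = l])
      ultimately have "res M V W (e V \<epsilon>) = 0"
        using E.section_res[OF U e V W(1,3) \<epsilon>] by simp
      then show "\<exists>W. openin (base M) W \<and> y \<in> W \<and> W \<subseteq> V \<and> res M V W (e V \<epsilon>) = res M V W 0"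
        using W presheaf_res_0[OF A.pre_ring V(1)] by auto
    qed
    then show "e V \<epsilon> = 0 V \<epsilon>" by simp
  qed
qed

lemma incl_inj:
  assumes U: "openin (base M) U" and e: "e \<in> E.secs U j" "e' \<in> E.secs U j" and eq: "incl' U e = incl' U e'"
  shows "e = e'"
proof -
  have "e - e' \<in> E.secs U j" using presheaf_diff[OF X.pre_G U] e by simp
  moreover have "incl' U (e - e') = 0"
    using X.tens_diff_right[OF U P.unity_poly[OF U], of e j e'] e eq by simp
  ultimately have "e - e' = 0" by (rule incl_eq_0[OF U])
  then show ?thesis by simp
qed

text \<open>
  The function \<open>b\<close> is \<open>1\<close> if all sections of \<open>A\<close> over \<open>V\<close> can be used, and a bump function if only
  the global ones are available.
\<close>

lemma contractions_eq_0:
  assumes U: "openin (base M) U" and y: "y \<in> sec m U (k, 1)"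
    and contr: "\<And>V x. openin (base M) V \<Longrightarrow> V \<subseteq> U \<Longrightarrow> x \<in> V \<Longrightarrow>
      \<exists>W b. openin (base M) W \<and> x \<in> W \<and> W \<subseteq> V \<and> b \<in> sec M W 0 \<and>
        (\<forall>f i. f \<in> sec M W i \<and> b * f = 0 \<longrightarrow> f = 0) \<and>
        (\<forall>l X. X \<in> A.secs V l \<longrightarrow> act m W (pull A1 W b) (\<iota>m V X W (res m U W y)) = 0)"
  shows "y = 0"
proof (rule sheaf_eqI[OF X.sheaf_m U y presheaf_0[OF X.pre_m U]])
  fix x assume x: "x \<in> U"
  obtain V0 N d e X where V0: "openin (base M) V0" "x \<in> V0" "V0 \<subseteq> U" and df: "A.dual_frame V0 N d e X"
    by (rule A.dual_frame_at[OF U x])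
  have X: "X i \<in> A.secs V0 (- d i)" if "i < N" for i
    using df that by (simp add: A.dual_frame_def)
  have dual: "\<delta> = 0" if "openin (base M) W" "W \<subseteq> V0" "\<delta> \<in> lin A W l" "\<And>i. i < N \<Longrightarrow> X i W \<delta> = 0" for W \<delta> l
    using df[unfolded A.dual_frame_def, THEN conjunct2, THEN conjunct1, THEN spec[of _ W], THEN spec[of _ \<delta>], THEN spec[of _ l]] that by simp
  obtain V1 d' g and I :: "(nat \<times> unit) set" where V1: "openin (base M) V1" "x \<in> V1" "V1 \<subseteq> V0"
    and fr: "frame_on M SE V1 I d' g"
    by (rule E.section_frame_at[OF V0(1,2)])
  interpret Fr: framed_tensor M A1 SE m tens V1 I d' g
    using fr X.tensor_module_axioms by (intro framed_tensor.intro)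
  have V1U: "V1 \<subseteq> U" using V1 V0 by blast
  obtain V2 \<beta> where V2: "openin (base M) V2" "x \<in> V2" "V2 \<subseteq> V1" and \<beta>: "\<And>i. i \<in> I \<Longrightarrow> \<beta> i \<in> P.polys V2 (k - d' i, 1)"
    and y2: "res m V1 V2 (res m U V1 y) = (\<Sum>i\<in>I. tens V2 (\<beta> i) (Fr.F.basis V2 i))"
    by (rule Fr.tens_expand[OF V1(1) order_refl presheaf_res_in[OF X.pre_m U V1(1) V1U y] V1(2)]) (rule that)
  \<comment> \<open>Near x all coefficients of y in the frame of E are linear at once, hence images
    under \<open>s\<close> of linear functions on A.\<close>
  obtain V where V: "openin (base M) V" "x \<in> V" "V \<subseteq> V2" and lin: "\<forall>i\<in>I. P.tres V2 V (\<beta> i) \<in> lin A1 V (k - d' i + 1)"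
    using P.poly_1_lin[where k = "\<lambda>i. k - d' i" and \<beta> = \<beta>, OF V2(1) Fr.F.finite_index \<beta> V2(2)] by auto
  have sub: "V \<subseteq> V1" "V \<subseteq> V0" "V \<subseteq> U" "V2 \<subseteq> U" using V V2 V1 V0 by auto
  have "\<exists>\<delta>. \<delta> \<in> lin A V (k - d' i) \<and> P.tres V2 V (\<beta> i) = s V \<delta>" if "i \<in> I" for i
  proof -
    have "P.tres V2 V (\<beta> i) \<in> lin A1 V (k - d' i + 1)" using lin that by blast
    from s_surj[OF V(1) this] show ?thesis by auto
  qed
  then obtain \<delta> where \<delta>: "\<And>i. i \<in> I \<Longrightarrow> \<delta> i \<in> lin A V (k - d' i)" "\<And>i. i \<in> I \<Longrightarrow> P.tres V2 V (\<beta> i) = s V (\<delta> i)"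
    by metis
  obtain W b where W: "openin (base M) W" "x \<in> W" "W \<subseteq> V" and b: "b \<in> sec M W 0"
    and nzd: "\<And>f i. f \<in> sec M W i \<Longrightarrow> b * f = 0 \<Longrightarrow> f = 0"
    and van: "\<And>l X. X \<in> A.secs V l \<Longrightarrow> act m W (pull A1 W b) (\<iota>m V X W (res m U W y)) = 0"
    using contr[OF V(1) sub(3) V(2)] by blast
  have Wsub: "W \<subseteq> V2" "W \<subseteq> V1" "W \<subseteq> V0" "W \<subseteq> U" using W V sub by auto
  define \<delta>W where "\<delta>W = (\<lambda>i. A.tres V W (\<delta> i))"
  have \<delta>W: "\<delta>W i \<in> lin A W (k - d' i)" if "i \<in> I" for i
    using presheaf_res_in[OF A.pre_lin V(1) W(1,3), of "\<delta> i" "k - d' i"] \<delta>(1)[OF that] by (simp add: \<delta>W_def)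
  note sW = P.lin_poly[OF W(1) s_in[OF W(1) \<delta>W], simplified]
  have gW: "Fr.F.basis W i \<in> E.secs W (d' i)" if "i \<in> I" for i
    using Fr.F.basis_in[OF W(1) Wsub(2) that] by simp
  have yW: "res m U W y = (\<Sum>i\<in>I. tens W (s W (\<delta>W i)) (Fr.F.basis W i))"
  proof -
    have "res m U W y = res m V2 W (res m V1 V2 (res m U V1 y))"
      using presheaf_res_res[OF X.pre_m U V1(1) V2(1) V2(3) V1U y] presheaf_res_res[OF X.pre_m U V2(1) W(1) Wsub(1) sub(4) y] by simp
    also have "\<dots> = (\<Sum>i\<in>I. res m V2 W (tens V2 (\<beta> i) (Fr.F.basis V2 i)))"
      unfolding y2
    proof (rule presheaf_res_sum[OF X.pre_m V2(1) W(1) Wsub(1)])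
      show "tens V2 (\<beta> i) (Fr.F.basis V2 i) \<in> sec m V2 (k, 1)" if "i \<in> I" for i
        using X.tens_in[OF V2(1) \<beta>[OF that] Fr.F.basis_in[OF V2(1,3) that]] by simp
    qed
    also have "\<dots> = (\<Sum>i\<in>I. tens W (s W (\<delta>W i)) (Fr.F.basis W i))"
    proof (rule sum.cong[OF refl])
      fix i assume i: "i \<in> I"
      have "P.tres V2 W (\<beta> i) = s W (\<delta>W i)"
        using P.tot_res_res[OF V2(1) V(1) W(1,3) V(3) P.poly_tot[OF V2(1) \<beta>[OF i]]] \<delta>(2)[OF i] s_res[OF V(1) W(1,3) \<delta>(1)[OF i]] by (simp add: \<delta>W_def)
      then show "res m V2 W (tens V2 (\<beta> i) (Fr.F.basis V2 i)) = tens W (s W (\<delta>W i)) (Fr.F.basis W i)"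
        using X.tens_res[OF V2(1) \<beta>[OF i] Fr.F.basis_in[OF V2(1,3) i] W(1) Wsub(1)] 
          presheaf_res_res[OF X.pre_G V1(1) V2(1) W(1) Wsub(1) V2(3) Fr.F.frame_in[OF i]] by simp
    qed
    finally show ?thesis .
  qed
  \<comment> \<open>Contraction with the dual vector \<open>X j\<close> replaces each
    \<open>s W (\<delta>W i)\<close> by the function \<open>X j W (\<delta>W i)\<close>. Multiplied
    by b these are the coefficients of a vanishing tensor, so they are 0, and b can be
    cancelled.\<close>
  have zero: "X j W (\<delta>W i) = 0" if j: "j < N" and i: "i \<in> I" for i j
  proof -
    have Xj: "res SA V0 V (X j) \<in> A.secs V (- d j)"
      using presheaf_res_in[OF module_presheaf[OF A.module_secs] V0(1) V(1) sub(2), of "X j" "- d j"] X[OF j] by simp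
    note Xd = A.section_in[OF V0(1) X[OF j] W(1) Wsub(3) \<delta>W]
    have tin: "tens W (s W (\<delta>W i)) (Fr.F.basis W i) \<in> sec m W (k, 1)" if "i \<in> I" for i
      using X.tens_in[OF W(1) sW[OF that] Fr.F.basis_in[OF W(1) Wsub(2) that]] by simp
    have pin: "tens W (pull A1 W (X j W (\<delta>W i))) (Fr.F.basis W i) \<in> sec m W (k - d j, 0)" if "i \<in> I" for i
      using X.tens_in[OF W(1) P.pull_poly[OF W(1) Xd[OF that]] Fr.F.basis_in[OF W(1) Wsub(2) that]] by (simp add: algebra_simps)
    have "\<iota>m V (res SA V0 V (X j)) W (res m U W y) = (\<Sum>i\<in>I. \<iota>m V0 (X j) W (tens W (s W (\<delta>W i)) (Fr.F.basis W i)))"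
      using \<iota>m_res[OF V0(1) X[OF j] V(1) sub(2) W(1,3) presheaf_res_in[OF X.pre_m U W(1) Wsub(4) y]]
        sheaf_map_sum[OF X.pre_m \<iota>m_map[OF V0(1) X[OF j]] W(1) Wsub(3) tin] yW by simp
    also have "\<dots> = (\<Sum>i\<in>I. tens W (pull A1 W (X j W (\<delta>W i))) (Fr.F.basis W i))"
      using \<iota>m_tens[OF V0(1) X[OF j] W(1) Wsub(3) sW gW] contraction_s[OF V0(1) X[OF j] W(1) Wsub(3) \<delta>W] by simp
    finally have "(\<Sum>i\<in>I. act m W (pull A1 W b) (tens W (pull A1 W (X j W (\<delta>W i))) (Fr.F.basis W i))) = 0"
      using van[OF Xj] sheaf_map_sum[OF X.pre_m X.act_map[OF W(1) P.pull_poly[OF W(1) b]] W(1) order_refl pin, of I]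
       presheaf_res_id[OF P.presheaf_tot P.over_open[OF W(1)] P.pull_in[OF W(1) b]] by simp
    moreover have "act m W (pull A1 W b) (tens W (pull A1 W (X j W (\<delta>W i))) (Fr.F.basis W i)) = tens W (pull A1 W (b * X j W (\<delta>W i))) (Fr.F.basis W i)"
      if "i \<in> I" for i
      using X.act_tens[OF W(1) P.pull_poly[OF W(1) Xd[OF that]] Fr.F.basis_in[OF W(1) Wsub(2) that] P.pull_poly[OF W(1) b]]
        P.pull_mult[OF W(1) b Xd[OF that]] by simp
    ultimately have s0: "(\<Sum>i\<in>I. tens W (pull A1 W (b * X j W (\<delta>W i))) (Fr.F.basis W i)) = 0"
      by simp
    have bX: "b * X j W (\<delta>W i) \<in> sec M W (k - d j - d' i)" if "i \<in> I" for i
      using ring_mult_in[OF A.ring W(1) b Xd[OF that]] by (simp add: algebra_simps)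
    have "pull A1 W (b * X j W (\<delta>W i)) = 0"
      by (rule Fr.tens_independent[OF W(1) Wsub(2) P.pull_poly[OF W(1) bX] s0 i])
    then have "b * X j W (\<delta>W i) = 0" using P.pull_eq_0[OF W(1) bX[OF i]] by blast
    then show ?thesis using nzd[OF Xd[OF i]] by blast
  qed
  have "\<delta>W i = 0" if "i \<in> I" for i
    by (rule dual[OF W(1) Wsub(3) \<delta>W[OF that] zero[OF _ that]])
  then have "res m U W y = 0"
    unfolding yW using X.tens_0_left[OF W(1) Fr.F.basis_in[OF W(1) Wsub(2)]] by (simp add: s_0[OF W(1)])
  then show "\<exists>W. openin (base M) W \<and> x \<in> W \<and> W \<subseteq> U \<and> res m U W y = res m U W 0"
    using W Wsub(4) presheaf_res_0[OF X.pre_m U] by auto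
qed

text \<open>The version with all local sections at hand: W = V and b = 1.\<close>

lemma contractions_eq_0':
  assumes U: "openin (base M) U" and y: "y \<in> sec m U (k, 1)"
    and contr: "\<And>V l X. openin (base M) V \<Longrightarrow> V \<subseteq> U \<Longrightarrow> X \<in> A.secs V l \<Longrightarrow> \<iota>m V X V (res m U V y) = 0"
  shows "y = 0"
proof (rule contractions_eq_0[OF U y])
  fix V x assume V: "openin (base M) V" "V \<subseteq> U" "x \<in> V"
  have "\<forall>f i. f \<in> sec M V i \<and> unity M V * f = 0 \<longrightarrow> f = 0"
    using ring_unity_left[OF A.ring V(1)] by metis
  moreover have "act m V (pull A1 V (unity M V)) (\<iota>m V X V (res m U V y)) = 0" if "X \<in> A.secs V l" for X l
    using contr[OF V(1,2) that] X.act_scale_right[OF V(1) P.unity_poly[OF V(1)] presheaf_0[OF X.pre_m V(1)], of 0] P.pull_unity[OF V(1)] by simp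
  ultimately show "\<exists>W b. openin (base M) W \<and> x \<in> W \<and> W \<subseteq> V \<and> b \<in> sec M W 0 \<and>
        (\<forall>f i. f \<in> sec M W i \<and> b * f = 0 \<longrightarrow> f = 0) \<and>
        (\<forall>l X. X \<in> A.secs V l \<longrightarrow> act m W (pull A1 W b) (\<iota>m V X W (res m U W y)) = 0)"
    using V ring_unity_in[OF A.ring V(1)] by blast
qed

section \<open>Linear operators on m and their contractions\<close>

abbreviation "homs \<equiv> module_homs (polynomials M A1) m"

lemma homs_map: "F \<in> homs U d \<Longrightarrow> sheaf_map m m U d F"
  by (simp add: module_homs_def)

lemma homs_act:
  assumes "F \<in> homs U (d, p)" "openin (base M) V" "V \<subseteq> U" "\<alpha> \<in> P.polys V (k, q)" "x \<in> sec m V j"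
  shows "F V (act m V \<alpha> x) = ksign ((d + p) * (k + q)) *\<^sub>R act m V \<alpha> (F V x)"
proof -
  from assms(1)[unfolded module_homs_def mem_Collect_eq poly_simps, THEN conjunct2, THEN spec[of _ V], THEN spec[of _ "(k, q)"],
      THEN spec[of _ \<alpha>], THEN spec[of _ j], THEN spec[of _ x]]
  show ?thesis using assms(2-) by (simp add: total_degree_def)
qed

lemma homsI:
  assumes "sheaf_map m m U (d, p) F"
    and "\<And>V k q \<alpha> j x. openin (base M) V \<Longrightarrow> V \<subseteq> U \<Longrightarrow> \<alpha> \<in> P.polys V (k, q) \<Longrightarrow> x \<in> sec m V j \<Longrightarrow>
      F V (act m V \<alpha> x) = ksign ((d + p) * (k + q)) *\<^sub>R act m V \<alpha> (F V x)"
  shows "F \<in> homs U (d, p)"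
  using assms unfolding module_homs_def by (auto simp: total_degree_def)

lemma homs_lincomb:
  assumes U: "openin (base M) U" and F: "F \<in> homs U (d, p)" and G: "G \<in> homs U (d, p)"
  shows "(\<lambda>V x. a *\<^sub>R F V x + b *\<^sub>R G V x) \<in> homs U (d, p)"
proof (rule homsI[OF sheaf_map_lincomb[OF X.pre_m X.pre_m homs_map[OF F] homs_map[OF G] U]])
  fix V k q \<alpha> j x assume V: "openin (base M) V" "V \<subseteq> U" and \<alpha>: "\<alpha> \<in> P.polys V (k, q)" and x: "x \<in> sec m V j"
  note Fx = sheaf_map_in[OF X.pre_m homs_map[OF F] V x] and Gx = sheaf_map_in[OF X.pre_m homs_map[OF G] V x]
  show "a *\<^sub>R F V (act m V \<alpha> x) + b *\<^sub>R G V (act m V \<alpha> x) = ksign ((d + p) * (k + q)) *\<^sub>R act m V \<alpha> (a *\<^sub>R F V x + b *\<^sub>R G V x)"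
    using X.act_add_right[OF V(1) \<alpha> presheaf_scale[OF X.pre_m V(1) Fx, of a] presheaf_scale[OF X.pre_m V(1) Gx, of b]]
    by (simp add: homs_act[OF F V \<alpha> x] homs_act[OF G V \<alpha> x] X.act_scale_right[OF V(1) \<alpha> Fx] X.act_scale_right[OF V(1) \<alpha> Gx]
       scaleR_add_right mult.commute)
qed

text \<open>Since \<alpha> (x) e is the action of \<alpha> on 1 (x) e, linearity reduces everything
  to sections of E.\<close>

lemma homs_ext:
  assumes U: "openin (base M) U" and F: "F \<in> homs U (d, p)" and G: "G \<in> homs U (d, p)"
    and eq: "\<And>V e j. openin (base M) V \<Longrightarrow> V \<subseteq> U \<Longrightarrow> e \<in> E.secs V j \<Longrightarrow> F V (incl' V e) = G V (incl' V e)"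
    and V: "openin (base M) V" "V \<subseteq> U" and x: "x \<in> sec m V i"
  shows "F V x = G V x"
proof (rule X.tens_ext[OF X.sheaf_m homs_map[OF F] homs_map[OF G] U _ V x])
  fix V \<alpha> k q e j assume V: "openin (base M) V" "V \<subseteq> U" and \<alpha>: "\<alpha> \<in> P.polys V (k, q)" and e: "e \<in> sec SE V j"
  show "F V (tens V \<alpha> e) = G V (tens V \<alpha> e)"
    using homs_act[OF F V \<alpha> X.incl_in[OF V(1) e]] homs_act[OF G V \<alpha> X.incl_in[OF V(1) e]] eq[OF V] e
    by (simp add: X.incl_act[OF V(1) e \<alpha>])
qed

text \<open>The relation between a form and a tensor in \<open>form_of\<close>, with an operator F
  in place of the image of the form under \<open>\<mu>\<close>.\<close>

definition contracts_to :: "int \<Rightarrow> ('p set \<Rightarrow> 'm \<Rightarrow> 'm) \<Rightarrow>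
    ('p set \<Rightarrow> ('p set \<Rightarrow> 'g \<Rightarrow> 'f) \<Rightarrow> ('p set \<Rightarrow> 'l \<Rightarrow> 'f) \<Rightarrow> 'p set \<Rightarrow> 'l \<Rightarrow> 'f) \<Rightarrow> bool" where
  "contracts_to d F S \<longleftrightarrow> (\<forall>U k X j e. openin (base M) U \<and> X \<in> A.secs U k \<and> e \<in> E.secs U j \<longrightarrow>
     \<iota>m U X U (F U (incl' U e)) = ksign (k * d) *\<^sub>R incl' U (S U X e))"

lemma contracts_toD: "contracts_to d F S \<Longrightarrow> openin (base M) U \<Longrightarrow> X \<in> A.secs U k \<Longrightarrow> e \<in> E.secs U j \<Longrightarrow>
     \<iota>m U X U (F U (incl' U e)) = ksign (k * d) *\<^sub>R incl' U (S U X e)"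
  unfolding contracts_to_def by simp

text \<open>The values on 1 (x) e have polynomial degree 1 and are therefore determined by their
  contractions.\<close>

lemma homs_contractions_ext:
  assumes F: "F \<in> homs T (d, 1)" and G: "G \<in> homs T (d, 1)"
    and eq: "\<And>U k X j e. openin (base M) U \<Longrightarrow> X \<in> A.secs U k \<Longrightarrow> e \<in> E.secs U j \<Longrightarrow>
      \<iota>m U X U (F U (incl' U e)) = \<iota>m U X U (G U (incl' U e))"
    and U: "openin (base M) U" and x: "x \<in> sec m U i"
  shows "F U x = G U x"
proof (rule homs_ext[OF openT F G _ U openin_sub[OF U] x])
  fix V e j assume V: "openin (base M) V" "V \<subseteq> T" and e: "e \<in> E.secs V j"
  have i: "incl' V e \<in> sec m V (j, 0)" using X.incl_in[OF V(1), of e j] e by simp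
  have Fe: "F V (incl' V e) \<in> sec m V (j + d, 1)" "G V (incl' V e) \<in> sec m V (j + d, 1)"
    using sheaf_map_in[OF X.pre_m homs_map[OF F] V i] sheaf_map_in[OF X.pre_m homs_map[OF G] V i] by simp_all
  have "F V (incl' V e) - G V (incl' V e) = 0"
  proof (rule contractions_eq_0'[OF V(1) presheaf_diff[OF X.pre_m V(1) Fe]])
    fix W l X assume W: "openin (base M) W" "W \<subseteq> V" and X: "X \<in> A.secs W l"
    have re: "res SE V W e \<in> E.secs W j" using presheaf_res_in[OF X.pre_G V(1) W, of e j] e by simp
    have ri: "res m V W (incl' V e) = incl' W (res SE V W e)" using X.incl_res[OF V(1) W, of e j] e by simp
    have "res m V W (F V (incl' V e) - G V (incl' V e)) = F W (incl' W (res SE V W e)) - G W (incl' W (res SE V W e))"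
      using presheaf_res_diff[OF X.pre_m V(1) W Fe] sheaf_map_res[OF X.pre_m homs_map[OF F] V W i] 
       sheaf_map_res[OF X.pre_m homs_map[OF G] V W i] ri by simp
    moreover have "F W (incl' W (res SE V W e)) \<in> sec m W (j + d, 1)" "G W (incl' W (res SE V W e)) \<in> sec m W (j + d, 1)"
      using presheaf_res_in[OF X.pre_m V(1) W] Fe ri sheaf_map_res[OF X.pre_m homs_map[OF F] V W i] 
       sheaf_map_res[OF X.pre_m homs_map[OF G] V W i] by auto
    ultimately show "\<iota>m W X W (res m V W (F V (incl' V e) - G V (incl' V e))) = 0"
      using sheaf_map_minus[OF X.pre_m \<iota>m_map[OF W(1) X] W(1) order_refl] eq[OF W(1) X re] by simp
  qed
  then show "F V (incl' V e) = G V (incl' V e)" by simp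
qed

text \<open>In this correspondence [Q_m, F] belongs to minus the differential of S: moving i_X past
  Q_m gives (-1)^(k - 1), where the sign convention in degree d + 1 adds (-1)^k to
  (-1)^(kd).\<close>

lemma contracts_diff:
  assumes F: "sheaf_map m m T (d, 1) F" and S: "contracts_to d F S"
    and SU: "\<And>U k X j e. openin (base M) U \<Longrightarrow> X \<in> A.secs U k \<Longrightarrow> e \<in> E.secs U j \<Longrightarrow> S U X e \<in> E.secs U (k + j + d)"
    and U: "openin (base M) U" and X: "X \<in> A.secs U k" and e: "e \<in> E.secs U j"
  shows "\<iota>m U X U (module_hom_diff Qm (d, 1) F U (incl' U e)) =
    - (ksign (k * (d + 1)) *\<^sub>R incl' U (bundle_hom_diff M QM A QA E QE d S U X e))"
proof -
  note Ut = openin_sub[OF U] and QX = A.section_field_in[OF U X] and Qe = E.section_field_in[OF U e]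
  have i: "incl' U e \<in> sec m U (j, 0)" using X.incl_in[OF U, of e j] e by simp
  have iQ: "incl' U (E.QS U e) \<in> sec m U (j + 1, 0)" using X.incl_in[OF U, of _ "j + 1"] Qe by simp
  have Fe: "F U (incl' U e) \<in> sec m U (j + d, 1)" using sheaf_map_in[OF X.pre_m F U Ut i] by simp
  have FQe: "F U (incl' U (E.QS U e)) \<in> sec m U (j + d + 1, 1)" using sheaf_map_in[OF X.pre_m F U Ut iQ] by (simp add: algebra_simps)
  note SX = SU[OF U X e] and SQX = SU[OF U QX e] and SXQ = SU[OF U X Qe]
  have h: "ksign (hdeg SA U X) *\<^sub>R S U X (E.QS U e) = ksign k *\<^sub>R S U X (E.QS U e)"
  proof (cases "X = 0")
    case True
    have "S U X (E.QS U e) = 0"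
    proof -
      \<comment> \<open>\<open>hdeg\<close> is arbitrary at X = 0. The zero section also has degree
        k + 2, so the value of S lies in two different degrees and vanishes.\<close>
      have X': "X \<in> A.secs U (k + 2)" using presheaf_0[OF module_presheaf[OF A.module_secs] U] True by simp
      have "S U X (E.QS U e) \<in> sec SE U (k + (j + 1) + d)" "S U X (E.QS U e) \<in> sec SE U (k + 2 + (j + 1) + d)"
        using SXQ SU[OF U X' Qe] by simp_all
      then show ?thesis using presheaf_degree[OF X.pre_G U] by fastforce
    qed
    then show ?thesis by simp
  next
    case False
    then show ?thesis using hdeg_eq[OF module_presheaf[OF A.module_secs] U, of X k] X by simp
  qed
  have B: "bundle_hom_diff M QM A QA E QE d S U X e = 
     E.QS U (S U X e) - ksign d *\<^sub>R S U (A.QS U X) e - ksign (d + k) *\<^sub>R S U X (E.QS U e)"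
    using arg_cong[OF h, of "\<lambda>z. ksign d *\<^sub>R z"] by (simp add: bundle_hom_diff_def ksign_add)
  have s: "E.QS U (S U X e) \<in> sec SE U (k + j + d + 1)" "S U (A.QS U X) e \<in> sec SE U (k + j + d + 1)" "S U X (E.QS U e) \<in> sec SE U (k + j + d + 1)"
    using E.section_field_in[OF U SX] SQX SXQ by (simp_all add: algebra_simps)
  have inclB: "incl' U (bundle_hom_diff M QM A QA E QE d S U X e) =
      incl' U (E.QS U (S U X e)) - ksign d *\<^sub>R incl' U (S U (A.QS U X) e) - ksign (d + k) *\<^sub>R incl' U (S U X (E.QS U e))"
    unfolding B
    using X.tens_diff_right[OF U P.unity_poly[OF U] presheaf_diff[OF X.pre_G U s(1) presheaf_scale[OF X.pre_G U s(2), of "ksign d"]] presheaf_scale[OF X.pre_G U s(3), of "ksign (d + k)"]]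
      X.tens_diff_right[OF U P.unity_poly[OF U] s(1) presheaf_scale[OF X.pre_G U s(2), of "ksign d"]]
      X.tens_scale_right[OF U P.unity_poly[OF U] s(2)] X.tens_scale_right[OF U P.unity_poly[OF U] s(3)] by simp
  have QF: "Qm U (F U (incl' U e)) \<in> sec m U (j + d + 1, 1)" using Qm_in[OF U Fe] .
  have "\<iota>m U X U (module_hom_diff Qm (d, 1) F U (incl' U e)) = 
     \<iota>m U X U (Qm U (F U (incl' U e))) - ksign (d + 1) *\<^sub>R \<iota>m U X U (F U (incl' U (E.QS U e)))"
    using sheaf_map_minus[OF X.pre_m \<iota>m_map[OF U X] U order_refl QF presheaf_scale[OF X.pre_m U FQe, of "ksign (d + 1)"]]
      sheaf_map_scale[OF X.pre_m \<iota>m_map[OF U X] U order_refl FQe] 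
    by (simp add: module_hom_diff_def graded_commutator_def total_degree_def Qm_incl[OF U e])
  also have "\<iota>m U X U (Qm U (F U (incl' U e))) = 
      ksign (k - 1) *\<^sub>R (Qm U (\<iota>m U X U (F U (incl' U e))) - \<iota>m U (A.QS U X) U (F U (incl' U e)))"
    by (rule \<iota>m_Qm[OF U X U order_refl Fe])
  also have "Qm U (\<iota>m U X U (F U (incl' U e))) = ksign (k * d) *\<^sub>R incl' U (E.QS U (S U X e))"
    using contracts_toD[OF S U X e] Qm_scale[OF U X.incl_in[OF U, of "S U X e" "k + j + d"]] Qm_incl[OF U SX] SX by simp
  also have "\<iota>m U (A.QS U X) U (F U (incl' U e)) = ksign ((k + 1) * d) *\<^sub>R incl' U (S U (A.QS U X) e)"
    by (rule contracts_toD[OF S U QX e])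
  also have "\<iota>m U X U (F U (incl' U (E.QS U e))) = ksign (k * d) *\<^sub>R incl' U (S U X (E.QS U e))"
    by (rule contracts_toD[OF S U X Qe])
  finally show ?thesis
    unfolding inclB by (simp add: ksign_add ksign_diff distrib_left distrib_right scaleR_diff_right algebra_simps)
qed

end

section \<open>The curvature of a connection on m\<close>

locale connection_setting = dg_setting +
  fixes D
  assumes connection: "module_connection M A1 dA m D"
begin

abbreviation "R \<equiv> curvature Qm D"

lemma R_eq: "R U x = - (Qm U (D U x) + D U (Qm U x))"
  by (simp add: curvature_def graded_commutator_def)

lemma D_map: "sheaf_map m m T (0, 1) D"
  using connection by (simp add: module_connection_def)

lemma D_act:
  assumes "openin (base M) U" "\<alpha> \<in> P.polys U (k, p)" "x \<in> sec m U j"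
  shows "D U (act m U \<alpha> x) = act m U (dA (over A1 U) \<alpha>) x + ksign (k + p) *\<^sub>R act m U \<alpha> (D U x)"
  using connection[unfolded module_connection_def, THEN conjunct2, THEN spec[of _ U], THEN spec[of _ "(k, p)"], THEN spec[of _ \<alpha>],
     THEN spec[of _ j], THEN spec[of _ x]] assms by (simp add: total_degree_def)

lemma R_map: "sheaf_map m m T (1, 1) R"
proof -
  have "sheaf_map m m T (1, 1) (\<lambda>U x. (-1) *\<^sub>R Qm U (D U x) + (-1) *\<^sub>R D U (Qm U x))"
    using sheaf_map_comp[OF X.pre_m X.pre_m D_map Qm_map] sheaf_map_comp[OF X.pre_m X.pre_m Qm_map D_map]
    by (intro sheaf_map_lincomb[OF X.pre_m X.pre_m _ _ openT]) simp_all
  moreover have "(\<lambda>U x. (-1) *\<^sub>R Qm U (D U x) + (-1) *\<^sub>R D U (Qm U x)) = R" by (simp add: fun_eq_iff R_eq)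
  ultimately show ?thesis by simp
qed

context
  fixes U
  assumes U: "openin (base M) U"
begin

lemma D_in: "x \<in> sec m U (k, p) \<Longrightarrow> D U x \<in> sec m U (k, p + 1)"
  using sheaf_map_in[OF X.pre_m D_map U openin_sub[OF U], of x "(k, p)"] by simp

lemma D_scale: "x \<in> sec m U i \<Longrightarrow> D U (c *\<^sub>R x) = c *\<^sub>R D U x"
  using sheaf_map_scale[OF X.pre_m D_map U openin_sub[OF U]] .

lemma D_add: "x \<in> sec m U i \<Longrightarrow> y \<in> sec m U i \<Longrightarrow> D U (x + y) = D U x + D U y"
  using sheaf_map_add[OF X.pre_m D_map U openin_sub[OF U]] .

lemma R_act:
  assumes \<alpha>: "\<alpha> \<in> P.polys U (k, p)" and x: "x \<in> sec m U (j, q)"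
  shows "R U (act m U \<alpha> x) = act m U \<alpha> (R U x)"
proof -
  note d\<alpha> = dA_poly[OF U \<alpha>] and Q\<alpha> = Q1_poly[OF U \<alpha>] and Dx = D_in[OF x] and Qx = Qm_in[OF U x]
  note dQ\<alpha> = dA_poly[OF U Q\<alpha>] and Qd\<alpha> = Q1_poly[OF U d\<alpha>] and QDx = Qm_in[OF U Dx] and DQx = D_in[OF Qx]
  have i: "act m U (dA (over A1 U) \<alpha>) x \<in> sec m U (k + j, p + 1 + q)" "act m U \<alpha> (D U x) \<in> sec m U (k + j, p + 1 + q)"
    "act m U (Q1 (over A1 U) \<alpha>) x \<in> sec m U (k + 1 + j, p + q)" "act m U \<alpha> (Qm U x) \<in> sec m U (k + 1 + j, p + q)"
    using X.act_in[OF U d\<alpha> x] X.act_in[OF U \<alpha> Dx] X.act_in[OF U Q\<alpha> x] X.act_in[OF U \<alpha> Qx] by (simp_all add: algebra_simps)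
  have sg: "ksign (k + (p + 1)) = - ksign (k + p)" "ksign (k + 1 + p) = - ksign (k + p)"
    by (simp_all add: ksign_add)
  have 1: "Qm U (D U (act m U \<alpha> x)) = act m U (Q1 (over A1 U) (dA (over A1 U) \<alpha>)) x - ksign (k + p) *\<^sub>R act m U (dA (over A1 U) \<alpha>) (Qm U x)
      + ksign (k + p) *\<^sub>R act m U (Q1 (over A1 U) \<alpha>) (D U x) + act m U \<alpha> (Qm U (D U x))"
    using Qm_add[OF U i(1) presheaf_scale[OF X.pre_m U i(2), of "ksign (k + p)"]] Qm_scale[OF U i(2)]
    by (simp add: D_act[OF U \<alpha> x] Qm_act[OF U d\<alpha> x] Qm_act[OF U \<alpha> Dx] sg scaleR_add_right)
  have 2: "D U (Qm U (act m U \<alpha> x)) = act m U (dA (over A1 U) (Q1 (over A1 U) \<alpha>)) x - ksign (k + p) *\<^sub>R act m U (Q1 (over A1 U) \<alpha>) (D U x)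
      + ksign (k + p) *\<^sub>R act m U (dA (over A1 U) \<alpha>) (Qm U x) + act m U \<alpha> (D U (Qm U x))"
    using D_add[OF i(3) presheaf_scale[OF X.pre_m U i(4), of "ksign (k + p)"]] D_scale[OF i(4)]
    by (simp add: Qm_act[OF U \<alpha> x] D_act[OF U Q\<alpha> x] D_act[OF U \<alpha> Qx] sg scaleR_add_right)
  \<comment> \<open>The compatibility [Q_1, d_A] = 0 of the dg-Lie algebroid enters here. The mixed
    terms in 1 and 2 cancel in pairs by their signs.\<close>
  have 3: "act m U (Q1 (over A1 U) (dA (over A1 U) \<alpha>)) x + act m U (dA (over A1 U) (Q1 (over A1 U) \<alpha>)) x = 0"
    using X.act_add_left[OF U Qd\<alpha> x dQ\<alpha>] Q1_dA[OF P.over_open[OF U] P.poly_tot[OF U \<alpha>]]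
      X.act_scale_left[OF U Qd\<alpha> x, of 0] by simp
  have "Qm U (D U (act m U \<alpha> x)) + D U (Qm U (act m U \<alpha> x)) =
      (act m U (Q1 (over A1 U) (dA (over A1 U) \<alpha>)) x + act m U (dA (over A1 U) (Q1 (over A1 U) \<alpha>)) x) +
      (act m U \<alpha> (Qm U (D U x)) + act m U \<alpha> (D U (Qm U x)))"
    unfolding 1 2 by (simp add: algebra_simps)
  then have 4: "Qm U (D U (act m U \<alpha> x)) + D U (Qm U (act m U \<alpha> x)) = act m U \<alpha> (Qm U (D U x)) + act m U \<alpha> (D U (Qm U x))"
    unfolding 3 by simp
  have a: "act m U \<alpha> (Qm U (D U x) + D U (Qm U x)) = act m U \<alpha> (Qm U (D U x)) + act m U \<alpha> (D U (Qm U x))"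
    by (rule X.act_add_right[OF U \<alpha> QDx DQx])
  have b: "act m U \<alpha> (- (Qm U (D U x) + D U (Qm U x))) = - act m U \<alpha> (Qm U (D U x) + D U (Qm U x))"
    using X.act_scale_right[OF U \<alpha> presheaf_add[OF X.pre_m U QDx DQx], of "-1"] by simp
  show ?thesis
    unfolding R_eq b a 4 by simp
qed

text \<open>Both sides are -Q_m D Q_m applied to x, because Q_m squares to zero.\<close>

lemma R_Qm:
  assumes x: "x \<in> sec m U (j, q)"
  shows "R U (Qm U x) = Qm U (R U x)"
proof -
  note Dx = D_in[OF x] and Qx = Qm_in[OF U x]
  note QDx = Qm_in[OF U Dx] and DQx = D_in[OF Qx]
  have z: "D U 0 = 0" using sheaf_map_0[OF X.pre_m D_map U openin_sub[OF U]] .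
  have "Qm U (- (Qm U (D U x) + D U (Qm U x))) = - (Qm U (Qm U (D U x)) + Qm U (D U (Qm U x)))"
    using Qm_scale[OF U presheaf_add[OF X.pre_m U QDx DQx], of "-1"] Qm_add[OF U QDx DQx] by simp
  then show ?thesis unfolding R_eq by (simp add: Qm_Qm[OF U x] Qm_Qm[OF U Dx] z)
qed

end

text \<open>The total degree of R is 2, hence even, so graded linearity carries no sign.\<close>

lemma R_homs: "R \<in> homs T (1, 1)"
proof (rule homsI[OF R_map])
  fix V k q \<alpha> j x assume V: "openin (base M) V" and \<alpha>: "\<alpha> \<in> P.polys V (k, q)" and x: "x \<in> sec m V j"
  obtain j1 j2 where "j = (j1, j2)" by (cases j)
  then show "R V (act m V \<alpha> x) = ksign ((1 + 1) * (k + q)) *\<^sub>R act m V \<alpha> (R V x)"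
    using R_act[OF V \<alpha>] x by (simp add: ksign_def)
qed

lemma R_dg_module_map: "dg_module_map (polynomials M A1) m Qm (shift11 m) Qm R"
  unfolding dg_module_map_def
proof (intro conjI allI impI)
  have "sheaf_map m (shift11 m) T (0, 0) R"
  proof (rule sheaf_mapI[OF presheaf_base[OF X.pre_m]], goal_cases)
    case (1 V i x)
    then show ?case using sheaf_map_in[OF X.pre_m R_map 1] by (cases i) (simp add: shift11_def)
  next
    case (2 V i x c)
    then show ?case using sheaf_map_scale[OF X.pre_m R_map 2] by simp
  next
    case (3 V i x y)
    then show ?case using sheaf_map_add[OF X.pre_m R_map 3] by simp
  next
    case (4 V W i x)
    then show ?case using sheaf_map_res[OF X.pre_m R_map 4] by (simp add: shift11_def)
  qed
  then show "sheaf_map m (shift11 m) (topspace (base (polynomials M A1))) (0, 0) R" by simp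
  fix U i \<alpha> j x assume "openin (base (polynomials M A1)) U \<and> \<alpha> \<in> P.polys U i \<and> x \<in> sec m U j"
  then have *: "openin (base M) U" "\<alpha> \<in> P.polys U (fst i, snd i)" "x \<in> sec m U (fst j, snd j)" by auto
  show "R U (act m U \<alpha> x) = act (shift11 m) U \<alpha> (R U x)" using R_act[OF *] by (simp add: shift11_def)
  show "R U (Qm U x) = Qm U (R U x)" using R_Qm[OF *(1,3)] .
qed

end

section \<open>Cohomology classes\<close>

lemma ksign_scaleR_eq_iff: "ksign a *\<^sub>R x = y \<longleftrightarrow> x = ksign a *\<^sub>R (y::'a::real_vector)"
  by auto

lemma bilinear_rules:
  assumes "bilinear_sheaf_map S S' T d F" "openin (base S) U" "x \<in> sec S U i" "y \<in> sec S' U j"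
  shows "F U x y \<in> sec T U (i + j + d)" 
    and "F U (c *\<^sub>R x) y = c *\<^sub>R F U x y" and "F U x (c *\<^sub>R y) = c *\<^sub>R F U x y"
    and "x' \<in> sec S U i \<Longrightarrow> F U (x + x') y = F U x y + F U x' y"
    and "y' \<in> sec S' U j \<Longrightarrow> F U x (y + y') = F U x y + F U x y'"
    and "openin (base S) V \<Longrightarrow> V \<subseteq> U \<Longrightarrow> F V (res S U V x) (res S' U V y) = res T U V (F U x y)"
  using assms(1)[unfolded bilinear_sheaf_map_def, THEN spec[of _ U], THEN spec[of _ i], THEN spec[of _ x], THEN spec[of _ j], THEN spec[of _ y]]
    assms(2-) by auto

lemma (in dg_bundle) section_field_add: "openin (base M) U \<Longrightarrow> \<sigma> \<in> secs U k \<Longrightarrow> \<tau> \<in> secs U k \<Longrightarrow> QS U (\<sigma> + \<tau>) = QS U \<sigma> + QS U \<tau>"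
  using section_field_lincomb[of U \<sigma> k \<tau> 1 1] by simp

lemma (in dg_bundle) section_field_scale: "openin (base M) U \<Longrightarrow> \<sigma> \<in> secs U k \<Longrightarrow> QS U (c *\<^sub>R \<sigma>) = c *\<^sub>R QS U \<sigma>"
  using section_field_lincomb[of U \<sigma> k \<sigma> c 0] by simp

section \<open>Differentials of pairings and of linear operators\<close>

context dg_setting
begin

abbreviation "bdiff \<equiv> bundle_hom_diff M QM A QA E QE"
abbreviation "bhoms \<equiv> bundle_homs M A E"

text \<open>The part of bilinearity that the formula for the differential requires. A connection has
  it as well, without being tensorial, so that At can be treated as a formal differential of
  nabla.\<close>

definition graded_pairing :: "int \<Rightarrow> ('p set \<Rightarrow> ('p set \<Rightarrow> 'g \<Rightarrow> 'f) \<Rightarrow> ('p set \<Rightarrow> 'l \<Rightarrow> 'f) \<Rightarrow> 'p set \<Rightarrow> 'l \<Rightarrow> 'f) \<Rightarrow> bool" where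
  "graded_pairing d S \<longleftrightarrow> (\<forall>U k X j e. openin (base M) U \<and> X \<in> A.secs U k \<and> e \<in> E.secs U j \<longrightarrow> S U X e \<in> E.secs U (k + j + d))"

lemma graded_pairingD: "graded_pairing d S \<Longrightarrow> openin (base M) U \<Longrightarrow> X \<in> A.secs U k \<Longrightarrow> e \<in> E.secs U j \<Longrightarrow> S U X e \<in> E.secs U (k + j + d)"
  unfolding graded_pairing_def by simp

lemma pre_SA: "presheaf_on (base M) SA"
  using module_presheaf[OF A.module_secs] .

lemma bdiff_eq:
  assumes S: "graded_pairing d S" and U: "openin (base M) U" and X: "X \<in> A.secs U k" and e: "e \<in> E.secs U j"
  shows "bdiff d S U X e = E.QS U (S U X e) - ksign d *\<^sub>R S U (A.QS U X) e - ksign (d + k) *\<^sub>R S U X (E.QS U e)"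
proof -
  note Qe = E.section_field_in[OF U e]
  have "ksign (hdeg SA U X) *\<^sub>R S U X (E.QS U e) = ksign k *\<^sub>R S U X (E.QS U e)"
  proof (cases "X = 0")
    case True
    have X': "X \<in> A.secs U (k + 2)" using presheaf_0[OF pre_SA U] True by simp
    have "S U X (E.QS U e) \<in> sec SE U (k + (j + 1) + d)" "S U X (E.QS U e) \<in> sec SE U (k + 2 + (j + 1) + d)"
      using graded_pairingD[OF S U X Qe] graded_pairingD[OF S U X' Qe] by simp_all
    then have "S U X (E.QS U e) = 0" using presheaf_degree[OF X.pre_G U] by fastforce
    then show ?thesis by simp
  next
    case False
    then show ?thesis using hdeg_eq[OF pre_SA U, of X k] X by simp
  qed
  from arg_cong[OF this, of "\<lambda>z. ksign d *\<^sub>R z"] show ?thesis by (simp add: bundle_hom_diff_def ksign_add)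
qed

lemma bdiff_in:
  assumes S: "graded_pairing d S" and U: "openin (base M) U" and X: "X \<in> A.secs U k" and e: "e \<in> E.secs U j"
  shows "bdiff d S U X e \<in> E.secs U (k + j + d + 1)"
proof -
  have s: "E.QS U (S U X e) \<in> sec SE U (k + j + d + 1)" "S U (A.QS U X) e \<in> sec SE U (k + j + d + 1)" "S U X (E.QS U e) \<in> sec SE U (k + j + d + 1)"
    using E.section_field_in[OF U graded_pairingD[OF S U X e]] graded_pairingD[OF S U A.section_field_in[OF U X] e] 
      graded_pairingD[OF S U X E.section_field_in[OF U e]] by (simp_all add: algebra_simps)
  show ?thesis
    using presheaf_diff[OF X.pre_G U presheaf_diff[OF X.pre_G U s(1) presheaf_scale[OF X.pre_G U s(2), of "ksign d"]] presheaf_scale[OF X.pre_G U s(3), of "ksign (d + k)"]]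
    by (simp add: bdiff_eq[OF S U X e])
qed

lemma bdiff_lincomb:
  assumes S: "graded_pairing d S" "graded_pairing d S'" and U: "openin (base M) U" and X: "X \<in> A.secs U k" and e: "e \<in> E.secs U j"
  shows "bdiff d (\<lambda>U X e. a *\<^sub>R S U X e + b *\<^sub>R S' U X e) U X e = a *\<^sub>R bdiff d S U X e + b *\<^sub>R bdiff d S' U X e"
proof -
  have "graded_pairing d (\<lambda>U X e. a *\<^sub>R S U X e + b *\<^sub>R S' U X e)"
    unfolding graded_pairing_def
  proof (intro allI impI; elim conjE)
    fix U k X j e assume *: "openin (base M) U" "X \<in> A.secs U k" "e \<in> E.secs U j"
    show "a *\<^sub>R S U X e + b *\<^sub>R S' U X e \<in> E.secs U (k + j + d)"
      using presheaf_add[OF X.pre_G *(1) presheaf_scale[OF X.pre_G *(1)] presheaf_scale[OF X.pre_G *(1)]]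
        graded_pairingD[OF S(1) *] graded_pairingD[OF S(2) *] by simp
  qed
  then show ?thesis
    by (simp add: bdiff_eq[OF _ U X e] S E.section_field_lincomb[OF U graded_pairingD[OF S(1) U X e] graded_pairingD[OF S(2) U X e]] algebra_simps)
qed

lemma bhoms_bilinear: "S \<in> bhoms d \<Longrightarrow> bilinear_sheaf_map SA SE SE d S"
  by (simp add: bundle_homs_def)

lemma bilinear_pairing: "bilinear_sheaf_map SA SE SE d S \<Longrightarrow> graded_pairing d S"
  unfolding graded_pairing_def using bilinear_rules(1)[of SA SE SE d S] by simp

lemmas bhoms_pairing = bilinear_pairing[OF bhoms_bilinear]

lemma bhoms_act:
  assumes "S \<in> bhoms d" "openin (base M) U" "f \<in> sec M U i" "X \<in> A.secs U k" "e \<in> E.secs U l"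
  shows "S U (act SA U f X) e = ksign (d * i) *\<^sub>R act SE U f (S U X e)"
    and "S U X (act SE U f e) = ksign ((d + k) * i) *\<^sub>R act SE U f (S U X e)"
proof -
  from assms(1)[unfolded bundle_homs_def mem_Collect_eq, THEN conjunct2, THEN spec[of _ U], THEN spec[of _ i], THEN spec[of _ f],
      THEN spec[of _ k], THEN spec[of _ X], THEN spec[of _ l], THEN spec[of _ e]]
  show "S U (act SA U f X) e = ksign (d * i) *\<^sub>R act SE U f (S U X e)"
    and "S U X (act SE U f e) = ksign ((d + k) * i) *\<^sub>R act SE U f (S U X e)"
    using assms(2-) by simp_all
qed

lemma bilinear_lincomb:
  assumes S: "bilinear_sheaf_map SA SE SE d S" "bilinear_sheaf_map SA SE SE d S'"
  shows "bilinear_sheaf_map SA SE SE d (\<lambda>U X e. a *\<^sub>R S U X e + b *\<^sub>R S' U X e)"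
  unfolding bilinear_sheaf_map_def
proof (intro allI impI; elim conjE; intro conjI allI ballI impI)
  fix U i x j y assume "openin (base SA) U" and x: "x \<in> sec SA U i" and y: "y \<in> sec SE U j"
  then have U: "openin (base M) U" "openin (base SA) U" by simp_all
  note r = bilinear_rules[OF S(1) U(2) x y] and r' = bilinear_rules[OF S(2) U(2) x y]
  show "a *\<^sub>R S U x y + b *\<^sub>R S' U x y \<in> sec SE U (i + j + d)"
    by (rule presheaf_add[OF X.pre_G U(1) presheaf_scale[OF X.pre_G U(1) r(1)] presheaf_scale[OF X.pre_G U(1) r'(1)]])
  show "a *\<^sub>R S U (c *\<^sub>R x) y + b *\<^sub>R S' U (c *\<^sub>R x) y = c *\<^sub>R (a *\<^sub>R S U x y + b *\<^sub>R S' U x y)" for c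
    by (simp add: r(2) r'(2) algebra_simps)
  show "a *\<^sub>R S U x (c *\<^sub>R y) + b *\<^sub>R S' U x (c *\<^sub>R y) = c *\<^sub>R (a *\<^sub>R S U x y + b *\<^sub>R S' U x y)" for c
    by (simp add: r(3) r'(3) algebra_simps)
  show "a *\<^sub>R S U (x + x') y + b *\<^sub>R S' U (x + x') y = a *\<^sub>R S U x y + b *\<^sub>R S' U x y + (a *\<^sub>R S U x' y + b *\<^sub>R S' U x' y)"
    if "x' \<in> sec SA U i" for x'
    unfolding r(4)[OF that] r'(4)[OF that] by (simp add: algebra_simps)
  show "a *\<^sub>R S U x (y + y') + b *\<^sub>R S' U x (y + y') = a *\<^sub>R S U x y + b *\<^sub>R S' U x y + (a *\<^sub>R S U x y' + b *\<^sub>R S' U x y')"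
    if "y' \<in> sec SE U j" for y'
    unfolding r(5)[OF that] r'(5)[OF that] by (simp add: algebra_simps)
  show "a *\<^sub>R S V (res SA U V x) (res SE U V y) + b *\<^sub>R S' V (res SA U V x) (res SE U V y) = res SE U V (a *\<^sub>R S U x y + b *\<^sub>R S' U x y)"
    if "openin (base SA) V \<and> V \<subseteq> U" for V
  proof -
    have V: "openin (base M) V" "V \<subseteq> U" using that by simp_all
    show ?thesis
      using presheaf_res_add[OF X.pre_G U(1) V presheaf_scale[OF X.pre_G U(1) r(1), of a] presheaf_scale[OF X.pre_G U(1) r'(1), of b]]
      by (simp add: r(6)[of V] r'(6)[of V] V presheaf_res_scale[OF X.pre_G U(1) V r(1)] presheaf_res_scale[OF X.pre_G U(1) V r'(1)])
  qed
qed

lemma SE_act_lincomb: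
  assumes "openin (base M) U" "f \<in> sec M U i" "x \<in> E.secs U j" "y \<in> E.secs U j"
  shows "act SE U f (a *\<^sub>R x + b *\<^sub>R y) = a *\<^sub>R act SE U f x + b *\<^sub>R act SE U f y"
  using module_add_right[OF X.module_G assms(1,2) presheaf_scale[OF X.pre_G assms(1), of x j a] presheaf_scale[OF X.pre_G assms(1), of y j b]]
    module_scale_right[OF X.module_G assms(1,2), of x j a] module_scale_right[OF X.module_G assms(1,2), of y j b] assms(3,4) by simp

lemma bhomsI:
  assumes "bilinear_sheaf_map SA SE SE d S"
    and "\<And>U f i X k e l. openin (base M) U \<Longrightarrow> f \<in> sec M U i \<Longrightarrow> X \<in> A.secs U k \<Longrightarrow> e \<in> E.secs U l \<Longrightarrow>
      S U (act SA U f X) e = ksign (d * i) *\<^sub>R act SE U f (S U X e)"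
    and "\<And>U f i X k e l. openin (base M) U \<Longrightarrow> f \<in> sec M U i \<Longrightarrow> X \<in> A.secs U k \<Longrightarrow> e \<in> E.secs U l \<Longrightarrow>
      S U X (act SE U f e) = ksign ((d + k) * i) *\<^sub>R act SE U f (S U X e)"
  shows "S \<in> bhoms d"
  unfolding bundle_homs_def using assms(1)
  by (intro CollectI conjI allI impI; (elim conjE)?) (simp_all add: assms(2,3))

lemma bhoms_lincomb:
  assumes S: "S \<in> bhoms d" "S' \<in> bhoms d"
  shows "(\<lambda>U X e. a *\<^sub>R S U X e + b *\<^sub>R S' U X e) \<in> bhoms d"
proof (rule bhomsI[OF bilinear_lincomb[OF bhoms_bilinear[OF S(1)] bhoms_bilinear[OF S(2)]]])
  fix U f i X k e l assume U: "openin (base M) U" and f: "f \<in> sec M U i" and X: "X \<in> A.secs U k" and e: "e \<in> E.secs U l"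
  note p = graded_pairingD[OF bhoms_pairing[OF S(1)] U X e] graded_pairingD[OF bhoms_pairing[OF S(2)] U X e]
  note r = bhoms_act[OF S(1) U f X e] bhoms_act[OF S(2) U f X e]
  show "a *\<^sub>R S U (act SA U f X) e + b *\<^sub>R S' U (act SA U f X) e = ksign (d * i) *\<^sub>R act SE U f (a *\<^sub>R S U X e + b *\<^sub>R S' U X e)"
    by (simp add: r SE_act_lincomb[OF U f p] scaleR_add_right mult.commute)
  show "a *\<^sub>R S U X (act SE U f e) + b *\<^sub>R S' U X (act SE U f e) = ksign ((d + k) * i) *\<^sub>R act SE U f (a *\<^sub>R S U X e + b *\<^sub>R S' U X e)"
    by (simp add: r SE_act_lincomb[OF U f p] scaleR_add_right mult.commute)
qed

text \<open>Primitives add up: \<open>P\<close> is added to the primitive that witnesses membership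
  in the first class.\<close>

lemma bundle_hom_class_mono:
  assumes S: "P \<in> bhoms 0"
    and diff: "\<And>U k X j e. openin (base M) U \<Longrightarrow> X \<in> A.secs U k \<Longrightarrow> e \<in> E.secs U j \<Longrightarrow> S1 U X e - S2 U X e = bdiff 0 P U X e"
  shows "bundle_hom_class M QM A QA E QE S1 \<subseteq> bundle_hom_class M QM A QA E QE S2"
proof
  fix S' assume "S' \<in> bundle_hom_class M QM A QA E QE S1"
  then obtain S0 where S': "S' \<in> bhoms 1" and S0: "S0 \<in> bhoms 0"
    and 1: "\<And>U k X j e. openin (base M) U \<Longrightarrow> X \<in> A.secs U k \<Longrightarrow> e \<in> E.secs U j \<Longrightarrow> bdiff 1 S' U X e = 0 \<and> S' U X e - S1 U X e = bdiff 0 S0 U X e"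
    unfolding bundle_hom_class_def by auto
  have "bdiff 1 S' U X e = 0 \<and> S' U X e - S2 U X e = bdiff 0 (\<lambda>U X e. 1 *\<^sub>R S0 U X e + 1 *\<^sub>R P U X e) U X e"
    if "openin (base M) U" "X \<in> A.secs U k" "e \<in> E.secs U j" for U k X j e
    unfolding bdiff_lincomb[OF bhoms_pairing[OF S0] bhoms_pairing[OF S] that]
    using 1[OF that] diff[OF that] by (simp add: algebra_simps)
  then show "S' \<in> bundle_hom_class M QM A QA E QE S2"
    unfolding bundle_hom_class_def using S' bhoms_lincomb[OF S0 S, of 1 1] by auto
qed

lemma module_hom_diff_lincomb:
  assumes F: "F \<in> homs T (d, 1)" "G \<in> homs T (d, 1)" and U: "openin (base M) U" and x: "x \<in> sec m U i"
  shows "module_hom_diff Qm (d, 1) (\<lambda>U x. a *\<^sub>R F U x + b *\<^sub>R G U x) U x =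
    a *\<^sub>R module_hom_diff Qm (d, 1) F U x + b *\<^sub>R module_hom_diff Qm (d, 1) G U x"
proof -
  note Fx = sheaf_map_in[OF X.pre_m homs_map[OF F(1)] U openin_sub[OF U] x] and Gx = sheaf_map_in[OF X.pre_m homs_map[OF F(2)] U openin_sub[OF U] x]
  show ?thesis
    using Qm_add[OF U presheaf_scale[OF X.pre_m U Fx, of a] presheaf_scale[OF X.pre_m U Gx, of b]]
    by (simp add: module_hom_diff_def graded_commutator_def Qm_scale[OF U Fx] Qm_scale[OF U Gx] algebra_simps)
qed

lemma module_hom_diff_homs:
  assumes F: "F \<in> homs T (d, 1)"
  shows "module_hom_diff Qm (d, 1) F \<in> homs T (d + 1, 1)"
proof (rule homsI)
  have C: "module_hom_diff Qm (d, 1) F = (\<lambda>U x. 1 *\<^sub>R Qm U (F U x) + (- ksign (d + 1)) *\<^sub>R F U (Qm U x))"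
    by (simp add: fun_eq_iff module_hom_diff_def graded_commutator_def total_degree_def)
  show "sheaf_map m m T (d + 1, 1) (module_hom_diff Qm (d, 1) F)"
    unfolding C using sheaf_map_comp[OF X.pre_m X.pre_m homs_map[OF F] Qm_map] sheaf_map_comp[OF X.pre_m X.pre_m Qm_map homs_map[OF F]]
    by (intro sheaf_map_lincomb[OF X.pre_m X.pre_m _ _ openT]) (simp_all add: add.commute)
  fix V k q \<alpha> j x assume V: "openin (base M) V" "V \<subseteq> T" and \<alpha>: "\<alpha> \<in> P.polys V (k, q)" and x': "x \<in> sec m V j"
  then obtain j1 j2 where x: "x \<in> sec m V (j1, j2)" by (cases j) auto
  note Fx = sheaf_map_in[OF X.pre_m homs_map[OF F] V x] and Qx = Qm_in[OF V(1) x] and Q\<alpha> = Q1_poly[OF V(1) \<alpha>]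
  note FQx = sheaf_map_in[OF X.pre_m homs_map[OF F] V Qx]
  have QFx: "Qm V (F V x) \<in> sec m V (j1 + d + 1, j2 + 1)" using Qm_in[OF V(1)] Fx by simp
  have FQx': "F V (Qm V x) \<in> sec m V (j1 + d + 1, j2 + 1)" using FQx by (simp add: algebra_simps)
  have i: "act m V (Q1 (over A1 V) \<alpha>) x \<in> sec m V (k + 1 + j1, q + j2)" "act m V \<alpha> (Qm V x) \<in> sec m V (k + 1 + j1, q + j2)"
    using X.act_in[OF V(1) Q\<alpha> x] X.act_in[OF V(1) \<alpha> Qx] by (simp_all add: algebra_simps)
  have 1: "Qm V (F V (act m V \<alpha> x)) = ksign ((d + 1) * (k + q)) *\<^sub>R (act m V (Q1 (over A1 V) \<alpha>) (F V x) + ksign (k + q) *\<^sub>R act m V \<alpha> (Qm V (F V x)))"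
    using Qm_scale[OF V(1) X.act_in[OF V(1) \<alpha> Fx]] by (simp add: homs_act[OF F V \<alpha> x] Qm_act[OF V(1) \<alpha> Fx])
  have 2: "F V (Qm V (act m V \<alpha> x)) = ksign ((d + 1) * (k + 1 + q)) *\<^sub>R act m V (Q1 (over A1 V) \<alpha>) (F V x)
      + ksign (k + q) *\<^sub>R ksign ((d + 1) * (k + q)) *\<^sub>R act m V \<alpha> (F V (Qm V x))"
    using sheaf_map_add[OF X.pre_m homs_map[OF F] V i(1) presheaf_scale[OF X.pre_m V(1) i(2), of "ksign (k + q)"]]
     sheaf_map_scale[OF X.pre_m homs_map[OF F] V i(2)]
    by (simp add: Qm_act[OF V(1) \<alpha> x] homs_act[OF F V Q\<alpha> x] homs_act[OF F V \<alpha> Qx])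
  \<comment> \<open>By this identity the two terms with \<open>Q1 (over A1 V) \<alpha>\<close>
    cancel, so the differential of a linear map is linear.\<close>
  have s1: "ksign (d + 1) * ksign ((d + 1) * (k + 1 + q)) = ksign ((d + 1) * (k + q))"
  proof -
    have "(d + 1) * (k + 1 + q) = (d + 1) + (d + 1) * (k + q)" by (simp add: algebra_simps)
    then show ?thesis by (simp only: ksign_add[of "d + 1" "(d + 1) * (k + q)"] ksign_square)
  qed
  have s2: "ksign ((d + 1 + 1) * (k + q)) = ksign (k + q) * ksign ((d + 1) * (k + q))"
    unfolding distrib_right[of "d + 1" 1 "k + q"] ksign_add[of "(d + 1) * (k + q)"] by simp
  have 3: "act m V \<alpha> (module_hom_diff Qm (d, 1) F V x) = act m V \<alpha> (Qm V (F V x)) - ksign (d + 1) *\<^sub>R act m V \<alpha> (F V (Qm V x))"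
    unfolding C using X.act_add_right[OF V(1) \<alpha> QFx presheaf_scale[OF X.pre_m V(1) FQx', of "- ksign (d + 1)"]]
      X.act_scale_right[OF V(1) \<alpha> FQx', of "- ksign (d + 1)"] by simp
  have "module_hom_diff Qm (d, 1) F V (act m V \<alpha> x) = Qm V (F V (act m V \<alpha> x)) - ksign (d + 1) *\<^sub>R F V (Qm V (act m V \<alpha> x))"
    unfolding C by simp
  also have "\<dots> = ksign (k + q) *\<^sub>R ksign ((d + 1) * (k + q)) *\<^sub>R (act m V \<alpha> (Qm V (F V x)) - ksign (d + 1) *\<^sub>R act m V \<alpha> (F V (Qm V x)))"
    unfolding 1 2 scaleR_add_right scaleR_scaleR s1 by (simp add: scaleR_diff_right mult.commute mult.left_commute)
  finally show "module_hom_diff Qm (d, 1) F V (act m V \<alpha> x) = ksign ((d + 1 + 1) * (k + q)) *\<^sub>R act m V \<alpha> (module_hom_diff Qm (d, 1) F V x)"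
    unfolding 3 s2 by simp
qed

abbreviation "mclass \<equiv> module_hom_class (polynomials M A1) m Qm"

lemma module_hom_class_mono:
  assumes G: "G \<in> homs T (0, 1)"
    and diff: "\<And>U i x. openin (base M) U \<Longrightarrow> x \<in> sec m U i \<Longrightarrow> F1 U x - F2 U x = module_hom_diff Qm (0, 1) G U x"
  shows "mclass F1 \<subseteq> mclass F2"
proof
  fix F' assume "F' \<in> mclass F1"
  then obtain G0 where F': "F' \<in> homs T (1, 1)" and G0: "G0 \<in> homs T (0, 1)"
    and 1: "\<And>U i x. openin (base M) U \<and> x \<in> sec m U i \<Longrightarrow> module_hom_diff Qm (1, 1) F' U x = 0 \<and> F' U x - F1 U x = module_hom_diff Qm (0, 1) G0 U x"
    unfolding module_hom_class_def by (auto simp del: split_paired_All)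
  have c: "module_hom_diff Qm (1, 1) F' U x = 0 \<and> F' U x - F2 U x = module_hom_diff Qm (0, 1) (\<lambda>U x. 1 *\<^sub>R G0 U x + 1 *\<^sub>R G U x) U x"
    if "openin (base M) U \<and> x \<in> sec m U i" for U i x
    unfolding module_hom_diff_lincomb[OF G0 G that[THEN conjunct1] that[THEN conjunct2]]
    using 1[OF that] diff[of U x i] that by (simp add: algebra_simps)
  have "\<exists>G\<in>homs T (0, 1). \<forall>U i x. openin (base M) U \<and> x \<in> sec m U i \<longrightarrow>
      module_hom_diff Qm (1, 1) F' U x = 0 \<and> F' U x - F2 U x = module_hom_diff Qm (0, 1) G U x"
    by (intro bexI[OF _ homs_lincomb[OF openT G0 G, of 1 1]] allI impI) (rule c)
  then show "F' \<in> mclass F2"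
    unfolding module_hom_class_def poly_simps using F' by blast
qed

text \<open>The reverse inclusion uses the primitive -G.\<close>

lemma module_hom_class_eq:
  assumes G: "G \<in> homs T (0, 1)"
    and diff: "\<And>U i x. openin (base M) U \<Longrightarrow> x \<in> sec m U i \<Longrightarrow> F1 U x - F2 U x = module_hom_diff Qm (0, 1) G U x"
  shows "mclass F1 = mclass F2"
proof
  show "mclass F1 \<subseteq> mclass F2" by (rule module_hom_class_mono[OF G diff])
  show "mclass F2 \<subseteq> mclass F1"
  proof (rule module_hom_class_mono[OF homs_lincomb[OF openT G G, of "-1" 0]])
    fix U i x assume *: "openin (base M) U" "x \<in> sec m U i"
    show "F2 U x - F1 U x = module_hom_diff Qm (0, 1) (\<lambda>V x. - 1 *\<^sub>R G V x + 0 *\<^sub>R G V x) U x"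
      unfolding module_hom_diff_lincomb[OF G G *] diff[OF *, symmetric] by simp
  qed
qed

end

text \<open>Two connections have the same derivation term, so D - D' is linear over the algebra, and
  its differential is the difference of the curvatures. Hence the set under \<open>the_elem\<close>
  is a singleton.\<close>

lemma (in connection_setting) module_class_eq: "module_class M A1 dA m Qm = mclass R"
proof -
  have eq: "mclass (curvature Qm D') = mclass R" if D': "module_connection M A1 dA m D'" for D'
  proof (rule module_hom_class_eq)
    interpret D': connection_setting M QM A QA A1 E QE m tens Q1 dA Qm \<rho> br s \<iota> \<iota>m D'
      by unfold_locales (rule D')
    have "(\<lambda>U x. 1 *\<^sub>R D U x + (-1) *\<^sub>R D' U x) \<in> homs T (0, 1)"
    proof (rule homsI[OF sheaf_map_lincomb[OF X.pre_m X.pre_m D_map D'.D_map openT]])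
      fix V k q \<alpha> j x assume V: "openin (base M) V" "V \<subseteq> T" and \<alpha>: "\<alpha> \<in> P.polys V (k, q)" and x: "x \<in> sec m V j"
      note Dx = sheaf_map_in[OF X.pre_m D_map V x] and D'x = sheaf_map_in[OF X.pre_m D'.D_map V x]
      show "1 *\<^sub>R D V (act m V \<alpha> x) + - 1 *\<^sub>R D' V (act m V \<alpha> x) = ksign ((0 + 1) * (k + q)) *\<^sub>R act m V \<alpha> (1 *\<^sub>R D V x + - 1 *\<^sub>R D' V x)"
        using X.act_add_right[OF V(1) \<alpha> Dx presheaf_scale[OF X.pre_m V(1) D'x, of "-1"]] X.act_scale_right[OF V(1) \<alpha> D'x, of "-1"]
        by (simp add: D_act[OF V(1) \<alpha> x] D'.D_act[OF V(1) \<alpha> x] scaleR_diff_right)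
    qed
    then show "(\<lambda>U x. D U x - D' U x) \<in> homs T (0, 1)" by simp
    fix U i x assume U: "openin (base M) U" and x: "x \<in> sec m U i"
    note Dx = sheaf_map_in[OF X.pre_m D_map U openin_sub[OF U] x] and D'x = sheaf_map_in[OF X.pre_m D'.D_map U openin_sub[OF U] x]
    show "curvature Qm D' U x - R U x = module_hom_diff Qm (0, 1) (\<lambda>U x. D U x - D' U x) U x"
      by (simp add: R_eq D'.R_eq module_hom_diff_def graded_commutator_def total_degree_def Qm_diff[OF U Dx D'x])
  qed
  have "{mclass (curvature Qm D') | D'. module_connection M A1 dA m D'} = {mclass R}"
  proof (intro equalityI subsetI)
    fix c assume "c \<in> {mclass (curvature Qm D') | D'. module_connection M A1 dA m D'}"
    then obtain D' where "c = mclass (curvature Qm D')" "module_connection M A1 dA m D'" by blast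
    then show "c \<in> {mclass R}" using eq[of D'] by (simp only: singleton_iff)
  qed (use connection in blast)
  then show ?thesis unfolding module_class_def by simp
qed

section \<open>The Atiyah cocycle and its class\<close>

locale atiyah_setting = connection_setting +
  fixes nabla
  assumes A_connection: "A_connection M A \<rho> E nabla"
    and induced: "openin (base M) U \<Longrightarrow> X \<in> hom_sec M (lin_mod M A) (fun_mod M) U k \<Longrightarrow> e \<in> hom_sec M (lin_mod M E) (fun_mod M) U j \<Longrightarrow>
      \<iota>m U X U (D U (tens U (unity (tot A1) (over A1 U)) e)) = tens U (unity (tot A1) (over A1 U)) (nabla U X e)"
begin

abbreviation "At \<equiv> atiyah M QM A QA E QE nabla"

text \<open>At is formally the differential of nabla in degree 0, so the rules for
  \<open>bdiff\<close> apply to it.\<close>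

lemma atiyah_bdiff: "atiyah M QM A QA E QE S = bdiff 0 S"
  by (simp add: fun_eq_iff atiyah_def bundle_hom_diff_def)

lemma nabla_bilinear: "bilinear_sheaf_map SA SE SE 0 nabla"
  using A_connection by (simp add: A_connection_def)

lemmas nabla_pairing = bilinear_pairing[OF nabla_bilinear]
lemmas nabla_in = graded_pairingD[OF nabla_pairing, simplified]
lemmas At_eq = bdiff_eq[OF nabla_pairing, folded atiyah_bdiff, simplified]
lemmas At_in = bdiff_in[OF nabla_pairing, folded atiyah_bdiff, simplified]

lemma At_pairing: "graded_pairing 1 At"
  unfolding graded_pairing_def using At_in by blast

text \<open>The contractions of D(1 (x) e) with X and with QX, and that of D(1 (x) Qe) with X, are
  prescribed by nabla, so D itself never has to be evaluated.\<close>

lemma R_contracts: "contracts_to 1 R At"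
  unfolding contracts_to_def
proof (intro allI impI; elim conjE)
  fix U k X j e assume U: "openin (base M) U" and X: "X \<in> A.secs U k" and e: "e \<in> E.secs U j"
  note QX = A.section_field_in[OF U X] and Qe = E.section_field_in[OF U e]
  have i: "incl' U e \<in> sec m U (j, 0)" "incl' U (E.QS U e) \<in> sec m U (j + 1, 0)" 
    using X.incl_in[OF U, of e j] X.incl_in[OF U, of "E.QS U e" "j + 1"] e Qe by simp_all
  have Di: "D U (incl' U e) \<in> sec m U (j, 1)" using D_in[OF U i(1)] by simp
  have Di': "D U (incl' U (E.QS U e)) \<in> sec m U (j + 1, 1)" using D_in[OF U i(2)] by simp
  have QD: "Qm U (D U (incl' U e)) \<in> sec m U (j + 1, 1)" using Qm_in[OF U Di] .
  have s: "E.QS U (nabla U X e) \<in> sec SE U (k + j + 1)" "nabla U (A.QS U X) e \<in> sec SE U (k + j + 1)" "nabla U X (E.QS U e) \<in> sec SE U (k + j + 1)"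
    using E.section_field_in[OF U nabla_in[OF U X e]] nabla_in[OF U QX e] nabla_in[OF U X Qe] by (simp_all add: algebra_simps)
  have inclAt: "incl' U (At U X e) = incl' U (E.QS U (nabla U X e)) - incl' U (nabla U (A.QS U X) e) - ksign k *\<^sub>R incl' U (nabla U X (E.QS U e))"
    unfolding At_eq[OF U X e]
    using X.tens_diff_right[OF U P.unity_poly[OF U] presheaf_diff[OF X.pre_G U s(1,2)] presheaf_scale[OF X.pre_G U s(3), of "ksign k"]]
      X.tens_diff_right[OF U P.unity_poly[OF U] s(1,2)] X.tens_scale_right[OF U P.unity_poly[OF U] s(3)] by simp
  have "\<iota>m U X U (R U (incl' U e)) = - (\<iota>m U X U (Qm U (D U (incl' U e))) + \<iota>m U X U (D U (incl' U (E.QS U e))))"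
    using sheaf_map_uminus[OF X.pre_m \<iota>m_map[OF U X] U order_refl presheaf_add[OF X.pre_m U QD Di']] 
      sheaf_map_add[OF X.pre_m \<iota>m_map[OF U X] U order_refl QD Di'] by (simp add: R_eq Qm_incl[OF U e])
  also have "\<iota>m U X U (Qm U (D U (incl' U e))) = ksign (k - 1) *\<^sub>R (Qm U (\<iota>m U X U (D U (incl' U e))) - \<iota>m U (A.QS U X) U (D U (incl' U e)))"
    by (rule \<iota>m_Qm[OF U X U order_refl Di])
  also have "\<dots> = ksign (k - 1) *\<^sub>R (incl' U (E.QS U (nabla U X e)) - incl' U (nabla U (A.QS U X) e))"
    by (simp add: induced[OF U X e] induced[OF U QX e] Qm_incl[OF U nabla_in[OF U X e]])
  finally show "\<iota>m U X U (R U (incl' U e)) = ksign (k * 1) *\<^sub>R incl' U (At U X e)"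
    by (simp add: inclAt induced[OF U X Qe] ksign_diff scaleR_diff_right)
qed

text \<open>Bilinearity and compatibility with restriction are inherited from nabla. Linearity over
  functions is taken from R instead: R is linear, i_X is linear in X and in the form up to sign, and
  1 (x) e determines e. This replaces a computation with the anchor.\<close>

lemma At_homs: "At \<in> bhoms 1"
proof (rule bhomsI)
  show "bilinear_sheaf_map SA SE SE 1 At"
    unfolding bilinear_sheaf_map_def
  proof (intro allI impI; elim conjE; intro conjI allI ballI impI)
    fix U i X j e assume "openin (base SA) U" and "X \<in> sec SA U i" and "e \<in> sec SE U j"
    then have U: "openin (base M) U" "openin (base SA) U" and X: "X \<in> A.secs U i" "X \<in> sec SA U i" and e: "e \<in> E.secs U j" "e \<in> sec SE U j" by simp_all
    have QX: "A.QS U X \<in> sec SA U (i + 1)" and Qe: "E.QS U e \<in> sec SE U (j + 1)" 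
      using A.section_field_in[OF U(1) X(1)] E.section_field_in[OF U(1) e(1)] by simp_all
    note r = bilinear_rules[OF nabla_bilinear U(2) X(2) e(2)] and rX = bilinear_rules[OF nabla_bilinear U(2) QX e(2)] and re = bilinear_rules[OF nabla_bilinear U(2) X(2) Qe]
    note n = nabla_in[OF U(1) X(1) e(1)]
    show "At U X e \<in> sec SE U (i + j + 1)" using At_in[OF U(1) X(1) e(1)] by simp
    have sc: "c *\<^sub>R X \<in> A.secs U i" "c *\<^sub>R e \<in> E.secs U j" for c
      using presheaf_scale[OF pre_SA U(1) X(2)] presheaf_scale[OF X.pre_G U(1) e(2)] by simp_all
    show "At U (c *\<^sub>R X) e = c *\<^sub>R At U X e" for c
      by (simp add: At_eq[OF U(1) sc(1) e(1)] At_eq[OF U(1) X(1) e(1)] r(2) re(2) rX(2) E.section_field_scale[OF U(1) n] A.section_field_scale[OF U(1) X(1)] algebra_simps)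
    show "At U X (c *\<^sub>R e) = c *\<^sub>R At U X e" for c
      by (simp add: At_eq[OF U(1) X(1) sc(2)] At_eq[OF U(1) X(1) e(1)] r(3) re(3) rX(3) E.section_field_scale[OF U(1) n] E.section_field_scale[OF U(1) e(1)] algebra_simps)
    show "At U (X + X') e = At U X e + At U X' e" if X': "X' \<in> sec SA U i" for X'
    proof -
      have X1: "X' \<in> A.secs U i" "X + X' \<in> A.secs U i" "A.QS U X' \<in> sec SA U (i + 1)"
        using X' presheaf_add[OF pre_SA U(1) X(2) X'] A.section_field_in[OF U(1), of X' i] by simp_all
      show ?thesis
        unfolding At_eq[OF U(1) X1(2) e(1)] At_eq[OF U(1) X(1) e(1)] At_eq[OF U(1) X1(1) e(1)] r(4)[OF X'] re(4)[OF X']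
          A.section_field_add[OF U(1) X(1) X1(1)] rX(4)[OF X1(3)] E.section_field_add[OF U(1) n nabla_in[OF U(1) X1(1) e(1)]]
        by (simp add: algebra_simps)
    qed
    show "At U X (e + e') = At U X e + At U X e'" if e': "e' \<in> sec SE U j" for e'
    proof -
      have e1: "e' \<in> E.secs U j" "e + e' \<in> E.secs U j" "E.QS U e' \<in> sec SE U (j + 1)"
        using e' presheaf_add[OF X.pre_G U(1) e(2) e'] E.section_field_in[OF U(1), of e' j] by simp_all
      show ?thesis
        unfolding At_eq[OF U(1) X(1) e1(2)] At_eq[OF U(1) X(1) e(1)] At_eq[OF U(1) X(1) e1(1)] r(5)[OF e'] rX(5)[OF e']
          E.section_field_add[OF U(1) e(1) e1(1)] re(5)[OF e1(3)] E.section_field_add[OF U(1) n nabla_in[OF U(1) X(1) e1(1)]]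
        by (simp add: algebra_simps)
    qed
    show "At V (res SA U V X) (res SE U V e) = res SE U V (At U X e)" if "openin (base SA) V \<and> V \<subseteq> U" for V
    proof -
      have V: "openin (base M) V" "V \<subseteq> U" "openin (base SA) V" using that by simp_all
      have rXe: "res SA U V X \<in> A.secs V i" "res SE U V e \<in> E.secs V j"
        using presheaf_res_in[OF pre_SA U(1) V(1,2) X(2)] presheaf_res_in[OF X.pre_G U(1) V(1,2) e(2)] by simp_all
      have s: "E.QS U (nabla U X e) \<in> sec SE U (i + j + 1)" "nabla U (A.QS U X) e \<in> sec SE U (i + j + 1)" "nabla U X (E.QS U e) \<in> sec SE U (i + j + 1)"
        using E.section_field_in[OF U(1) n] rX(1) re(1) by (simp_all add: algebra_simps)
      show ?thesis
        using presheaf_res_diff[OF X.pre_G U(1) V(1,2) presheaf_diff[OF X.pre_G U(1) s(1,2)] presheaf_scale[OF X.pre_G U(1) s(3), of "ksign i"]]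
          presheaf_res_diff[OF X.pre_G U(1) V(1,2) s(1,2)] presheaf_res_scale[OF X.pre_G U(1) V(1,2) s(3)]
        by (simp add: At_eq[OF V(1) rXe] At_eq[OF U(1) X(1) e(1)] r(6)[OF V(3,2)] A.section_field_res'[OF U(1) X(1) V(1,2)] E.section_field_res'[OF U(1) e(1) V(1,2)]
          rX(6)[OF V(3,2)] re(6)[OF V(3,2)] E.section_field_res'[OF U(1) n V(1,2)])
    qed
  qed
  fix U f i X k e l assume U: "openin (base M) U" and f: "f \<in> sec M U i" and X: "X \<in> A.secs U k" and e: "e \<in> E.secs U l"
  have inc: "incl' U e \<in> sec m U (l, 0)" using X.incl_in[OF U, of e l] e by simp
  have Ri: "R U (incl' U e) \<in> sec m U (l + 1, 1)" using sheaf_map_in[OF X.pre_m R_map U openin_sub[OF U] inc] by simp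
  have fX: "act SA U f X \<in> A.secs U (i + k)" and fe: "act SE U f e \<in> E.secs U (i + l)"
    using A.section_act_in[OF U f X] E.section_act_in[OF U f e] .
  note at = At_in[OF U X e]
  have fat: "act SE U f (At U X e) \<in> E.secs U (i + (k + l + 1))" by (rule E.section_act_in[OF U f at])
  have ifat: "act m U (pull A1 U f) (incl' U (At U X e)) = incl' U (act SE U f (At U X e))"
    using X.incl_act[OF U _ P.pull_poly[OF U f], of "At U X e" "k + l + 1"] X.incl_pull[OF U _ f, of "At U X e" "k + l + 1"] at by simp
  have iat: "incl' U (At U X e) \<in> sec m U (k + l + 1, 0)" using X.incl_in[OF U, of "At U X e" "k + l + 1"] at by simp
  have resf: "res M U U f = f" by (rule presheaf_res_id[OF A.pre_ring U f])
  have isc: "c *\<^sub>R incl' U (act SE U f (At U X e)) = incl' U (c *\<^sub>R act SE U f (At U X e))" for c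
    using X.tens_scale_right[OF U P.unity_poly[OF U], of "act SE U f (At U X e)" "i + (k + l + 1)" c] fat by simp
  have scin: "c *\<^sub>R act SE U f (At U X e) \<in> E.secs U (i + (k + l + 1))" for c
    using presheaf_scale[OF X.pre_G U, of "act SE U f (At U X e)"] fat by simp
  have "ksign (i + k) *\<^sub>R incl' U (At U (act SA U f X) e) = act m U (pull A1 U f) (\<iota>m U X U (R U (incl' U e)))"
    using contracts_toD[OF R_contracts U fX e] \<iota>m_act[OF U X f U order_refl Ri] resf by simp
  also have "\<dots> = ksign k *\<^sub>R incl' U (act SE U f (At U X e))"
    using contracts_toD[OF R_contracts U X e] X.act_scale_right[OF U P.pull_poly[OF U f] iat] ifat by simp
  finally have "incl' U (At U (act SA U f X) e) = incl' U (ksign i *\<^sub>R act SE U f (At U X e))"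
    unfolding isc[symmetric] ksign_scaleR_eq_iff by (simp add: ksign_add mult.assoc)
  moreover have "At U (act SA U f X) e \<in> E.secs U (i + (k + l + 1))" using At_in[OF U fX e] by (simp add: algebra_simps)
  ultimately show "At U (act SA U f X) e = ksign (1 * i) *\<^sub>R act SE U f (At U X e)"
    using incl_inj[OF U _ scin] by simp
  have "ksign k *\<^sub>R incl' U (At U X (act SE U f e)) = \<iota>m U X U (act m U (pull A1 U f) (R U (incl' U e)))"
    using contracts_toD[OF R_contracts U X fe] X.incl_act[OF U _ P.pull_poly[OF U f], of e l] X.incl_pull[OF U _ f, of e l] e
      R_act[OF U P.pull_poly[OF U f] inc] by simp
  also have "\<dots> = ksign ((k - 1) * i) *\<^sub>R ksign k *\<^sub>R incl' U (act SE U f (At U X e))"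
    using contracts_toD[OF R_contracts U X e] \<iota>m_pull[OF U X U order_refl f Ri] X.act_scale_right[OF U P.pull_poly[OF U f] iat] ifat by simp
  finally have "incl' U (At U X (act SE U f e)) = incl' U (ksign ((k - 1) * i) *\<^sub>R act SE U f (At U X e))"
    unfolding isc[symmetric] ksign_scaleR_eq_iff by (simp add: mult.left_commute)
  moreover have "At U X (act SE U f e) \<in> E.secs U (i + (k + l + 1))" using At_in[OF U X fe] by (simp add: algebra_simps)
  moreover have "ksign ((k - 1) * i) = ksign ((1 + k) * i)" by (simp add: ksign_def)
  ultimately show "At U X (act SE U f e) = ksign ((1 + k) * i) *\<^sub>R act SE U f (At U X e)"
    using incl_inj[OF U _ scin] by simp
qed

text \<open>The identity [Q_m, R] = 0 is transported by \<open>contracts_diff\<close>, and 1 (x) e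
  determines e.\<close>

lemma At_closed:
  assumes U: "openin (base M) U" and X: "X \<in> A.secs U k" and e: "e \<in> E.secs U j"
  shows "bdiff 1 At U X e = 0"
proof -
  have i: "incl' U e \<in> sec m U (j, 0)" using X.incl_in[OF U, of e j] e by simp
  have "module_hom_diff Qm (1, 1) R U (incl' U e) = 0"
    using R_Qm[OF U i] by (simp add: module_hom_diff_def graded_commutator_def total_degree_def ksign_def)
  then have "incl' U (bdiff 1 At U X e) = 0"
    using contracts_diff[OF R_map R_contracts graded_pairingD[OF At_pairing] U X e] sheaf_map_0[OF X.pre_m \<iota>m_map[OF U X] U order_refl] by simp
  then show ?thesis using incl_eq_0[OF U bdiff_in[OF At_pairing U X e]] by blast
qed

text \<open>In the difference of two connections the anchor terms cancel, so it is a tensor, and its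
  differential is the difference of the Atiyah cocycles.\<close>

lemma atiyah_class_eq: "atiyah_class M QM A QA \<rho> E QE = bundle_hom_class M QM A QA E QE At"
proof -
  have le: "bundle_hom_class M QM A QA E QE (atiyah M QM A QA E QE N1) \<subseteq> bundle_hom_class M QM A QA E QE (atiyah M QM A QA E QE N2)"
    if N1: "A_connection M A \<rho> E N1" and N2: "A_connection M A \<rho> E N2" for N1 N2
  proof -
    have b: "bilinear_sheaf_map SA SE SE 0 N1" "bilinear_sheaf_map SA SE SE 0 N2"
      using N1 N2 by (simp_all add: A_connection_def)
    have lin: "N U (act SA U f X) e = act SE U f (N U X e) \<and> 
        N U X (act SE U f e) = ksign (k * i) *\<^sub>R act SE U f (N U X e) + act SE U (\<rho> U X f) e"
      if N: "A_connection M A \<rho> E N" and "openin (base M) U" "f \<in> sec M U i" "X \<in> A.secs U k" "e \<in> E.secs U l" for N U f i X k e l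
      using N[unfolded A_connection_def, THEN conjunct2, THEN spec[of _ U], THEN spec[of _ i], THEN spec[of _ f], THEN spec[of _ k], THEN spec[of _ X],
          THEN spec[of _ l], THEN spec[of _ e]] that(2-) by simp
    have "(\<lambda>U X e. 1 *\<^sub>R N1 U X e + (-1) *\<^sub>R N2 U X e) \<in> bhoms 0"
    proof (rule bhomsI[OF bilinear_lincomb[OF b]])
      fix U f i X k e l assume *: "openin (base M) U" "f \<in> sec M U i" "X \<in> A.secs U k" "e \<in> E.secs U l"
      note p = graded_pairingD[OF bilinear_pairing[OF b(1)] *(1,3,4)] graded_pairingD[OF bilinear_pairing[OF b(2)] *(1,3,4)]
      note l = lin[OF N1 *] lin[OF N2 *]
      show "1 *\<^sub>R N1 U (act SA U f X) e + - 1 *\<^sub>R N2 U (act SA U f X) e = ksign (0 * i) *\<^sub>R act SE U f (1 *\<^sub>R N1 U X e + - 1 *\<^sub>R N2 U X e)"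
        unfolding SE_act_lincomb[OF *(1,2) p] using l by simp
      show "1 *\<^sub>R N1 U X (act SE U f e) + - 1 *\<^sub>R N2 U X (act SE U f e) = ksign ((0 + k) * i) *\<^sub>R act SE U f (1 *\<^sub>R N1 U X e + - 1 *\<^sub>R N2 U X e)"
        unfolding SE_act_lincomb[OF *(1,2) p] using l by (simp add: scaleR_diff_right)
    qed
    then show ?thesis
    proof (rule bundle_hom_class_mono)
      fix U k X j e assume *: "openin (base M) U" "X \<in> A.secs U k" "e \<in> E.secs U j"
      show "atiyah M QM A QA E QE N1 U X e - atiyah M QM A QA E QE N2 U X e = bdiff 0 (\<lambda>U X e. 1 *\<^sub>R N1 U X e + (-1) *\<^sub>R N2 U X e) U X e"
        unfolding atiyah_bdiff bdiff_lincomb[OF bilinear_pairing[OF b(1)] bilinear_pairing[OF b(2)] *] by simp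
    qed
  qed
  have "{bundle_hom_class M QM A QA E QE (atiyah M QM A QA E QE N) | N. A_connection M A \<rho> E N} = {bundle_hom_class M QM A QA E QE At}"
    using le A_connection by (auto intro!: subset_antisym)
  then show ?thesis unfolding atiyah_class_def by simp
qed

text \<open>Makes the class non-empty, without which its image could not be a singleton. The
  primitive 0 is written as a combination of nabla with coefficients 0, so that the rules for
  combinations apply.\<close>

lemma At_in_class: "At \<in> bundle_hom_class M QM A QA E QE At"
proof -
  have "bilinear_sheaf_map SA SE SE 0 (\<lambda>U X e. 0 *\<^sub>R nabla U X e + 0 *\<^sub>R nabla U X e)"
    by (rule bilinear_lincomb[OF nabla_bilinear nabla_bilinear])
  then have z: "(\<lambda>U X e. 0 *\<^sub>R nabla U X e + 0 *\<^sub>R nabla U X e) \<in> bhoms 0"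
  proof (rule bhomsI)
    fix U f i X k e l assume *: "openin (base M) U" "f \<in> sec M U i" "X \<in> A.secs U k" "e \<in> E.secs U l"
    have "act SE U f 0 = 0" using module_zero_right[OF X.module_G *(1,2)] .
    then show "0 *\<^sub>R nabla U (act SA U f X) e + 0 *\<^sub>R nabla U (act SA U f X) e = ksign (0 * i) *\<^sub>R act SE U f (0 *\<^sub>R nabla U X e + 0 *\<^sub>R nabla U X e)"
      and "0 *\<^sub>R nabla U X (act SE U f e) + 0 *\<^sub>R nabla U X (act SE U f e) = ksign ((0 + k) * i) *\<^sub>R act SE U f (0 *\<^sub>R nabla U X e + 0 *\<^sub>R nabla U X e)"
      by simp_all
  qed
  have "\<exists>S\<in>bhoms 0. \<forall>U k X j e. openin (base M) U \<and> X \<in> sec SA U k \<and> e \<in> sec SE U j \<longrightarrow>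
      bdiff 1 At U X e = 0 \<and> At U X e - At U X e = bdiff 0 S U X e"
  proof (intro bexI[OF _ z] allI impI; elim conjE)
    fix U k X j e assume "openin (base M) U" "X \<in> sec SA U k" "e \<in> sec SE U j"
    then have *: "openin (base M) U" "X \<in> A.secs U k" "e \<in> E.secs U j" by simp_all
    show "bdiff 1 At U X e = 0 \<and> At U X e - At U X e = bdiff 0 (\<lambda>U X e. 0 *\<^sub>R nabla U X e + 0 *\<^sub>R nabla U X e) U X e"
      unfolding bdiff_lincomb[OF nabla_pairing nabla_pairing *] by (simp add: At_closed[OF *])
  qed
  then show ?thesis unfolding bundle_hom_class_def using At_homs by blast
qed

end

section \<open>Forms with values in endomorphisms\<close>

locale forms_setting = dg_setting M QM A QA A1 E QE m tens Q1 dA Qm \<rho> br s \<iota> \<iota>m +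
    Y: tensor_module M A1 "endos M E" n tensn
  for M :: "('p, int, 'f::real_algebra) gring" and QM :: "'p set \<Rightarrow> 'f \<Rightarrow> 'f"
    and A :: "('p, 'f, 'q, 'g::real_algebra) vbundle" and QA :: "'q set \<Rightarrow> 'g \<Rightarrow> 'g"
    and A1 :: "('p, 'f, 'r, 'h::real_algebra) vbundle"
    and E :: "('p, 'f, 's, 'l::real_algebra) vbundle" and QE :: "'s set \<Rightarrow> 'l \<Rightarrow> 'l"
    and m :: "('p, int \<times> int, 'h, 'm::real_vector) gmod" and tens
    and Q1 dA :: "'r set \<Rightarrow> 'h \<Rightarrow> 'h" and Qm :: "'p set \<Rightarrow> 'm \<Rightarrow> 'm" and \<rho> br s \<iota> \<iota>m
    and n :: "('p, int \<times> int, 'h, 'n::real_vector) gmod" and tensn +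
  fixes \<mu>
  assumes hom_iso: "hom_iso M A1 E m tens n tensn \<mu>"
begin

abbreviation "EE \<equiv> endos M E"

lemma mu_rules:
  assumes "openin (base M) U" "x \<in> sec n U d"
  shows "\<mu> U x \<in> homs U d \<and>
       (\<forall>V j \<xi>. openin (base M) V \<and> V \<subseteq> U \<and> \<xi> \<in> sec m V j \<longrightarrow>
          (\<forall>c. \<mu> U (c *\<^sub>R x) V \<xi> = c *\<^sub>R \<mu> U x V \<xi>) \<and>
          (\<forall>y\<in>sec n U d. \<mu> U (x + y) V \<xi> = \<mu> U x V \<xi> + \<mu> U y V \<xi>) \<and>
          \<mu> V (res n U V x) V \<xi> = \<mu> U x V \<xi>)"
  by (rule hom_iso[unfolded hom_iso_def, THEN conjunct1, THEN spec, THEN spec, THEN spec, THEN mp]) (use assms in simp)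

lemma mu_homs: "openin (base M) U \<Longrightarrow> x \<in> sec n U d \<Longrightarrow> \<mu> U x \<in> homs U d"
  by (rule mu_rules[THEN conjunct1])

lemma mu_linear:
  assumes "openin (base M) U" "x \<in> sec n U d" "openin (base M) V" "V \<subseteq> U" "\<xi> \<in> sec m V j"
  shows "\<mu> U (c *\<^sub>R x) V \<xi> = c *\<^sub>R \<mu> U x V \<xi>"
    and "y \<in> sec n U d \<Longrightarrow> \<mu> U (x + y) V \<xi> = \<mu> U x V \<xi> + \<mu> U y V \<xi>"
    and "\<mu> V (res n U V x) V \<xi> = \<mu> U x V \<xi>"
  using mu_rules[OF assms(1,2), THEN conjunct2, THEN spec[of _ V], THEN spec[of _ j], THEN spec[of _ \<xi>]] assms(3-) by auto

lemma mu_tens: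
  assumes "openin (base M) U" "\<alpha> \<in> P.polys U i" "\<Phi> \<in> sec EE U d" "e \<in> E.secs U j"
  shows "\<mu> U (tensn U \<alpha> \<Phi>) U (incl' U e) = tens U \<alpha> (\<Phi> U e)"
  using hom_iso[unfolded hom_iso_def, THEN conjunct2, THEN spec[of _ U], THEN spec[of _ i], THEN spec[of _ \<alpha>], THEN spec[of _ d],
     THEN spec[of _ \<Phi>], THEN spec[of _ j], THEN spec[of _ e]] assms by simp

lemma mu_sum:
  assumes U: "openin (base M) U" and V: "openin (base M) V" "V \<subseteq> U" and \<xi>: "\<xi> \<in> sec m V j"
    and x: "\<And>r. r \<in> J \<Longrightarrow> x r \<in> sec n U d"
  shows "\<mu> U (\<Sum>r\<in>J. x r) V \<xi> = (\<Sum>r\<in>J. \<mu> U (x r) V \<xi>)"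
  using x
proof (induction J rule: infinite_finite_induct)
  case (insert r J)
  then show ?case
    using mu_linear(2)[OF U _ V \<xi>, of "x r" d "\<Sum>r\<in>J. x r"] presheaf_sum[OF Y.pre_m U, of J x d] by simp
qed (use mu_linear(1)[OF U presheaf_0[OF Y.pre_m U] V \<xi>, of 0] in auto)

lemma mu_res:
  assumes U: "openin (base M) U" and V: "openin (base M) V" "V \<subseteq> U" and W: "openin (base M) W" "W \<subseteq> V"
    and x: "x \<in> sec n U d" and \<xi>: "\<xi> \<in> sec m W j"
  shows "\<mu> V (res n U V x) W \<xi> = \<mu> U x W \<xi>"
  using mu_linear(3)[OF V(1) presheaf_res_in[OF Y.pre_m U V x] W \<xi>] mu_linear(3)[OF U x W(1) subset_trans[OF W(2) V(2)] \<xi>]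
    presheaf_res_res[OF Y.pre_m U V(1) W V(2) x] by simp

text \<open>
  Although \<open>hom_iso\<close> does not demand it, \<open>\<mu>\<close> is injective, since elementary endomorphisms are a
  local frame of \<open>End E\<close> and the tensor product with a free module is free.
\<close>

lemma mu_eq_0:
  assumes U: "openin (base M) U" and x: "x \<in> sec n U (k, p)"
    and 0: "\<And>V e j. openin (base M) V \<Longrightarrow> V \<subseteq> U \<Longrightarrow> e \<in> E.secs V j \<Longrightarrow> \<mu> U x V (incl' V e) = 0"
  shows "x = 0"
proof (rule sheaf_eqI[OF Y.sheaf_m U x presheaf_0[OF Y.pre_m U]])
  fix y assume y: "y \<in> U"
  obtain V d g and I :: "(nat \<times> unit) set" where V: "openin (base M) V" "y \<in> V" "V \<subseteq> U" and fr: "frame_on M SE V I d g"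
    by (rule E.section_frame_at[OF U y])
  interpret Fr: framed_tensor M A1 SE m tens V I d g
    using fr X.tensor_module_axioms by (intro framed_tensor.intro)
  interpret T2: two_frames M SE SE V I d g I d g
    by (intro two_frames.intro fr)
  interpret Fn: framed_tensor M A1 EE n tensn V "I \<times> I" "\<lambda>(i, j). d j - d i" T2.elementary
    using T2.frame_hom Y.tensor_module_axioms by (intro framed_tensor.intro)
  obtain W \<beta> where W: "openin (base M) W" "y \<in> W" "W \<subseteq> V"
    and \<beta>: "\<And>ij. ij \<in> I \<times> I \<Longrightarrow> \<beta> ij \<in> P.polys W (k - (case ij of (i, j) \<Rightarrow> d j - d i), p)"
    and xW: "res n V W (res n U V x) = (\<Sum>ij\<in>I \<times> I. tensn W (\<beta> ij) (Fn.F.basis W ij))"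
    by (rule Fn.tens_expand[OF V(1) order_refl presheaf_res_in[OF Y.pre_m U V(1,3) x] V(2)]) (rule that)
  have WU: "W \<subseteq> U" using W V by blast
  have xW': "res n U W x = (\<Sum>ij\<in>I \<times> I. tensn W (\<beta> ij) (Fn.F.basis W ij))"
    using xW presheaf_res_res[OF Y.pre_m U V(1) W(1,3) V(3) x] by simp
  have "\<beta> (l, j) = 0" if l: "l \<in> I" and j: "j \<in> I" for l j
  proof -
    have gl: "Fr.F.basis W l \<in> sec SE W (d l)" by (rule Fr.F.basis_in[OF W(1,3) l])
    then have gl': "Fr.F.basis W l \<in> E.secs W (d l)" by simp
    have tin: "tensn W (\<beta> ij) (Fn.F.basis W ij) \<in> sec n W (k, p)" if "ij \<in> I \<times> I" for ij
      using Y.tens_in[OF W(1) \<beta>[OF that] Fn.F.basis_in[OF W(1,3) that]] by simp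
    have val: "Fn.F.basis W (i, j) W (Fr.F.basis W l) = (if i = l then Fr.F.basis W j else 0)" if "i \<in> I" "j \<in> I" for i j
      using T2.elementary_basis[OF W(1,3) that l] gl W(1) by (simp add: hom_mod_simps(3)[of M SE] hom_ext_apply[where i = "d l"])
    \<comment> \<open>Evaluation at the l-th frame element of E keeps only row l of the
      coefficients; \<open>Fr.tens_independent\<close> then separates the entries of that
      row.\<close>
    have "0 = \<mu> W (res n U W x) W (incl' W (Fr.F.basis W l))"
      using mu_linear(3)[OF U x W(1) WU X.incl_in[OF W(1) gl]] 0[OF W(1) WU gl'] by simp
    also have "\<dots> = (\<Sum>ij\<in>I \<times> I. \<mu> W (tensn W (\<beta> ij) (Fn.F.basis W ij)) W (incl' W (Fr.F.basis W l)))"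
      unfolding xW' by (rule mu_sum[OF W(1) W(1) order_refl X.incl_in[OF W(1) gl] tin])
    also have "\<dots> = (\<Sum>i\<in>I. \<Sum>j\<in>I. \<mu> W (tensn W (\<beta> (i, j)) (Fn.F.basis W (i, j))) W (incl' W (Fr.F.basis W l)))"
      by (simp add: sum.cartesian_product case_prod_beta)
    also have "\<dots> = (\<Sum>i\<in>I. \<Sum>j\<in>I. if i = l then tens W (\<beta> (i, j)) (Fr.F.basis W j) else 0)"
    proof (intro sum.cong refl)
      fix i j assume i: "i \<in> I" and j: "j \<in> I"
      then have b: "\<beta> (i, j) \<in> P.polys W (k - (d j - d i), p)" and e: "Fn.F.basis W (i, j) \<in> sec EE W (d j - d i)"
        using \<beta>[of "(i, j)"] Fn.F.basis_in[OF W(1,3), of "(i, j)"] by simp_all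
      show "\<mu> W (tensn W (\<beta> (i, j)) (Fn.F.basis W (i, j))) W (incl' W (Fr.F.basis W l)) = (if i = l then tens W (\<beta> (i, j)) (Fr.F.basis W j) else 0)"
        unfolding mu_tens[OF W(1) b e gl'] val[OF i j] by (simp add: X.tens_0_right[OF W(1) b])
    qed
    also have "\<dots> = (\<Sum>j\<in>I. tens W (\<beta> (l, j)) (Fr.F.basis W j))"
      by (subst sum_delta_eq[OF Fr.F.finite_index l]) auto
    finally have s: "(\<Sum>j\<in>I. tens W (\<beta> (l, j)) (Fr.F.basis W j)) = 0" by simp
    show ?thesis
      by (rule Fr.tens_independent[OF W(1,3) _ s j, where k = "k + d l" and p = p]) (use \<beta>[of "(l, _)"] l in \<open>simp add: algebra_simps\<close>)
  qed
  then have "tensn W (\<beta> ij) (Fn.F.basis W ij) = 0" if "ij \<in> I \<times> I" for ij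
    using Y.tens_0_left[OF W(1) Fn.F.basis_in[OF W(1,3) that]] that by (cases ij) auto
  then have "res n U W x = 0" unfolding xW' by simp
  then show "\<exists>W. openin (base M) W \<and> y \<in> W \<and> W \<subseteq> U \<and> res n U W x = res n U W 0"
    using W WU presheaf_res_0[OF Y.pre_m U] by auto
qed

text \<open>Injectivity of \<open>\<mu>\<close> combined with the fact that elements of m of
  polynomial degree 1 are determined by their contractions. It yields both the uniqueness of forms
  and their agreement on overlaps.\<close>

lemma form_eq_0:
  assumes U: "openin (base M) U" and x: "x \<in> sec n U (d, 1)"
    and 0: "\<And>V k X e j. openin (base M) V \<Longrightarrow> V \<subseteq> U \<Longrightarrow> X \<in> A.secs V k \<Longrightarrow> e \<in> E.secs V j \<Longrightarrow> \<iota>m V X V (\<mu> U x V (incl' V e)) = 0"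
  shows "x = 0"
proof (rule mu_eq_0[OF U x])
  fix V e j assume V: "openin (base M) V" "V \<subseteq> U" and e: "e \<in> E.secs V j"
  note map = homs_map[OF mu_homs[OF U x]]
  have i: "incl' V e \<in> sec m V (j, 0)" using X.incl_in[OF V(1), of e j] e by simp
  have in1: "\<mu> U x V (incl' V e) \<in> sec m V (j + d, 1)" using sheaf_map_in[OF X.pre_m map V i] by simp
  show "\<mu> U x V (incl' V e) = 0"
  proof (rule contractions_eq_0'[OF V(1) in1])
    fix W l X assume W: "openin (base M) W" "W \<subseteq> V" and X: "X \<in> A.secs W l"
    have re: "res SE V W e \<in> E.secs W j" using presheaf_res_in[OF X.pre_G V(1) W, of e j] e by simp
    have "res m V W (\<mu> U x V (incl' V e)) = \<mu> U x W (incl' W (res SE V W e))"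
      using sheaf_map_res[OF X.pre_m map V W i] X.incl_res[OF V(1) W, of e j] e by simp
    then show "\<iota>m W X W (res m V W (\<mu> U x V (incl' V e))) = 0"
      using 0[OF W(1) subset_trans[OF W(2) V(2)] X re] by simp
  qed
qed

text \<open>In a dual frame the form is, up to signs, the sum of the tensors of
  \<open>s V (\<epsilon> i)\<close> with the endomorphisms S(X_i, -). Contraction with Z produces
  the coefficients Z(\<epsilon>_i) of Z in the frame, and linearity of S recovers S(Z, e).\<close>

lemma local_form:
  assumes S: "S \<in> bhoms d" and df: "A.dual_frame V N dg \<epsilon> X" and V: "openin (base M) V"
  obtains x where "x \<in> sec n V (d, 1)"
    "\<And>W k X e j. openin (base M) W \<Longrightarrow> W \<subseteq> V \<Longrightarrow> X \<in> A.secs W k \<Longrightarrow> e \<in> E.secs W j \<Longrightarrow>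
       \<iota>m W X W (\<mu> V x W (incl' W e)) = ksign (k * d) *\<^sub>R incl' W (S W X e)"
proof -
  have \<epsilon>: "\<epsilon> i \<in> lin A V (dg i)" and X: "X i \<in> A.secs V (- dg i)" if "i < N" for i
    using df that by (simp_all add: A.dual_frame_def)
  have expand: "Z = (\<Sum>i<N. act SA W (Z W (A.tres V W (\<epsilon> i))) (res SA V W (X i)))"
    if "openin (base M) W" "W \<subseteq> V" "Z \<in> A.secs W k" for W Z k
    using df[unfolded A.dual_frame_def, THEN conjunct2, THEN conjunct2, THEN spec[of _ W], THEN spec[of _ Z], THEN spec[of _ k]] that by simp
  note Sb = bhoms_bilinear[OF S]
  have rX: "res SA V W (X i) \<in> A.secs W (- dg i)" if "openin (base M) W" "W \<subseteq> V" "i < N" for W i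
    using presheaf_res_in[OF pre_SA V that(1,2), of "X i" "- dg i"] X[OF that(3)] by simp
  have SXin: "S W (res SA V W (X i)) e \<in> sec SE W (j + (d - dg i))" if "openin (base M) W" "W \<subseteq> V" "i < N" "e \<in> sec SE W j" for W i e j
    using graded_pairingD[OF bhoms_pairing[OF S] that(1) rX[OF that(1-3)], of e j] that(4) by (simp add: algebra_simps)
  \<comment> \<open>The endomorphism S(X_i, -); over a smaller open set X_i has to be restricted
    first.\<close>
  define \<Phi> where "\<Phi> = (\<lambda>i. hom_ext SE V (\<lambda>W e. S W (res SA V W (X i)) e))"
  have \<Phi>: "\<Phi> i \<in> sec EE V (d - dg i)" if i: "i < N" for i
  proof -
    have "hom_ext SE V (\<lambda>W e. S W (res SA V W (X i)) e) \<in> hom_sec M SE SE V (d - dg i)"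
    proof (rule hom_ext_in_hom_sec[OF X.module_G])
      show "sheaf_map SE SE V (d - dg i) (\<lambda>W. S W (res SA V W (X i)))"
      proof (rule sheaf_mapI[OF presheaf_base[OF X.pre_G]], goal_cases)
        case (1 W j e)
        then show ?case using SXin[OF 1(1,2) i 1(3)] by simp
      next
        case (2 W j e c)
        then show ?case using bilinear_rules(3)[OF Sb, of W "res SA V W (X i)" "- dg i" e j] rX[OF 2(1,2) i] by simp
      next
        case (3 W j e e')
        then show ?case using bilinear_rules(5)[OF Sb, of W "res SA V W (X i)" "- dg i" e j e'] rX[OF 3(1,2) i] by simp
      next
        case (4 W W' j e)
        then show ?case using bilinear_rules(6)[OF Sb, of W "res SA V W (X i)" "- dg i" e j W'] rX[OF 4(1,2) i]
          presheaf_res_res[OF pre_SA V 4(1,3,4,2), of "X i" "- dg i"] X[OF i] by simp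
      qed
      fix W l f e j assume W: "openin (base M) W" "W \<subseteq> V" and f: "f \<in> sec M W l" and "e \<in> sec SE W j"
      then show "S W (res SA V W (X i)) (act SE W f e) = ksign ((d - dg i) * l) *\<^sub>R act SE W f (S W (res SA V W (X i)) e)"
        using bhoms_act(2)[OF S W(1) f rX[OF W i], of e j] by simp
    qed
    then show ?thesis by (simp add: \<Phi>_def)
  qed
  have s\<epsilon>: "s W (A.tres V W (\<epsilon> i)) \<in> P.polys W (dg i, 1)" and \<epsilon>W: "A.tres V W (\<epsilon> i) \<in> lin A W (dg i)"
    if "openin (base M) W" "W \<subseteq> V" "i < N" for W i
  proof -
    show e: "A.tres V W (\<epsilon> i) \<in> lin A W (dg i)"
      using presheaf_res_in[OF A.pre_lin V that(1,2), of "\<epsilon> i" "dg i"] \<epsilon>[OF that(3)] by simp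
    show "s W (A.tres V W (\<epsilon> i)) \<in> P.polys W (dg i, 1)"
      using P.lin_poly[OF that(1) s_in[OF that(1) e]] by simp
  qed
  have s\<epsilon>V: "s V (\<epsilon> i) \<in> P.polys V (dg i, 1)" if "i < N" for i
    using P.lin_poly[OF V s_in[OF V \<epsilon>[OF that]]] by simp
  have t: "tensn V (s V (\<epsilon> i)) (\<Phi> i) \<in> sec n V (d, 1)" if "i \<in> {..<N}" for i
    using Y.tens_in[OF V s\<epsilon>V \<Phi>, of i i] that by simp
  \<comment> \<open>The sign (-1)^(d dg_i) makes up for the difference between (-1)^(kd), demanded
    of the form, and (-1)^(d (dg_i + k)), which arises when S passes the function Z(\<epsilon>_i) of
    degree dg_i + k.\<close>
  define x where "x = (\<Sum>i<N. ksign (d * dg i) *\<^sub>R tensn V (s V (\<epsilon> i)) (\<Phi> i))"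
  have x: "x \<in> sec n V (d, 1)"
    unfolding x_def by (rule presheaf_sum[OF Y.pre_m V]) (rule presheaf_scale[OF Y.pre_m V t])
  have "\<iota>m W Z W (\<mu> V x W (incl' W e)) = ksign (k * d) *\<^sub>R incl' W (S W Z e)"
    if W: "openin (base M) W" "W \<subseteq> V" and Z: "Z \<in> A.secs W k" and e: "e \<in> E.secs W j" for W k Z e j
  proof -
    have eS: "e \<in> sec SE W j" using e by simp
    have ie: "incl' W e \<in> sec m W (j, 0)" using X.incl_in[OF W(1) eS] .
    let ?a = "\<lambda>i. s W (A.tres V W (\<epsilon> i))" and ?X = "\<lambda>i. res SA V W (X i)" and ?z = "\<lambda>i. Z W (A.tres V W (\<epsilon> i))"
    have 1: "\<mu> V (tensn V (s V (\<epsilon> i)) (\<Phi> i)) W (incl' W e) = tens W (?a i) (S W (?X i) e)" if i: "i < N" for i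
    proof -
      have r: "res EE V W (\<Phi> i) \<in> sec EE W (d - dg i)" by (rule presheaf_res_in[OF Y.pre_G V W \<Phi>[OF i]])
      have "\<mu> V (tensn V (s V (\<epsilon> i)) (\<Phi> i)) W (incl' W e) = \<mu> W (tensn W (?a i) (res EE V W (\<Phi> i))) W (incl' W e)"
        using mu_linear(3)[OF V t W ie, of i] Y.tens_res[OF V s\<epsilon>V \<Phi> W, of i i] s_res[OF V W \<epsilon>[OF i]] i by simp
      also have "\<dots> = tens W (?a i) (res EE V W (\<Phi> i) W e)"
        by (rule mu_tens[OF W(1) s\<epsilon>[OF W i] r e])
      also have "res EE V W (\<Phi> i) W e = S W (?X i) e"
        using W eS by (simp add: \<Phi>_def hom_mod_simps(3)[of M SE] hom_ext_apply[where i = j])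
      finally show ?thesis .
    qed
    have z: "?z i \<in> sec M W (dg i + k)" if "i < N" for i
      by (rule A.section_in[OF W(1) Z W(1) order_refl \<epsilon>W[OF W that]])
    have tin: "tens W (?a i) (S W (?X i) e) \<in> sec m W (j + d, 1)" if "i \<in> {..<N}" for i
      using X.tens_in[OF W(1) s\<epsilon>[OF W] SXin[OF W _ eS], of i i] that by simp
    have aS: "act SE W (?z i) (S W (?X i) e) \<in> sec SE W (j + k + d)" if "i \<in> {..<N}" for i
      using module_act_in[OF X.module_G W(1) z SXin[OF W _ eS], of i i] that by (simp add: algebra_simps)
    have "\<mu> V x W (incl' W e) = (\<Sum>i<N. \<mu> V (ksign (d * dg i) *\<^sub>R tensn V (s V (\<epsilon> i)) (\<Phi> i)) W (incl' W e))"
      unfolding x_def by (rule mu_sum[OF V W ie presheaf_scale[OF Y.pre_m V t]])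
    also have "\<dots> = (\<Sum>i<N. ksign (d * dg i) *\<^sub>R tens W (?a i) (S W (?X i) e))"
      by (rule sum.cong[OF refl]) (use mu_linear(1)[OF V t W ie] 1 in auto)
    finally have "\<iota>m W Z W (\<mu> V x W (incl' W e)) = \<iota>m W Z W (\<Sum>i<N. ksign (d * dg i) *\<^sub>R tens W (?a i) (S W (?X i) e))"
      by simp
    also have "\<dots> = (\<Sum>i<N. \<iota>m W Z W (ksign (d * dg i) *\<^sub>R tens W (?a i) (S W (?X i) e)))"
      by (rule sheaf_map_sum[OF X.pre_m \<iota>m_map[OF W(1) Z] W(1) order_refl presheaf_scale[OF X.pre_m W(1) tin]])
    also have "\<dots> = (\<Sum>i<N. incl' W (ksign (d * dg i) *\<^sub>R act SE W (?z i) (S W (?X i) e)))"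
    proof (rule sum.cong[OF refl])
      fix i assume i': "i \<in> {..<N}"
      then have i: "i < N" by simp
      have SX: "S W (?X i) e \<in> E.secs W (j + (d - dg i))" using SXin[OF W i eS] by simp
      show "\<iota>m W Z W (ksign (d * dg i) *\<^sub>R tens W (?a i) (S W (?X i) e)) = incl' W (ksign (d * dg i) *\<^sub>R act SE W (?z i) (S W (?X i) e))"
        using sheaf_map_scale[OF X.pre_m \<iota>m_map[OF W(1) Z] W(1) order_refl tin[OF i']] \<iota>m_tens[OF W(1) Z W(1) order_refl s\<epsilon>[OF W i] SX]
          contraction_s[OF W(1) Z W(1) order_refl \<epsilon>W[OF W i]] X.incl_pull[OF W(1) SXin[OF W i eS] z[OF i]]
          X.tens_scale_right[OF W(1) P.unity_poly[OF W(1)] aS[OF i']] by simp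
    qed
    also have "\<dots> = incl' W (\<Sum>i<N. ksign (d * dg i) *\<^sub>R act SE W (?z i) (S W (?X i) e))"
      by (rule X.tens_sum_right[OF W(1) P.unity_poly[OF W(1)] presheaf_scale[OF X.pre_G W(1) aS], symmetric])
    also have "(\<Sum>i<N. ksign (d * dg i) *\<^sub>R act SE W (?z i) (S W (?X i) e)) = ksign (k * d) *\<^sub>R S W Z e"
    proof -
      have zX: "act SA W (?z i) (?X i) \<in> sec SA W k" if "i \<in> {..<N}" for i
        using A.section_act_in[OF W(1) z rX[OF W], of i i] that by simp
      have sumX: "S W (\<Sum>i\<in>J. act SA W (?z i) (?X i)) e = (\<Sum>i\<in>J. S W (act SA W (?z i) (?X i)) e)" if "J \<subseteq> {..<N}" for J
        using finite_subset[OF that finite_lessThan] that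
      proof (induction J rule: finite_induct)
        case empty
        have "S W (0 *\<^sub>R Z) e = 0 *\<^sub>R S W Z e"
          by (rule bilinear_rules(2)[OF Sb, where i = k and j = j]) (use W Z e in simp_all)
        then show ?case by (simp only: sum.empty scaleR_zero_left)
      next
        case (insert r J)
        then have r: "act SA W (?z r) (?X r) \<in> sec SA W k" and J: "(\<Sum>i\<in>J. act SA W (?z i) (?X i)) \<in> sec SA W k"
          by (auto intro!: presheaf_sum[OF pre_SA W(1)] zX simp del: hom_mod_simps)
        have WA: "openin (base SA) W" using W(1) by simp
        have "S W (act SA W (?z r) (?X r) + (\<Sum>i\<in>J. act SA W (?z i) (?X i))) e =
            S W (act SA W (?z r) (?X r)) e + S W (\<Sum>i\<in>J. act SA W (?z i) (?X i)) e"
          by (rule bilinear_rules(4)[OF Sb WA r eS J])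
        moreover have "S W (\<Sum>i\<in>J. act SA W (?z i) (?X i)) e = (\<Sum>i\<in>J. S W (act SA W (?z i) (?X i)) e)"
          using insert by blast
        ultimately show ?case unfolding sum.insert[OF insert(1,2)] by (simp only:)
      qed
      have "S W Z e = S W (\<Sum>i<N. act SA W (?z i) (?X i)) e"
        using expand[OF W Z] by simp
      also have "\<dots> = (\<Sum>i<N. ksign (d * (dg i + k)) *\<^sub>R act SE W (?z i) (S W (?X i) e))"
        unfolding sumX[OF order_refl] by (rule sum.cong[OF refl]) (use bhoms_act(1)[OF S W(1) z rX[OF W] e] in auto)
      finally have "S W Z e = (\<Sum>i<N. ksign (d * (dg i + k)) *\<^sub>R act SE W (?z i) (S W (?X i) e))" .
      moreover have "ksign (k * d) * ksign (d * (dg i + k)) = ksign (d * dg i)" for i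
        by (auto simp: ksign_def)
      ultimately show ?thesis by (simp add: scaleR_sum_right)
    qed
    also have "incl' W (ksign (k * d) *\<^sub>R S W Z e) = ksign (k * d) *\<^sub>R incl' W (S W Z e)"
      by (rule X.tens_scale_right[OF W(1) P.unity_poly[OF W(1)], of _ "k + j + d"])
        (use graded_pairingD[OF bhoms_pairing[OF S] W(1) Z e] in simp)
    finally show ?thesis .
  qed
  then show ?thesis using that[OF x] by blast
qed

text \<open>Local forms agree on overlaps by \<open>form_eq_0\<close>, since both have the
  contractions prescribed by S, and are glued in the sheaf n.\<close>

lemma form_exists:
  assumes S: "S \<in> bhoms d"
  shows "\<exists>x. x \<in> sec n T (d, 1) \<and> contracts_to d (\<mu> T x) S"
proof -
  \<comment> \<open>The contractions are prescribed over all smaller open sets, so that the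
    condition can be used on overlaps.\<close>
  define good where "good = (\<lambda>V x. x \<in> sec n V (d, 1) \<and> (\<forall>W k X e j. openin (base M) W \<longrightarrow> W \<subseteq> V \<longrightarrow> X \<in> A.secs W k \<longrightarrow> e \<in> E.secs W j \<longrightarrow>
       \<iota>m W X W (\<mu> V x W (incl' W e)) = ksign (k * d) *\<^sub>R incl' W (S W X e)))"
  have "\<exists>V x. openin (base M) V \<and> y \<in> V \<and> V \<subseteq> T \<and> good V x" if y: "y \<in> T" for y
  proof -
    obtain V N dg \<epsilon> X where V: "openin (base M) V" "y \<in> V" "V \<subseteq> T" "A.dual_frame V N dg \<epsilon> X"
      by (rule A.dual_frame_at[OF openT y])
    obtain x where "good V x"
      unfolding good_def by (rule local_form[OF S V(4,1)]) blast
    then show ?thesis using V by blast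
  qed
  then have "\<exists>f. \<forall>y\<in>T. openin (base M) (fst (f y)) \<and> y \<in> fst (f y) \<and> fst (f y) \<subseteq> T \<and> good (fst (f y)) (snd (f y))"
    by (intro bchoice ballI) (auto simp: split_paired_Ex)
  then obtain f where f: "\<And>y. y \<in> T \<Longrightarrow> openin (base M) (fst (f y)) \<and> y \<in> fst (f y) \<and> fst (f y) \<subseteq> T \<and> good (fst (f y)) (snd (f y))"
    by blast
  define V where "V = (\<lambda>y. fst (f y))"
  define x where "x = (\<lambda>y. snd (f y))"
  have V: "openin (base M) (V y)" "y \<in> V y" "V y \<subseteq> T" and good: "good (V y) (x y)" if "y \<in> T" for y
    using f[OF that] by (simp_all add: V_def x_def)
  have x: "x y \<in> sec n (V y) (d, 1)" if "y \<in> T" for y using good[OF that] by (simp add: good_def)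
  have c: "\<iota>m W X W (\<mu> (V y) (x y) W (incl' W e)) = ksign (k * d) *\<^sub>R incl' W (S W X e)"
    if "y \<in> T" "openin (base M) W" "W \<subseteq> V y" "X \<in> A.secs W k" "e \<in> E.secs W j" for y W X k e j
    by (rule good[OF that(1), unfolded good_def, THEN conjunct2, rule_format, OF that(2-5)])
  have un: "\<Union>(V ` T) = T" using V by blast
  have "\<exists>!a. a \<in> sec n (\<Union>(V ` T)) (d, 1) \<and> (\<forall>y\<in>T. res n (\<Union>(V ` T)) (V y) a = x y)"
  proof (rule sheaf_glue[OF Y.sheaf_m V(1) x])
    fix y z assume y: "y \<in> T" and z: "z \<in> T"
    let ?W = "V y \<inter> V z"
    have W: "openin (base M) ?W" using V(1) y z by blast
    have Wy: "?W \<subseteq> V y" and Wz: "?W \<subseteq> V z" by auto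
    note ry = presheaf_res_in[OF Y.pre_m V(1)[OF y] W Wy x[OF y]] and rz = presheaf_res_in[OF Y.pre_m V(1)[OF z] W Wz x[OF z]]
    have "res n (V y) ?W (x y) + (-1) *\<^sub>R res n (V z) ?W (x z) = 0"
    proof (rule form_eq_0[OF W presheaf_add[OF Y.pre_m W ry presheaf_scale[OF Y.pre_m W rz]]])
      fix W' k X e j assume W': "openin (base M) W'" "W' \<subseteq> ?W" and X: "X \<in> A.secs W' k" and e: "e \<in> E.secs W' j"
      have i: "incl' W' e \<in> sec m W' (j, 0)" using X.incl_in[OF W'(1), of e j] e by simp
      have W'y: "W' \<subseteq> V y" "W' \<subseteq> V z" using W' by auto
      have my: "\<mu> (V y) (x y) W' (incl' W' e) \<in> sec m W' (j + d, 1)" "\<mu> (V z) (x z) W' (incl' W' e) \<in> sec m W' (j + d, 1)"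
        using sheaf_map_in[OF X.pre_m homs_map[OF mu_homs[OF V(1)[OF y] x[OF y]]] W'(1) W'y(1) i]
          sheaf_map_in[OF X.pre_m homs_map[OF mu_homs[OF V(1)[OF z] x[OF z]]] W'(1) W'y(2) i] by simp_all
      have "\<mu> ?W (res n (V y) ?W (x y) + (-1) *\<^sub>R res n (V z) ?W (x z)) W' (incl' W' e) =
         \<mu> (V y) (x y) W' (incl' W' e) - \<mu> (V z) (x z) W' (incl' W' e)"
        using mu_linear(2)[OF W ry W' i presheaf_scale[OF Y.pre_m W rz, of "-1"]] mu_linear(1)[OF W rz W' i, of "-1"]
          mu_res[OF V(1)[OF y] W Wy W' x[OF y] i] mu_res[OF V(1)[OF z] W Wz W' x[OF z] i] by simp
      then show "\<iota>m W' X W' (\<mu> ?W (res n (V y) ?W (x y) + (-1) *\<^sub>R res n (V z) ?W (x z)) W' (incl' W' e)) = 0"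
        using sheaf_map_minus[OF X.pre_m \<iota>m_map[OF W'(1) X] W'(1) order_refl my] c[OF y W'(1) W'y(1) X e] c[OF z W'(1) W'y(2) X e] by simp
    qed
    then show "res n (V y) ?W (x y) = res n (V z) ?W (x z)" by simp
  qed
  then obtain a where a: "a \<in> sec n T (d, 1)" and ra: "\<And>y. y \<in> T \<Longrightarrow> res n T (V y) a = x y"
    unfolding un by blast
  have "contracts_to d (\<mu> T a) S"
    unfolding contracts_to_def
  proof (intro allI impI; elim conjE)
    fix U k X j e assume U: "openin (base M) U" and X: "X \<in> A.secs U k" and e: "e \<in> E.secs U j"
    note map = homs_map[OF mu_homs[OF openT a]]
    have i: "incl' U e \<in> sec m U (j, 0)" using X.incl_in[OF U, of e j] e by simp
    have m1: "\<mu> T a U (incl' U e) \<in> sec m U (j + d, 1)" using sheaf_map_in[OF X.pre_m map U openin_sub[OF U] i] by simp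
    have SXe: "S U X e \<in> sec SE U (k + j + d)" using graded_pairingD[OF bhoms_pairing[OF S] U X e] by simp
    have m2: "\<iota>m U X U (\<mu> T a U (incl' U e)) \<in> sec m U (k + j + d, 0)" using sheaf_map_in[OF X.pre_m \<iota>m_map[OF U X] U order_refl m1] by (simp add: algebra_simps)
    note m3 = X.incl_in[OF U SXe]
    show "\<iota>m U X U (\<mu> T a U (incl' U e)) = ksign (k * d) *\<^sub>R incl' U (S U X e)"
    proof (rule sheaf_eqI[OF X.sheaf_m U m2 presheaf_scale[OF X.pre_m U m3]])
      fix y assume y: "y \<in> U"
      then have yT: "y \<in> T" using openin_sub[OF U] by blast
      define W where "W = U \<inter> V y"
      have W: "openin (base M) W" "y \<in> W" "W \<subseteq> U" "W \<subseteq> V y" using U V(1,2)[OF yT] y by (auto simp: W_def)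
      have rX: "res SA U W X \<in> A.secs W k" and re: "res SE U W e \<in> E.secs W j"
        using presheaf_res_in[OF pre_SA U W(1,3), of X k] X presheaf_res_in[OF X.pre_G U W(1,3), of e j] e by simp_all
      have ri: "res m U W (incl' U e) = incl' W (res SE U W e)" using X.incl_res[OF U W(1,3), of e j] e by simp
      have iW: "incl' W (res SE U W e) \<in> sec m W (j, 0)" using X.incl_in[OF W(1), of "res SE U W e" j] re by simp
      have "res m U W (\<iota>m U X U (\<mu> T a U (incl' U e))) = \<iota>m U X W (\<mu> T a W (incl' W (res SE U W e)))"
        using sheaf_map_res[OF X.pre_m \<iota>m_map[OF U X] U order_refl W(1,3) m1] sheaf_map_res[OF X.pre_m map U openin_sub[OF U] W(1,3) i] ri by simp
      also have "\<dots> = \<iota>m W (res SA U W X) W (\<mu> (V y) (x y) W (incl' W (res SE U W e)))"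
        using \<iota>m_res[OF U X W(1,3) W(1) order_refl sheaf_map_in[OF X.pre_m map W(1) openin_sub[OF W(1)] iW]]
          mu_res[OF openT V(1)[OF yT] V(3)[OF yT] W(1,4) a iW] ra[OF yT] by simp
      also have "\<dots> = ksign (k * d) *\<^sub>R incl' W (S W (res SA U W X) (res SE U W e))"
        by (rule c[OF yT W(1,4) rX re])
      also have "\<dots> = res m U W (ksign (k * d) *\<^sub>R incl' U (S U X e))"
        using presheaf_res_scale[OF X.pre_m U W(1,3) m3] X.incl_res[OF U W(1,3) SXe] bilinear_rules(6)[OF bhoms_bilinear[OF S], of U X k e j W] U X e W by simp
      finally show "\<exists>W. openin (base M) W \<and> y \<in> W \<and> W \<subseteq> U \<and>
          res m U W (\<iota>m U X U (\<mu> T a U (incl' U e))) = res m U W (ksign (k * d) *\<^sub>R incl' U (S U X e))"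
        using W by blast
    qed
  qed
  then show ?thesis using a by blast
qed

abbreviation "form d S \<equiv> form_of M A A1 E tens \<iota>m n \<mu> d S"

text \<open>Existence and uniqueness justify the definite description in
  \<open>form_of\<close>.\<close>

lemma form_of_props:
  assumes S: "S \<in> bhoms d"
  shows "form d S \<in> sec n T (d, 1)" and "contracts_to d (\<mu> T (form d S)) S"
proof -
  obtain x where x: "x \<in> sec n T (d, 1)" "contracts_to d (\<mu> T x) S" using form_exists[OF S] by blast
  have unique: "y = x" if y: "y \<in> sec n T (d, 1)" "contracts_to d (\<mu> T y) S" for y
  proof -
    have "y + (-1) *\<^sub>R x = 0"
    proof (rule form_eq_0[OF openT presheaf_add[OF Y.pre_m openT y(1) presheaf_scale[OF Y.pre_m openT x(1)]]])
      fix V k X e j assume V: "openin (base M) V" "V \<subseteq> T" and X: "X \<in> A.secs V k" and e: "e \<in> E.secs V j"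
      have i: "incl' V e \<in> sec m V (j, 0)" using X.incl_in[OF V(1), of e j] e by simp
      have "\<mu> T (y + (-1) *\<^sub>R x) V (incl' V e) = \<mu> T y V (incl' V e) - \<mu> T x V (incl' V e)"
        using mu_linear(2)[OF openT y(1) V i presheaf_scale[OF Y.pre_m openT x(1), of "-1"]] mu_linear(1)[OF openT x(1) V i, of "-1"] by simp
      then show "\<iota>m V X V (\<mu> T (y + (-1) *\<^sub>R x) V (incl' V e)) = 0"
        using sheaf_map_minus[OF X.pre_m \<iota>m_map[OF V(1) X] V(1) order_refl sheaf_map_in[OF X.pre_m homs_map[OF mu_homs[OF openT y(1)]] V i]
            sheaf_map_in[OF X.pre_m homs_map[OF mu_homs[OF openT x(1)]] V i]]
          contracts_toD[OF x(2) V(1) X e] contracts_toD[OF y(2) V(1) X e] by simp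
    qed
    then show ?thesis by simp
  qed
  have eq: "form d S = (THE x. x \<in> sec n T (d, 1) \<and> contracts_to d (\<mu> T x) S)"
    unfolding form_of_def contracts_to_def by simp
  have "form d S \<in> sec n T (d, 1) \<and> contracts_to d (\<mu> T (form d S)) S"
    unfolding eq by (rule theI[of _ x]) (use x unique in blast)+
  then show "form d S \<in> sec n T (d, 1)" and "contracts_to d (\<mu> T (form d S)) S" by auto
qed

end

section \<open>The image of the Atiyah class under \<open>\<mu>\<close>\<close>

locale proposition_setting = atiyah_setting M QM A QA A1 E QE m tens Q1 dA Qm \<rho> br s \<iota> \<iota>m D nabla +
    forms_setting M QM A QA A1 E QE m tens Q1 dA Qm \<rho> br s \<iota> \<iota>m n tensn \<mu>
  for M :: "('p, int, 'f::real_algebra) gring" and QM :: "'p set \<Rightarrow> 'f \<Rightarrow> 'f"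
    and A :: "('p, 'f, 'q, 'g::real_algebra) vbundle" and QA :: "'q set \<Rightarrow> 'g \<Rightarrow> 'g"
    and A1 :: "('p, 'f, 'r, 'h::real_algebra) vbundle"
    and E :: "('p, 'f, 's, 'l::real_algebra) vbundle" and QE :: "'s set \<Rightarrow> 'l \<Rightarrow> 'l"
    and m :: "('p, int \<times> int, 'h, 'm::real_vector) gmod" and tens
    and Q1 dA :: "'r set \<Rightarrow> 'h \<Rightarrow> 'h" and Qm :: "'p set \<Rightarrow> 'm \<Rightarrow> 'm" and \<rho> br s \<iota> \<iota>m D nabla
    and n :: "('p, int \<times> int, 'h, 'n::real_vector) gmod" and tensn and \<mu>
begin

text \<open>If S is At plus the differential of S_0, then \<open>\<mu>\<close> sends the form of S
  to R - [Q_m, G], where G is the image of the form of S_0; the minus sign is that of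
  \<open>contracts_diff\<close>. The identity is checked on contractions.\<close>

lemma mu_form_class:
  assumes S: "S \<in> bundle_hom_class M QM A QA E QE At"
  shows "mclass (\<mu> T (form 1 S)) = mclass R"
proof -
  obtain S0 where S1: "S \<in> bhoms 1" and S0: "S0 \<in> bhoms 0"
    and diff: "\<And>U k X j e. openin (base M) U \<Longrightarrow> X \<in> A.secs U k \<Longrightarrow> e \<in> E.secs U j \<Longrightarrow> S U X e - At U X e = bdiff 0 S0 U X e"
    using S unfolding bundle_hom_class_def by auto
  define F where "F = \<mu> T (form 1 S)"
  define G where "G = \<mu> T (form 0 S0)"
  have F: "F \<in> homs T (1, 1)" "contracts_to 1 F S" and G: "G \<in> homs T (0, 1)" "contracts_to 0 G S0"
    using form_of_props[OF S1] form_of_props[OF S0] mu_homs[OF openT] by (auto simp: F_def G_def)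
  have dG: "module_hom_diff Qm (0, 1) G \<in> homs T (1, 1)" using module_hom_diff_homs[OF G(1)] by simp
  have K: "(\<lambda>U x. 1 *\<^sub>R R U x + (-1) *\<^sub>R module_hom_diff Qm (0, 1) G U x) \<in> homs T (1, 1)"
    by (rule homs_lincomb[OF openT R_homs dG])
  have eq: "F U x = 1 *\<^sub>R R U x + (-1) *\<^sub>R module_hom_diff Qm (0, 1) G U x" if U: "openin (base M) U" and x: "x \<in> sec m U i" for U x i
  proof (rule homs_contractions_ext[OF F(1) K _ U x])
    fix U k X j e assume U: "openin (base M) U" and X: "X \<in> A.secs U k" and e: "e \<in> E.secs U j"
    have i: "incl' U e \<in> sec m U (j, 0)" using X.incl_in[OF U, of e j] e by simp
    note Ri = sheaf_map_in[OF X.pre_m R_map U openin_sub[OF U] i] and Gi = sheaf_map_in[OF X.pre_m homs_map[OF dG] U openin_sub[OF U] i]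
    have at: "At U X e \<in> sec SE U (k + j + 1)" and bd: "bdiff 0 S0 U X e \<in> sec SE U (k + j + 1)"
      using At_in[OF U X e] bdiff_in[OF bhoms_pairing[OF S0] U X e] by simp_all
    have "\<iota>m U X U (1 *\<^sub>R R U (incl' U e) + (-1) *\<^sub>R module_hom_diff Qm (0, 1) G U (incl' U e)) =
        \<iota>m U X U (R U (incl' U e)) - \<iota>m U X U (module_hom_diff Qm (0, 1) G U (incl' U e))"
      using sheaf_map_minus[OF X.pre_m \<iota>m_map[OF U X] U order_refl Ri Gi] by simp
    also have "\<dots> = ksign k *\<^sub>R incl' U (At U X e) + ksign k *\<^sub>R incl' U (bdiff 0 S0 U X e)"
      using contracts_toD[OF R_contracts U X e] contracts_diff[OF homs_map[OF G(1)] G(2) graded_pairingD[OF bhoms_pairing[OF S0]] U X e] by simp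
    also have "\<dots> = ksign k *\<^sub>R incl' U (S U X e)"
      using X.tens_add_right[OF U P.unity_poly[OF U] at bd] diff[OF U X e, symmetric] by (simp add: scaleR_add_right[symmetric])
    finally show "\<iota>m U X U (F U (incl' U e)) = \<iota>m U X U (1 *\<^sub>R R U (incl' U e) + - 1 *\<^sub>R module_hom_diff Qm (0, 1) G U (incl' U e))"
      using contracts_toD[OF F(2) U X e] by simp
  qed
  show ?thesis
    unfolding F_def[symmetric]
  proof (rule module_hom_class_eq[OF homs_lincomb[OF openT G(1) G(1), of "-1" 0]])
    fix U i x assume *: "openin (base M) U" "x \<in> sec m U i"
    show "F U x - R U x = module_hom_diff Qm (0, 1) (\<lambda>V x. - 1 *\<^sub>R G V x + 0 *\<^sub>R G V x) U x"
      unfolding module_hom_diff_lincomb[OF G(1) G(1) *] eq[OF *] by simp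
  qed
qed

lemma image_atiyah_class:
  "(\<lambda>S. mclass (\<mu> T (form 1 S))) ` atiyah_class M QM A QA \<rho> E QE = {module_class M A1 dA m Qm}"
  unfolding atiyah_class_eq module_class_eq using At_in_class mu_form_class by (auto simp: image_iff)

end

section \<open>Bump functions\<close>

text \<open>The functions p(1/x) exp(-1/x), extended by 0. Unlike exp(-1/x) alone, this family is
  closed under differentiation, which gives smoothness by induction.\<close>

definition exp_poly :: "real poly \<Rightarrow> real \<Rightarrow> real" where
  "exp_poly p x = (if x > 0 then poly p (1 / x) * exp (- (1 / x)) else 0)"

text \<open>With u = 1/x and du/dx = -u^2, the derivative of p(u) exp(-u) is u^2 (p(u) - p'(u))
  exp(-u).\<close>

definition exp_poly_deriv :: "real poly \<Rightarrow> real poly" where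
  "exp_poly_deriv p = [:0, 0, 1:] * (p - pderiv p)"

lemma exp_poly_tendsto_0: "((\<lambda>x. exp_poly p x) \<longlongrightarrow> 0) (at 0)"
proof -
  have "((\<lambda>u. \<Sum>i\<le>degree p. coeff p i * (u ^ i / exp u)) \<longlongrightarrow> (\<Sum>i\<le>degree p. coeff p i * 0)) at_top"
    by (intro tendsto_intros tendsto_power_div_exp_0)
  then have "((\<lambda>u. poly p u * exp (- u)) \<longlongrightarrow> 0) at_top"
    by (simp add: poly_altdef sum_distrib_right exp_minus divide_inverse mult.assoc)
  then have "((\<lambda>x. poly p (inverse x) * exp (- inverse x)) \<longlongrightarrow> 0) (at_right 0)"
    using filterlim_compose[OF _ filterlim_inverse_at_top_right] by fast
  then have "(exp_poly p \<longlongrightarrow> 0) (at_right 0)"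
    by (rule Lim_transform_eventually) (auto simp: eventually_at_filter exp_poly_def inverse_eq_divide)
  moreover have "(exp_poly p \<longlongrightarrow> 0) (at_left 0)"
    by (rule Lim_transform_eventually[OF tendsto_const]) (auto simp: eventually_at_filter exp_poly_def)
  ultimately show ?thesis by (simp add: filterlim_split_at)
qed

lemma exp_poly_has_derivative: "(exp_poly p has_real_derivative exp_poly (exp_poly_deriv p) x) (at x)"
proof (cases "x = 0")
  case False
  then consider "x > 0" | "x < 0" by linarith
  then show ?thesis
  proof cases
    case 1
    have u: "((\<lambda>x. 1 / x) has_real_derivative - (1 / x\<^sup>2)) (at x)"
      using 1 by (auto intro!: derivative_eq_intros simp: power2_eq_square)
    have "((\<lambda>x. poly p (1 / x) * exp (- (1 / x))) has_real_derivative
        poly (pderiv p) (1 / x) * - (1 / x\<^sup>2) * exp (- (1 / x)) + exp (- (1 / x)) * - (- (1 / x\<^sup>2)) * poly p (1 / x)) (at x)"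
      by (rule DERIV_mult[OF DERIV_chain2[OF poly_DERIV u] DERIV_chain2[OF DERIV_exp DERIV_minus[OF u]]])
    also have "poly (pderiv p) (1 / x) * - (1 / x\<^sup>2) * exp (- (1 / x)) + exp (- (1 / x)) * - (- (1 / x\<^sup>2)) * poly p (1 / x) =
        exp_poly (exp_poly_deriv p) x"
      using 1 by (simp add: exp_poly_def exp_poly_deriv_def power2_eq_square algebra_simps)
    finally have "((\<lambda>x. poly p (1 / x) * exp (- (1 / x))) has_real_derivative exp_poly (exp_poly_deriv p) x) (at x)" .
    then show ?thesis
      by (rule has_field_derivative_transform_within_open[where S = "{0<..}"]) (use 1 in \<open>auto simp: exp_poly_def\<close>)
  next
    case 2
    have "((\<lambda>_. 0) has_real_derivative exp_poly (exp_poly_deriv p) x) (at x)"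
      using 2 by (simp add: exp_poly_def)
    then show ?thesis
      by (rule has_field_derivative_transform_within_open[where S = "{..<0}"]) (use 2 in \<open>auto simp: exp_poly_def\<close>)
  qed
next
  case True
  \<comment> \<open>Dividing by h multiplies p(1/h) by 1/h, so the difference quotient at 0 is again
    in the family and tends to 0.\<close>
  have "exp_poly p h / h = exp_poly ([:0, 1:] * p) h" for h
    by (simp add: exp_poly_def)
  then show ?thesis
    using exp_poly_tendsto_0[of "[:0, 1:] * p"] True by (simp add: has_field_derivative_iff exp_poly_def)
qed

lemma exp_poly_iterate: "(exp_poly ((exp_poly_deriv ^^ k) p) has_real_derivative exp_poly ((exp_poly_deriv ^^ Suc k) p) x) (at x)"
  using exp_poly_has_derivative by simp

section \<open>Calculus of continuously differentiable functions on Euclidean space\<close>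

lemma Euclidean_slice_open:
  assumes "openin (Euclidean_space n) W" "x \<in> W" "i < n"
  shows "open {t. x(i := t) \<in> W}"
proof -
  have x: "x \<in> topspace (Euclidean_space n)" using assms openin_subset by blast
  have "continuous_map euclideanreal (Euclidean_space n) (\<lambda>t. x(i := t))"
    unfolding Euclidean_space_def continuous_map_in_subtopology
    using x assms(3) by (auto simp: continuous_map_componentwise_UNIV topspace_Euclidean_space' fun_upd_def)
  then have "openin euclideanreal {t \<in> topspace euclideanreal. x(i := t) \<in> W}"
    by (rule openin_continuous_map_preimage) (rule assms(1))
  then show ?thesis by simp
qed

text \<open>A partial derivative sees only values on a coordinate line, which W meets in an open
  set. Formulas for partial derivatives are available on W only, hence this congruence.\<close>

lemma partial_cong:
  assumes "openin (Euclidean_space n) W" "x \<in> W" "i < n" and eq: "\<And>x. x \<in> W \<Longrightarrow> f x = g x"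
  shows "partial i f x = partial i g x"
    and "(\<lambda>t. f (x(i := t))) differentiable at (x i) \<Longrightarrow> (\<lambda>t. g (x(i := t))) differentiable at (x i)"
proof -
  have o: "open {t. x(i := t) \<in> W}" "x i \<in> {t. x(i := t) \<in> W}"
    using Euclidean_slice_open[OF assms(1-3)] assms(2) by auto
  have ev: "\<forall>\<^sub>F t in nhds (x i). f (x(i := t)) = g (x(i := t))"
    using o eq eventually_nhds by blast
  then show "partial i f x = partial i g x"
    unfolding partial_def by (rule deriv_cong_ev) simp
  assume "(\<lambda>t. f (x(i := t))) differentiable at (x i)"
  then obtain D where D: "((\<lambda>t. f (x(i := t))) has_real_derivative D) (at (x i))"
    by (auto simp: real_differentiable_def)
  have "((\<lambda>t. g (x(i := t))) has_real_derivative D) (at (x i))"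
    by (rule has_field_derivative_transform_within_open[OF D o]) (use eq in simp)
  then show "(\<lambda>t. g (x(i := t))) differentiable at (x i)" by (auto simp: real_differentiable_def)
qed

lemma cont_diff_cong:
  assumes W: "openin (Euclidean_space n) W" and f: "cont_diff k n W f" and eq: "\<And>x. x \<in> W \<Longrightarrow> f x = g x"
  shows "cont_diff k n W g"
  using f eq
proof (induction k arbitrary: f g)
  case 0
  then show ?case by (auto intro: continuous_map_eq)
next
  case (Suc k)
  have "continuous_map (subtopology (Euclidean_space n) W) euclideanreal g"
    using Suc.prems by (auto intro: continuous_map_eq)
  moreover have "(\<lambda>t. g (x(i := t))) differentiable at (x i)" if "i < n" "x \<in> W" for i x
    using partial_cong(2)[where f = f and g = g, OF W that(2,1) Suc.prems(2)] Suc.prems(1) that by simp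
  moreover have "cont_diff k n W (partial i g)" if "i < n" for i
    using Suc.IH[of "partial i f" "partial i g"] partial_cong(1)[OF W _ that Suc.prems(2)] Suc.prems(1) that by simp
  ultimately show ?case by simp
qed

lemma cont_diff_Suc: "cont_diff (Suc k) n W f \<Longrightarrow> cont_diff k n W f"
proof (induction k arbitrary: f)
  case (Suc k)
  then show ?case using cont_diff.simps(2) by metis
qed simp

lemma cont_diff_add: "openin (Euclidean_space n) W \<Longrightarrow> cont_diff k n W f \<Longrightarrow> cont_diff k n W g \<Longrightarrow> cont_diff k n W (\<lambda>x. f x + g x)"
proof (induction k arbitrary: f g)
  case 0
  then show ?case by (auto intro: continuous_intros)
next
  case (Suc k)
  have p: "partial i (\<lambda>x. f x + g x) x = partial i f x + partial i g x" if "i < n" "x \<in> W" for i x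
  proof -
    have "(\<lambda>t. f (x(i := t))) differentiable at (x i)" "(\<lambda>t. g (x(i := t))) differentiable at (x i)"
      using Suc.prems that by auto
    then show ?thesis unfolding partial_def
      by (intro DERIV_imp_deriv derivative_intros) (simp_all add: DERIV_deriv_iff_real_differentiable)
  qed
  have "cont_diff k n W (partial i (\<lambda>x. f x + g x))" if "i < n" for i
    by (rule cont_diff_cong[OF Suc.prems(1) Suc.IH[of "partial i f" "partial i g"]]) (use Suc.prems that p in auto)
  then show ?case using Suc.prems by (auto intro: continuous_intros)
qed

lemma cont_diff_mult: "openin (Euclidean_space n) W \<Longrightarrow> cont_diff k n W f \<Longrightarrow> cont_diff k n W g \<Longrightarrow> cont_diff k n W (\<lambda>x. f x * g x)"
proof (induction k arbitrary: f g)
  case 0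
  then show ?case by (auto intro: continuous_intros)
next
  case (Suc k)
  have p: "partial i (\<lambda>x. f x * g x) x = partial i f x * g x + f x * partial i g x" if "i < n" "x \<in> W" for i x
  proof -
    have "(\<lambda>t. f (x(i := t))) differentiable at (x i)" "(\<lambda>t. g (x(i := t))) differentiable at (x i)"
      using Suc.prems that by auto
    then have d: "((\<lambda>t. f (x(i := t))) has_real_derivative partial i f x) (at (x i))" "((\<lambda>t. g (x(i := t))) has_real_derivative partial i g x) (at (x i))"
      by (simp_all add: DERIV_deriv_iff_real_differentiable partial_def)
    show ?thesis
      using DERIV_imp_deriv[OF DERIV_mult[OF d]] by (simp add: partial_def algebra_simps)
  qed
  have "cont_diff k n W (partial i (\<lambda>x. f x * g x))" if i: "i < n" for i
  proof (rule cont_diff_cong[OF Suc.prems(1)])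
    \<comment> \<open>In each product the undifferentiated factor is used at one order less than it
      has.\<close>
    show "cont_diff k n W (\<lambda>x. partial i f x * g x + f x * partial i g x)"
      using Suc.prems i cont_diff_Suc by (intro cont_diff_add Suc.IH) auto
  qed (use p[OF i] in simp)
  then show ?case using Suc.prems by (auto intro: continuous_intros)
qed

lemma cont_diff_const: "cont_diff k n W (\<lambda>x. c)"
proof (induction k arbitrary: c)
  case (Suc k)
  have "partial i (\<lambda>x. c) = (\<lambda>x. 0)" for i by (simp add: partial_def fun_eq_iff)
  with Suc show ?case by simp
qed simp

lemma Euclidean_projection: "continuous_map (Euclidean_space n) euclideanreal (\<lambda>x. x j)"
  unfolding Euclidean_space_def
  by (intro continuous_map_from_subtopology continuous_map_product_projection) simp

text \<open>F lists the successive derivatives of a function of one variable; treating all of them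
  together makes the induction on k go through.\<close>

lemma cont_diff_coordinate:
  assumes F: "\<And>k t. (F k has_real_derivative F (Suc k) t) (at t)"
  shows "cont_diff k n W (\<lambda>x. F l (x j))"
proof -
  have c: "continuous_map (subtopology (Euclidean_space n) W) euclideanreal (\<lambda>x. F l (x j))" for l
  proof -
    have "isCont (F l) t" for t using F[of l t] by (rule DERIV_isCont)
    then have "continuous_map euclideanreal euclideanreal (F l)"
      by (simp add: continuous_at_imp_continuous_on)
    from continuous_map_compose[OF continuous_map_from_subtopology[OF Euclidean_projection] this] show ?thesis
      by (simp add: o_def)
  qed
  have p: "partial i (\<lambda>x. F l (x j)) = (if i = j then (\<lambda>x. F (Suc l) (x j)) else (\<lambda>x. 0))" for i l
    using DERIV_imp_deriv[OF F] by (simp add: partial_def fun_eq_iff)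
  have d: "(\<lambda>t. F l ((x(i := t)) j)) differentiable at (x i)" for x i l
    using F by (cases "i = j") (auto simp: real_differentiable_def)
  show ?thesis
  proof (induction k arbitrary: l)
    case (Suc k)
    then show ?case using c d cont_diff_const by (simp add: p)
  qed (simp add: c)
qed

lemma cont_diff_prod:
  assumes "openin (Euclidean_space n) W" "\<And>i. i \<in> I \<Longrightarrow> cont_diff k n W (f i)"
  shows "cont_diff k n W (\<lambda>x. \<Prod>i\<in>I. f i x)"
  using assms(2)
proof (induction I rule: infinite_finite_induct)
  case (insert i I)
  then show ?case using cont_diff_mult[OF assms(1)] by simp
qed (auto simp: cont_diff_const)

text \<open>Each coordinate contributes two one-sided factors, so the product is nonzero exactly on
  the open cube of radius r about a.\<close>

definition box_bump :: "nat \<Rightarrow> (nat \<Rightarrow> real) \<Rightarrow> real \<Rightarrow> (nat \<Rightarrow> real) \<Rightarrow> real" where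
  "box_bump n a r x = (\<Prod>i<n. exp_poly 1 (r + (x i - a i)) * exp_poly 1 (r - (x i - a i)))"

lemma box_bump_eq_0_iff: "box_bump n a r x = 0 \<longleftrightarrow> (\<exists>i<n. \<bar>x i - a i\<bar> \<ge> r)"
proof -
  have "exp_poly 1 t = 0 \<longleftrightarrow> t \<le> 0" for t by (auto simp: exp_poly_def)
  then have "box_bump n a r x = 0 \<longleftrightarrow> (\<exists>i\<in>{..<n}. r + (x i - a i) \<le> 0 \<or> r - (x i - a i) \<le> 0)"
    by (simp add: box_bump_def)
  then show ?thesis by (simp add: Bex_def abs_le_iff le_minus_iff) (smt (verit))
qed

lemma cont_diff_box_bump:
  assumes W: "openin (Euclidean_space n) W"
  shows "cont_diff k n W (box_bump n a r)"
  unfolding box_bump_def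
proof (intro cont_diff_prod[OF W] cont_diff_mult[OF W])
  fix i
  let ?F = "\<lambda>k t. exp_poly ((exp_poly_deriv ^^ k) 1) (r + (t - a i))"
  have "(?F k has_real_derivative ?F (Suc k) t) (at t)" for k t
    by (rule DERIV_chain2[OF exp_poly_iterate, where Db = 1, simplified mult_1_right]) (auto intro!: derivative_eq_intros)
  from cont_diff_coordinate[of ?F, OF this, of k n W 0 i] show "cont_diff k n W (\<lambda>x. exp_poly 1 (r + (x i - a i)))" by simp
  \<comment> \<open>The reflected argument contributes a factor -1 for each derivative.\<close>
  let ?G = "\<lambda>k t. (-1) ^ k * exp_poly ((exp_poly_deriv ^^ k) 1) (r - (t - a i))"
  have "(?G k has_real_derivative ?G (Suc k) t) (at t)" for k t
  proof -
    have "((\<lambda>t. exp_poly ((exp_poly_deriv ^^ k) 1) (r - (t - a i))) has_real_derivative exp_poly ((exp_poly_deriv ^^ Suc k) 1) (r - (t - a i)) * (-1)) (at t)"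
      by (rule DERIV_chain2[OF exp_poly_iterate]) (auto intro!: derivative_eq_intros)
    from DERIV_cmult[OF this, of "(-1) ^ k"] show ?thesis by (simp add: mult.assoc)
  qed
  from cont_diff_coordinate[of ?G, OF this, of k n W 0 i] show "cont_diff k n W (\<lambda>x. exp_poly 1 (r - (x i - a i)))" by simp
qed

definition cube :: "nat \<Rightarrow> (nat \<Rightarrow> real) \<Rightarrow> real \<Rightarrow> (nat \<Rightarrow> real) set" where
  "cube n a r = {x \<in> topspace (Euclidean_space n). \<forall>i<n. \<bar>x i - a i\<bar> \<le> r}"

lemma cube_subset_open:
  assumes W: "openin (Euclidean_space n) W" and a: "a \<in> W"
  shows "\<exists>r>0. cube n a r \<subseteq> W"
proof -
  obtain S where S: "openin (powertop_real UNIV) S" "W = S \<inter> {x. \<forall>i\<ge>n. x i = 0}"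
    using W by (auto simp: Euclidean_space_def openin_subtopology)
  have "a \<in> S" using S(2) a by simp
  then obtain U where "\<forall>i\<in>UNIV. openin euclideanreal (U i)" "a \<in> Pi\<^sub>E UNIV U" "Pi\<^sub>E UNIV U \<subseteq> S"
    using S(1)[unfolded openin_product_topology_alt] by (auto dest!: bspec)
  then have U: "\<And>i. open (U i)" "\<And>i. a i \<in> U i" "Pi\<^sub>E UNIV U \<subseteq> S" by auto
  have "\<exists>e>0. cball (a i) e \<subseteq> U i" for i using U open_contains_cball by blast
  then obtain e where e: "\<And>i. e i > 0" "\<And>i. cball (a i) (e i) \<subseteq> U i" by metis
  \<comment> \<open>The element 1 keeps the minimum defined for n = 0. Coordinates beyond n are 0
    throughout and impose no bound.\<close>
  define r where "r = Min (insert 1 (e ` {..<n}))"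
  have r: "r > 0" "\<And>i. i < n \<Longrightarrow> r \<le> e i" using e(1) by (auto simp: r_def)
  have "cube n a r \<subseteq> W"
  proof
    fix x assume x: "x \<in> cube n a r"
    have "x i \<in> U i" for i
    proof (cases "i < n")
      case True
      then have "\<bar>x i - a i\<bar> \<le> e i" using x r(2)[OF True] by (force simp: cube_def)
      then show ?thesis using e(2)[of i] by (auto simp: dist_real_def abs_minus_commute)
    next
      case False
      then show ?thesis using x S(2) a U(2)[of i] by (auto simp: cube_def topspace_Euclidean_space')
    qed
    then show "x \<in> W" using U(3) S(2) x by (auto simp: cube_def topspace_Euclidean_space')
  qed
  then show ?thesis using r(1) by blast
qed

text \<open>Compactness makes the preimage of the cube closed in the Hausdorff base, so that its
  complement is open.\<close>

lemma compactin_cube: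
  assumes a: "a \<in> topspace (Euclidean_space n)"
  shows "compactin (Euclidean_space n) (cube n a r)"
proof -
  have "cube n a r = Pi\<^sub>E UNIV (\<lambda>i. if i < n then {a i - r..a i + r} else {0})" (is "_ = Pi\<^sub>E UNIV ?S")
    by (auto simp: cube_def topspace_Euclidean_space' PiE_iff abs_le_iff split: if_splits) (smt (verit))+
  moreover have "compactin (powertop_real UNIV) (Pi\<^sub>E UNIV ?S)"
    by (subst compactin_PiE) auto
  ultimately show ?thesis
    unfolding Euclidean_space_def compactin_subtopology by (auto simp: cube_def topspace_Euclidean_space')
qed

lemma openin_open_cube:
  "openin (Euclidean_space n) {x \<in> topspace (Euclidean_space n). \<forall>i<n. \<bar>x i - a i\<bar> < r}"
proof -
  have o: "openin (Euclidean_space n) {x \<in> topspace (Euclidean_space n). x i \<in> {a i - r<..<a i + r}}" for i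
    by (rule openin_continuous_map_preimage[OF Euclidean_projection]) simp
  have "openin (Euclidean_space n) (topspace (Euclidean_space n) \<inter> (\<Inter>i\<in>{..<n}. {x \<in> topspace (Euclidean_space n). x i \<in> {a i - r<..<a i + r}}))"
    using o by (cases "n = 0") (auto intro!: openin_Int openin_INT)
  moreover have "topspace (Euclidean_space n) \<inter> (\<Inter>i\<in>{..<n}. {x \<in> topspace (Euclidean_space n). x i \<in> {a i - r<..<a i + r}}) =
      {x \<in> topspace (Euclidean_space n). \<forall>i<n. \<bar>x i - a i\<bar> < r}"
  proof -
    have "\<bar>x i - a i\<bar> < r \<longleftrightarrow> x i \<in> {a i - r<..<a i + r}" for x i by auto
    then show ?thesis by auto
  qed
  ultimately show ?thesis by simp
qed

section \<open>Extension of local sections\<close>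

text \<open>A bump function described by what is used of it: b is not a zero divisor on open subsets
  of V, and it vanishes on an open set W that together with U covers the base. The second condition
  replaces a statement about supports and is suited to gluing with 0.\<close>

definition bump_at :: "('p, int, 'f::real_algebra) gring \<Rightarrow> 'p set \<Rightarrow> 'f \<Rightarrow> 'p set \<Rightarrow> 'p set \<Rightarrow> bool" where
  "bump_at M U b V W \<longleftrightarrow> openin (base M) V \<and> V \<subseteq> U \<and> b \<in> sec M (topspace (base M)) 0 \<and>
    openin (base M) W \<and> W \<union> U = topspace (base M) \<and> res M (topspace (base M)) W b = 0 \<and>
    (\<forall>V' f i. openin (base M) V' \<and> V' \<subseteq> V \<and> f \<in> sec M V' i \<and> res M (topspace (base M)) V' b * f = 0 \<longrightarrow> f = 0)"

lemma bump_exists: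
  assumes M: "graded_manifold_of n ds M" and U: "openin (base M) U" and p: "p \<in> U"
  shows "\<exists>b V W. p \<in> V \<and> bump_at M U b V W"
proof -
  let ?T = "topspace (base M)"
  have ring: "graded_ring_sheaf M" and haus: "Hausdorff_space (base M)"
    and charts: "\<forall>x\<in>?T. \<exists>U \<phi> \<Phi>. x \<in> U \<and> chart M n ds U \<phi> \<Phi>"
    using M unfolding graded_manifold_of_def by auto
  note pre = ring_presheaf[OF ring]
  have UT: "U \<subseteq> ?T" using U openin_subset by blast
  obtain U0 \<phi> \<Phi> where U0: "p \<in> U0" "chart M n ds U0 \<phi> \<Phi>" using charts UT p by blast
  interpret c: chart_on M n ds U0 \<phi> \<Phi> using U0(2) ring by unfold_locales
  define U1 where "U1 = U \<inter> U0"
  have U1: "openin (base M) U1" "U1 \<subseteq> U" "U1 \<subseteq> U0" "p \<in> U1"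
    using U c.open_U p U0(1) by (auto simp: U1_def)
  have U0T: "U0 \<subseteq> ?T" using c.open_U openin_subset by blast
  have top0: "topspace (subtopology (base M) U0) = U0" using U0T by (simp add: topspace_subtopology Int_absorb1)
  let ?\<Omega> = "\<phi> ` U1"
  have "openin (subtopology (base M) U0) U1" using U1 c.open_U by (simp add: openin_open_subtopology)
  then have "openin (subtopology (Euclidean_space n) (\<phi> ` U0)) ?\<Omega>"
    using homeomorphic_map_openness_eq[OF c.homeo] by blast
  then have \<Omega>: "openin (Euclidean_space n) ?\<Omega>" using c.open_image by (simp add: openin_open_subtopology)
  define a where "a = \<phi> p"
  have a: "a \<in> ?\<Omega>" using U1 by (simp add: a_def)
  have aE: "a \<in> topspace (Euclidean_space n)" using \<Omega> a openin_subset by blast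
  obtain r where r: "r > 0" "cube n a r \<subseteq> ?\<Omega>" using cube_subset_open[OF \<Omega> a] by blast
  \<comment> \<open>The preimage of the closed cube: it contains all points of the chart at which
    the bump is nonzero, and it is compact, hence closed in the base.\<close>
  define K where "K = {u \<in> U0. \<phi> u \<in> cube n a r}"
  have KU1: "K \<subseteq> U1"
  proof
    fix u assume u: "u \<in> K"
    then obtain v where "v \<in> U1" "\<phi> u = \<phi> v" using r(2) by (auto simp: K_def)
    then show "u \<in> U1" using c.inj u U1(3) by (auto simp: K_def inj_on_def)
  qed
  have \<phi>K: "\<phi> ` K = cube n a r" using r(2) U1(3) by (auto simp: K_def)
  have KU0: "K \<subseteq> U0" by (auto simp: K_def)
  have "compactin (subtopology (Euclidean_space n) (\<phi> ` U0)) (\<phi> ` K)"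
    unfolding compactin_subtopology \<phi>K using compactin_cube[OF aE] subset_trans[OF r(2) image_mono[OF U1(3)]] by simp
  then have "compactin (subtopology (base M) U0) K"
    using homeomorphic_map_compactness[OF c.homeo, of K] KU0 subset_trans[OF KU0 U0T] by simp
  then have "closedin (base M) K"
    using compactin_imp_closedin[OF haus] by (simp add: compactin_subtopology)
  then have W: "openin (base M) (?T - K)" by (simp add: openin_diff)
  define W where "W = ?T - K"
  \<comment> \<open>Only the constant coefficient is nonzero, so multiplication by it acts
    coefficientwise. It is cut off outside the chart image, as smooth functions are in the local
    model.\<close>
  define ser :: series where "ser = (\<lambda>I x. if I = 0 \<and> x \<in> ?\<Omega> then box_bump n a r x else 0)"
  have "ser \<in> series_sec n ds ?\<Omega> 0"
    unfolding series_sec_def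
  proof (intro CollectI allI conjI impI)
    fix I
    show "smooth_function n ?\<Omega> (ser I)"
    proof (cases "I = 0")
      case True
      then show ?thesis
        unfolding smooth_function_def
        by (intro conjI allI impI cont_diff_cong[OF \<Omega> cont_diff_box_bump[OF \<Omega>, of _ a r]]) (auto simp: ser_def)
    next
      case False
      then have "ser I = (\<lambda>x. 0)" by (auto simp: ser_def)
      then show ?thesis unfolding smooth_function_def by (simp add: cont_diff_const)
    qed
    assume "\<not> (exponent ds I \<and> exponent_degree ds I = 0)"
    then have "I \<noteq> 0" by (auto simp: exponent_def exponent_degree_def)
    then show "ser I = 0" by (auto simp: ser_def)
  qed
  then obtain b1 where b1: "b1 \<in> sec M U1 0" "\<Phi> U1 b1 = ser"
    using c.bij[OF U1(1,3), of 0] unfolding bij_betw_def by (metis imageE)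
  have UW: "openin (base M) (U1 \<inter> W)" "U1 \<inter> W \<subseteq> U0" "U1 \<inter> W \<subseteq> U1" using U1 W by (auto simp: W_def)
  have zero: "res M U1 (U1 \<inter> W) b1 = 0"
  proof (rule c.eq_0I[OF UW(1,2) presheaf_res_in[OF pre U1(1) UW(1,3) b1(1)]])
    fix I x assume x: "x \<in> \<phi> ` (U1 \<inter> W)"
    then obtain u where u: "u \<in> U1" "u \<notin> K" "x = \<phi> u" by (auto simp: W_def)
    then have "x \<notin> cube n a r" using U1(3) by (auto simp: K_def)
    moreover have "x \<in> topspace (Euclidean_space n)" using u c.image_subset U1(3) by auto
    ultimately have "box_bump n a r x = 0" unfolding box_bump_eq_0_iff by (auto simp: cube_def)
    then show "\<Phi> (U1 \<inter> W) (res M U1 (U1 \<inter> W) b1) I x = 0"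
      using c.restrict[OF U1(1,3) b1(1) UW(1,3)] b1(2) by (simp add: series_res_def ser_def)
  qed
  have un: "U1 \<union> W = ?T" using KU1 U1 openin_subset by (fastforce simp: W_def)
  \<comment> \<open>The bump on \<open>U1\<close> is glued with 0 on \<open>W\<close>; the two
    members of the cover are indexed by booleans.\<close>
  define V' where "V' = (\<lambda>j. if j then U1 else W)"
  define x' where "x' = (\<lambda>j. if j then b1 else 0)"
  have un': "\<Union>(V' ` UNIV) = ?T" using un by (auto simp: V'_def UNIV_bool)
  have "\<exists>!b. b \<in> sec M (\<Union>(V' ` UNIV)) 0 \<and> (\<forall>j\<in>UNIV. res M (\<Union>(V' ` UNIV)) (V' j) b = x' j)"
  proof (rule sheaf_glue[OF ring_sheaf[OF ring]])
    fix j k :: bool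
    show "openin (base M) (V' j)" using U1 W by (simp add: V'_def W_def)
    show "x' j \<in> sec M (V' j) 0" using b1 presheaf_0[OF pre W] by (simp add: V'_def x'_def W_def)
    have z: "res M W (U1 \<inter> W) 0 = 0" using presheaf_res_0[OF pre, of W "U1 \<inter> W"] W UW by (simp add: W_def)
    show "res M (V' j) (V' j \<inter> V' k) (x' j) = res M (V' k) (V' j \<inter> V' k) (x' k)"
      using zero z by (cases j; cases k) (simp_all add: V'_def x'_def Int_commute)
  qed
  then obtain b where b: "b \<in> sec M ?T 0" and rb: "\<And>j. res M ?T (V' j) b = x' j" unfolding un' by blast
  have bU1: "res M ?T U1 b = b1" and bW: "res M ?T W b = 0" using rb[of True] rb[of False] by (simp_all add: V'_def x'_def)
  \<comment> \<open>The preimage of the open cube, on which the bump has no zero.\<close>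
  define V where "V = {u \<in> U1. \<phi> u \<in> {x \<in> topspace (Euclidean_space n). \<forall>i<n. \<bar>x i - a i\<bar> < r}}"
  have "continuous_map (subtopology (base M) U0) (Euclidean_space n) \<phi>"
    using homeomorphic_imp_continuous_map[OF c.homeo] by (rule continuous_map_into_fulltopology)
  from openin_continuous_map_preimage[OF this openin_open_cube[of n a r]]
  have "openin (base M) {u \<in> U0. \<phi> u \<in> {x \<in> topspace (Euclidean_space n). \<forall>i<n. \<bar>x i - a i\<bar> < r}}"
    unfolding top0 using c.open_U by (simp add: openin_open_subtopology)
  then have "openin (base M) (U1 \<inter> {u \<in> U0. \<phi> u \<in> {x \<in> topspace (Euclidean_space n). \<forall>i<n. \<bar>x i - a i\<bar> < r}})"
    using U1(1) by blast
  moreover have "U1 \<inter> {u \<in> U0. \<phi> u \<in> {x \<in> topspace (Euclidean_space n). \<forall>i<n. \<bar>x i - a i\<bar> < r}} = V"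
    using U1(3) by (auto simp: V_def)
  ultimately have V: "openin (base M) V" "V \<subseteq> U1" "p \<in> V"
    using U1(4) aE r(1) by (auto simp: V_def a_def)
  have nzd: "f = 0" if G: "openin (base M) G" "G \<subseteq> V" and f: "f \<in> sec M G i" and 0: "res M ?T G b * f = 0" for G f i
  proof -
    have OU: "G \<subseteq> U1" "G \<subseteq> U0" using G V U1 by auto
    have rb1: "res M ?T G b = res M U1 G b1"
      using presheaf_res_res[OF pre openin_topspace U1(1) G(1) OU(1) _ b] bU1 U1 UT by auto
    note rin = presheaf_res_in[OF pre U1(1) G(1) OU(1) b1(1)]
    show ?thesis
    proof (rule c.eq_0I[OF G(1) OU(2) f])
      fix I x assume I: "exponent ds I" and x: "x \<in> \<phi> ` G"
      have xU1: "x \<in> ?\<Omega>" using x OU by auto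
      have "\<Phi> G (res M U1 G b1) J x = (if J = 0 then box_bump n a r x else 0)" for J
        using c.restrict[OF U1(1,3) b1(1) G(1) OU(1)] b1(2) x xU1 by (simp add: series_res_def ser_def)
      then have "series_mult ds (\<Phi> G (res M U1 G b1)) (\<Phi> G f) I x = box_bump n a r x * \<Phi> G f I x"
        using I by (rule series_mult_one)
      moreover have "series_mult ds (\<Phi> G (res M U1 G b1)) (\<Phi> G f) = 0"
        using c.mult[OF G(1) OU(2) rin f] 0 rb1 c.zero[OF G(1) OU(2)] by simp
      moreover have "box_bump n a r x \<noteq> 0"
        unfolding box_bump_eq_0_iff using x G(2) by (auto simp: V_def not_le)
      ultimately show "\<Phi> G f I x = 0" by simp
    qed
  qed
  have "W \<union> U = ?T" using un U1(2) UT by auto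
  then have "bump_at M U b V W"
    unfolding bump_at_def using V U1 b W bW nzd by (auto simp: W_def)
  then show ?thesis using V(3) by blast
qed

context vector_bundle
begin

abbreviation "bsecs \<equiv> hom_sec M (lin_mod M B) (fun_mod M)"

text \<open>The product b \<sigma> vanishes on \<open>U \<inter> W\<close>, so it extends by 0. Its
  value on \<epsilon> over G is glued from b \<sigma>(\<epsilon>) on \<open>G \<inter> U\<close> and
  0 on \<open>G \<inter> W\<close>; linearity and compatibility with restriction follow from the
  uniqueness of gluing.\<close>

lemma extend_section:
  assumes bump: "bump_at M U b V W" and U: "openin (base M) U" and \<sigma>: "\<sigma> \<in> bsecs U k"
  obtains \<tau> where "\<tau> \<in> bsecs (topspace (base M)) k"
    "res (sections M B) (topspace (base M)) U \<tau> = act (sections M B) U (res M (topspace (base M)) U b) \<sigma>"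
proof -
  let ?T = "topspace (base M)"
  have b: "b \<in> sec M ?T 0" and W: "openin (base M) W" "W \<union> U = ?T" and bW: "res M ?T W b = 0"
    using bump by (auto simp: bump_at_def)
  have sub: "G \<subseteq> ?T" if "openin (base M) G" for G using that openin_subset by blast
  note pl = sheaf_on_presheaf[OF sheaf_lin] and oT = openin_topspace[of "base M"]
  let ?b = "\<lambda>G. res M ?T G b"
  let ?v = "\<lambda>G \<epsilon>. ?b (G \<inter> U) * \<sigma> (G \<inter> U) (tres G (G \<inter> U) \<epsilon>)"
  define extends where "extends = (\<lambda>G \<epsilon> y. res M G (G \<inter> U) y = ?v G \<epsilon> \<and> res M G (G \<inter> W) y = 0)"
  have rb: "?b G \<in> sec M G 0" if "openin (base M) G" for G
    using presheaf_res_in[OF pre_ring oT that sub[OF that] b] .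
  have OU: "openin (base M) (G \<inter> U)" "G \<inter> U \<subseteq> G" "G \<inter> U \<subseteq> U" and OW: "openin (base M) (G \<inter> W)" "G \<inter> W \<subseteq> G" "G \<inter> W \<subseteq> W"
    if "openin (base M) G" for G
    using that U W by auto
  have re: "tres G (G \<inter> U) \<epsilon> \<in> lin B (G \<inter> U) l" if "openin (base M) G" "\<epsilon> \<in> lin B G l" for G \<epsilon> l
    using presheaf_res_in[OF pl that(1) OU(1,2)[OF that(1)], of \<epsilon> l] that(2) by simp
  have s_in: "\<sigma> G \<epsilon> \<in> sec M G (l + k)" if "openin (base M) G" "G \<subseteq> U" "\<epsilon> \<in> lin B G l" for G \<epsilon> l
    using sheaf_map_in[OF pl hom_sec_map[OF \<sigma>] that(1,2)] that(3) by simp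
  have s_res: "\<sigma> G' (tres G G' \<epsilon>) = res M G G' (\<sigma> G \<epsilon>)" if "openin (base M) G" "G \<subseteq> U" "openin (base M) G'" "G' \<subseteq> G" "\<epsilon> \<in> lin B G l" for G G' \<epsilon> l
    using sheaf_map_res[OF pl hom_sec_map[OF \<sigma>] that(1-4)] that(5) by simp
  have v_in: "?v G \<epsilon> \<in> sec M (G \<inter> U) (l + k)" if "openin (base M) G" "\<epsilon> \<in> lin B G l" for G \<epsilon> l
    using ring_mult_in[OF ring OU(1)[OF that(1)] rb[OF OU(1)[OF that(1)]] s_in[OF OU(1,3)[OF that(1)] re[OF that]]] by simp
  have ex: "\<exists>!y. y \<in> sec M G (l + k) \<and> extends G \<epsilon> y" if G: "openin (base M) G" and \<epsilon>: "\<epsilon> \<in> lin B G l" for G \<epsilon> l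
  proof -
    define V' where "V' = (\<lambda>j. if j then G \<inter> U else G \<inter> W)"
    define x' where "x' = (\<lambda>j. if j then ?v G \<epsilon> else 0)"
    have un: "\<Union>(V' ` UNIV) = G" using W(2) sub[OF G] by (auto simp: V'_def UNIV_bool)
    have ov: "openin (base M) (G \<inter> U \<inter> (G \<inter> W))" "G \<inter> U \<inter> (G \<inter> W) \<subseteq> G \<inter> U" "G \<inter> U \<inter> (G \<inter> W) \<subseteq> G \<inter> W"
      using OU(1)[OF G] OW(1)[OF G] by auto
    have "res M ?T (G \<inter> U \<inter> (G \<inter> W)) b = res M W (G \<inter> U \<inter> (G \<inter> W)) (res M ?T W b)"
      by (rule presheaf_res_res[OF pre_ring oT W(1) ov(1) _ sub[OF W(1)] b, symmetric]) auto
    also have "\<dots> = 0" unfolding bW by (rule presheaf_res_0[OF pre_ring W(1) ov(1)]) auto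
    finally have b0: "res M (G \<inter> U) (G \<inter> U \<inter> (G \<inter> W)) (?b (G \<inter> U)) = 0"
      using presheaf_res_res[OF pre_ring oT OU(1)[OF G] ov(1,2) sub[OF OU(1)[OF G]] b] by simp
    have z1: "res M (G \<inter> U) (G \<inter> U \<inter> (G \<inter> W)) (?v G \<epsilon>) = 0"
      using ring_res_mult[OF ring OU(1)[OF G] ov(1,2) rb[OF OU(1)[OF G]] s_in[OF OU(1,3)[OF G] re[OF G \<epsilon>]]] b0 by simp
    have z2: "res M (G \<inter> W) (G \<inter> U \<inter> (G \<inter> W)) 0 = 0" by (rule presheaf_res_0[OF pre_ring OW(1)[OF G] ov(1,3)])
    have "\<exists>!y. y \<in> sec M (\<Union>(V' ` UNIV)) (l + k) \<and> (\<forall>j\<in>UNIV. res M (\<Union>(V' ` UNIV)) (V' j) y = x' j)"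
    proof (rule sheaf_glue[OF ring_sheaf[OF ring]])
      fix i j :: bool
      show "openin (base M) (V' j)" using OU(1)[OF G] OW(1)[OF G] by (simp add: V'_def)
      show "x' j \<in> sec M (V' j) (l + k)" using v_in[OF G \<epsilon>] presheaf_0[OF pre_ring OW(1)[OF G]] by (simp add: V'_def x'_def)
      have c: "G \<inter> W \<inter> (G \<inter> U) = G \<inter> U \<inter> (G \<inter> W)" by auto
      show "res M (V' i) (V' i \<inter> V' j) (x' i) = res M (V' j) (V' i \<inter> V' j) (x' j)"
        unfolding V'_def x'_def by (cases i; cases j) (simp_all only: if_True if_False simp_thms c z1 z2)
    qed
    then show ?thesis unfolding un by (simp add: extends_def V'_def x'_def UNIV_bool conj_commute ex_bool_eq)
  qed
  \<comment> \<open>The degree l is chosen together with the value, since \<epsilon> = 0 has several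
    degrees; in that case every choice gives the value 0.\<close>
  define \<tau> where "\<tau> = (\<lambda>G \<epsilon>. SOME y. \<exists>l. \<epsilon> \<in> lin B G l \<and> y \<in> sec M G (l + k) \<and> extends G \<epsilon> y)"
  have \<tau>: "\<tau> G \<epsilon> \<in> sec M G (l + k) \<and> extends G \<epsilon> (\<tau> G \<epsilon>)" if G: "openin (base M) G" and \<epsilon>: "\<epsilon> \<in> lin B G l" for G \<epsilon> l
  proof -
    obtain y where y: "y \<in> sec M G (l + k)" "extends G \<epsilon> y" using ex[OF G \<epsilon>] by blast
    have "\<exists>y l. \<epsilon> \<in> lin B G l \<and> y \<in> sec M G (l + k) \<and> extends G \<epsilon> y" using y \<epsilon> by blast
    from someI_ex[OF this] obtain l' where l': "\<epsilon> \<in> lin B G l'" "\<tau> G \<epsilon> \<in> sec M G (l' + k)" "extends G \<epsilon> (\<tau> G \<epsilon>)"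
      unfolding \<tau>_def by blast
    show ?thesis
    proof (cases "l = l'")
      case False
      have e0: "\<epsilon> = 0" using presheaf_degree[OF pl G, of \<epsilon> l l'] \<epsilon> l'(1) False by simp
      have "?v G \<epsilon> = 0"
      proof -
        have "tres G (G \<inter> U) \<epsilon> = 0" unfolding e0 by (rule tot_res_0[OF G OU(1,2)[OF G]])
        then show ?thesis using sheaf_map_0[OF pl hom_sec_map[OF \<sigma>] OU(1,3)[OF G]] by simp
      qed
      then have "extends G \<epsilon> 0"
        unfolding extends_def using presheaf_res_0[OF pre_ring G OU(1,2)[OF G]] presheaf_res_0[OF pre_ring G OW(1,2)[OF G]] by simp
      then have "\<tau> G \<epsilon> = 0" using ex[OF G l'(1)] l' presheaf_0[OF pre_ring G] by blast
      then show ?thesis using presheaf_0[OF pre_ring G] l'(3) by simp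
    qed (use l' in auto)
  qed
  have \<tau>_eq: "\<tau> G \<epsilon> = y" if G: "openin (base M) G" and \<epsilon>: "\<epsilon> \<in> lin B G l" and y: "y \<in> sec M G (l + k)" "extends G \<epsilon> y" for G \<epsilon> l y
    using ex[OF G \<epsilon>] \<tau>[OF G \<epsilon>] y by blast
  have \<tau>U: "res M G (G \<inter> U) (\<tau> G \<epsilon>) = ?v G \<epsilon>" and \<tau>W: "res M G (G \<inter> W) (\<tau> G \<epsilon>) = 0"
    if "openin (base M) G" "\<epsilon> \<in> lin B G l" for G \<epsilon> l
    using \<tau>[OF that] by (auto simp: extends_def)
  have map: "sheaf_map (lin_mod M B) (fun_mod M) ?T k \<tau>"
  proof (rule sheaf_mapI[OF presheaf_base[OF pl]], goal_cases)
    case (1 G l \<epsilon>)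
    then show ?case using \<tau> by simp
  next
    case (2 G l \<epsilon> c)
    then have G: "openin (base M) G" and \<epsilon>: "\<epsilon> \<in> lin B G l" by simp_all
    have c\<epsilon>: "c *\<^sub>R \<epsilon> \<in> lin B G l" using presheaf_scale[OF pl G, of \<epsilon> l c] \<epsilon> by simp
    have t: "\<tau> G \<epsilon> \<in> sec M G (l + k)" using \<tau>[OF G \<epsilon>] by blast
    have "tres G (G \<inter> U) (c *\<^sub>R \<epsilon>) = c *\<^sub>R tres G (G \<inter> U) \<epsilon>"
      using presheaf_res_scale[OF pl G OU(1,2)[OF G], of \<epsilon> l c] \<epsilon> by simp
    moreover have "\<sigma> (G \<inter> U) (c *\<^sub>R tres G (G \<inter> U) \<epsilon>) = c *\<^sub>R \<sigma> (G \<inter> U) (tres G (G \<inter> U) \<epsilon>)"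
      using sheaf_map_scale[OF pl hom_sec_map[OF \<sigma>] OU(1,3)[OF G]] re[OF G \<epsilon>] by simp
    ultimately have "extends G (c *\<^sub>R \<epsilon>) (c *\<^sub>R \<tau> G \<epsilon>)"
      unfolding extends_def presheaf_res_scale[OF pre_ring G OU(1,2)[OF G] t] presheaf_res_scale[OF pre_ring G OW(1,2)[OF G] t] \<tau>U[OF G \<epsilon>] \<tau>W[OF G \<epsilon>] by simp
    then show ?case by (rule \<tau>_eq[OF G c\<epsilon> presheaf_scale[OF pre_ring G t]])
  next
    case (3 G l \<epsilon> \<delta>)
    then have G: "openin (base M) G" and \<epsilon>: "\<epsilon> \<in> lin B G l" and \<delta>: "\<delta> \<in> lin B G l" by simp_all
    have s: "\<epsilon> + \<delta> \<in> lin B G l" using presheaf_add[OF pl G, of \<epsilon> l \<delta>] \<epsilon> \<delta> by simp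
    have t: "\<tau> G \<epsilon> \<in> sec M G (l + k)" "\<tau> G \<delta> \<in> sec M G (l + k)" using \<tau>[OF G \<epsilon>] \<tau>[OF G \<delta>] by auto
    have "tres G (G \<inter> U) (\<epsilon> + \<delta>) = tres G (G \<inter> U) \<epsilon> + tres G (G \<inter> U) \<delta>"
      using presheaf_res_add[OF pl G OU(1,2)[OF G], of \<epsilon> l \<delta>] \<epsilon> \<delta> by simp
    moreover have "\<sigma> (G \<inter> U) (tres G (G \<inter> U) \<epsilon> + tres G (G \<inter> U) \<delta>) = \<sigma> (G \<inter> U) (tres G (G \<inter> U) \<epsilon>) + \<sigma> (G \<inter> U) (tres G (G \<inter> U) \<delta>)"
      using sheaf_map_add[OF pl hom_sec_map[OF \<sigma>] OU(1,3)[OF G]] re[OF G \<epsilon>] re[OF G \<delta>] by simp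
    ultimately have "extends G (\<epsilon> + \<delta>) (\<tau> G \<epsilon> + \<tau> G \<delta>)"
      unfolding extends_def presheaf_res_add[OF pre_ring G OU(1,2)[OF G] t] presheaf_res_add[OF pre_ring G OW(1,2)[OF G] t] \<tau>U[OF G \<epsilon>] \<tau>W[OF G \<epsilon>] \<tau>U[OF G \<delta>] \<tau>W[OF G \<delta>]
      by (simp add: distrib_left)
    then show ?case by (rule \<tau>_eq[OF G s presheaf_add[OF pre_ring G t]])
  next
    case (4 G G' l \<epsilon>)
    then have G: "openin (base M) G" and G': "openin (base M) G'" "G' \<subseteq> G" and \<epsilon>: "\<epsilon> \<in> lin B G l" by simp_all
    have \<epsilon>': "tres G G' \<epsilon> \<in> lin B G' l" using presheaf_res_in[OF pl G G', of \<epsilon> l] \<epsilon> by simp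
    have t: "\<tau> G \<epsilon> \<in> sec M G (l + k)" using \<tau>[OF G \<epsilon>] by auto
    have s1: "G' \<inter> U \<subseteq> G \<inter> U" "G' \<inter> W \<subseteq> G \<inter> W" using G' by auto
    have "res M G' (G' \<inter> U) (res M G G' (\<tau> G \<epsilon>)) = res M (G \<inter> U) (G' \<inter> U) (?v G \<epsilon>)"
      using presheaf_res_res[OF pre_ring G G'(1) OU(1,2)[OF G'(1)] G'(2) t] presheaf_res_res[OF pre_ring G OU(1)[OF G] OU(1)[OF G'(1)] s1(1) OU(2)[OF G] t]
        \<tau>U[OF G \<epsilon>] by simp
    also have "\<dots> = res M (G \<inter> U) (G' \<inter> U) (?b (G \<inter> U)) * res M (G \<inter> U) (G' \<inter> U) (\<sigma> (G \<inter> U) (tres G (G \<inter> U) \<epsilon>))"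
      by (rule ring_res_mult[OF ring OU(1)[OF G] OU(1)[OF G'(1)] s1(1) rb[OF OU(1)[OF G]] s_in[OF OU(1,3)[OF G] re[OF G \<epsilon>]]])
    also have "\<dots> = ?v G' (tres G G' \<epsilon>)"
      using presheaf_res_res[OF pre_ring oT OU(1)[OF G] OU(1)[OF G'(1)] s1(1) sub[OF OU(1)[OF G]] b]
        s_res[OF OU(1,3)[OF G] OU(1)[OF G'(1)] s1(1) re[OF G \<epsilon>]] 
        tot_res_res[OF G OU(1)[OF G] OU(1)[OF G'(1)] s1(1) OU(2)[OF G] lin_tot[OF G \<epsilon>]]
        tot_res_res[OF G G'(1) OU(1,2)[OF G'(1)] G'(2) lin_tot[OF G \<epsilon>]] by simp
    finally have 1: "res M G' (G' \<inter> U) (res M G G' (\<tau> G \<epsilon>)) = ?v G' (tres G G' \<epsilon>)" .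
    have "res M G' (G' \<inter> W) (res M G G' (\<tau> G \<epsilon>)) = res M (G \<inter> W) (G' \<inter> W) 0"
      using presheaf_res_res[OF pre_ring G G'(1) OW(1,2)[OF G'(1)] G'(2) t] presheaf_res_res[OF pre_ring G OW(1)[OF G] OW(1)[OF G'(1)] s1(2) OW(2)[OF G] t]
        \<tau>W[OF G \<epsilon>] by simp
    then have "extends G' (tres G G' \<epsilon>) (res M G G' (\<tau> G \<epsilon>))"
      unfolding extends_def using 1 presheaf_res_0[OF pre_ring OW(1)[OF G] OW(1)[OF G'(1)] s1(2)] by simp
    then show ?case using \<tau>_eq[OF G'(1) \<epsilon>' presheaf_res_in[OF pre_ring G G' t]] by simp
  qed
  have lin: "\<tau> G (act (lin_mod M B) G f \<epsilon>) = ksign (k * i) *\<^sub>R act (fun_mod M) G f (\<tau> G \<epsilon>)"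
    if G: "openin (base M) G" and f: "f \<in> sec M G i" and "\<epsilon> \<in> sec (lin_mod M B) G l" for G f i \<epsilon> l
  proof -
    have \<epsilon>: "\<epsilon> \<in> lin B G l" using that(3) by simp
    have t: "\<tau> G \<epsilon> \<in> sec M G (l + k)" using \<tau>[OF G \<epsilon>] by auto
    have ft: "f * \<tau> G \<epsilon> \<in> sec M G (i + l + k)" using ring_mult_in[OF ring G f t] by (simp add: add.assoc)
    have rf: "res M G (G \<inter> U) f \<in> sec M (G \<inter> U) i" by (rule presheaf_res_in[OF pre_ring G OU(1,2)[OF G] f])
    have "tres G (G \<inter> U) (pull B G f * \<epsilon>) = pull B (G \<inter> U) (res M G (G \<inter> U) f) * tres G (G \<inter> U) \<epsilon>"
      using tot_res_mult[OF G OU(1,2)[OF G] pull_in[OF G f] lin_tot[OF G \<epsilon>]] pull_res[OF G OU(1,2)[OF G] f] by simp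
    then have "?v G (pull B G f * \<epsilon>) = ksign (k * i) *\<^sub>R (?b (G \<inter> U) * (res M G (G \<inter> U) f * \<sigma> (G \<inter> U) (tres G (G \<inter> U) \<epsilon>)))"
      using hom_sec_act[OF \<sigma> OU(1,3)[OF G] rf, of "tres G (G \<inter> U) \<epsilon>" l] re[OF G \<epsilon>] by simp
    also have "?b (G \<inter> U) * (res M G (G \<inter> U) f * \<sigma> (G \<inter> U) (tres G (G \<inter> U) \<epsilon>)) = res M G (G \<inter> U) f * ?v G \<epsilon>"
      using ring_commute[OF ring OU(1)[OF G] rf rb[OF OU(1)[OF G]]] by (simp add: mult.assoc[symmetric])
    finally have "?v G (pull B G f * \<epsilon>) = ksign (k * i) *\<^sub>R (res M G (G \<inter> U) f * ?v G \<epsilon>)" .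
    then have "extends G (pull B G f * \<epsilon>) (ksign (k * i) *\<^sub>R (f * \<tau> G \<epsilon>))"
      unfolding extends_def presheaf_res_scale[OF pre_ring G OU(1,2)[OF G] ft] presheaf_res_scale[OF pre_ring G OW(1,2)[OF G] ft]
        ring_res_mult[OF ring G OU(1,2)[OF G] f t] ring_res_mult[OF ring G OW(1,2)[OF G] f t] \<tau>U[OF G \<epsilon>] \<tau>W[OF G \<epsilon>] by simp
    then show ?thesis using \<tau>_eq[OF G lin_pull[OF G f \<epsilon>] presheaf_scale[OF pre_ring G ft]] by simp
  qed
  define \<tau>' where "\<tau>' = hom_ext (lin_mod M B) ?T \<tau>"
  have \<tau>': "\<tau>' \<in> bsecs ?T k"
    unfolding \<tau>'_def by (rule hom_ext_in_hom_sec[OF module_lin map]) (rule lin)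
  note module = module_hom_mod[OF ring module_lin module_fun_mod[OF ring]]
  have "res (sections M B) ?T U \<tau>' \<in> bsecs U k"
    using presheaf_res_in[OF module_presheaf[OF module] oT U sub[OF U], of \<tau>' k] \<tau>' by simp
  moreover have "act (sections M B) U (?b U) \<sigma> \<in> bsecs U k"
    using module_act_in[OF module U rb[OF U], of \<sigma> k] \<sigma> by simp
  ultimately have "res (sections M B) ?T U \<tau>' = act (sections M B) U (?b U) \<sigma>"
  proof (rule hom_sec_eqI)
    fix G l \<epsilon> assume *: "openin (base (lin_mod M B)) G" "G \<subseteq> U" "\<epsilon> \<in> sec (lin_mod M B) G l"
    then have G: "openin (base M) G" and \<epsilon>: "\<epsilon> \<in> lin B G l" and OUeq: "G \<inter> U = G" by auto
    have t: "\<tau> G \<epsilon> \<in> sec M G (l + k)" using \<tau>[OF G \<epsilon>] by auto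
    have "\<tau> G \<epsilon> = ?b G * \<sigma> G \<epsilon>"
      using \<tau>U[OF G \<epsilon>] presheaf_res_id[OF pre_ring G t] presheaf_res_id[OF presheaf_tot over_open[OF G] lin_tot[OF G \<epsilon>]] by (simp add: OUeq)
    moreover have "res (sections M B) ?T U \<tau>' G \<epsilon> = \<tau> G \<epsilon>"
      using hom_ext_apply[OF *, of \<tau>'] hom_ext_apply[OF *(1) sub[OF G] *(3), of \<tau>] by (simp add: hom_mod_simps \<tau>'_def)
    moreover have "act (sections M B) U (?b U) \<sigma> G \<epsilon> = ?b G * \<sigma> G \<epsilon>"
      using hom_ext_apply[OF *, of "\<lambda>V x. res M U V (?b U) * \<sigma> V x"] presheaf_res_res[OF pre_ring oT U G *(2) sub[OF U] b] by (simp add: hom_mod_simps)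
    ultimately show "res (sections M B) ?T U \<tau>' G \<epsilon> = act (sections M B) U (?b U) \<sigma> G \<epsilon>" by simp
  qed
  then show ?thesis using that \<tau>' by blast
qed

end

section \<open>Uniqueness\<close>

context dg_setting
begin

text \<open>
  Local sections need not extend to \<open>T\<close>, so they are first multiplied by a bump function \<open>b\<close>; both
  the form and the vector are multiplied, which is why \<open>b * b\<close> occurs.
\<close>

lemma global_contractions_eq_0:
  assumes H: "H \<in> homs T (d, 1)"
    and eq: "\<And>k X j e. X \<in> A.secs T k \<Longrightarrow> e \<in> E.secs T j \<Longrightarrow> \<iota>m T X T (H T (incl' T e)) = 0"
    and V: "openin (base M) V" and e: "e \<in> E.secs V j"
  shows "H V (incl' V e) = 0"
proof -
  note Hm = homs_map[OF H]
  have H_in: "H W (incl' W f) \<in> sec m W (i + d, 1)" if "openin (base M) W" "f \<in> E.secs W i" for W f i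
    using sheaf_map_in[OF X.pre_m Hm that(1) openin_sub[OF that(1)] X.incl_in[OF that(1), of f i]] that(2) by simp
  have H_res: "res m W W' (H W (incl' W f)) = H W' (incl' W' (res SE W W' f))"
    if "openin (base M) W" "openin (base M) W'" "W' \<subseteq> W" "f \<in> E.secs W i" for W W' f i
    using sheaf_map_res[OF X.pre_m Hm that(1) openin_sub[OF that(1)] that(2,3) X.incl_in[OF that(1), of f i]]
      X.incl_res[OF that(1-3), of f i] that(4) by simp
  show ?thesis
  proof (rule contractions_eq_0[OF V H_in[OF V e]])
    fix V0 x assume V0: "openin (base M) V0" "V0 \<subseteq> V" "x \<in> V0"
    obtain n ds where "graded_manifold_of n ds M"
      using A.graded_vector_bundle unfolding graded_vector_bundle_def by (elim conjE exE) (rule that)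
    \<comment> \<open>The bump is subordinate to V0 rather than V, because the vectors X to be
      extended are given over V0 only.\<close>
    then obtain b V' W' where x: "x \<in> V'" and bump: "bump_at M V0 b V' W'"
      using bump_exists[OF _ V0(1,3)] by blast
    define c where "c = res M T V' b"
    have V': "openin (base M) V'" "V' \<subseteq> V0" and b: "b \<in> sec M T 0"
      using bump unfolding bump_at_def by auto
    have nzd: "f = 0" if "f \<in> sec M V' i" "c * f = 0" for f i
      using bump V'(1) that unfolding bump_at_def c_def by (elim conjE) (blast dest: order_refl[of V', THEN subset_trans])
    note VV' = subset_trans[OF V'(2) V0(2)] and V0T = openin_sub[OF V0(1)] and V'T = openin_sub[OF V'(1)]
    have b0: "res M T V0 b \<in> sec M V0 0" by (rule presheaf_res_in[OF A.pre_ring openT V0(1) V0T b])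
    have c: "c \<in> sec M V' 0" unfolding c_def by (rule presheaf_res_in[OF A.pre_ring openT V'(1) V'T b])
    have bc: "res M V0 V' (res M T V0 b) = c"
      unfolding c_def by (rule presheaf_res_res[OF A.pre_ring openT V0(1) V'(1,2) V0T b])
    have cc: "res M V' V' c = c" by (rule presheaf_res_id[OF A.pre_ring V'(1) c])
    define eV where "eV = res SE V V' e"
    have eV: "eV \<in> E.secs V' j" using presheaf_res_in[OF X.pre_G V V'(1) VV', of e j] e by (simp add: eV_def)
    have e0: "res SE V V0 e \<in> E.secs V0 j" using presheaf_res_in[OF X.pre_G V V0(1,2), of e j] e by simp
    \<comment> \<open>A global section that over \<open>V'\<close> is c e, with c the restriction of
      b.\<close>
    obtain e' where e': "e' \<in> E.secs T j" "res SE T V0 e' = act SE V0 (res M T V0 b) (res SE V V0 e)"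
      using E.extend_section[OF bump V0(1) e0] .
    have "res SE T V' e' = act SE V' c eV"
      using presheaf_res_res[OF X.pre_G openT V0(1) V'(1,2) V0T, of e' j] presheaf_res_res[OF X.pre_G V V0(1) V'(1,2) V0(2), of e j]
        module_res[OF X.module_G V0(1) b0 _ V'(1,2), of "res SE V V0 e" j] e e' e0 bc by (simp add: eV_def)
    define y where "y = res m V V' (H V (incl' V e))"
    have y_eq: "y = H V' (incl' V' eV)" unfolding y_def eV_def by (rule H_res[OF V V'(1) VV' e])
    have y: "y \<in> sec m V' (j + d, 1)" unfolding y_eq by (rule H_in[OF V'(1) eV])
    let ?c = "pull A1 V' c"
    have pc: "?c \<in> P.polys V' (0, 0)" by (rule P.pull_poly[OF V'(1) c])
    have "res m T V' (H T (incl' T e')) = H V' (incl' V' (act SE V' c eV))"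
      unfolding H_res[OF openT V'(1) V'T e'(1)] \<open>res SE T V' e' = _\<close> ..
    also have "\<dots> = H V' (act m V' ?c (incl' V' eV))"
      using X.incl_act[OF V'(1) _ pc, of eV j] X.incl_pull[OF V'(1) _ c, of eV j] eV by simp
    also have "\<dots> = act m V' ?c y"
      using homs_act[OF H V'(1) V'T pc X.incl_in[OF V'(1), of eV j]] eV by (simp add: y_eq)
    finally have z: "res m T V' (H T (incl' T e')) = act m V' ?c y" .
    have "act m V' (pull A1 V' (c * c)) (\<iota>m V0 X V' y) = 0" if X: "X \<in> A.secs V0 l" for l X
    proof -
      obtain Z where Z: "Z \<in> A.secs T l" "res SA T V0 Z = act SA V0 (res M T V0 b) X"
        using A.extend_section[OF bump V0(1) X] .
      define XV where "XV = res SA V0 V' X"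
      note pA = module_presheaf[OF A.module_secs]
      have XV: "XV \<in> A.secs V' l" using presheaf_res_in[OF pA V0(1) V'(1,2), of X l] X by (simp add: XV_def)
      have resZ: "res SA T V' Z = act SA V' c XV"
        using presheaf_res_res[OF pA openT V0(1) V'(1,2) V0T, of Z l]
          module_res[OF A.module_secs V0(1) b0 _ V'(1,2), of X l] Z X bc by (simp add: XV_def)
      have cy: "act m V' ?c y \<in> sec m V' (j + d, 1)" using X.act_in[OF V'(1) pc y] by simp
      have iy: "\<iota>m V' XV V' y \<in> sec m V' (j + d + l, 0)"
        using sheaf_map_in[OF X.pre_m \<iota>m_map[OF V'(1) XV] V'(1) order_refl y] by simp
      have "0 = res m T V' (\<iota>m T Z T (H T (incl' T e')))"
        unfolding eq[OF Z(1) e'(1)] by (rule presheaf_res_0[OF X.pre_m openT V'(1) V'T, symmetric])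
      also have "\<dots> = \<iota>m T Z V' (act m V' ?c y)"
        unfolding z[symmetric]
        by (rule sheaf_map_res[OF X.pre_m \<iota>m_map[OF openT Z(1)] openT order_refl V'(1) V'T H_in[OF openT e'(1)], symmetric])
      \<comment> \<open>Contractions are local: over \<open>V'\<close> the global Z may be replaced
        by its restriction, which is c X. Each of the next two steps releases one factor c.\<close>
      also have "\<dots> = \<iota>m V' (act SA V' c XV) V' (act m V' ?c y)"
        unfolding resZ[symmetric] by (rule \<iota>m_res[OF openT Z(1) V'(1) V'T V'(1) order_refl cy, symmetric])
      also have "\<dots> = act m V' ?c (\<iota>m V' XV V' (act m V' ?c y))"
        using \<iota>m_act[OF V'(1) XV c V'(1) order_refl cy] by (simp add: cc)
      also have "\<dots> = act m V' ?c (act m V' ?c (\<iota>m V' XV V' y))"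
        using \<iota>m_pull[OF V'(1) XV V'(1) order_refl c y] by simp
      also have "\<dots> = act m V' (pull A1 V' (c * c)) (\<iota>m V' XV V' y)"
        unfolding P.pull_mult[OF V'(1) c c] by (rule X.act_assoc[OF V'(1) pc iy pc, symmetric])
      also have "\<iota>m V' XV V' y = \<iota>m V0 X V' y"
        unfolding XV_def by (rule \<iota>m_res[OF V0(1) X V'(1,2) V'(1) order_refl y])
      finally show ?thesis by simp
    qed
    \<comment> \<open>The factor c is cancelled twice.\<close>
    moreover have "f = 0" if f: "f \<in> sec M V' i" and 0: "c * c * f = 0" for f i
    proof -
      have "c * f \<in> sec M V' (0 + i)" by (rule ring_mult_in[OF A.ring V'(1) c f])
      then show ?thesis using nzd[OF _ , of "c * f"] nzd[OF f] 0 by (simp add: mult.assoc)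
    qed
    moreover have "c * c \<in> sec M V' 0" using ring_mult_in[OF A.ring V'(1) c c] by simp
    ultimately show "\<exists>W b. openin (base M) W \<and> x \<in> W \<and> W \<subseteq> V0 \<and> b \<in> sec M W 0 \<and>
        (\<forall>f i. f \<in> sec M W i \<and> b * f = 0 \<longrightarrow> f = 0) \<and>
        (\<forall>l X. X \<in> A.secs V0 l \<longrightarrow> act m W (pull A1 W b) (\<iota>m V0 X W (res m V W (H V (incl' V e)))) = 0)"
      unfolding y_def using V' x by (intro exI[of _ V'] exI[of _ "c * c"]) blast
  qed
qed

lemma homs_global_contractions_ext:
  assumes F: "F \<in> homs T (d, 1)" and G: "G \<in> homs T (d, 1)"
    and eq: "\<And>k X j e. X \<in> A.secs T k \<Longrightarrow> e \<in> E.secs T j \<Longrightarrow> \<iota>m T X T (F T (incl' T e)) = \<iota>m T X T (G T (incl' T e))"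
    and U: "openin (base M) U" and x: "x \<in> sec m U i"
  shows "F U x = G U x"
proof (rule homs_ext[OF openT F G _ U openin_sub[OF U] x])
  fix V e j assume V: "openin (base M) V" "V \<subseteq> T" and e: "e \<in> E.secs V j"
  have "(\<lambda>V x. 1 *\<^sub>R F V x + (-1) *\<^sub>R G V x) \<in> homs T (d, 1)" by (rule homs_lincomb[OF openT F G])
  then have H: "(\<lambda>V x. F V x - G V x) \<in> homs T (d, 1)" by simp
  have "F V (incl' V e) - G V (incl' V e) = 0"
  proof (rule global_contractions_eq_0[OF H _ V(1) e])
    fix k X j e assume X: "X \<in> A.secs T k" and e: "e \<in> E.secs T j"
    have i: "incl' T e \<in> sec m T (j, 0)" using X.incl_in[OF openT, of e j] e by simp
    show "\<iota>m T X T (F T (incl' T e) - G T (incl' T e)) = 0"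
      using sheaf_map_minus[OF X.pre_m \<iota>m_map[OF openT X] openT order_refl sheaf_map_in[OF X.pre_m homs_map[OF F] openT order_refl i]
        sheaf_map_in[OF X.pre_m homs_map[OF G] openT order_refl i]] eq[OF X e] by simp
  qed
  then show "F V (incl' V e) = G V (incl' V e)" by simp
qed

text \<open>\<open>shift11\<close> keeps the action, and (1, 1) has even total degree, so a map into
  the shift is a linear map of bidegree (1, 1) with no sign to adjust.\<close>

lemma dg_module_map_homs:
  assumes "dg_module_map (polynomials M A1) m Qm (shift11 m) Qm F"
  shows "F \<in> homs T (1, 1)"
proof (rule homsI)
  have map: "sheaf_map m (shift11 m) T (0, 0) F"
    and act: "\<And>V \<alpha> i x j. openin (base M) V \<Longrightarrow> \<alpha> \<in> P.polys V i \<Longrightarrow> x \<in> sec m V j \<Longrightarrow> F V (act m V \<alpha> x) = act m V \<alpha> (F V x)"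
    using assms unfolding dg_module_map_def by (auto simp: shift11_def)
  show "sheaf_map m m T (1, 1) F"
    using map unfolding sheaf_map_def by (simp add: shift11_def) blast
  fix V k q \<alpha> j x assume *: "openin (base M) V" "V \<subseteq> T" "\<alpha> \<in> P.polys V (k, q)" "x \<in> sec m V j"
  show "F V (act m V \<alpha> x) = ksign ((1 + 1) * (k + q)) *\<^sub>R act m V \<alpha> (F V x)"
    using act[OF *(1,3,4)] by (simp add: ksign_def)
qed

end

context atiyah_setting
begin

lemma contracts_to_atiyah_iff: "contracts_to_atiyah M QM A QA A1 E QE nabla tens \<iota>m U F \<longleftrightarrow>
    (\<forall>k X j e. X \<in> A.secs U k \<and> e \<in> E.secs U j \<longrightarrow> \<iota>m U X U (F U (incl' U e)) = ksign k *\<^sub>R incl' U (At U X e))"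
  unfolding contracts_to_atiyah_def by simp

lemma R_contracts_to_atiyah: "openin (base M) U \<Longrightarrow> contracts_to_atiyah M QM A QA A1 E QE nabla tens \<iota>m U R"
  unfolding contracts_to_atiyah_iff
proof (intro allI impI; elim conjE)
  fix k X j e assume "openin (base M) U" "X \<in> A.secs U k" "e \<in> E.secs U j"
  from contracts_toD[OF R_contracts this]
  show "\<iota>m U X U (R U (incl' U e)) = ksign k *\<^sub>R incl' U (At U X e)" by simp
qed

lemma R_unique:
  assumes F: "dg_module_map (polynomials M A1) m Qm (shift11 m) Qm F"
    and contr: "contracts_to_atiyah M QM A QA A1 E QE nabla tens \<iota>m T F"
    and U: "openin (base M) U" and x: "x \<in> sec m U i"
  shows "F U x = R U x"
proof (rule homs_global_contractions_ext[OF dg_module_map_homs[OF F] R_homs _ U x])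
  fix k X j e assume *: "X \<in> A.secs T k" "e \<in> E.secs T j"
  show "\<iota>m T X T (F T (incl' T e)) = \<iota>m T X T (R T (incl' T e))"
    using contr[unfolded contracts_to_atiyah_iff] R_contracts_to_atiyah[OF openT, unfolded contracts_to_atiyah_iff] * by simp
qed

end

text \<open>Maps are compared on homogeneous sections over open sets, since their values elsewhere
  are arbitrary. Uniqueness assumes the contraction formula for global X and e only. Classes are
  sets of cocycles, so the last part says that every cocycle in the Atiyah class yields the one
  class \<open>module_class\<close>.\<close>

theorem proposition3p2:
  fixes M :: "('p, int, 'f::real_algebra) gring" and QM :: "'p set \<Rightarrow> 'f \<Rightarrow> 'f"
    and A :: "('p, 'f, 'q, 'g::real_algebra) vbundle" and QA :: "'q set \<Rightarrow> 'g \<Rightarrow> 'g"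
    and A1 :: "('p, 'f, 'r, 'h::real_algebra) vbundle" and Q1 dA :: "'r set \<Rightarrow> 'h \<Rightarrow> 'h"
    and E :: "('p, 'f, 's, 'l::real_algebra) vbundle" and QE :: "'s set \<Rightarrow> 'l \<Rightarrow> 'l"
    and m :: "('p, int \<times> int, 'h, 'm::real_vector) gmod" and Qm D :: "'p set \<Rightarrow> 'm \<Rightarrow> 'm"
    and n :: "('p, int \<times> int, 'h, 'n::real_vector) gmod"
  assumes "dg_manifold M QM"
    and "dg_Lie_algebroid M QM A QA \<rho> br A1 s \<iota> Q1 dA"
    and "dg_vector_bundle M QM E QE"
    and "A_connection M A \<rho> E nabla"
    and "tensor_product M A1 (sections M E) m tens"
    and "tensor_field M QM A1 Q1 E QE m tens Qm"
    and "tensor_contraction M A A1 \<iota> E m tens \<iota>m"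
    and "induced_connection M A A1 dA E nabla m tens \<iota>m D"
    and "tensor_product M A1 (endos M E) n tensn"
    and "hom_iso M A1 E m tens n tensn \<mu>"
  shows "dg_module_map (polynomials M A1) m Qm (shift11 m) Qm (curvature Qm D) \<and>
         (\<forall>U. openin (base M) U \<longrightarrow>
           contracts_to_atiyah M QM A QA A1 E QE nabla tens \<iota>m U (curvature Qm D)) \<and>
         (\<forall>R. dg_module_map (polynomials M A1) m Qm (shift11 m) Qm R \<and>
           contracts_to_atiyah M QM A QA A1 E QE nabla tens \<iota>m (topspace (base M)) R \<longrightarrow>
           (\<forall>U i x. openin (base M) U \<and> x \<in> sec m U i \<longrightarrow> R U x = curvature Qm D U x)) \<and>
         (\<lambda>T. module_hom_class (polynomials M A1) m Qm
               (\<mu> (topspace (base M)) (form_of M A A1 E tens \<iota>m n \<mu> 1 T))) `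
           atiyah_class M QM A QA \<rho> E QE =
         {module_class M A1 dA m Qm}"
proof -
  have hom: "homological M QM" using assms(1) by (simp add: dg_manifold_def)
  have A: "dg_vector_bundle M QM A QA" and A1: "graded_vector_bundle M A1"
    using assms(2) by (simp_all add: dg_Lie_algebroid_def shifted_bundle_def)
  interpret A: dg_bundle M A QM QA
    using A hom by unfold_locales (simp_all add: dg_vector_bundle_def)
  interpret E: dg_bundle M E QM QE
    using assms(3) hom by unfold_locales (simp_all add: dg_vector_bundle_def)
  interpret A1: vector_bundle M A1 using A1 by unfold_locales
  interpret X: tensor_module M A1 "sections M E" m tens
    using assms(5) by (simp add: tensor_module_def tensor_module_axioms_def A1.vector_bundle_axioms E.module_secs)
  interpret Y: tensor_module M A1 "endos M E" n tensn
    using assms(9) module_hom_mod[OF E.ring E.module_secs E.module_secs]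
    by (simp add: tensor_module_def tensor_module_axioms_def A1.vector_bundle_axioms)
  interpret dg_setting M QM A QA A1 E QE m tens Q1 dA Qm \<rho> br s \<iota> \<iota>m
    using assms(2,6,7) by unfold_locales
  have D: "module_connection M A1 dA m D"
    and induced: "\<And>U X k e j. openin (base M) U \<Longrightarrow> X \<in> hom_sec M (lin_mod M A) (fun_mod M) U k \<Longrightarrow> e \<in> hom_sec M (lin_mod M E) (fun_mod M) U j \<Longrightarrow>
      \<iota>m U X U (D U (tens U (unity (tot A1) (over A1 U)) e)) = tens U (unity (tot A1) (over A1 U)) (nabla U X e)"
    using assms(8) by (simp_all add: induced_connection_def)
  interpret proposition_setting M QM A QA A1 E QE m tens Q1 dA Qm \<rho> br s \<iota> \<iota>m D nabla n tensn \<mu>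
    using D assms(4) induced assms(10) by unfold_locales
  show ?thesis
    using R_dg_module_map R_contracts_to_atiyah R_unique image_atiyah_class by blast
qed

end
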